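(* Let $e\in\mathbb{R}$, $t_0\in\mathbb{R}$ and $-\infty<s<3/2$. Let $\varphi$ be a differentiable function on $\mathbb{R}^3$ such that $\|\varphi\|_{Y}<\infty$ for $Y=\dot H^{-s},\dot H^{-s+1},\dot H^{s},\dot H^{s+1}$, and such that the divergence equations $$\nabla\cdot E=\rho,\qquad \nabla\cdot B=0$$ admit a solution in $(\dot H^s(\mathbb{R}^3))^3\oplus(\dot H^s(\mathbb{R}^3))^3$, where $\rho=e\varphi(\xi-x)$. Furthermore let $\xi_{(0)},v_{(0)}\in\mathbb{R}^3$ and let $E_{(0)},B_{(0)}\in(\dot H^s(\mathbb{R}^3))^3$ satisfy $\nabla\cdot E_{(0)}=e\varphi(\xi_{(0)}-\cdot)$ and $\nabla\cdot B_{(0)}=0$. Then the Maxwell-Newton system $$\partial_tB+\nabla\times E=0,\quad \partial_tE-\nabla\times B=-j,\quad \nabla\cdot E=\rho,\quad \nabla\cdot B=0,$$ $$\dot\xi=v,\quad \dot v=e\big[(\varphi*E)(\xi)+v\times(\varphi*B)(\xi)\big],$$ with $j=ev\,\varphi(\xi-x)$, $\rho=e\varphi(\xi-x)$ and initial data $E(t_0)=E_{(0)}$, $B(t_0)=B_{(0)}$, $\xi(t_0)=\xi_{(0)}$, $v(t_0)=v_{(0)}$, admits a unique solution $(E,B,\xi,v)$ in $$\mathscr{C}^0\big(\mathbb{R},(\dot H^s(\mathbb{R}^3))^3\oplus(\dot H^s(\mathbb{R}^3))^3\oplus\mathbb{R}^3\oplus\mathbb{R}^3\big).$$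
   Context: All fields and $\varphi$ are real-valued. $\hat f$ is the unitary Fourier transform on $\mathbb{R}^3$. For $\sigma\in\mathbb{R}$, $\|f\|_{\dot H^\sigma}^2=\int_{\mathbb{R}^3}|k|^{2\sigma}|\hat f(k)|^2\,dk$; $\dot H^\sigma(\mathbb{R}^3)$ is the homogeneous Sobolev space (tempered distributions $f$ with $\hat f\in L^1_{loc}$ and finite norm), a Hilbert space for $\sigma<3/2$. For vectors, $\|f\|_{(\dot H^\sigma)^3}^2=\sum_{j=1}^3\|f_j\|_{\dot H^\sigma}^2$. For $\varphi\in\dot H^{-s}$ and $f\in\dot H^s$, $(\varphi*f)(x)=\int e^{ik\cdot x}\hat\varphi(k)\hat f(k)\,dk$. Notion of solution: the evolution part of the system together with the initial data is understood in integral (Duhamel) form, $$(E,B)(t)=U(t-t_0)(E_{(0)},B_{(0)})+\int_{t_0}^tU(t-\tau)(-j(\tau),0)\,d\tau,$$ $$(\xi,v)(t)=W(t-t_0)(\xi_{(0)},v_{(0)})+\int_{t_0}^tW(t-\tau)(0,f_{em}(\tau))\,d\tau,$$ where $j(\tau)=ev(\tau)\varphi(\xi(\tau)-\cdot)$, $f_{em}(\tau)=e[(\varphi*E(\tau))(\xi(\tau))+v(\tau)\times(\varphi*B(\tau))(\xi(\tau))]$, $U(t)$ is the unitary one-parameter group on $(\dot H^s)^3\oplus(\dot H^s)^3$ solving the free equations $\partial_tE=\nabla\times B$, $\partial_tB=-\nabla\times E$ (defined by Fourier transform), and $W(t)(\xi,v)=(\xi+tv,v)$. The divergence equations are required to hold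 in the sense of distributions for every $t$. *)

theory Defs
  imports "HOL-Analysis.Analysis"
begin

type_synonym R3 = "real ^ 3"
type_synonym C3 = "complex ^ 3"

definition partial_deriv :: "3 \<Rightarrow> (R3 \<Rightarrow> complex) \<Rightarrow> R3 \<Rightarrow> complex" where
  "partial_deriv j f x = frechet_derivative f (at x) (axis j 1)"

text \<open>Higher partial derivatives are indexed by the list of the directions of differentiation.\<close>

definition partial_derivs :: "3 list \<Rightarrow> (R3 \<Rightarrow> complex) \<Rightarrow> R3 \<Rightarrow> complex" where
  "partial_derivs \<alpha> f = foldr partial_deriv \<alpha> f"

definition schwartz :: "(R3 \<Rightarrow> complex) set" where
  "schwartz = {\<psi>. (\<forall>\<alpha> x. partial_derivs \<alpha> \<psi> differentiable (at x)) \<and>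
     (\<forall>n \<alpha>. bdd_above (range (\<lambda>x. (1 + norm x) ^ n * norm (partial_derivs \<alpha> \<psi> x))))}"

definition schwartz_seminorm :: "nat \<Rightarrow> 3 list \<Rightarrow> (R3 \<Rightarrow> complex) \<Rightarrow> real" where
  "schwartz_seminorm n \<alpha> \<psi> = (SUP x. (1 + norm x) ^ n * norm (partial_derivs \<alpha> \<psi> x))"

text \<open>Tempered distributions are functionals on the type of all functions; they are set to zero
  outside the Schwartz space so that equality is equality on the Schwartz space.\<close>

definition is_tempered :: "((R3 \<Rightarrow> complex) \<Rightarrow> complex) \<Rightarrow> bool" where
  "is_tempered T \<longleftrightarrow>
     (\<forall>\<psi>. \<psi> \<notin> schwartz \<longrightarrow> T \<psi> = 0) \<and>
     (\<forall>\<psi>\<in>schwartz. \<forall>\<eta>\<in>schwartz. \<forall>a b. T (\<lambda>x. a * \<psi> x + b * \<eta> x) = a * T \<psi> + b * T \<eta>) \<and>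
     (\<exists>F C. finite F \<and> (\<forall>\<psi>\<in>schwartz. norm (T \<psi>) \<le> C * (\<Sum>(n, \<alpha>)\<in>F. schwartz_seminorm n \<alpha> \<psi>)))"

lemma schwartz_seminorm_nonneg:
  assumes "\<psi> \<in> schwartz"
  shows "0 \<le> schwartz_seminorm n \<alpha> \<psi>"
  unfolding schwartz_seminorm_def
  by (rule cSUP_upper2[where x = 0]) (use assms in \<open>auto simp: schwartz_def\<close>)

lemma is_tempered_zero: "is_tempered (\<lambda>_. 0)"
  unfolding is_tempered_def by (auto intro!: exI[of _ "{}"])

lemma is_tempered_add:
  assumes "is_tempered S" "is_tempered T"
  shows "is_tempered (\<lambda>\<psi>. S \<psi> + T \<psi>)"
proof -
  obtain F C where F: "finite F"
    "\<And>\<psi>. \<psi> \<in> schwartz \<Longrightarrow> norm (S \<psi>) \<le> C * (\<Sum>(n, \<alpha>)\<in>F. schwartz_seminorm n \<alpha> \<psi>)"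
    using assms(1) unfolding is_tempered_def by blast
  obtain G D where G: "finite G"
    "\<And>\<psi>. \<psi> \<in> schwartz \<Longrightarrow> norm (T \<psi>) \<le> D * (\<Sum>(n, \<alpha>)\<in>G. schwartz_seminorm n \<alpha> \<psi>)"
    using assms(2) unfolding is_tempered_def by blast
  have "norm (S \<psi> + T \<psi>) \<le> (\<bar>C\<bar> + \<bar>D\<bar>) * (\<Sum>(n, \<alpha>)\<in>F \<union> G. schwartz_seminorm n \<alpha> \<psi>)"
    if \<psi>: "\<psi> \<in> schwartz" for \<psi>
  proof -
    let ?s = "\<lambda>H. \<Sum>(n, \<alpha>)\<in>H. schwartz_seminorm n \<alpha> \<psi>"
    have "0 \<le> ?s F" "0 \<le> ?s G"
      using schwartz_seminorm_nonneg[OF \<psi>] by (auto intro!: sum_nonneg)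
    moreover have "?s F \<le> ?s (F \<union> G)" "?s G \<le> ?s (F \<union> G)"
      using F(1) G(1) schwartz_seminorm_nonneg[OF \<psi>] by (auto intro!: sum_mono2)
    ultimately have "C * ?s F \<le> \<bar>C\<bar> * ?s (F \<union> G)" "D * ?s G \<le> \<bar>D\<bar> * ?s (F \<union> G)"
      using mult_mono[of C "\<bar>C\<bar>" "?s F" "?s (F \<union> G)"] mult_mono[of D "\<bar>D\<bar>" "?s G" "?s (F \<union> G)"]
      by auto
    then show ?thesis
      using F(2)[OF \<psi>] G(2)[OF \<psi>] norm_triangle_ineq[of "S \<psi>" "T \<psi>"]
      by (simp add: distrib_right)
  qed
  then have "\<exists>F C. finite F \<and> (\<forall>\<psi>\<in>schwartz.
      norm (S \<psi> + T \<psi>) \<le> C * (\<Sum>(n, \<alpha>)\<in>F. schwartz_seminorm n \<alpha> \<psi>))"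
    using F(1) G(1) by (meson finite_UnI)
  then show ?thesis
    using assms unfolding is_tempered_def by (simp add: algebra_simps)
qed

lemma is_tempered_scaleR:
  assumes "is_tempered T"
  shows "is_tempered (\<lambda>\<psi>. r *\<^sub>R T \<psi>)"
proof -
  obtain F C where F: "finite F"
    "\<And>\<psi>. \<psi> \<in> schwartz \<Longrightarrow> norm (T \<psi>) \<le> C * (\<Sum>(n, \<alpha>)\<in>F. schwartz_seminorm n \<alpha> \<psi>)"
    using assms unfolding is_tempered_def by blast
  have "norm (r *\<^sub>R T \<psi>) \<le> (\<bar>r\<bar> * C) * (\<Sum>(n, \<alpha>)\<in>F. schwartz_seminorm n \<alpha> \<psi>)"
    if "\<psi> \<in> schwartz" for \<psi>
    using mult_left_mono[OF F(2)[OF that], of "\<bar>r\<bar>"] by (simp add: mult.assoc)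
  then have "\<exists>F C. finite F \<and>
      (\<forall>\<psi>\<in>schwartz. norm (r *\<^sub>R T \<psi>) \<le> C * (\<Sum>(n, \<alpha>)\<in>F. schwartz_seminorm n \<alpha> \<psi>))"
    using F(1) by blast
  then show ?thesis
    using assms unfolding is_tempered_def by (simp add: scaleR_conv_of_real algebra_simps)
qed

typedef tempered = "{T. is_tempered T}"
  morphisms pairing Abs_tempered
  using is_tempered_zero by blast

setup_lifting type_definition_tempered

instantiation tempered :: real_vector
begin

lift_definition zero_tempered :: tempered is "\<lambda>_. 0"
  by (rule is_tempered_zero)

lift_definition plus_tempered :: "tempered \<Rightarrow> tempered \<Rightarrow> tempered" is "\<lambda>S T \<psi>. S \<psi> + T \<psi>"
  by (rule is_tempered_add)

lift_definition scaleR_tempered :: "real \<Rightarrow> tempered \<Rightarrow> tempered" is "\<lambda>r T \<psi>. r *\<^sub>R T \<psi>"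
  by (rule is_tempered_scaleR)

lift_definition uminus_tempered :: "tempered \<Rightarrow> tempered" is "\<lambda>T \<psi>. - T \<psi>"
  using is_tempered_scaleR[of _ "-1"] by simp

lift_definition minus_tempered :: "tempered \<Rightarrow> tempered \<Rightarrow> tempered" is "\<lambda>S T \<psi>. S \<psi> - T \<psi>"
  using is_tempered_add[OF _ is_tempered_scaleR[of _ "-1"]] by simp

instance
  by standard (transfer; simp add: fun_eq_iff algebra_simps)+

end

text \<open>The (absolutely convergent) regular distribution of a locally integrable function.\<close>

definition represents :: "tempered \<Rightarrow> (R3 \<Rightarrow> complex) \<Rightarrow> bool" where
  "represents T g \<longleftrightarrow>
     (\<forall>K. compact K \<longrightarrow> set_integrable lborel K g) \<and>
     (\<forall>\<psi>\<in>schwartz. integrable lborel (\<lambda>x. g x * \<psi> x) \<and> pairing T \<psi> = (LINT x|lborel. g x * \<psi> x))"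

definition of_fun :: "(R3 \<Rightarrow> real) \<Rightarrow> tempered" where
  "of_fun f = (THE T. represents T (\<lambda>x. complex_of_real (f x)))"

definition fourier :: "(R3 \<Rightarrow> complex) \<Rightarrow> R3 \<Rightarrow> complex" where
  "fourier \<psi> k = complex_of_real ((2 * pi) powr (- 3 / 2)) *
     (LINT x|lborel. cis (- (k \<bullet> x)) * \<psi> x)"

text \<open>The Fourier transform of \<open>T\<close> is the distribution sending \<open>\<psi>\<close> to \<open>pairing T (fourier \<psi>)\<close>;
  here it is required to be the regular distribution of \<open>g\<close>.\<close>

definition has_fourier :: "tempered \<Rightarrow> (R3 \<Rightarrow> complex) \<Rightarrow> bool" where
  "has_fourier T g \<longleftrightarrow>
     (\<forall>K. compact K \<longrightarrow> set_integrable lborel K g) \<and>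
     (\<forall>\<psi>\<in>schwartz. integrable lborel (\<lambda>k. g k * \<psi> k) \<and>
        pairing T (fourier \<psi>) = (LINT k|lborel. g k * \<psi> k))"

text \<open>\<open>fhat T\<close> is determined only almost everywhere; all uses below are under integrals.\<close>

definition fhat :: "tempered \<Rightarrow> R3 \<Rightarrow> complex" where
  "fhat T = (SOME g. has_fourier T g)"

definition of_fourier :: "(R3 \<Rightarrow> complex) \<Rightarrow> tempered" where
  "of_fourier g = (THE T. has_fourier T g)"

definition real_distribution :: "tempered \<Rightarrow> bool" where
  "real_distribution T \<longleftrightarrow> (\<forall>\<psi>\<in>schwartz. pairing T (\<lambda>x. cnj (\<psi> x)) = cnj (pairing T \<psi>))"

definition hdot :: "real \<Rightarrow> tempered set" where
  "hdot \<sigma> = {T. real_distribution T \<and>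
     (\<exists>g. has_fourier T g \<and> integrable lborel (\<lambda>k. norm k powr (2 * \<sigma>) * (norm (g k))\<^sup>2))}"

definition hdot_norm :: "real \<Rightarrow> tempered \<Rightarrow> real" where
  "hdot_norm \<sigma> T = sqrt (LINT k|lborel. norm k powr (2 * \<sigma>) * (norm (fhat T k))\<^sup>2)"

definition fun_in_hdot :: "real \<Rightarrow> (R3 \<Rightarrow> real) \<Rightarrow> bool" where
  "fun_in_hdot \<sigma> f \<longleftrightarrow> (\<exists>T\<in>hdot \<sigma>. represents T (\<lambda>x. complex_of_real (f x)))"

definition hdot3 :: "real \<Rightarrow> (tempered ^ 3) set" where
  "hdot3 \<sigma> = {E. \<forall>j. E $ j \<in> hdot \<sigma>}"

definition hdot3_norm :: "real \<Rightarrow> tempered ^ 3 \<Rightarrow> real" where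
  "hdot3_norm \<sigma> E = sqrt (\<Sum>j\<in>UNIV. (hdot_norm \<sigma> (E $ j))\<^sup>2)"

text \<open>No factor \<open>2 * pi\<close>: the convolution theorem for the unitary transform contributes
  \<open>(2 * pi) powr (3 / 2)\<close>, which cancels against the inverse transform. The integral is real for
  real-valued arguments, so \<open>Re\<close> only adjusts the type.\<close>

definition conv :: "tempered \<Rightarrow> tempered \<Rightarrow> R3 \<Rightarrow> real" where
  "conv \<Phi> f x = Re (LINT k|lborel. cis (k \<bullet> x) * fhat \<Phi> k * fhat f k)"

definition conv3 :: "tempered \<Rightarrow> tempered ^ 3 \<Rightarrow> R3 \<Rightarrow> R3" where
  "conv3 \<Phi> E x = (\<chi> j. conv \<Phi> (E $ j) x)"

definition has_divergence :: "tempered ^ 3 \<Rightarrow> tempered \<Rightarrow> bool" where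
  "has_divergence E T \<longleftrightarrow>
     (\<forall>\<psi>\<in>schwartz. - (\<Sum>j\<in>UNIV. pairing (E $ j) (partial_deriv j \<psi>)) = pairing T \<psi>)"

definition ccross :: "C3 \<Rightarrow> C3 \<Rightarrow> C3" where
  "ccross a b = vector [a$2 * b$3 - a$3 * b$2, a$3 * b$1 - a$1 * b$3, a$1 * b$2 - a$2 * b$1]"

definition cvec :: "R3 \<Rightarrow> C3" where
  "cvec k = (\<chi> j. complex_of_real (k $ j))"

definition longitudinal :: "R3 \<Rightarrow> C3 \<Rightarrow> C3" where
  "longitudinal n a = (\<Sum>j\<in>UNIV. cvec n $ j * a $ j) *s cvec n"

text \<open>The solution at time \<open>t\<close> of \<open>a' = i k \<times> b\<close>, \<open>b' = - i k \<times> a\<close> with data \<open>(a, b)\<close>,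
  i.e. of the free Maxwell equations at frequency \<open>k\<close>; see the two lemmas below.\<close>

definition maxwell_symbol :: "real \<Rightarrow> R3 \<Rightarrow> C3 \<times> C3 \<Rightarrow> C3 \<times> C3" where
  "maxwell_symbol t k = (\<lambda>(a, b). let n = k /\<^sub>R norm k; \<omega> = norm k in
     (longitudinal n a + cos (\<omega> * t) *\<^sub>R (a - longitudinal n a)
        + sin (\<omega> * t) *\<^sub>R (\<i> *s ccross (cvec n) b),
      longitudinal n b + cos (\<omega> * t) *\<^sub>R (b - longitudinal n b)
        - sin (\<omega> * t) *\<^sub>R (\<i> *s ccross (cvec n) a)))"

lemma maxwell_symbol_0: "maxwell_symbol 0 k w = w"
  by (cases w) (simp add: maxwell_symbol_def Let_def)

lemma maxwell_symbol_deriv: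
  "((\<lambda>t. maxwell_symbol t k w) has_vector_derivative
     (\<i> *s ccross (cvec k) (snd (maxwell_symbol t k w)),
      - (\<i> *s ccross (cvec k) (fst (maxwell_symbol t k w))))) (at t)"
proof -
  obtain a b where w: "w = (a, b)" by (cases w)
  define n where "n = k /\<^sub>R norm k"
  define \<omega> where "\<omega> = norm k"
  have k: "k = \<omega> *\<^sub>R n" unfolding n_def \<omega>_def by (cases "k = 0") auto
  have ck: "ccross (cvec k) c = \<omega> *\<^sub>R ccross (cvec n) c" for c
    unfolding k by (simp add: ccross_def cvec_def vec_eq_iff forall_3 algebra_simps scaleR_conv_of_real[where 'a = complex])
  have long: "ccross (cvec n) (longitudinal n c) = 0" for c
    by (simp add: ccross_def longitudinal_def vec_eq_iff forall_3)
  have lin: "ccross u (x + y) = ccross u x + ccross u y"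
    "ccross u (x - y) = ccross u x - ccross u y"
    "ccross u (r *\<^sub>R x) = r *\<^sub>R ccross u x"
    "ccross u (z *s x) = z *s ccross u x" for u x y r z
    by (simp_all add: ccross_def vec_eq_iff forall_3 algebra_simps scaleR_conv_of_real[where 'a = complex])
  have nn: "\<omega> *\<^sub>R ccross (cvec n) (ccross (cvec n) c) = \<omega> *\<^sub>R (longitudinal n c - c)" for c
  proof (cases "k = 0")
    case False
    have "norm n = 1" using False by (simp add: n_def)
    then have "n \<bullet> n = 1" by (simp add: norm_eq_1)
    then have "(n$1)^2 + (n$2)^2 + (n$3)^2 = 1"
      by (simp add: inner_vec_def sum_3 power2_eq_square)
    then have "complex_of_real ((n$1)^2 + (n$2)^2 + (n$3)^2) = 1" by simp
    then have s: "(complex_of_real (n$1))^2 + (complex_of_real (n$2))^2 + (complex_of_real (n$3))^2 = 1" by simp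
    have id: "y * (x * q - y * p) - z * (z * p - x * r) = (x * p + y * q + z * r) * x - p"
      if "x\<^sup>2 + y\<^sup>2 + z\<^sup>2 = 1" for x y z p q r :: complex
      using that by algebra
    have s': "(complex_of_real (n$2))^2 + (complex_of_real (n$3))^2 + (complex_of_real (n$1))^2 = 1"
      "(complex_of_real (n$3))^2 + (complex_of_real (n$1))^2 + (complex_of_real (n$2))^2 = 1"
      using s by (simp_all add: add.commute add.left_commute)
    have "ccross (cvec n) (ccross (cvec n) c) = longitudinal n c - c"
      using id[of "n$1" "n$2" "n$3" "c$1" "c$2" "c$3", OF s]
        id[of "n$2" "n$3" "n$1" "c$2" "c$3" "c$1", OF s'(1)]
        id[of "n$3" "n$1" "n$2" "c$3" "c$1" "c$2", OF s'(2)]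
      unfolding ccross_def longitudinal_def cvec_def vec_eq_iff forall_3
      by (simp add: sum_3 algebra_simps)
    then show ?thesis by simp
  qed (simp add: \<omega>_def)
  have ii: "\<i> *s (\<i> *s x) = - x" for x :: C3
    by (simp add: vec_eq_iff)
  have lin2: "z *s (r *\<^sub>R x) = r *\<^sub>R (z *s x)" "z *s (x + y) = z *s x + z *s y"
    "z *s (x - y) = z *s x - z *s y" for z r and x y :: C3
    by (simp_all add: vec_eq_iff algebra_simps scaleR_conv_of_real[where 'a = complex])
  have nn': "\<omega> *\<^sub>R (r *\<^sub>R ccross (cvec n) (ccross (cvec n) c)) = r *\<^sub>R (\<omega> *\<^sub>R (longitudinal n c - c))" for r c
    using nn[of c] by (metis scaleR_left_commute)
  have scal: "((\<lambda>t. p + cos (\<omega> * t) *\<^sub>R q + sin (\<omega> * t) *\<^sub>R r) has_vector_derivative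
      (\<omega> * - sin (\<omega> * t)) *\<^sub>R q + (\<omega> * cos (\<omega> * t)) *\<^sub>R r) (at t)" for p q r :: C3
    by (auto intro!: derivative_eq_intros simp: has_real_derivative_iff_has_vector_derivative[symmetric] mult.commute)
  have e: "maxwell_symbol t k w =
     (longitudinal n a + cos (\<omega> * t) *\<^sub>R (a - longitudinal n a) + sin (\<omega> * t) *\<^sub>R (\<i> *s ccross (cvec n) b),
      longitudinal n b + cos (\<omega> * t) *\<^sub>R (b - longitudinal n b) + sin (\<omega> * t) *\<^sub>R (- (\<i> *s ccross (cvec n) a)))" for t
    by (simp add: maxwell_symbol_def Let_def w n_def \<omega>_def)
  have d1: "\<i> *s ccross (cvec k) (snd (maxwell_symbol t k w)) =
     (\<omega> * - sin (\<omega> * t)) *\<^sub>R (a - longitudinal n a) + (\<omega> * cos (\<omega> * t)) *\<^sub>R (\<i> *s ccross (cvec n) b)"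
    using nn'[of "sin (\<omega> * t)" a]
    by (simp add: e ck lin long lin2 ii algebra_simps)
  have d2: "- (\<i> *s ccross (cvec k) (fst (maxwell_symbol t k w))) =
     (\<omega> * - sin (\<omega> * t)) *\<^sub>R (b - longitudinal n b) + (\<omega> * cos (\<omega> * t)) *\<^sub>R (- (\<i> *s ccross (cvec n) a))"
    using nn'[of "sin (\<omega> * t)" b]
    by (simp add: e ck lin long lin2 ii algebra_simps)
  show ?thesis
    unfolding d1 d2 unfolding e by (intro has_vector_derivative_Pair scal)
qed

type_synonym em_field = "(tempered ^ 3) \<times> (tempered ^ 3)"

definition field_norm :: "real \<Rightarrow> em_field \<Rightarrow> real" where
  "field_norm s = (\<lambda>(E, B). sqrt ((hdot3_norm s E)\<^sup>2 + (hdot3_norm s B)\<^sup>2))"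

definition maxwell_group :: "real \<Rightarrow> em_field \<Rightarrow> em_field" where
  "maxwell_group t = (\<lambda>(E, B).
     let w = (\<lambda>k. maxwell_symbol t k (\<chi> j. fhat (E $ j) k, \<chi> j. fhat (B $ j) k))
     in (\<chi> j. of_fourier (\<lambda>k. fst (w k) $ j), \<chi> j. of_fourier (\<lambda>k. snd (w k) $ j)))"

text \<open>\<open>(f has_integral I) {a..b}\<close> unfolded, with convergence of the Riemann sums measured by \<open>N\<close>
  (the spaces here are not types, so their norms are not available through type classes);
  for \<open>b < a\<close> the integral is the oriented one.\<close>

definition has_oriented_integral ::
  "('a::real_vector \<Rightarrow> real) \<Rightarrow> (real \<Rightarrow> 'a) \<Rightarrow> real \<Rightarrow> real \<Rightarrow> 'a \<Rightarrow> bool" where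
  "has_oriented_integral N f a b I \<longleftrightarrow>
     ((\<lambda>p. N ((\<Sum>(x, K)\<in>p. measure lborel K *\<^sub>R f x) - (if a \<le> b then I else - I))) \<longlongrightarrow> 0)
       (division_filter (cbox (min a b) (max a b)))"

lemma has_oriented_integral_norm:
  "has_oriented_integral norm f a b I \<longleftrightarrow>
     (f has_integral (if a \<le> b then I else - I)) {min a b..max a b}"
  unfolding has_oriented_integral_def cbox_interval[symmetric] has_integral_def
  by (auto simp: tendsto_norm_zero_iff LIM_zero_iff)

definition particle_flow :: "real \<Rightarrow> R3 \<times> R3 \<Rightarrow> R3 \<times> R3" where
  "particle_flow t = (\<lambda>(\<xi>, v). (\<xi> + t *\<^sub>R v, v))"

definition charge_density :: "real \<Rightarrow> (R3 \<Rightarrow> real) \<Rightarrow> R3 \<Rightarrow> tempered" where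
  "charge_density e \<phi> \<xi> = of_fun (\<lambda>x. e * \<phi> (\<xi> - x))"

definition current :: "real \<Rightarrow> (R3 \<Rightarrow> real) \<Rightarrow> R3 \<Rightarrow> R3 \<Rightarrow> tempered ^ 3" where
  "current e \<phi> \<xi> v = (\<chi> i. of_fun (\<lambda>x. e * v $ i * \<phi> (\<xi> - x)))"

definition em_force ::
  "real \<Rightarrow> (R3 \<Rightarrow> real) \<Rightarrow> tempered ^ 3 \<Rightarrow> tempered ^ 3 \<Rightarrow> R3 \<Rightarrow> R3 \<Rightarrow> R3" where
  "em_force e \<phi> E B \<xi> v =
     e *\<^sub>R (conv3 (of_fun \<phi>) E \<xi> + cross3 v (conv3 (of_fun \<phi>) B \<xi>))"

type_synonym state = "(tempered ^ 3) \<times> (tempered ^ 3) \<times> R3 \<times> R3"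

definition state_space :: "real \<Rightarrow> state set" where
  "state_space s = hdot3 s \<times> hdot3 s \<times> UNIV \<times> UNIV"

definition state_norm :: "real \<Rightarrow> state \<Rightarrow> real" where
  "state_norm s = (\<lambda>(E, B, \<xi>, v).
     sqrt ((hdot3_norm s E)\<^sup>2 + (hdot3_norm s B)\<^sup>2 + (norm \<xi>)\<^sup>2 + (norm v)\<^sup>2))"

definition continuous_curves :: "real \<Rightarrow> (real \<Rightarrow> state) set" where
  "continuous_curves s = {u. (\<forall>t. u t \<in> state_space s) \<and>
     (\<forall>t. ((\<lambda>\<tau>. state_norm s (u \<tau> - u t)) \<longlongrightarrow> 0) (at t))}"

text \<open>The evolution equations with the initial data, in Duhamel form, and the constraints.\<close>

definition maxwell_newton_solution ::
  "real \<Rightarrow> real \<Rightarrow> (R3 \<Rightarrow> real) \<Rightarrow> real \<Rightarrow> tempered ^ 3 \<Rightarrow> tempered ^ 3 \<Rightarrow> R3 \<Rightarrow> R3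
    \<Rightarrow> (real \<Rightarrow> state) \<Rightarrow> bool" where
  "maxwell_newton_solution s e \<phi> t0 E0 B0 \<xi>0 v0 u \<longleftrightarrow>
     (\<exists>E B \<xi> v. u = (\<lambda>t. (E t, B t, \<xi> t, v t)) \<and>
       (\<forall>t. has_oriented_integral (field_norm s)
              (\<lambda>\<tau>. maxwell_group (t - \<tau>) (- current e \<phi> (\<xi> \<tau>) (v \<tau>), 0)) t0 t
              ((E t, B t) - maxwell_group (t - t0) (E0, B0))) \<and>
       (\<forall>t. has_oriented_integral norm
              (\<lambda>\<tau>. particle_flow (t - \<tau>) (0, em_force e \<phi> (E \<tau>) (B \<tau>) (\<xi> \<tau>) (v \<tau>))) t0 t
              ((\<xi> t, v t) - particle_flow (t - t0) (\<xi>0, v0))) \<and>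
       (\<forall>t. has_divergence (E t) (charge_density e \<phi> (\<xi> t)) \<and> has_divergence (B t) 0))"

end

theory Submission
  imports Defs "HOL-Probability.Characteristic_Functions" "HOL-Probability.Sinc_Integral"
begin

text \<open>In Fourier variables the free Maxwell flow is an explicit isometry at each frequency, so for a
  given particle trajectory the field is an explicit function of the trajectory, computed frequency
  by frequency as an integral over the past of the current. Inserting it into the Lorentz force
  leaves a Volterra equation for the velocity with values in \<open>R3\<close>; the hypotheses on the form factor
  are what make the force functional locally Lipschitz. Because the magnetic force is orthogonal to
  the velocity, the speed grows at most like the solution of a linear differential inequality, and
  the solution is global. The Gauss laws hold for all times because the longitudinal part of the
  flow is trivial and the charge is conserved. The Duhamel integral is recovered from its
  frequency-wise version since its Riemann sums converge uniformly in the frequency up to a weight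
  in the energy space.\<close>

section \<open>Schwartz functions\<close>

text \<open>\<open>hdot\<close> is a set of distributions rather than a normed type, so statements
  about fields are moved to their symbols, measurable functions of the frequency. A symbol is fixed
  only almost everywhere; going back and forth rests on Fourier inversion and on the fact that test
  functions separate functions, which is why the Schwartz space comes first. The obstacle in the
  evolution is a loss of one derivative: the generator of the free flow and the phase of a moving
  source both produce a factor \<open>norm k\<close>, and multiplying a field in the energy space by
  it leads out of that space. Each such factor is charged to the form factor: the order
  \<open>- s + 1\<close> serves the Lipschitz bound of the force, the order \<open>s + 1\<close> the
  Riemann sums of the current. For the initial field nothing can absorb it, so its continuity in
  time comes from dominated convergence, without a rate. The force is only locally Lipschitz in the
  velocity, while Picard iteration wants one constant on each time interval. Velocities are
  therefore first truncated at a radius that grows with time.\<close>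

lemma partial_derivs_Nil: "partial_derivs [] f = f"
  and partial_derivs_Cons: "partial_derivs (j # \<alpha>) f = partial_deriv j (partial_derivs \<alpha> f)"
  by (simp_all add: partial_derivs_def)

lemma partial_derivs_append: "partial_derivs (\<alpha> @ \<beta>) f = partial_derivs \<alpha> (partial_derivs \<beta> f)"
  by (simp add: partial_derivs_def)

lemma partial_deriv_eqI: "(f has_derivative D) (at x) \<Longrightarrow> partial_deriv j f x = D (axis j 1)"
  by (metis frechet_derivative_at partial_deriv_def)

lemma has_derivative_partial_deriv:
  assumes "f differentiable at x"
  shows "(f has_derivative (\<lambda>h. \<Sum>j\<in>UNIV. of_real (h $ j) * partial_deriv j f x)) (at x)"
proof -
  let ?D = "frechet_derivative f (at x)"
  have D: "(f has_derivative ?D) (at x)" using assms frechet_derivative_works by blast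
  interpret D: bounded_linear ?D using D by (rule has_derivative_bounded_linear)
  have "?D h = (\<Sum>j\<in>UNIV. of_real (h $ j) * partial_deriv j f x)" for h
  proof -
    have "?D h = ?D (\<Sum>j\<in>UNIV. (h $ j) *\<^sub>R axis j 1)"
      using basis_expansion[of h] by (simp add: scalar_mult_eq_scaleR)
    also have "\<dots> = (\<Sum>j\<in>UNIV. (h $ j) *\<^sub>R ?D (axis j 1))"
      by (simp add: D.sum D.scale)
    also have "\<dots> = (\<Sum>j\<in>UNIV. of_real (h $ j) * partial_deriv j f x)"
      by (simp add: partial_deriv_def scaleR_conv_of_real)
    finally show ?thesis .
  qed
  then have "?D = (\<lambda>h. \<Sum>j\<in>UNIV. of_real (h $ j) * partial_deriv j f x)" by blast
  then show ?thesis using D by simp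
qed

lemma sum_axis [simp]: "(\<Sum>j\<in>UNIV. complex_of_real (axis i 1 $ j) * F j) = F i"
proof -
  have "(\<Sum>j\<in>UNIV. complex_of_real (axis i 1 $ j) * F j) = (\<Sum>j\<in>UNIV. if j = i then F j else 0)"
    by (intro sum.cong) (auto simp: axis_def)
  then show ?thesis by simp
qed

definition rapid :: "(R3 \<Rightarrow> complex) \<Rightarrow> bool" where
  "rapid f \<longleftrightarrow> (\<forall>n. \<exists>C. \<forall>x. (1 + norm x) ^ n * norm (f x) \<le> C)"

text \<open>Iterated derivatives never need to be computed: it is enough to exhibit a set of
  differentiable, rapidly decreasing functions that is closed under one partial derivative. The
  later membership proofs only choose such a set.\<close>

lemma schwartz_coinduct [consumes 1, case_names differentiable rapid partial_deriv]:
  assumes "f \<in> S"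
    and "\<And>f x. f \<in> S \<Longrightarrow> f differentiable at x"
    and "\<And>f. f \<in> S \<Longrightarrow> rapid f"
    and "\<And>f j. f \<in> S \<Longrightarrow> partial_deriv j f \<in> S"
  shows "f \<in> schwartz"
proof -
  have "partial_derivs \<alpha> f \<in> S" for \<alpha>
    using assms(1) by (induction \<alpha>) (auto simp: partial_derivs_Nil partial_derivs_Cons intro: assms)
  then show ?thesis
    unfolding schwartz_def using assms(2,3) by (fastforce simp: rapid_def bdd_above_def)
qed

lemma schwartz_differentiable: "f \<in> schwartz \<Longrightarrow> f differentiable at x"
  unfolding schwartz_def by (metis (mono_tags, lifting) mem_Collect_eq partial_derivs_Nil)

lemma schwartz_partial_derivs: "f \<in> schwartz \<Longrightarrow> partial_derivs \<alpha> f \<in> schwartz"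
  unfolding schwartz_def by (auto simp flip: partial_derivs_append)

lemma schwartz_partial_deriv: "f \<in> schwartz \<Longrightarrow> partial_deriv j f \<in> schwartz"
  using schwartz_partial_derivs[of f "[j]"] by (simp add: partial_derivs_Nil partial_derivs_Cons)

lemma schwartz_seminorm_bound:
  assumes "f \<in> schwartz"
  shows "(1 + norm x) ^ n * norm (partial_derivs \<alpha> f x) \<le> schwartz_seminorm n \<alpha> f"
  unfolding schwartz_seminorm_def using assms by (intro cSUP_upper) (auto simp: schwartz_def)

lemma schwartz_rapid: "f \<in> schwartz \<Longrightarrow> rapid f"
  unfolding rapid_def using schwartz_seminorm_bound[of f _ _ "[]"] by (auto simp: partial_derivs_Nil)

lemma schwartz_has_derivative:
  "f \<in> schwartz \<Longrightarrow>
    (f has_derivative (\<lambda>h. \<Sum>j\<in>UNIV. of_real (h $ j) * partial_deriv j f x)) (at x)"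
  by (intro has_derivative_partial_deriv schwartz_differentiable)

lemma rapid_lin:
  assumes "rapid f" "rapid g"
  shows "rapid (\<lambda>x. a * f x + b * g x)"
  unfolding rapid_def
proof
  fix n
  obtain C D where C: "\<forall>x. (1 + norm x) ^ n * norm (f x) \<le> C" and D: "\<forall>x. (1 + norm x) ^ n * norm (g x) \<le> D"
    using assms unfolding rapid_def by meson
  have "(1 + norm x) ^ n * norm (a * f x + b * g x) \<le> norm a * C + norm b * D" for x :: R3
  proof -
    have "(1 + norm x) ^ n * norm (a * f x + b * g x)
        \<le> (1 + norm x) ^ n * (norm a * norm (f x) + norm b * norm (g x))"
      by (intro mult_left_mono) (metis norm_mult norm_triangle_ineq, simp)
    also have "\<dots> = norm a * ((1 + norm x) ^ n * norm (f x)) + norm b * ((1 + norm x) ^ n * norm (g x))"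
      by (simp add: algebra_simps)
    also have "\<dots> \<le> norm a * C + norm b * D"
      using C D by (intro add_mono mult_left_mono) auto
    finally show ?thesis .
  qed
  then show "\<exists>C. \<forall>x. (1 + norm x) ^ n * norm (a * f x + b * g x) \<le> C" by blast
qed

lemma rapid_mult_growth:
  assumes "rapid f" "\<And>x. norm (g x) \<le> c * (1 + norm x) ^ m"
  shows "rapid (\<lambda>x. g x * f x)"
  unfolding rapid_def
proof
  fix n
  obtain C where C: "\<forall>x. (1 + norm x) ^ (n + m) * norm (f x) \<le> C"
    using assms(1) unfolding rapid_def by meson
  have "(1 + norm x) ^ n * norm (g x * f x) \<le> \<bar>c\<bar> * C" for x :: R3
  proof -
    have "norm (g x) \<le> \<bar>c\<bar> * (1 + norm x) ^ m"
      using assms(2)[of x] by (rule order_trans) (auto intro!: mult_right_mono)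
    then have "(1 + norm x) ^ n * norm (g x * f x)
        \<le> (1 + norm x) ^ n * ((\<bar>c\<bar> * (1 + norm x) ^ m) * norm (f x))"
      unfolding norm_mult by (intro mult_left_mono mult_right_mono) auto
    also have "\<dots> = \<bar>c\<bar> * ((1 + norm x) ^ (n + m) * norm (f x))"
      by (simp add: power_add)
    also have "\<dots> \<le> \<bar>c\<bar> * C" using C by (intro mult_left_mono) auto
    finally show ?thesis .
  qed
  then show "\<exists>C. \<forall>x. (1 + norm x) ^ n * norm (g x * f x) \<le> C" by blast
qed

section \<open>Closure properties of the Schwartz space\<close>

lemma schwartz_lin:
  assumes "f \<in> schwartz" "g \<in> schwartz"
  shows "(\<lambda>x. a * f x + b * g x) \<in> schwartz"
proof -
  let ?S = "{(\<lambda>x. a * f x + b * g x) | f g. f \<in> schwartz \<and> g \<in> schwartz}"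
  have "(\<lambda>x. a * f x + b * g x) \<in> ?S" using assms by blast
  then show ?thesis
  proof (coinduct rule: schwartz_coinduct)
    case (differentiable f x)
    then show ?case
      by (auto intro!: differentiable_add differentiable_mult differentiable_const dest: schwartz_differentiable)
  next
    case (rapid f)
    then show ?case by (auto intro!: rapid_lin dest: schwartz_rapid)
  next
    case (partial_deriv h j)
    then obtain f g where fg: "h = (\<lambda>x. a * f x + b * g x)" "f \<in> schwartz" "g \<in> schwartz" by blast
    have "partial_deriv j h = (\<lambda>x. a * partial_deriv j f x + b * partial_deriv j g x)"
    proof
      fix x
      show "partial_deriv j h x = a * partial_deriv j f x + b * partial_deriv j g x"
        unfolding fg(1)
        by (rule trans[OF partial_deriv_eqI[OF has_derivative_add[OF
            has_derivative_mult_right[OF schwartz_has_derivative] has_derivative_mult_right[OF schwartz_has_derivative]]]])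
          (simp_all add: fg)
    qed
    then show ?case using fg schwartz_partial_deriv by blast
  qed
qed

lemma schwartz_zero: "(\<lambda>x. 0) \<in> schwartz"
proof -
  have "partial_deriv j (\<lambda>x. 0) = (\<lambda>x. 0)" for j
    using partial_deriv_eqI[OF has_derivative_const] by fast
  then show ?thesis
    by (intro schwartz_coinduct[of _ "{\<lambda>x. 0}"]) (auto simp: rapid_def)
qed

lemma schwartz_add: "f \<in> schwartz \<Longrightarrow> g \<in> schwartz \<Longrightarrow> (\<lambda>x. f x + g x) \<in> schwartz"
  using schwartz_lin[of f g 1 1] by simp

lemma schwartz_cmult: "f \<in> schwartz \<Longrightarrow> (\<lambda>x. a * f x) \<in> schwartz"
  using schwartz_lin[of f f a 0] by simp

lemma rapid_coord:
  assumes "rapid f" shows "rapid (\<lambda>x. of_real (x $ j) * f x)"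
proof (rule rapid_mult_growth[OF assms, of _ 1 1])
  fix x :: R3
  show "norm (complex_of_real (x $ j)) \<le> 1 * (1 + norm x) ^ 1"
    using component_le_norm_cart[of x j] by simp
qed

lemma coord_has_derivative:
  assumes "f differentiable at x"
  shows "((\<lambda>x. complex_of_real (x $ j) * f x) has_derivative (\<lambda>h. of_real (x $ j) *
      (\<Sum>j\<in>UNIV. of_real (h $ j) * partial_deriv j f x) + of_real (h $ j) * f x)) (at x)"
  by (intro has_derivative_mult has_derivative_of_real has_derivative_partial_deriv assms
      bounded_linear_imp_has_derivative bounded_linear_vec_nth)

lemma differentiable_coord:
  fixes f :: "R3 \<Rightarrow> complex"
  shows "f differentiable at x \<Longrightarrow> (\<lambda>x. complex_of_real (x $ j) * f x) differentiable at x"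
  using coord_has_derivative[of f x j] unfolding differentiable_def by blast

lemma partial_deriv_coord:
  assumes "f differentiable at x"
  shows "partial_deriv i (\<lambda>x. of_real (x $ j) * f x) x
    = (if i = j then f x else 0) + of_real (x $ j) * partial_deriv i f x"
proof -
  have "axis i 1 $ j = (if i = j then 1 else 0 :: real)"
    by (simp add: axis_def)
  then show ?thesis
    using partial_deriv_eqI[OF coord_has_derivative[OF assms, of j], of i] by simp
qed

lemma schwartz_coord:
  assumes "f \<in> schwartz"
  shows "(\<lambda>x. of_real (x $ j) * f x) \<in> schwartz"
proof -
  \<comment> \<open>The extra summand \<open>g\<close> closes the set under derivatives: the product
    rule leaves the term \<open>f\<close> when the direction is \<open>j\<close>.\<close>
  let ?S = "{(\<lambda>x. g x + of_real (x $ j) * f x) | f g. f \<in> schwartz \<and> g \<in> schwartz}"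
  have "(\<lambda>x. of_real (x $ j) * f x) \<in> ?S"
    by (intro CollectI exI[of _ f] exI[of _ "\<lambda>x. 0"]) (simp add: assms schwartz_zero)
  then show ?thesis
  proof (coinduct rule: schwartz_coinduct)
    case (differentiable h x)
    then obtain f g where fg: "h = (\<lambda>x. g x + of_real (x $ j) * f x)" "f \<in> schwartz" "g \<in> schwartz" by blast
    show ?case unfolding fg(1)
      by (intro differentiable_add differentiable_coord) (use fg schwartz_differentiable in blast)+
  next
    case (rapid h)
    then obtain f g where fg: "h = (\<lambda>x. g x + of_real (x $ j) * f x)" "f \<in> schwartz" "g \<in> schwartz" by blast
    show ?case
      using rapid_lin[OF schwartz_rapid[OF fg(3)] rapid_coord[OF schwartz_rapid[OF fg(2)]], of 1 1]
      by (simp add: fg(1))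
  next
    case (partial_deriv h i)
    then obtain f g where fg: "h = (\<lambda>x. g x + of_real (x $ j) * f x)" "f \<in> schwartz" "g \<in> schwartz" by blast
    have d: "(\<lambda>x. of_real (x $ j) * f x) differentiable at x" for x
      by (intro differentiable_coord schwartz_differentiable fg(2))
    have "partial_deriv i h = (\<lambda>x. (partial_deriv i g x + (if i = j then f x else 0)) + of_real (x $ j) * partial_deriv i f x)"
    proof
      fix x
      show "partial_deriv i h x = (partial_deriv i g x + (if i = j then f x else 0)) + of_real (x $ j) * partial_deriv i f x"
        unfolding fg(1)
        using partial_deriv_eqI[OF has_derivative_add[OF schwartz_has_derivative[OF fg(3)]
            has_derivative_partial_deriv], of "\<lambda>x. of_real (x $ j) * f x" x i]
          schwartz_differentiable[OF fg(2)] d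
        by (simp add: partial_deriv_coord)
    qed
    moreover have "(\<lambda>x. partial_deriv i g x + (if i = j then f x else 0)) \<in> schwartz"
      using fg by (cases "i = j") (simp_all add: schwartz_add schwartz_partial_deriv)
    ultimately show ?case
      by (intro CollectI exI[of _ "partial_deriv i f"] exI conjI schwartz_partial_deriv fg(2))
  qed
qed

lemma cis_has_derivative:
  assumes "f differentiable at x"
  shows "((\<lambda>x. cis (k \<bullet> x) * f x) has_derivative (\<lambda>h. cis (k \<bullet> x) *
      (\<Sum>j\<in>UNIV. of_real (h $ j) * partial_deriv j f x) + ((k \<bullet> h) *\<^sub>R (\<i> * cis (k \<bullet> x))) * f x)) (at x)"
  by (intro has_derivative_mult has_derivative_cis has_derivative_partial_deriv assms
      has_derivative_inner_right has_derivative_ident)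

lemma partial_deriv_cis:
  assumes "f differentiable at x"
  shows "partial_deriv j (\<lambda>x. cis (k \<bullet> x) * f x) x
    = cis (k \<bullet> x) * (\<i> * of_real (k $ j) * f x + partial_deriv j f x)"
  using partial_deriv_eqI[OF cis_has_derivative[OF assms], of j k]
  by (simp add: inner_axis scaleR_conv_of_real distrib_left)

lemma schwartz_cis:
  assumes "f \<in> schwartz"
  shows "(\<lambda>x. cis (k \<bullet> x) * f x) \<in> schwartz"
proof -
  let ?S = "{(\<lambda>x. cis (k \<bullet> x) * f x) | f. f \<in> schwartz}"
  have "(\<lambda>x. cis (k \<bullet> x) * f x) \<in> ?S" using assms by blast
  then show ?thesis
  proof (coinduct rule: schwartz_coinduct)
    case (differentiable h x)
    then obtain f where f: "h = (\<lambda>x. cis (k \<bullet> x) * f x)" "f \<in> schwartz" by blast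
    show ?case unfolding f(1)
      using cis_has_derivative[OF schwartz_differentiable[OF f(2)]] unfolding differentiable_def by blast
  next
    case (rapid h)
    then obtain f where f: "h = (\<lambda>x. cis (k \<bullet> x) * f x)" "f \<in> schwartz" by blast
    show ?case unfolding f(1)
      by (rule rapid_mult_growth[OF schwartz_rapid[OF f(2)], where c = 1 and m = 0]) simp
  next
    case (partial_deriv h j)
    then obtain f where f: "h = (\<lambda>x. cis (k \<bullet> x) * f x)" "f \<in> schwartz" by blast
    have "(\<lambda>x. \<i> * of_real (k $ j) * f x + partial_deriv j f x) \<in> schwartz"
      using schwartz_lin[OF f(2) schwartz_partial_deriv[OF f(2)], of _ 1] by simp
    moreover have "partial_deriv j h = (\<lambda>x. cis (k \<bullet> x) * (\<i> * of_real (k $ j) * f x + partial_deriv j f x))"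
      unfolding f(1) using partial_deriv_cis schwartz_differentiable[OF f(2)] by blast
    ultimately show ?case by (intro CollectI exI conjI)
  qed
qed

lemma schwartz_affine:
  fixes t :: R3
  assumes "f \<in> schwartz" "c \<noteq> 0"
  shows "(\<lambda>x. f (t + c *\<^sub>R x)) \<in> schwartz"
proof -
  let ?S = "{(\<lambda>x. f (t + c *\<^sub>R x)) | f. f \<in> schwartz}"
  have "(\<lambda>x. f (t + c *\<^sub>R x)) \<in> ?S" using assms by blast
  then show ?thesis
  proof (coinduct rule: schwartz_coinduct)
    case (differentiable h x)
    then show ?case
      by (auto intro!: differentiable_compose[of _ "\<lambda>x. t + c *\<^sub>R x"] differentiable_add differentiable_const
          differentiable_scaleR differentiable_ident dest: schwartz_differentiable)
  next
    case (rapid h)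
    then obtain f where f: "h = (\<lambda>x. f (t + c *\<^sub>R x))" "f \<in> schwartz" by blast
    \<comment> \<open>Comes from solving for \<open>x\<close>: \<open>norm x\<close> is at most
      \<open>norm t / \<bar>c\<bar>\<close> plus \<open>1 / \<bar>c\<bar>\<close> times the norm of
      the transformed point. \<open>K\<close> trades the weight at \<open>x\<close> for the weight
      there.\<close>
    define K where "K = 1 + norm t / \<bar>c\<bar> + 1 / \<bar>c\<bar>"
    have K: "1 + norm x \<le> K * (1 + norm (t + c *\<^sub>R x))" for x
    proof -
      have "norm (c *\<^sub>R x) \<le> norm t + norm (t + c *\<^sub>R x)"
        using norm_triangle_ineq4[of "t + c *\<^sub>R x" t] by simp
      then have "norm x \<le> norm t / \<bar>c\<bar> + 1 / \<bar>c\<bar> * norm (t + c *\<^sub>R x)"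
        using assms(2) by (simp add: field_simps)

      moreover have "1 + r \<le> (1 + a + b) * (1 + n)"
        if "r \<le> a + b * n" "0 \<le> a" "0 \<le> b" "0 \<le> n" for r a b n :: real
        using that mult_nonneg_nonneg[OF that(2,4)] unfolding distrib_left distrib_right by linarith
      ultimately show ?thesis unfolding K_def by auto
    qed
    show ?case unfolding rapid_def
    proof
      fix n
      obtain C where C: "\<forall>x. (1 + norm x) ^ n * norm (f x) \<le> C"
        using schwartz_rapid[OF f(2)] unfolding rapid_def by meson
      have "(1 + norm x) ^ n * norm (h x) \<le> K ^ n * C" for x
      proof -
        have "0 \<le> K" by (simp add: K_def)
        have "(1 + norm x) ^ n * norm (h x) \<le> (K * (1 + norm (t + c *\<^sub>R x))) ^ n * norm (f (t + c *\<^sub>R x))"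
          unfolding f(1) by (intro mult_right_mono power_mono K) auto
        also have "\<dots> \<le> K ^ n * C"
          using C \<open>0 \<le> K\<close> by (auto simp: power_mult_distrib mult.assoc intro!: mult_left_mono)
        finally show ?thesis .
      qed
      then show "\<exists>C. \<forall>x. (1 + norm x) ^ n * norm (h x) \<le> C" by blast
    qed
  next
    case (partial_deriv h j)
    then obtain f where f: "h = (\<lambda>x. f (t + c *\<^sub>R x))" "f \<in> schwartz" by blast
    have "partial_deriv j h = (\<lambda>x. of_real c * partial_deriv j f (t + c *\<^sub>R x))"
    proof
      fix x
      have "(h has_derivative (\<lambda>y. \<Sum>i\<in>UNIV. of_real ((c *\<^sub>R y) $ i) * partial_deriv i f (t + c *\<^sub>R x))) (at x)"
        unfolding f(1)
      proof (rule has_derivative_compose[of "\<lambda>x. t + c *\<^sub>R x" _ _ _ f, OF _ schwartz_has_derivative[OF f(2)]])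
        show "((\<lambda>x. t + c *\<^sub>R x) has_derivative (*\<^sub>R) c) (at x)"
          using has_derivative_add[OF has_derivative_const has_derivative_scaleR_right[OF has_derivative_ident]]
          by auto
      qed
      from partial_deriv_eqI[OF this, of j]
      show "partial_deriv j h x = of_real c * partial_deriv j f (t + c *\<^sub>R x)"
        by (simp add: mult.assoc flip: sum_distrib_left)
    qed
    then show ?case
      using schwartz_cmult[OF schwartz_partial_deriv[OF f(2), of j], of "of_real c"]
      by (intro CollectI exI conjI)
  qed
qed

lemma schwartz_cnj:
  assumes "f \<in> schwartz"
  shows "(\<lambda>x. cnj (f x)) \<in> schwartz"
proof -
  let ?S = "{(\<lambda>x. cnj (f x)) | f. f \<in> schwartz}"
  have "(\<lambda>x. cnj (f x)) \<in> ?S" using assms by blast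
  then show ?thesis
  proof (coinduct rule: schwartz_coinduct)
    case (differentiable h x)
    then obtain f where f: "h = (\<lambda>x. cnj (f x))" "f \<in> schwartz" by blast
    show ?case unfolding f(1)
      by (rule differentiableI) (rule has_derivative_cnj schwartz_has_derivative f)+
  next
    case (rapid h)
    then show ?case using schwartz_rapid by (auto simp: rapid_def)
  next
    case (partial_deriv h j)
    then obtain f where f: "h = (\<lambda>x. cnj (f x))" "f \<in> schwartz" by blast
    have "partial_deriv j h = (\<lambda>x. cnj (partial_deriv j f x))"
    proof
      fix x
      show "partial_deriv j h x = cnj (partial_deriv j f x)" unfolding f(1)
        by (simp add: partial_deriv_eqI[OF has_derivative_cnj[OF schwartz_has_derivative[OF f(2)]], of j x])
    qed
    then show ?case using schwartz_partial_deriv[OF f(2)] by auto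
  qed
qed

text \<open>Sums are included because the Leibniz rule turns one product into two; this is the
  invariant set for the coinduction that follows.\<close>

inductive_set schwartz_products :: "(R3 \<Rightarrow> complex) set" where
  prod: "f \<in> schwartz \<Longrightarrow> g \<in> schwartz \<Longrightarrow> (\<lambda>x. f x * g x) \<in> schwartz_products"
| add: "f \<in> schwartz_products \<Longrightarrow> g \<in> schwartz_products \<Longrightarrow> (\<lambda>x. f x + g x) \<in> schwartz_products"

lemma schwartz_mult:
  assumes "f \<in> schwartz" "g \<in> schwartz"
  shows "(\<lambda>x. f x * g x) \<in> schwartz"
proof -
  have "(\<lambda>x. f x * g x) \<in> schwartz_products" using assms by (rule schwartz_products.prod)
  then show ?thesis
  proof (coinduct rule: schwartz_coinduct)
    case (differentiable h x)
    then show ?case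
      by induction (auto intro!: differentiable_add differentiable_mult dest: schwartz_differentiable)
  next
    case (rapid h)
    then show ?case
    proof induction
      case (prod f g)
      obtain C where "\<forall>x. (1 + norm x) ^ 0 * norm (f x) \<le> C"
        using schwartz_rapid[OF prod(1)] unfolding rapid_def by blast
      then show ?case
        by (intro rapid_mult_growth[OF schwartz_rapid[OF prod(2)], of _ C 0]) auto
    next
      case (add f g)
      then show ?case using rapid_lin[of f g 1 1] by simp
    qed
  next
    case (partial_deriv h j)
    then show ?case
    proof induction
      case (prod f g)
      have "partial_deriv j (\<lambda>x. f x * g x) = (\<lambda>x. f x * partial_deriv j g x + partial_deriv j f x * g x)"
        by (intro ext trans[OF partial_deriv_eqI[OF has_derivative_mult[OF schwartz_has_derivative schwartz_has_derivative]]] prod)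
          simp
      then show ?case
        using prod by (auto intro!: schwartz_products.intros schwartz_partial_deriv)
    next
      case (add f g)
      have d: "u differentiable at x" if "u \<in> schwartz_products" for u x
        using that by induction (auto intro!: differentiable_add differentiable_mult dest: schwartz_differentiable)
      have "partial_deriv j (\<lambda>x. f x + g x) = (\<lambda>x. partial_deriv j f x + partial_deriv j g x)"
        by (intro ext trans[OF partial_deriv_eqI[OF has_derivative_add[OF has_derivative_partial_deriv has_derivative_partial_deriv]]] d add)
          simp
      then show ?case using add by (auto intro!: schwartz_products.intros)
    qed
  qed
qed

text \<open>The factor 1/2 in the exponent makes this function a fixed point of the unitary Fourier
  transform.\<close>

definition gaussian :: "R3 \<Rightarrow> complex" where
  "gaussian x = of_real (exp (- (x \<bullet> x) / 2))"

text \<open>Polynomial multiples of the Gaussian, the smallest convenient set that contains it and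
  is closed under derivatives.\<close>

inductive_set hermite :: "(R3 \<Rightarrow> complex) set" where
  gauss: "gaussian \<in> hermite"
| lin: "f \<in> hermite \<Longrightarrow> g \<in> hermite \<Longrightarrow> (\<lambda>x. a * f x + b * g x) \<in> hermite"
| coord: "f \<in> hermite \<Longrightarrow> (\<lambda>x. of_real (x $ j) * f x) \<in> hermite"

lemma rapid_gaussian: "rapid gaussian"
  unfolding rapid_def
proof
  fix n
  \<comment> \<open>\<open>real n ^ n\<close> comes from
    \<open>(1 + (1 + r) / n) ^ n \<le> exp (1 + r)\<close>, and \<open>3 / 2\<close> is the maximum
    of \<open>1 + r - r * r / 2\<close>, attained at \<open>r = 1\<close>.\<close>
  have *: "(1 + r) ^ n * exp (- (r * r) / 2) \<le> real n ^ n * exp (3 / 2)" if "0 \<le> r" for r :: real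
  proof -
    have "(1 + r) ^ n \<le> real n ^ n * exp (1 + r)"
    proof (cases "n = 0")
      case False
      have "((1 + r) / real n) ^ n \<le> (1 + (1 + r) / real n) ^ n"
        using that by (intro power_mono) auto
      also have "\<dots> \<le> exp (1 + r)"
        using that False by (intro exp_ge_one_plus_x_over_n_power_n) auto
      finally show ?thesis using False by (simp add: power_divide field_simps)
    qed (use that in simp)
    then have "(1 + r) ^ n * exp (- (r * r) / 2) \<le> (real n ^ n * exp (1 + r)) * exp (- (r * r) / 2)"
      by (intro mult_right_mono) auto
    also have "\<dots> = real n ^ n * exp (1 + r - r * r / 2)"
      by (simp add: mult.assoc flip: exp_add)
    also have "\<dots> \<le> real n ^ n * exp (3 / 2)"
      using zero_le_square[of "r - 1"] by (intro mult_left_mono) (auto simp: algebra_simps)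
    finally show ?thesis .
  qed
  have "(1 + norm x) ^ n * norm (gaussian x) \<le> real n ^ n * exp (3 / 2)" for x :: R3
    using *[of "norm x"]
    by (simp add: gaussian_def power2_norm_eq_inner flip: power2_eq_square)
  then show "\<exists>C. \<forall>x. (1 + norm x) ^ n * norm (gaussian x) \<le> C" by blast
qed

lemma gaussian_has_derivative:
  "(gaussian has_derivative (\<lambda>h. - of_real (x \<bullet> h) * gaussian x)) (at x)"
proof -
  have "((\<lambda>x::R3. exp (- (x \<bullet> x) / 2)) has_derivative (\<lambda>h. exp (- (x \<bullet> x) / 2) * - (x \<bullet> h))) (at x)"
    by (auto intro!: derivative_eq_intros simp: inner_commute)
  from has_derivative_of_real[OF this, where 'a = complex] show ?thesis
    by (simp add: gaussian_def [abs_def] mult.commute)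
qed

lemma schwartz_gaussian: "gaussian \<in> schwartz"
proof -
  have d: "f differentiable at x" if "f \<in> hermite" for f x
    using that
  proof induction
    case gauss
    then show ?case using gaussian_has_derivative differentiableI by blast
  qed (auto intro: differentiable_coord differentiable_add differentiable_mult)
  have "gaussian \<in> hermite" by (rule gauss)
  then show ?thesis
  proof (coinduct rule: schwartz_coinduct)
    case (differentiable h x)
    then show ?case by (rule d)
  next
    case (rapid h)
    then show ?case by induction (auto intro: rapid_gaussian rapid_lin rapid_coord)
  next
    case (partial_deriv h i)
    then show ?case
    proof induction
      case gauss
      have "partial_deriv i gaussian = (\<lambda>x. (-1) * (of_real (x $ i) * gaussian x) + 0 * gaussian x)"
        by (intro ext trans[OF partial_deriv_eqI[OF gaussian_has_derivative]]) (simp add: inner_axis)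
      then show ?case by (metis hermite.intros)
    next
      case (lin f g a b)
      have "partial_deriv i (\<lambda>x. a * f x + b * g x) = (\<lambda>x. a * partial_deriv i f x + b * partial_deriv i g x)"
        by (intro ext trans[OF partial_deriv_eqI[OF has_derivative_add[OF
            has_derivative_mult_right[OF has_derivative_partial_deriv] has_derivative_mult_right[OF has_derivative_partial_deriv]]]])
          (simp_all add: d lin)
      then show ?case using lin by (auto intro: hermite.intros)
    next
      case (coord f j)
      have "partial_deriv i (\<lambda>x. of_real (x $ j) * f x)
         = (\<lambda>x. (if i = j then 1 else 0) * f x + 1 * (of_real (x $ j) * partial_deriv i f x))"
        using partial_deriv_coord[OF d[OF coord(1)]] by (auto simp: fun_eq_iff)
      then show ?case using hermite.lin[OF coord(1) hermite.coord[OF coord(2)]] by presburger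
    qed
  qed
qed

section \<open>The Fourier transform on Schwartz functions\<close>

lemma integrable_lborel_affine:
  fixes f :: "'a::euclidean_space \<Rightarrow> 'b::{banach, second_countable_topology}"
  assumes "integrable lborel f" "c \<noteq> 0"
  shows "integrable lborel (\<lambda>x. f (t + c *\<^sub>R x))"
proof -
  have [measurable]: "f \<in> borel_measurable borel" using assms(1) by auto
  have "integrable (density (distr lborel borel (\<lambda>x. t + c *\<^sub>R x)) (\<lambda>_. ennreal (\<bar>c\<bar> ^ DIM('a)))) f"
    using assms(1) lborel_affine[OF assms(2), of t] by simp
  then have "integrable lborel (\<lambda>x. \<bar>c\<bar> ^ DIM('a) *\<^sub>R f (t + c *\<^sub>R x))"
    by (simp add: integrable_density integrable_distr_eq)
  from integrable_scaleR_right[OF this, of "inverse (\<bar>c\<bar> ^ DIM('a))"] show ?thesis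
    using assms(2) by simp
qed

lemma integral_lborel_affine:
  fixes f :: "'a::euclidean_space \<Rightarrow> 'b::{banach, second_countable_topology}"
  assumes "f \<in> borel_measurable borel" "c \<noteq> 0"
  shows "(LINT x|lborel. f x) = \<bar>c\<bar> ^ DIM('a) *\<^sub>R (LINT x|lborel. f (t + c *\<^sub>R x))"
  by (subst lborel_affine[OF assms(2), of t]) (use assms in \<open>simp add: integral_density integral_distr\<close>)

lemma integrable_inverse_square_plus_1: "integrable lborel (\<lambda>x::real. 1 / (1 + x\<^sup>2))"
  using integrable_inverse_1_plus_square
  by (simp add: set_integrable_def einterval_def divide_inverse)

text \<open>The exponent 6 is twice the dimension: the function lies below the product of three
  one-dimensional functions \<open>1 / (1 + r\<^sup>2)\<close>, whose integrals factorise. This 6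
  recurs in all decay estimates.\<close>

lemma integrable_inverse_norm_power: "integrable lborel (\<lambda>x::R3. 1 / (1 + norm x) ^ 6)"
proof (rule Bochner_Integration.integrable_bound)
  let ?P = "\<lambda>x::R3. (\<Prod>b\<in>Basis. 1 / (1 + (x \<bullet> b)\<^sup>2))"
  have fin: "(\<integral>\<^sup>+ r. ennreal (1 / (1 + (r::real)\<^sup>2)) \<partial>lborel) < \<infinity>"
    using integrable_inverse_square_plus_1 unfolding integrable_iff_bounded by simp
  have "(\<integral>\<^sup>+x. ennreal (?P x) \<partial>lborel) = (\<integral>\<^sup>+x. (\<Prod>b\<in>Basis. ennreal (1 / (1 + (x \<bullet> b)\<^sup>2))) \<partial>(lborel :: R3 measure))"
    by (intro nn_integral_cong) (simp add: prod_ennreal)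
  also have "\<dots> = (\<Prod>b\<in>(Basis :: R3 set). \<integral>\<^sup>+r. ennreal (1 / (1 + r\<^sup>2)) \<partial>lborel)"
    by (rule nn_integral_lborel_prod) auto
  also have "\<dots> < \<infinity>" using fin by (simp add: power_less_top_ennreal)
  finally show "integrable lborel ?P"
    by (intro integrableI_nonneg) (auto intro!: prod_nonneg)
  show "AE x in lborel. norm (1 / (1 + norm x) ^ 6) \<le> norm (?P x)"
  proof (rule AE_I2)
    fix x :: R3
    have "(\<Prod>b\<in>Basis. (1 + (x \<bullet> b)\<^sup>2)) \<le> (\<Prod>b\<in>(Basis :: R3 set). (1 + norm x)\<^sup>2)"
    proof (intro prod_mono conjI)
      fix b :: R3 assume "b \<in> Basis"
      then have "\<bar>x \<bullet> b\<bar> \<le> norm x" by (rule Basis_le_norm)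
      then have "(x \<bullet> b)\<^sup>2 \<le> (norm x)\<^sup>2" by (metis abs_norm_cancel abs_le_square_iff)
      moreover have "(1 + norm x)\<^sup>2 = 1 + 2 * norm x + (norm x)\<^sup>2" by (simp add: power2_sum)
      ultimately show "1 + (x \<bullet> b)\<^sup>2 \<le> (1 + norm x)\<^sup>2" using norm_ge_zero[of x] by linarith
    qed auto
    also have "\<dots> = (1 + norm x) ^ 6" by (simp flip: power_mult)
    finally have le: "(\<Prod>b\<in>Basis. (1 + (x \<bullet> b)\<^sup>2)) \<le> (1 + norm x) ^ 6" .
    have "0 < (\<Prod>b\<in>Basis. (1 + (x \<bullet> b)\<^sup>2))" by (intro prod_pos) (auto intro!: add_pos_nonneg)
    then have "1 / (1 + norm x) ^ 6 \<le> 1 / (\<Prod>b\<in>Basis. (1 + (x \<bullet> b)\<^sup>2))"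
      using le by (intro divide_left_mono mult_pos_pos) (auto intro: less_le_trans)
    also have "\<dots> = ?P x" by (simp add: prod_dividef)
    finally show "norm (1 / (1 + norm x) ^ 6) \<le> norm (?P x)" by (simp add: abs_of_nonneg prod_nonneg)
  qed
qed simp

section \<open>Integrability of Schwartz functions\<close>

lemma schwartz_continuous: "f \<in> schwartz \<Longrightarrow> continuous_on A f"
  by (meson continuous_at_imp_continuous_on differentiable_imp_continuous_within schwartz_differentiable)

lemma schwartz_borel_measurable: "f \<in> schwartz \<Longrightarrow> f \<in> borel_measurable borel"
  using schwartz_continuous borel_measurable_continuous_onI by blast

lemma schwartz_decay:
  assumes "f \<in> schwartz"
  shows "norm (partial_derivs \<alpha> f x) \<le> schwartz_seminorm n \<alpha> f / (1 + norm x) ^ n"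
proof -
  have "0 < (1 + norm x) ^ n" by (simp add: add_pos_nonneg)
  then show ?thesis
    using schwartz_seminorm_bound[OF assms, of x n \<alpha>] by (simp add: pos_le_divide_eq mult.commute)
qed

lemma schwartz_growth_integrable:
  assumes "f \<in> schwartz"
  shows "integrable lborel (\<lambda>x. (1 + norm x) ^ n * norm (f x))"
proof (rule Bochner_Integration.integrable_bound)
  show "integrable lborel (\<lambda>x::R3. schwartz_seminorm (n + 6) [] f * (1 / (1 + norm x) ^ 6))"
    by (intro integrable_mult_right integrable_inverse_norm_power)
  have "(1 + norm x) ^ n * norm (f x) \<le> schwartz_seminorm (n + 6) [] f / (1 + norm x) ^ 6" for x
  proof -
    have "((1 + norm x) ^ n * norm (f x)) * (1 + norm x) ^ 6 \<le> schwartz_seminorm (n + 6) [] f"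
      using schwartz_seminorm_bound[OF assms, of x "n + 6" "[]"]
      by (simp add: partial_derivs_Nil power_add mult_ac)
    moreover have "0 < (1 + norm x) ^ 6" by (intro zero_less_power add_pos_nonneg) auto
    ultimately show ?thesis using pos_le_divide_eq by blast
  qed
  then show "AE x in lborel. norm ((1 + norm x) ^ n * norm (f x))
      \<le> norm (schwartz_seminorm (n + 6) [] f * (1 / (1 + norm x) ^ 6))"
    by (intro AE_I2) (simp add: abs_of_nonneg schwartz_seminorm_nonneg[OF assms])
  show "(\<lambda>x. (1 + norm x) ^ n * norm (f x)) \<in> borel_measurable lborel"
    using schwartz_borel_measurable[OF assms] by measurable
qed

lemma schwartz_integrable:
  assumes "f \<in> schwartz" shows "integrable lborel f"
  using schwartz_growth_integrable[OF assms, of 0] schwartz_borel_measurable[OF assms]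
  by (simp add: integrable_norm_iff)

definition fourier_const :: complex where
  "fourier_const = complex_of_real ((2 * pi) powr (- 3 / 2))"

lemma fourier_altdef: "fourier f k = fourier_const * (LINT x|lborel. cis (- (k \<bullet> x)) * f x)"
  by (simp add: fourier_def fourier_const_def)

lemma schwartz_cis_minus: "f \<in> schwartz \<Longrightarrow> (\<lambda>x. cis (- (k \<bullet> x)) * f x) \<in> schwartz"
  using schwartz_cis[of f "- k"] by simp

lemma integral_mult_bound:
  fixes f :: "R3 \<Rightarrow> complex"
  assumes "integrable lborel f" "integrable lborel b" "\<And>x. norm (f x) \<le> b x"
  shows "norm (LINT x|lborel. f x) \<le> (LINT x|lborel. b x)"
proof -
  have "norm (LINT x|lborel. f x) \<le> (LINT x|lborel. norm (f x))" by (rule integral_norm_bound)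
  also have "\<dots> \<le> (LINT x|lborel. b x)"
    using assms by (intro integral_mono) auto
  finally show ?thesis .
qed

lemma norm_fourier_le:
  assumes "f \<in> schwartz"
  shows "norm (fourier f k) \<le> norm fourier_const * (LINT x|lborel. norm (f x))"
proof -
  have "norm (LINT x|lborel. cis (- (k \<bullet> x)) * f x) \<le> (LINT x|lborel. norm (f x))"
    using assms by (intro integral_mult_bound schwartz_integrable schwartz_cis_minus)
      (auto simp: norm_mult schwartz_integrable)
  then show ?thesis unfolding fourier_altdef norm_mult by (rule mult_left_mono) simp
qed

lemma fourier_lin:
  assumes "f \<in> schwartz" "g \<in> schwartz"
  shows "fourier (\<lambda>x. a * f x + b * g x) k = a * fourier f k + b * fourier g k"
proof -
  have "(LINT x|lborel. cis (- (k \<bullet> x)) * (a * f x + b * g x))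
    = (LINT x|lborel. a * (cis (- (k \<bullet> x)) * f x) + b * (cis (- (k \<bullet> x)) * g x))"
    by (simp add: algebra_simps)
  also have "\<dots> = a * (LINT x|lborel. cis (- (k \<bullet> x)) * f x) + b * (LINT x|lborel. cis (- (k \<bullet> x)) * g x)"
    using schwartz_integrable[OF schwartz_cis_minus[OF assms(1), of k]] schwartz_integrable[OF schwartz_cis_minus[OF assms(2), of k]]
    by (subst Bochner_Integration.integral_add) simp_all
  finally show ?thesis by (simp add: fourier_altdef algebra_simps)
qed

lemma cis_taylor_bound: "norm (cis (- r) - 1 + \<i> * of_real r) \<le> r\<^sup>2 / 2"
  using iexp_approx1[of "- r" 1] by (simp add: cis_conv_exp numeral_2_eq_2 algebra_simps)

text \<open>Differentiation under the integral with an explicit remainder: the second-order Taylor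
  bound of the phase leaves \<open>(norm h)\<^sup>2 * (1 + norm x) ^ 2 / 2\<close>, which is
  integrable against a Schwartz function. \<open>M\<close> is this integral with its
  constants.\<close>

lemma fourier_has_derivative:
  assumes "f \<in> schwartz"
  shows "(fourier f has_derivative
    (\<lambda>h. \<Sum>j\<in>UNIV. of_real (h $ j) * fourier (\<lambda>x. (- \<i>) * (of_real (x $ j) * f x)) k)) (at k)"
    (is "(_ has_derivative ?D) _")
proof -
  define M where "M = norm fourier_const * (LINT x|lborel. (1 + norm x) ^ 2 * norm (f x)) / 2"
  have sj: "(\<lambda>x. (- \<i>) * (of_real (x $ j) * f x)) \<in> schwartz" for j
    by (intro schwartz_cmult schwartz_coord assms)
  have bl: "bounded_linear ?D"
    by (intro bounded_linear_intros bounded_linear_vec_nth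
        bounded_linear_compose[OF bounded_linear_mult_left] bounded_linear_compose[OF bounded_linear_of_real])
  have bnd: "norm (fourier f y - fourier f k - ?D (y - k)) \<le> M * norm (y - k) * norm (y - k)" for y
  proof -
    define h where "h = y - k"
    have D: "?D h = fourier_const * (LINT x|lborel. (\<Sum>j\<in>UNIV. of_real (h $ j) * (cis (- (k \<bullet> x)) * ((- \<i>) * (of_real (x $ j) * f x)))))"
    proof -
      have i: "integrable lborel (\<lambda>x. of_real (h $ j) * (cis (- (k \<bullet> x)) * ((- \<i>) * (of_real (x $ j) * f x))))" for j
        by (intro integrable_mult_right schwartz_integrable[OF schwartz_cis_minus] schwartz_cmult schwartz_coord assms)
      show ?thesis
        unfolding fourier_altdef Bochner_Integration.integral_sum[OF i] integral_mult_right_zero sum_distrib_left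
        by (intro sum.cong refl) (rule mult.left_commute)
    qed
    have D': "(\<Sum>j\<in>UNIV. of_real (h $ j) * (cis (- (k \<bullet> x)) * ((- \<i>) * (of_real (x $ j) * f x))))
       = - (cis (- (k \<bullet> x)) * f x * (\<i> * of_real (h \<bullet> x)))" for x
      by (simp add: inner_vec_def sum_distrib_left mult_ac flip: sum_negf)
    have ints: "integrable lborel (\<lambda>x. cis (- (y \<bullet> x)) * f x)" "integrable lborel (\<lambda>x. cis (- (k \<bullet> x)) * f x)"
      "integrable lborel (\<lambda>x. - (cis (- (k \<bullet> x)) * f x * (\<i> * of_real (h \<bullet> x))))"
    proof -
      show "integrable lborel (\<lambda>x. - (cis (- (k \<bullet> x)) * f x * (\<i> * of_real (h \<bullet> x))))"
        unfolding D'[symmetric]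
        by (intro Bochner_Integration.integrable_sum integrable_mult_right schwartz_integrable schwartz_cis_minus schwartz_cmult schwartz_coord assms)
    qed (intro schwartz_integrable schwartz_cis_minus assms)+
    have "fourier f y - fourier f k - ?D h
      = fourier_const * (LINT x|lborel. cis (- (y \<bullet> x)) * f x - cis (- (k \<bullet> x)) * f x
          - - (cis (- (k \<bullet> x)) * f x * (\<i> * of_real (h \<bullet> x))))"
      unfolding D D' unfolding fourier_altdef using ints
      by (simp add: Bochner_Integration.integral_diff right_diff_distrib distrib_left)
    also have "norm \<dots> \<le> norm fourier_const * (LINT x|lborel. (norm h)\<^sup>2 / 2 * ((1 + norm x) ^ 2 * norm (f x)))"
      unfolding norm_mult
    proof (intro mult_left_mono integral_mult_bound)
      fix x :: R3
      have "cis (- (y \<bullet> x)) = cis (- (k \<bullet> x)) * cis (- (h \<bullet> x))"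
        by (simp add: cis_mult h_def inner_diff_left)
      then have "cis (- (y \<bullet> x)) * f x - cis (- (k \<bullet> x)) * f x - - (cis (- (k \<bullet> x)) * f x * (\<i> * of_real (h \<bullet> x)))
         = cis (- (k \<bullet> x)) * f x * (cis (- (h \<bullet> x)) - 1 + \<i> * of_real (h \<bullet> x))"
        by (simp add: algebra_simps)
      then have "norm (cis (- (y \<bullet> x)) * f x - cis (- (k \<bullet> x)) * f x - - (cis (- (k \<bullet> x)) * f x * (\<i> * of_real (h \<bullet> x))))
        \<le> norm (f x) * ((h \<bullet> x)\<^sup>2 / 2)"
        using mult_left_mono[OF cis_taylor_bound[of "h \<bullet> x"], of "norm (f x)"] by (simp add: norm_mult mult.assoc)
      also have "\<dots> \<le> norm (f x) * ((norm h)\<^sup>2 * (1 + norm x)\<^sup>2 / 2)"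
      proof -
        have "\<bar>h \<bullet> x\<bar> \<le> norm h * (1 + norm x)"
          using Cauchy_Schwarz_ineq2[of h x] by (simp add: algebra_simps add_increasing)
        then have "(h \<bullet> x)\<^sup>2 \<le> (norm h * (1 + norm x))\<^sup>2"
          by (metis abs_ge_zero power2_abs power_mono)
        then show ?thesis by (intro mult_left_mono) (auto simp: power_mult_distrib)
      qed
      finally show "norm (cis (- (y \<bullet> x)) * f x - cis (- (k \<bullet> x)) * f x - - (cis (- (k \<bullet> x)) * f x * (\<i> * of_real (h \<bullet> x))))
        \<le> (norm h)\<^sup>2 / 2 * ((1 + norm x) ^ 2 * norm (f x))" by (simp add: mult_ac)
    qed (use ints schwartz_growth_integrable[OF assms, of 2] in \<open>auto intro!: Bochner_Integration.integrable_diff integrable_mult_right\<close>)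
    also have "\<dots> = M * norm h * norm h" by (simp add: M_def power2_eq_square)
    finally show ?thesis unfolding h_def .
  qed
  have "((\<lambda>y. norm (fourier f y - fourier f k - ?D (y - k)) / norm (y - k)) \<longlongrightarrow> 0) (at k)"
  proof (rule Lim_null_comparison)
    show "\<forall>\<^sub>F y in at k. norm (norm (fourier f y - fourier f k - ?D (y - k)) / norm (y - k)) \<le> M * norm (y - k)"
    proof (rule eventually_mono[OF eventually_neq_at_within[of k k UNIV]])
      show "norm (norm (fourier f y - fourier f k - ?D (y - k)) / norm (y - k)) \<le> M * norm (y - k)"
        if "y \<noteq> k" for y
        using bnd[of y] that by (simp add: divide_le_eq)
    qed
    show "((\<lambda>y. M * norm (y - k)) \<longlongrightarrow> 0) (at k)"
      by (auto intro!: tendsto_eq_intros)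
  qed
  then show ?thesis unfolding has_derivative_iff_norm using bl by blast
qed

lemma partial_deriv_fourier:
  "f \<in> schwartz \<Longrightarrow> partial_deriv j (fourier f) = fourier (\<lambda>x. (- \<i>) * (of_real (x $ j) * f x))"
  using partial_deriv_eqI[OF fourier_has_derivative, of f j] by (simp add: fun_eq_iff)

lemma partial_deriv_line:
  assumes "f \<in> schwartz"
  shows "((\<lambda>r. f (x + r *\<^sub>R axis j 1)) has_derivative (\<lambda>h. h *\<^sub>R partial_deriv j f (x + r *\<^sub>R axis j 1))) (at r within A)"
proof -
  have "((\<lambda>r. f (x + r *\<^sub>R axis j 1)) has_derivative
    (\<lambda>h. \<Sum>i\<in>UNIV. of_real ((h *\<^sub>R axis j 1) $ i) * partial_deriv i f (x + r *\<^sub>R axis j 1))) (at r within A)"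
    by (rule has_derivative_compose[of "\<lambda>r. x + r *\<^sub>R axis j 1" _ _ _ f, OF _ schwartz_has_derivative[OF assms]])
      (auto intro!: derivative_eq_intros)
  moreover have "(\<Sum>i\<in>UNIV. of_real ((h *\<^sub>R axis j 1) $ i) * partial_deriv i f y) = h *\<^sub>R partial_deriv j f y" for h y
    using sum_axis[of j "\<lambda>i. of_real h * partial_deriv i f y"]
    by (simp add: scaleR_conv_of_real[where 'a = complex] mult_ac)
  ultimately show ?thesis by simp
qed

text \<open>By translation invariance the difference quotients have integral zero.\<close>

lemma integral_partial_deriv:
  assumes "f \<in> schwartz"
  shows "(LINT x|lborel. partial_deriv j f x) = 0"
proof -
  define C where "C = schwartz_seminorm 6 [j] f"
  define q where "q n x = (f (x + inverse (real (Suc n)) *\<^sub>R axis j 1) - f x) / of_real (inverse (real (Suc n)))" for n x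
  have fm: "f \<in> borel_measurable borel" by (rule schwartz_borel_measurable[OF assms])
  have fi: "integrable lborel f" by (rule schwartz_integrable[OF assms])
  have sh: "integrable lborel (\<lambda>x. f (x + t))" "(LINT x|lborel. f (x + t)) = (LINT x|lborel. f x)" for t
    using integrable_lborel_affine[OF fi, of 1 t] integral_lborel_affine[OF fm, of 1 t] by (simp_all add: add.commute)
  have pd: "norm (partial_deriv j f x) \<le> C / (1 + norm x) ^ 6" for x
    using schwartz_decay[OF assms, of "[j]" x 6] by (simp add: C_def partial_derivs_Cons partial_derivs_Nil)
  have C: "0 \<le> C" unfolding C_def by (rule schwartz_seminorm_nonneg[OF assms])
  have "(\<lambda>n. LINT x|lborel. q n x) \<longlonglongrightarrow> (LINT x|lborel. partial_deriv j f x)"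
  proof (rule integral_dominated_convergence)
    show "partial_deriv j f \<in> borel_measurable lborel"
      using schwartz_borel_measurable[OF schwartz_partial_deriv[OF assms]] by simp
    show "q n \<in> borel_measurable lborel" for n
      unfolding q_def using fm by measurable
    show "integrable lborel (\<lambda>x::R3. 64 * C * (1 / (1 + norm x) ^ 6))"
      by (intro integrable_mult_right integrable_inverse_norm_power)
    show "AE x in lborel. norm (q n x) \<le> 64 * C * (1 / (1 + norm x) ^ 6)" for n
    proof (rule AE_I2)
      fix x :: R3
      define \<epsilon> where "\<epsilon> = inverse (real (Suc n))"
      have \<epsilon>: "0 < \<epsilon>" "\<epsilon> \<le> 1" unfolding \<epsilon>_def by (auto simp: field_simps)
      \<comment> \<open>64 is \<open>2 ^ 6\<close>: a displacement of length at most 1 changes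
        \<open>1 + norm x\<close> by at most the factor 2. The mean value theorem then turns this
        into a majorant of the difference quotients.\<close>
      have *: "norm (partial_deriv j f (x + r *\<^sub>R axis j 1)) \<le> 64 * C / (1 + norm x) ^ 6" if "r \<in> {0..\<epsilon>}" for r
      proof -
        have "norm x \<le> norm (x + r *\<^sub>R axis j 1) + norm (r *\<^sub>R axis j (1::real) :: R3)"
          using norm_triangle_ineq4[of "x + r *\<^sub>R axis j 1" "r *\<^sub>R axis j 1"] by simp
        moreover have "norm (r *\<^sub>R axis j (1::real) :: R3) \<le> 1"
          using that \<epsilon> by (simp add: norm_axis_1)
        moreover have "0 \<le> norm (x + r *\<^sub>R axis j 1)" by simp
        ultimately have "1 + norm x \<le> 2 * (1 + norm (x + r *\<^sub>R axis j 1))" by argo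
        then have "(1 + norm x) ^ 6 \<le> (2 * (1 + norm (x + r *\<^sub>R axis j 1))) ^ 6"
          by (rule power_mono) simp
        then have "(1 + norm x) ^ 6 \<le> 64 * (1 + norm (x + r *\<^sub>R axis j 1)) ^ 6"
          unfolding power_mult_distrib by simp
        moreover have "c / b \<le> 64 * c / a" if "a \<le> 64 * b" "0 < a" "0 < b" "0 \<le> c" for a b c :: real
          using that mult_left_mono[OF that(1,4)] by (simp add: pos_divide_le_eq pos_le_divide_eq mult.commute mult.left_commute)
        moreover have "0 < (1 + norm x) ^ 6" "0 < (1 + norm (x + r *\<^sub>R axis j 1)) ^ 6"
          by (intro zero_less_power add_pos_nonneg; simp)+
        ultimately have "C / (1 + norm (x + r *\<^sub>R axis j 1)) ^ 6 \<le> 64 * C / (1 + norm x) ^ 6"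
          using C by blast
        then show ?thesis by (rule order_trans[OF pd])
      qed
      have "norm (f (x + \<epsilon> *\<^sub>R axis j 1) - f (x + 0 *\<^sub>R axis j 1)) \<le> 64 * C / (1 + norm x) ^ 6 * norm (\<epsilon> - 0)"
      proof (rule differentiable_bound[of "{0..\<epsilon>}" "\<lambda>r. f (x + r *\<^sub>R axis j 1)"])
        fix r assume r: "r \<in> {0..\<epsilon>}"
        show "((\<lambda>r. f (x + r *\<^sub>R axis j 1)) has_derivative (\<lambda>h. h *\<^sub>R partial_deriv j f (x + r *\<^sub>R axis j 1))) (at r within {0..\<epsilon>})"
          by (rule partial_deriv_line[OF assms])
        show "onorm (\<lambda>h. h *\<^sub>R partial_deriv j f (x + r *\<^sub>R axis j 1)) \<le> 64 * C / (1 + norm x) ^ 6"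
        proof (rule onorm_le)
          fix h :: real
          show "norm (h *\<^sub>R partial_deriv j f (x + r *\<^sub>R axis j 1)) \<le> 64 * C / (1 + norm x) ^ 6 * norm h"
            using mult_right_mono[OF *[OF r], of "norm h"] by (simp add: mult.commute[of "\<bar>h\<bar>"])
        qed
      qed (use \<epsilon> in auto)
      then show "norm (q n x) \<le> 64 * C * (1 / (1 + norm x) ^ 6)"
        using \<epsilon> unfolding q_def \<epsilon>_def[symmetric] by (simp add: norm_divide divide_le_eq)
    qed
    show "AE x in lborel. (\<lambda>n. q n x) \<longlonglongrightarrow> partial_deriv j f x"
    proof (rule AE_I2)
      fix x :: R3
      have L1: "((\<lambda>r. norm (f (x + r *\<^sub>R axis j 1) - f (x + 0 *\<^sub>R axis j 1) - (r - 0) *\<^sub>R partial_deriv j f (x + 0 *\<^sub>R axis j 1)) / norm (r - 0)) \<longlongrightarrow> 0) (at 0)"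
        using partial_deriv_line[OF assms, of x j 0 UNIV] unfolding has_derivative_iff_norm by blast
      \<comment> \<open>The derivative is a limit at 0 with 0 excluded, so the step sizes must be
        nonzero as well as null.\<close>
      have L2: "filterlim (\<lambda>n. inverse (real (Suc n))) (at 0) sequentially"
        unfolding filterlim_at using LIMSEQ_inverse_real_of_nat by (simp del: of_nat_Suc)
      have "(\<lambda>n. norm (f (x + inverse (real (Suc n)) *\<^sub>R axis j 1) - f x - inverse (real (Suc n)) *\<^sub>R partial_deriv j f x)
          / norm (inverse (real (Suc n)))) \<longlonglongrightarrow> 0"
        using filterlim_compose[OF L1 L2] by (simp del: of_nat_Suc)
      moreover have "norm (f (x + inverse (real (Suc n)) *\<^sub>R axis j 1) - f x - inverse (real (Suc n)) *\<^sub>R partial_deriv j f x)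
          / norm (inverse (real (Suc n))) = norm (q n x - partial_deriv j f x)" for n
      proof -
        have "q n x - partial_deriv j f x = (f (x + inverse (real (Suc n)) *\<^sub>R axis j 1) - f x - inverse (real (Suc n)) *\<^sub>R partial_deriv j f x)
          / of_real (inverse (real (Suc n)))"
          unfolding q_def by (simp add: scaleR_conv_of_real diff_divide_distrib del: of_nat_Suc)
        then show ?thesis by (simp only: norm_divide norm_of_real real_norm_def)
      qed
      ultimately have "(\<lambda>n. norm (q n x - partial_deriv j f x)) \<longlonglongrightarrow> 0" by simp
      then show "(\<lambda>n. q n x) \<longlonglongrightarrow> partial_deriv j f x"
        by (rule LIM_zero_cancel[OF tendsto_norm_zero_cancel])
    qed
  qed
  moreover have "(LINT x|lborel. q n x) = 0" for n
    unfolding q_def by (simp add: sh fi)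
  ultimately show ?thesis by (simp add: LIMSEQ_const_iff)
qed

text \<open>Integration by parts, in the form that the derivative of
  \<open>cis (- (k \<bullet> x)) * f x\<close> has integral zero.\<close>

lemma coord_fourier:
  assumes "f \<in> schwartz"
  shows "\<i> * of_real (k $ j) * fourier f k = fourier (partial_deriv j f) k"
proof -
  have "partial_deriv j (\<lambda>x. cis (- k \<bullet> x) * f x) = (\<lambda>x. cis (- k \<bullet> x) * (\<i> * of_real ((- k) $ j) * f x + partial_deriv j f x))"
    by (intro ext partial_deriv_cis schwartz_differentiable[OF assms])
  then have "(LINT x|lborel. cis (- k \<bullet> x) * (\<i> * of_real ((- k) $ j) * f x + partial_deriv j f x)) = 0"
    using integral_partial_deriv[OF schwartz_cis[OF assms], of j "- k"] by (simp only:)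
  then have "(LINT x|lborel. cis (- (k \<bullet> x)) * partial_deriv j f x - \<i> * of_real (k $ j) * (cis (- (k \<bullet> x)) * f x)) = 0"
    by (simp add: algebra_simps)
  also have "(LINT x|lborel. cis (- (k \<bullet> x)) * partial_deriv j f x - \<i> * of_real (k $ j) * (cis (- (k \<bullet> x)) * f x))
    = (LINT x|lborel. cis (- (k \<bullet> x)) * partial_deriv j f x) - \<i> * of_real (k $ j) * (LINT x|lborel. cis (- (k \<bullet> x)) * f x)"
    using schwartz_integrable[OF schwartz_cis_minus[OF assms, of k]]
      schwartz_integrable[OF schwartz_cis_minus[OF schwartz_partial_deriv[OF assms], of k j]]
    by (subst Bochner_Integration.integral_diff) simp_all
  finally show ?thesis by (simp add: fourier_altdef)
qed

text \<open>Order 6 makes the differentiated function integrable, and pure powers of one derivative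
  suffice since \<open>(1 + norm k) ^ n\<close> is at most
  \<open>4 ^ n * (1 + (\<Sum>j\<in>UNIV. \<bar>k $ j\<bar> ^ n))\<close>.\<close>

definition fourier_bound :: "nat \<Rightarrow> (R3 \<Rightarrow> complex) \<Rightarrow> real" where
  "fourier_bound n f = schwartz_seminorm 6 [] f + (\<Sum>j\<in>UNIV. schwartz_seminorm 6 (replicate n j) f)"

definition decay_const :: real where
  "decay_const = norm fourier_const * (LINT x|lborel. 1 / (1 + norm (x :: R3)) ^ 6)"

lemma decay_const_nonneg: "0 \<le> decay_const"
  unfolding decay_const_def by (intro mult_nonneg_nonneg integral_nonneg_AE) auto

lemma norm_fourier_seminorm:
  assumes "f \<in> schwartz"
  shows "norm (fourier (partial_derivs \<alpha> f) k) \<le> decay_const * schwartz_seminorm 6 \<alpha> f"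
proof -
  have "norm (fourier (partial_derivs \<alpha> f) k) \<le> norm fourier_const * (LINT x|lborel. norm (partial_derivs \<alpha> f x))"
    by (intro norm_fourier_le schwartz_partial_derivs assms)
  also have "(LINT x|lborel. norm (partial_derivs \<alpha> f x)) \<le> (LINT x|lborel. schwartz_seminorm 6 \<alpha> f * (1 / (1 + norm (x::R3)) ^ 6))"
  proof (rule Bochner_Integration.integral_mono)
    show "integrable lborel (\<lambda>x. norm (partial_derivs \<alpha> f x))"
      by (intro integrable_norm schwartz_integrable schwartz_partial_derivs assms)
    show "integrable lborel (\<lambda>x::R3. schwartz_seminorm 6 \<alpha> f * (1 / (1 + norm x) ^ 6))"
      by (intro integrable_mult_right integrable_inverse_norm_power)
    show "norm (partial_derivs \<alpha> f x) \<le> schwartz_seminorm 6 \<alpha> f * (1 / (1 + norm x) ^ 6)" for x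
      using schwartz_decay[OF assms, of \<alpha> x 6] by simp
  qed
  finally have "norm (fourier (partial_derivs \<alpha> f) k) \<le> norm fourier_const *
      (LINT x|lborel. schwartz_seminorm 6 \<alpha> f * (1 / (1 + norm (x::R3)) ^ 6))"
    by (simp add: mult_left_mono)
  also have "\<dots> = decay_const * schwartz_seminorm 6 \<alpha> f"
    by (simp only: decay_const_def integral_mult_right_zero) (simp add: mult_ac)
  finally show ?thesis .
qed

lemma coord_power_fourier:
  assumes "f \<in> schwartz"
  shows "(\<i> * of_real (k $ j)) ^ n * fourier f k = fourier (partial_derivs (replicate n j) f) k"
proof (induction n)
  case (Suc n)
  then show ?case
    using coord_fourier[OF schwartz_partial_derivs[OF assms, of "replicate n j"], of k j]
    by (simp add: partial_derivs_Cons mult.assoc)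
qed (simp add: partial_derivs_Nil)

lemma fourier_decay:
  assumes "f \<in> schwartz"
  shows "(1 + norm k) ^ n * norm (fourier f k) \<le> 4 ^ n * decay_const * fourier_bound n f"
proof -
  have cp: "\<bar>k $ j\<bar> ^ n * norm (fourier f k) \<le> decay_const * schwartz_seminorm 6 (replicate n j) f" for j
  proof -
    have "\<bar>k $ j\<bar> ^ n * norm (fourier f k) = norm ((\<i> * of_real (k $ j)) ^ n * fourier f k)"
      by (simp add: norm_mult norm_power)
    also have "\<dots> \<le> decay_const * schwartz_seminorm 6 (replicate n j) f"
      unfolding coord_power_fourier[OF assms] by (rule norm_fourier_seminorm[OF assms])
    finally show ?thesis .
  qed
  have c0: "norm (fourier f k) \<le> decay_const * schwartz_seminorm 6 [] f"
    using norm_fourier_seminorm[OF assms, of "[]"] by (simp add: partial_derivs_Nil)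
  \<comment> \<open>Inserting 1 absorbs the constant in \<open>1 + norm k\<close>; with the three
    coordinates this gives the factor 4.\<close>
  define m where "m = Max (insert 1 (range (\<lambda>j. \<bar>k $ j\<bar>)))"
  have m: "1 \<le> m" "\<bar>k $ j\<bar> \<le> m" for j unfolding m_def by (rule Max_ge; simp)+
  have "norm k \<le> (\<Sum>j\<in>UNIV. \<bar>k $ j\<bar>)" by (rule norm_le_l1_cart)
  also have "\<dots> \<le> (\<Sum>j\<in>(UNIV::3 set). m)" by (intro sum_mono m)
  finally have "1 + norm k \<le> 4 * m" using m by simp
  then have "(1 + norm k) ^ n \<le> 4 ^ n * m ^ n"
    by (metis add_nonneg_nonneg norm_ge_zero power_mono power_mult_distrib zero_le_one)
  also have "m ^ n \<le> 1 + (\<Sum>j\<in>UNIV. \<bar>k $ j\<bar> ^ n)"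
  proof -
    have "m \<in> insert 1 (range (\<lambda>j. \<bar>k $ j\<bar>))" unfolding m_def by (rule Max_in) auto
    then show ?thesis
    proof
      assume "m = 1" then show ?thesis by (simp add: sum_nonneg)
    next
      assume "m \<in> range (\<lambda>j. \<bar>k $ j\<bar>)"
      then obtain j where "m = \<bar>k $ j\<bar>" by blast
      moreover have "\<bar>k $ j\<bar> ^ n \<le> (\<Sum>j\<in>UNIV. \<bar>k $ j\<bar> ^ n)" by (rule member_le_sum) auto
      ultimately show ?thesis by simp
    qed
  qed
  finally have "(1 + norm k) ^ n \<le> 4 ^ n * (1 + (\<Sum>j\<in>UNIV. \<bar>k $ j\<bar> ^ n))" by simp
  then have "(1 + norm k) ^ n * norm (fourier f k) \<le> 4 ^ n * (1 + (\<Sum>j\<in>UNIV. \<bar>k $ j\<bar> ^ n)) * norm (fourier f k)"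
    by (rule mult_right_mono) simp
  also have "\<dots> = 4 ^ n * (norm (fourier f k) + (\<Sum>j\<in>UNIV. \<bar>k $ j\<bar> ^ n * norm (fourier f k)))"
    by (simp add: algebra_simps sum_distrib_left sum_distrib_right)
  also have "\<dots> \<le> 4 ^ n * (decay_const * schwartz_seminorm 6 [] f + (\<Sum>j\<in>UNIV. decay_const * schwartz_seminorm 6 (replicate n j) f))"
    by (intro mult_left_mono add_mono sum_mono cp c0) simp
  also have "\<dots> = 4 ^ n * decay_const * fourier_bound n f"
    by (simp add: fourier_bound_def algebra_simps sum_distrib_left)
  finally show ?thesis .
qed

lemma schwartz_fourier:
  assumes "f \<in> schwartz"
  shows "fourier f \<in> schwartz"
proof -
  have "fourier f \<in> fourier ` schwartz" using assms by blast
  then show ?thesis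
  proof (coinduct rule: schwartz_coinduct)
    case (differentiable h x)
    then obtain f where f: "h = fourier f" "f \<in> schwartz" by blast
    show ?case using fourier_has_derivative[OF f(2)] unfolding f(1) differentiable_def by blast
  next
    case (rapid h)
    then obtain f where f: "h = fourier f" "f \<in> schwartz" by blast
    show ?case using fourier_decay[OF f(2)] unfolding f(1) rapid_def by blast
  next
    case (partial_deriv h j)
    then obtain f where f: "h = fourier f" "f \<in> schwartz" by blast
    show ?case unfolding f(1) partial_deriv_fourier[OF f(2)]
      by (intro imageI schwartz_cmult schwartz_coord f(2))
  qed
qed

section \<open>Fourier inversion and test functions\<close>

text \<open>This is the characteristic function of the standard normal distribution, up to the
  normalisation \<open>sqrt (2 * pi)\<close>.\<close>

lemma gaussian_characteristic_1d:
  "(LINT r|lborel. cis (- (t * r)) * complex_of_real (exp (- r\<^sup>2 / 2)))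
     = of_real (sqrt (2 * pi) * exp (- t\<^sup>2 / 2))"
  "integrable lborel (\<lambda>r. cis (- (t * r)) * complex_of_real (exp (- r\<^sup>2 / 2)))"
proof -
  have i: "integrable lborel (\<lambda>r. sqrt (2 * pi) * std_normal_density r)"
    by (intro integrable_mult_right integrable_normal_density zero_less_one)
  have s: "exp (- r\<^sup>2 / 2) = sqrt (2 * pi) * std_normal_density r" for r
    by (simp add: std_normal_density_def)
  have cis_m [measurable]: "cis \<in> borel_measurable borel"
    by (intro borel_measurable_continuous_onI continuous_intros)
  show int: "integrable lborel (\<lambda>r. cis (- (t * r)) * complex_of_real (exp (- r\<^sup>2 / 2)))"
    by (rule Bochner_Integration.integrable_bound[OF i])
      (auto simp: norm_mult std_normal_density_def abs_mult)
  have "of_real (exp (- t\<^sup>2 / 2)) = char std_normal_distribution (- t)"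
    by (simp add: char_std_normal_distribution)
  also have "\<dots> = (LINT r|lborel. std_normal_density r *\<^sub>R iexp (- t * r))"
    unfolding char_def by (subst integral_density) auto
  also have "of_real (sqrt (2 * pi)) * \<dots> = (LINT r|lborel. cis (- (t * r)) * complex_of_real (exp (- r\<^sup>2 / 2)))"
    unfolding integral_mult_right_zero [symmetric] s
    by (intro Bochner_Integration.integral_cong) (auto simp: cis_conv_exp scaleR_conv_of_real)
  finally show "(LINT r|lborel. cis (- (t * r)) * complex_of_real (exp (- r\<^sup>2 / 2)))
     = of_real (sqrt (2 * pi) * exp (- t\<^sup>2 / 2))" by simp
qed

lemma inner_self_Basis: "(x \<bullet> x) = (\<Sum>b\<in>Basis. (x \<bullet> b)\<^sup>2)" for x :: "'a::euclidean_space"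
  by (subst euclidean_inner) (simp add: power2_eq_square)

lemma integral_cis_gaussian:
  "(LINT x|lborel. cis (- (k \<bullet> x)) * gaussian x) = of_real ((2 * pi) powr (3 / 2)) * gaussian k"
proof -
  define f where "f b r = cis (- ((k \<bullet> b) * r)) * complex_of_real (exp (- r\<^sup>2 / 2))" for b :: R3 and r :: real
  interpret product_sigma_finite "\<lambda>_::R3. lborel :: real measure" ..
  have f: "cis (- (k \<bullet> x)) * gaussian x = (\<Prod>b\<in>Basis. f b (x \<bullet> b))" for x
  proof -
    have "(\<Prod>b\<in>Basis. f b (x \<bullet> b)) = (\<Prod>b\<in>Basis. exp (\<i> * of_real (- ((k \<bullet> b) * (x \<bullet> b))) + complex_of_real (- (x \<bullet> b)\<^sup>2 / 2)))"
      unfolding f_def cis_conv_exp exp_add exp_of_real ..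
    also have "\<dots> = exp (\<Sum>b\<in>Basis. \<i> * of_real (- ((k \<bullet> b) * (x \<bullet> b))) + complex_of_real (- (x \<bullet> b)\<^sup>2 / 2))"
      by (simp add: exp_sum)
    also have "(\<Sum>b\<in>Basis. \<i> * of_real (- ((k \<bullet> b) * (x \<bullet> b))) + complex_of_real (- (x \<bullet> b)\<^sup>2 / 2))
       = \<i> * of_real (- (\<Sum>b\<in>Basis. (k \<bullet> b) * (x \<bullet> b))) + of_real (- (\<Sum>b\<in>Basis. (x \<bullet> b)\<^sup>2) / 2)"
      by (simp add: sum.distrib sum_subtractf sum_distrib_left sum_negf sum_divide_distrib)
    also have "\<dots> = \<i> * of_real (- (k \<bullet> x)) + of_real (- (x \<bullet> x) / 2)"
      unfolding inner_self_Basis[of x] by (subst euclidean_inner[of k x]) simp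
    finally show ?thesis by (simp only: gaussian_def cis_conv_exp exp_add exp_of_real)
  qed
  have m: "f b \<in> borel_measurable borel" for b
    using borel_measurable_integrable[OF gaussian_characteristic_1d(2)] unfolding f_def by simp
  let ?P = "Pi\<^sub>M (Basis :: R3 set) (\<lambda>_. lborel :: real measure)"
  have "(LINT x|lborel. cis (- (k \<bullet> x)) * gaussian x)
      = (LINT x|distr ?P borel (\<lambda>g. \<Sum>b\<in>Basis. g b *\<^sub>R b). (\<Prod>b\<in>Basis. f b (x \<bullet> b)))"
    unfolding f by (subst lborel_eq) simp
  also have "\<dots> = (LINT g|?P. (\<Prod>b\<in>Basis. f b ((\<Sum>c\<in>Basis. g c *\<^sub>R c) \<bullet> b)))"
    using m by (subst integral_distr) auto
  also have "\<dots> = (LINT g|?P. (\<Prod>b\<in>Basis. f b (g b)))"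
    by (intro Bochner_Integration.integral_cong prod.cong) auto
  also have "\<dots> = (\<Prod>b\<in>Basis. (LINT r|lborel. f b r))"
    unfolding f_def by (rule product_integral_prod[OF finite_Basis gaussian_characteristic_1d(2)])
  also have "\<dots> = (\<Prod>b\<in>Basis. complex_of_real (sqrt (2 * pi)) * of_real (exp (- (k \<bullet> b)\<^sup>2 / 2)))"
    unfolding f_def gaussian_characteristic_1d by simp
  also have "\<dots> = of_real (sqrt (2 * pi)) ^ 3 * of_real (exp (\<Sum>b\<in>Basis. - (k \<bullet> b)\<^sup>2 / 2))"
    by (simp add: prod.distrib exp_sum)
  also have "(\<Sum>b\<in>Basis. - (k \<bullet> b)\<^sup>2 / 2) = - (k \<bullet> k) / 2"
    by (simp add: inner_self_Basis[of k] sum_negf sum_divide_distrib)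
  also have "complex_of_real (sqrt (2 * pi)) ^ 3 = of_real ((2 * pi) powr (3 / 2))"
    by (simp add: powr_half_sqrt[symmetric] powr_powr powr_realpow[symmetric] flip: of_real_power)
  finally show ?thesis by (simp add: gaussian_def)
qed

lemma fourier_const_mult: "fourier_const * of_real ((2 * pi) powr (3 / 2)) = 1"
  unfolding fourier_const_def by (simp add: powr_minus flip: of_real_mult)

lemma fourier_gaussian: "fourier gaussian = gaussian"
  by (rule ext) (simp add: fourier_altdef integral_cis_gaussian fourier_const_mult flip: mult.assoc)

lemma integral_gaussian: "(LINT x|lborel. gaussian x) = of_real ((2 * pi) powr (3 / 2))"
  using integral_cis_gaussian[of 0] by (simp add: gaussian_def)

text \<open>Fubini: a bounded kernel leaves the product of two integrable functions integrable. It
  is applied to the Fourier kernel and to a Gaussian convolution kernel.\<close>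

lemma integral_swap_kernel:
  fixes f g :: "R3 \<Rightarrow> complex"
  assumes f: "integrable lborel f" and g: "integrable lborel g"
    and K: "case_prod K \<in> borel_measurable borel" and B: "\<And>x y. norm (K x y) \<le> B"
  shows "(LINT x|lborel. f x * (LINT y|lborel. g y * K x y)) = (LINT y|lborel. g y * (LINT x|lborel. f x * K x y))"
proof -

  have [measurable]: "f \<in> borel_measurable borel" "g \<in> borel_measurable borel"
    "case_prod K \<in> borel_measurable (borel \<Otimes>\<^sub>M borel)"
    using f g K by (auto simp: borel_prod)
  let ?h = "\<lambda>(x, y). f x * (g y * K x y)"
  have Ky: "(\<lambda>y. K x y) \<in> borel_measurable borel" for x
    by measurable
  have i1: "integrable lborel (\<lambda>y. g y * K x y)" for x
    by (rule Bochner_Integration.integrable_bound[where f = "\<lambda>y. B * g y"])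
      (use g B[of x] Ky in \<open>auto simp: norm_mult mult.commute[of "norm (g _)"] intro!: mult_right_mono order_trans[OF B abs_ge_self]\<close>)
  have "integrable (lborel \<Otimes>\<^sub>M lborel) ?h"
  proof (rule lborel_pair.Fubini_integrable)
    show "?h \<in> borel_measurable (lborel \<Otimes>\<^sub>M lborel)" by measurable
    show "AE x in lborel. integrable lborel (\<lambda>y. ?h (x, y))"
      using i1 by auto
    show "integrable lborel (\<lambda>x. LINT y|lborel. norm (?h (x, y)))"
    proof (rule Bochner_Integration.integrable_bound[where f = "\<lambda>x. (\<bar>B\<bar> * (LINT y|lborel. norm (g y))) * norm (f x)"])
      show "AE x in lborel. norm (LINT y|lborel. norm (?h (x, y))) \<le> norm ((\<bar>B\<bar> * (LINT y|lborel. norm (g y))) * norm (f x))"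
      proof (rule AE_I2)
        fix x
        have "(LINT y|lborel. norm (g y * K x y)) \<le> (LINT y|lborel. \<bar>B\<bar> * norm (g y))"
        proof (rule Bochner_Integration.integral_mono)
          show "integrable lborel (\<lambda>y. norm (g y * K x y))" by (rule integrable_norm[OF i1])
          show "integrable lborel (\<lambda>y. \<bar>B\<bar> * norm (g y))"
            by (intro integrable_mult_right integrable_norm g)
          show "norm (g y * K x y) \<le> \<bar>B\<bar> * norm (g y)" for y
            using mult_right_mono[OF order_trans[OF B[of x y] abs_ge_self], of "norm (g y)"]
            by (simp add: norm_mult mult.commute)
        qed
        then have "norm (f x) * (LINT y|lborel. norm (g y * K x y)) \<le> norm (f x) * (\<bar>B\<bar> * (LINT y|lborel. norm (g y)))"
          by (intro mult_left_mono) auto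
        then show "norm (LINT y|lborel. norm (?h (x, y))) \<le> norm ((\<bar>B\<bar> * (LINT y|lborel. norm (g y))) * norm (f x))"
          by (simp add: norm_mult[of "f x"] mult_ac abs_mult)
      qed
    qed (use f in auto)
  qed
  from lborel_pair.Fubini_integral[of "\<lambda>x y. f x * (g y * K x y)"] this
  have "(LINT x|lborel. LINT y|lborel. f x * (g y * K x y)) = (LINT y|lborel. LINT x|lborel. f x * (g y * K x y))"
    by simp
  also have "\<dots> = (LINT y|lborel. LINT x|lborel. g y * (f x * K x y))"
    by (simp only: mult.left_commute)
  finally show ?thesis by (simp only: integral_mult_right_zero)
qed

lemma fourier_multiplication:
  assumes "f \<in> schwartz" "g \<in> schwartz"
  shows "(LINT k|lborel. fourier f k * g k) = (LINT x|lborel. f x * fourier g x)"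
proof -
  have K: "(\<lambda>(k, x). cis (- (k \<bullet> x))) \<in> borel_measurable (borel :: (R3 \<times> R3) measure)"
    by (intro borel_measurable_continuous_onI) (auto intro!: continuous_intros simp: case_prod_unfold)
  have "(LINT k|lborel. fourier f k * g k) = fourier_const * (LINT k|lborel. g k * (LINT x|lborel. f x * cis (- (k \<bullet> x))))"
    by (simp add: fourier_altdef mult_ac flip: integral_mult_right_zero)
  also have "\<dots> = fourier_const * (LINT x|lborel. f x * (LINT k|lborel. g k * cis (- (k \<bullet> x))))"
    by (subst integral_swap_kernel[OF schwartz_integrable[OF assms(2)] schwartz_integrable[OF assms(1)] K, of 1]) auto
  also have "\<dots> = (LINT x|lborel. f x * fourier g x)"
    by (simp add: fourier_altdef mult_ac inner_commute flip: integral_mult_right_zero)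
  finally show ?thesis .
qed

section \<open>Gaussian regularisation\<close>

lemma gaussian_bounds: "norm (gaussian x) \<le> 1"
  by (simp add: gaussian_def)

lemma gaussian_continuous: "continuous_on A gaussian"
  using schwartz_gaussian schwartz_continuous by blast

lemma gaussian_borel [measurable]: "gaussian \<in> borel_measurable borel"
  using schwartz_gaussian schwartz_borel_measurable by blast

text \<open>The scale sits in the argument of \<open>f\<close>, so
  \<open>B * norm (gaussian z)\<close> dominates for every \<open>n\<close>. The sign
  \<open>c\<close> covers both uses: \<open>+1\<close> in the inversion formula, \<open>-1\<close>
  in a convolution.\<close>

lemma gaussian_approximate_identity:
  assumes f: "f \<in> borel_measurable borel" "isCont f x" "\<And>x. norm (f x) \<le> B" and c: "c = 1 \<or> c = -1"
  shows "(\<lambda>n. LINT z|lborel. f (x + (c * inverse (real (Suc n))) *\<^sub>R z) * gaussian z)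
     \<longlonglongrightarrow> f x * of_real ((2 * pi) powr (3 / 2))"
proof -
  have "(\<lambda>n. LINT z|lborel. f (x + (c * inverse (real (Suc n))) *\<^sub>R z) * gaussian z) \<longlonglongrightarrow> (LINT z|lborel. f x * gaussian z)"
  proof (rule integral_dominated_convergence)
    show "integrable lborel (\<lambda>z. B * norm (gaussian z))"
      by (intro integrable_mult_right integrable_norm schwartz_integrable schwartz_gaussian)
    show "AE z in lborel. norm (f (x + (c * inverse (real (Suc n))) *\<^sub>R z) * gaussian z) \<le> B * norm (gaussian z)" for n
      using f(3) by (intro AE_I2) (simp add: norm_mult mult_right_mono)
    show "AE z in lborel. (\<lambda>n. f (x + (c * inverse (real (Suc n))) *\<^sub>R z) * gaussian z) \<longlonglongrightarrow> f x * gaussian z"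
    proof (intro AE_I2 tendsto_intros isCont_tendsto_compose[OF f(2)])
      fix z
      have "(\<lambda>n. x + (c * inverse (real (Suc n))) *\<^sub>R z) \<longlonglongrightarrow> x + (c * 0) *\<^sub>R z"
        by (intro tendsto_add tendsto_mult tendsto_const tendsto_scaleR LIMSEQ_inverse_real_of_nat)
      then show "(\<lambda>n. x + (c * inverse (real (Suc n))) *\<^sub>R z) \<longlonglongrightarrow> x" by simp
    qed
  qed (use f(1) in measurable)
  then show ?thesis by (simp add: integral_gaussian)
qed

lemma schwartz_bounded:
  assumes "f \<in> schwartz" obtains B where "\<And>x. norm (f x) \<le> B"
  using schwartz_rapid[OF assms] unfolding rapid_def by (metis mult_1 power_0)

text \<open>The integral of \<open>fourier f k * cis (k \<bullet> y)\<close> is regularised by the factor \<open>gaussian (\<epsilon> *\<^sub>R k)\<close>,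
  whose Fourier transform is an approximate identity.\<close>

lemma fourier_inversion:
  assumes "f \<in> schwartz"
  shows "fourier (fourier f) x = f (- x)"
proof -
  define \<epsilon> where "\<epsilon> n = inverse (real (Suc n))" for n
  have \<epsilon>: "\<epsilon> n > 0" "\<epsilon> n \<noteq> 0" for n by (auto simp: \<epsilon>_def)
  define y where "y = - x"
  define \<eta> where "\<eta> n k = cis (y \<bullet> k) * gaussian (0 + \<epsilon> n *\<^sub>R k)" for n k
  have \<eta>: "\<eta> n \<in> schwartz" for n
    unfolding \<eta>_def by (intro schwartz_cis schwartz_affine schwartz_gaussian \<epsilon>)
  have F\<eta>: "fourier (\<eta> n) z = of_real (inverse (\<epsilon> n) ^ 3) * gaussian (inverse (\<epsilon> n) *\<^sub>R (z - y))" for n z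
  proof -
    define u where "u = inverse (\<epsilon> n) *\<^sub>R (z - y)"
    have "(LINT k|lborel. cis (- (u \<bullet> k)) * gaussian k) = \<bar>\<epsilon> n\<bar> ^ 3 *\<^sub>R (LINT k|lborel. cis (- (u \<bullet> (0 + \<epsilon> n *\<^sub>R k))) * gaussian (0 + \<epsilon> n *\<^sub>R k))"
      using integral_lborel_affine[OF schwartz_borel_measurable[OF schwartz_cis_minus[OF schwartz_gaussian, of u]] \<epsilon>(2)[of n], where t = 0]
      by simp
    also have "(\<lambda>k. cis (- (u \<bullet> (0 + \<epsilon> n *\<^sub>R k))) * gaussian (0 + \<epsilon> n *\<^sub>R k)) = (\<lambda>k. cis (- (z \<bullet> k)) * \<eta> n k)"
    proof
      fix k
      have "- (u \<bullet> (0 + \<epsilon> n *\<^sub>R k)) = - (z \<bullet> k) + y \<bullet> k"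
        using \<epsilon>(2)[of n] by (simp add: u_def inner_diff_left flip: mult.assoc)
      then show "cis (- (u \<bullet> (0 + \<epsilon> n *\<^sub>R k))) * gaussian (0 + \<epsilon> n *\<^sub>R k) = cis (- (z \<bullet> k)) * \<eta> n k"
        by (simp add: \<eta>_def cis_mult flip: mult.assoc)
    qed
    finally have *: "(LINT k|lborel. cis (- (u \<bullet> k)) * gaussian k) = \<bar>\<epsilon> n\<bar> ^ 3 *\<^sub>R (LINT k|lborel. cis (- (z \<bullet> k)) * \<eta> n k)" .
    have "fourier_const * (LINT k|lborel. cis (- (z \<bullet> k)) * \<eta> n k) = of_real (inverse (\<epsilon> n) ^ 3) * (fourier_const * (LINT k|lborel. cis (- (u \<bullet> k)) * gaussian k))"
      unfolding * using \<epsilon>[of n] by (simp add: scaleR_conv_of_real field_simps)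
    then show ?thesis
      using fun_cong[OF fourier_gaussian, of u] unfolding fourier_altdef u_def by (simp only:)
  qed
  have "(\<lambda>n. LINT k|lborel. fourier f k * \<eta> n k) \<longlonglongrightarrow> (LINT k|lborel. fourier f k * cis (y \<bullet> k))"
  proof (rule integral_dominated_convergence)
    show "integrable lborel (\<lambda>k. norm (fourier f k))"
      by (intro integrable_norm schwartz_integrable schwartz_fourier assms)
    show "AE k in lborel. norm (fourier f k * \<eta> n k) \<le> norm (fourier f k)" for n
      by (intro AE_I2) (simp add: norm_mult \<eta>_def gaussian_bounds mult_left_le)
    show "AE k in lborel. (\<lambda>n. fourier f k * \<eta> n k) \<longlonglongrightarrow> fourier f k * cis (y \<bullet> k)"
    proof (rule AE_I2)
      fix k :: R3
      have "(\<lambda>n. 0 + \<epsilon> n *\<^sub>R k) \<longlonglongrightarrow> 0 + 0 *\<^sub>R k"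
        unfolding \<epsilon>_def
        by (rule tendsto_add[OF tendsto_const tendsto_scaleR[OF LIMSEQ_inverse_real_of_nat tendsto_const]])
      then have "(\<lambda>n. gaussian (0 + \<epsilon> n *\<^sub>R k)) \<longlonglongrightarrow> gaussian 0"
        using gaussian_continuous[of UNIV] by (auto intro!: isCont_tendsto_compose[of _ gaussian] simp: continuous_on_eq_continuous_at)
      then have "(\<lambda>n. fourier f k * \<eta> n k) \<longlonglongrightarrow> fourier f k * (cis (y \<bullet> k) * gaussian 0)"
        unfolding \<eta>_def by (intro tendsto_intros)
      then show "(\<lambda>n. fourier f k * \<eta> n k) \<longlonglongrightarrow> fourier f k * cis (y \<bullet> k)"
        by (simp add: gaussian_def)
    qed
    have "(\<lambda>k. cis (y \<bullet> k) * fourier f k) \<in> borel_measurable borel"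
      by (intro schwartz_borel_measurable schwartz_cis schwartz_fourier assms)
    then show "(\<lambda>k. fourier f k * cis (y \<bullet> k)) \<in> borel_measurable lborel" by (simp add: mult.commute)
    show "(\<lambda>k. fourier f k * \<eta> n k) \<in> borel_measurable lborel" for n
      using schwartz_borel_measurable[OF schwartz_mult[OF schwartz_fourier[OF assms] \<eta>]] by simp
  qed
  \<comment> \<open>The multiplication formula moves the transform from \<open>f\<close> to the
    regulariser, whose transform is a Gaussian of width \<open>\<epsilon> n\<close> around
    \<open>y\<close>; rescaling about \<open>y\<close> normalises it.\<close>
  moreover have "(LINT k|lborel. fourier f k * \<eta> n k) = (LINT z|lborel. f (y + (1 * inverse (real (Suc n))) *\<^sub>R z) * gaussian z)" for n
  proof -
    have m: "(\<lambda>z. f z * fourier (\<eta> n) z) \<in> borel_measurable borel"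
      by (intro schwartz_borel_measurable schwartz_mult schwartz_fourier assms \<eta>)
    have "(LINT k|lborel. fourier f k * \<eta> n k) = (LINT z|lborel. f z * fourier (\<eta> n) z)"
      by (rule fourier_multiplication[OF assms \<eta>])
    also have "\<dots> = \<bar>\<epsilon> n\<bar> ^ 3 *\<^sub>R (LINT z|lborel. f (y + \<epsilon> n *\<^sub>R z) * fourier (\<eta> n) (y + \<epsilon> n *\<^sub>R z))"
      using integral_lborel_affine[OF m \<epsilon>(2), of n y] by simp
    also have "\<dots> = (LINT z|lborel. f (y + \<epsilon> n *\<^sub>R z) * gaussian z)"
      unfolding F\<eta> integral_scaleR_right[symmetric] using \<epsilon>[of n]
      by (intro Bochner_Integration.integral_cong refl) (simp add: scaleR_conv_of_real[where 'a = complex] power_inverse)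
    finally show ?thesis by (simp add: \<epsilon>_def)
  qed
  moreover have "(\<lambda>n. LINT z|lborel. f (y + (1 * inverse (real (Suc n))) *\<^sub>R z) * gaussian z) \<longlonglongrightarrow> f y * of_real ((2 * pi) powr (3 / 2))"
  proof -
    obtain B where B: "\<And>x. norm (f x) \<le> B" using schwartz_bounded[OF assms] by metis
    show ?thesis
      using gaussian_approximate_identity[OF schwartz_borel_measurable[OF assms] _ B, of y 1]
        schwartz_continuous[OF assms, of UNIV] by (simp add: continuous_on_eq_continuous_at)
  qed
  ultimately have "(LINT k|lborel. fourier f k * cis (y \<bullet> k)) = f y * of_real ((2 * pi) powr (3 / 2))"
    using LIMSEQ_unique by simp
  then have "fourier (fourier f) x = (fourier_const * of_real ((2 * pi) powr (3 / 2))) * f y"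
    by (simp add: fourier_altdef[of "fourier f"] y_def mult.commute)
  then show ?thesis by (simp add: fourier_const_mult y_def)
qed

lemma schwartz_reflect: "f \<in> schwartz \<Longrightarrow> (\<lambda>x. f (- x)) \<in> schwartz"
  using schwartz_affine[of f "-1" 0] by simp

lemma fourier_reflect:
  assumes "f \<in> schwartz"
  shows "fourier (\<lambda>x. f (- x)) k = fourier f (- k)"
  using integral_lborel_affine[OF schwartz_borel_measurable[OF schwartz_cis_minus[OF assms]], of "-1" "- k" 0]
  by (simp add: fourier_altdef)

text \<open>By inversion every test function is itself a Fourier transform, so a distribution is
  determined by its values on transforms.\<close>

lemma fourier_surj:
  assumes "f \<in> schwartz"
  shows "fourier (fourier (\<lambda>x. f (- x))) = f" "fourier (\<lambda>x. f (- x)) \<in> schwartz"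
  using assms by (auto simp: fourier_inversion schwartz_reflect schwartz_fourier)

text \<open>The Borel sets over which \<open>h\<close> integrates to zero form a Dynkin system, and
  the closed sets are a generator stable under intersection.\<close>

lemma AE_zero_if_integral_closed_zero:
  fixes h :: "'a::euclidean_space \<Rightarrow> complex"
  assumes "integrable lborel h" "\<And>C. closed C \<Longrightarrow> (LINT x:C|lborel. h x) = 0"
  shows "AE x in lborel. h x = 0"
proof (rule sigma_finite_measure.density_zero[OF lborel.sigma_finite_measure_axioms assms(1)])
  fix A :: "'a set" assume "A \<in> sets lborel"
  then have "A \<in> sigma_sets UNIV (Collect closed)" by (simp add: borel_eq_closed)
  then show "(LINT x:A|lborel. h x) = 0"
  proof (rule sigma_sets_induct_disjoint[rotated 2])
    show "Int_stable (Collect (closed :: 'a set \<Rightarrow> bool))" "Collect closed \<subseteq> Pow (UNIV :: 'a set)"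
      by (auto simp: Int_stable_def)
    show "(LINT x:A|lborel. h x) = 0" if "A \<in> Collect closed" for A
      using that assms(2) by simp
    show "(LINT x:{}|lborel. h x) = 0" by (simp add: set_lebesgue_integral_def)
  next
    fix A assume compl: "A \<in> sigma_sets UNIV (Collect closed)" "(LINT x:A|lborel. h x) = 0"
    have "A \<in> sets lborel" using compl(1) by (simp add: borel_eq_closed)
    then have "set_integrable lborel A h" "set_integrable lborel (UNIV - A) h"
      unfolding set_integrable_def by (auto intro!: integrable_mult_indicator assms(1))
    then have "(LINT x:A \<union> (UNIV - A)|lborel. h x) = (LINT x:A|lborel. h x) + (LINT x:UNIV - A|lborel. h x)"
      by (intro set_integral_Un) auto
    then show "(LINT x:UNIV - A|lborel. h x) = 0" using assms(2)[of UNIV] compl(2) by simp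
  next
    fix A :: "nat \<Rightarrow> 'a set"
    assume union: "disjoint_family A" "range A \<subseteq> sigma_sets UNIV (Collect closed)" "\<And>i. (LINT x:A i|lborel. h x) = 0"
    have s: "A i \<in> sets lborel" for i using union(2) by (auto simp: borel_eq_closed)
    have "(LINT x:(\<Union>i. A i)|lborel. h x) = (\<Sum>i. LINT x:A i|lborel. h x)"
      using s union(1) unfolding set_integrable_def
      by (intro lebesgue_integral_countable_add)
        (auto simp: disjoint_family_on_def set_integrable_def intro!: integrable_mult_indicator assms(1))
    then show "(LINT x:(\<Union>i. A i)|lborel. h x) = 0" using union(3) by simp
  qed
qed

text \<open>Mollifying a test function by Gaussians turns the vanishing of all Gaussian averages of \<open>h\<close>
  into the vanishing of its integrals against bounded continuous functions.\<close>

lemma schwartz_test_zero_L1: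
  assumes h: "integrable lborel h" and zero: "\<And>f. f \<in> schwartz \<Longrightarrow> (LINT x|lborel. h x * f x) = 0"
    and f: "continuous_on UNIV f" "integrable lborel f" "\<And>x. norm (f x) \<le> B"
  shows "(LINT x|lborel. h x * f x) = 0"
proof -
  define \<epsilon> where "\<epsilon> n = inverse (real (Suc n))" for n
  have \<epsilon>: "\<epsilon> n > 0" "\<epsilon> n \<noteq> 0" for n by (auto simp: \<epsilon>_def)
  have fm: "f \<in> borel_measurable borel" using f(1) by (rule borel_measurable_continuous_onI)
  have hm: "h \<in> borel_measurable borel" using h by auto
  have "(\<lambda>n. LINT x|lborel. h x * (LINT z|lborel. f (x + (- 1 * inverse (real (Suc n))) *\<^sub>R z) * gaussian z))
     \<longlonglongrightarrow> (LINT x|lborel. h x * (f x * of_real ((2 * pi) powr (3 / 2))))"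
  proof (rule integral_dominated_convergence)
    show "integrable lborel (\<lambda>x. norm (h x) * (B * (LINT z|lborel. norm (gaussian z))))"
      using h by auto
    show "AE x in lborel. (\<lambda>n. h x * (LINT z|lborel. f (x + (- 1 * inverse (real (Suc n))) *\<^sub>R z) * gaussian z))
        \<longlonglongrightarrow> h x * (f x * of_real ((2 * pi) powr (3 / 2)))"
      using f(1) by (intro AE_I2 tendsto_intros gaussian_approximate_identity[OF fm _ f(3)])
        (auto simp: continuous_on_eq_continuous_at)
    show "AE x in lborel. norm (h x * (LINT z|lborel. f (x + (- 1 * inverse (real (Suc n))) *\<^sub>R z) * gaussian z))
        \<le> norm (h x) * (B * (LINT z|lborel. norm (gaussian z)))" for n
    proof (rule AE_I2)
      fix x
      have "norm (LINT z|lborel. f (x + (- 1 * inverse (real (Suc n))) *\<^sub>R z) * gaussian z) \<le> (LINT z|lborel. B * norm (gaussian z))"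
      proof (rule integral_mult_bound)
        show i: "integrable lborel (\<lambda>z. B * norm (gaussian z))"
          by (intro integrable_mult_right integrable_norm schwartz_integrable schwartz_gaussian)
        show b: "norm (f (x + (- 1 * inverse (real (Suc n))) *\<^sub>R z) * gaussian z) \<le> B * norm (gaussian z)" for z
          using f(3) by (simp add: norm_mult mult_right_mono)
        show "integrable lborel (\<lambda>z. f (x + (- 1 * inverse (real (Suc n))) *\<^sub>R z) * gaussian z)"
          by (rule Bochner_Integration.integrable_bound[OF i]) (use fm b in \<open>auto intro: order_trans[OF _ abs_ge_self]\<close>)
      qed
      then show "norm (h x * (LINT z|lborel. f (x + (- 1 * inverse (real (Suc n))) *\<^sub>R z) * gaussian z))
        \<le> norm (h x) * (B * (LINT z|lborel. norm (gaussian z)))"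
        by (simp add: norm_mult mult_left_mono)
    qed
    show "(\<lambda>x. h x * (LINT z|lborel. f (x + (- 1 * inverse (real (Suc n))) *\<^sub>R z) * gaussian z)) \<in> borel_measurable lborel" for n
      using hm fm by measurable
  qed (use hm fm in measurable)
  moreover have "(LINT x|lborel. h x * (LINT z|lborel. f (x + (- 1 * inverse (real (Suc n))) *\<^sub>R z) * gaussian z)) = 0" for n
  proof -
    \<comment> \<open>For fixed \<open>y\<close> the kernel is a Schwartz function of
      \<open>x\<close>, so after exchanging the integrals the inner one vanishes by
      \<open>zero\<close>.\<close>
    define K where "K x y = gaussian (inverse (\<epsilon> n) *\<^sub>R x + (- inverse (\<epsilon> n)) *\<^sub>R y)" for x y
    have K: "case_prod K \<in> borel_measurable borel"
      unfolding K_def case_prod_unfold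
      by (intro borel_measurable_continuous_onI continuous_on_compose2[OF gaussian_continuous[of UNIV]]) (auto intro!: continuous_intros)
    have e: "(LINT z|lborel. f (x + (- 1 * inverse (real (Suc n))) *\<^sub>R z) * gaussian z) = inverse (\<epsilon> n) ^ 3 *\<^sub>R (LINT y|lborel. f y * K x y)" for x
    proof -
      have "(\<lambda>y. f y * K x y) \<in> borel_measurable borel" using fm unfolding K_def by measurable
      from integral_lborel_affine[OF this, of "- \<epsilon> n" x]
      have "(LINT y|lborel. f y * K x y) = \<epsilon> n ^ 3 *\<^sub>R (LINT z|lborel. f (x + (- \<epsilon> n) *\<^sub>R z) * K x (x + (- \<epsilon> n) *\<^sub>R z))"
        using \<epsilon>[of n] by simp
      also have "(\<lambda>z. K x (x + (- \<epsilon> n) *\<^sub>R z)) = gaussian"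
        using \<epsilon>(2)[of n] by (auto simp: K_def fun_eq_iff algebra_simps)
      finally show ?thesis using \<epsilon>[of n]
        by (simp add: fun_eq_iff) (simp add: \<epsilon>_def field_simps)
    qed
    have "(LINT x|lborel. h x * (LINT y|lborel. f y * K x y)) = (LINT y|lborel. f y * (LINT x|lborel. h x * K x y))"
      by (rule integral_swap_kernel[OF h f(2) K, of 1]) (simp add: K_def gaussian_bounds)
    also have "(\<lambda>y. LINT x|lborel. h x * K x y) = (\<lambda>y. 0)"
    proof
      fix y
      have "(\<lambda>x. K x y) = (\<lambda>x. gaussian ((- inverse (\<epsilon> n)) *\<^sub>R y + inverse (\<epsilon> n) *\<^sub>R x))"
        by (simp add: K_def add.commute)
      also have "\<dots> \<in> schwartz" using \<epsilon>[of n] by (intro schwartz_affine schwartz_gaussian) simp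
      finally show "(LINT x|lborel. h x * K x y) = 0" by (rule zero)
    qed
    finally show ?thesis unfolding e by (simp add: fun_eq_iff)
  qed
  ultimately have "(LINT x|lborel. h x * (f x * of_real ((2 * pi) powr (3 / 2)))) = 0"
    by (simp add: LIMSEQ_const_iff)
  then show ?thesis by (simp flip: mult.assoc)
qed

text \<open>Since \<open>h\<close> need not be integrable, it is multiplied by a Gaussian; this
  loses nothing because the Gaussian has no zeros. What remains is to pass from test functions to
  indicators of closed sets.\<close>

lemma schwartz_test_zero:
  assumes h: "h \<in> borel_measurable borel" "\<And>f. f \<in> schwartz \<Longrightarrow> integrable lborel (\<lambda>x. h x * f x)"
    and zero: "\<And>f. f \<in> schwartz \<Longrightarrow> (LINT x|lborel. h x * f x) = 0"
  shows "AE x in lborel. h x = 0"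
proof -
  let ?h = "\<lambda>x. h x * gaussian x"
  have hi: "integrable lborel ?h" by (rule h(2)[OF schwartz_gaussian])
  have z: "(LINT x|lborel. ?h x * f x) = 0" if "f \<in> schwartz" for f
    using zero[OF schwartz_mult[OF schwartz_gaussian that]] by (simp add: mult.assoc)
  \<comment> \<open>The first Gaussian makes \<open>h\<close> integrable, the second is a factor of
    the continuous cut-offs and makes those integrable.\<close>
  have "AE x in lborel. ?h x * gaussian x = 0"
  proof (rule AE_zero_if_integral_closed_zero)
    show hgi: "integrable lborel (\<lambda>x. ?h x * gaussian x)"
      using h(2)[OF schwartz_mult[OF schwartz_gaussian schwartz_gaussian]] by (simp add: mult.assoc)
    fix C :: "R3 set" assume C: "closed C"
    show "(LINT x:C|lborel. ?h x * gaussian x) = 0"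
    \<comment> \<open>The empty set is separate because \<open>infdist\<close> to it is 0 by
      convention, so the cut-offs would be constantly 1 instead of tending to 0.\<close>
    proof (cases "C = {}")
      case False
      define g where "g n x = max 0 (1 - real n * infdist x C)" for n x
      have g: "0 \<le> g n x" "g n x \<le> 1" for n x
        unfolding g_def by (auto simp: infdist_nonneg)
      have gc: "continuous_on UNIV (g n)" for n
        unfolding g_def by (intro continuous_intros)
      have lim: "(\<lambda>n. LINT x|lborel. ?h x * (of_real (g n x) * gaussian x)) \<longlonglongrightarrow> (LINT x|lborel. ?h x * (indicator C x * gaussian x))"
      proof (rule integral_dominated_convergence)
        show "integrable lborel (\<lambda>x. norm (?h x * gaussian x))" using hgi by (rule integrable_norm)
        show "AE x in lborel. norm (?h x * (of_real (g n x) * gaussian x)) \<le> norm (?h x * gaussian x)" for n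
        proof (rule AE_I2)
          fix x
          have "norm (?h x * (of_real (g n x) * gaussian x)) = g n x * norm (?h x * gaussian x)"
            using g(1)[of n x] by (simp add: norm_mult)
          then show "norm (?h x * (of_real (g n x) * gaussian x)) \<le> norm (?h x * gaussian x)"
            using g[of n x] by (simp add: mult_left_le_one_le)
        qed
        show "AE x in lborel. (\<lambda>n. ?h x * (of_real (g n x) * gaussian x)) \<longlonglongrightarrow> ?h x * (indicator C x * gaussian x)"
        proof (intro AE_I2 tendsto_intros)
          fix x
          show "(\<lambda>n. complex_of_real (g n x)) \<longlonglongrightarrow> indicator C x"
          proof (cases "x \<in> C")
            case True
            then show ?thesis by (simp add: g_def)
          next
            case False
            then have d: "infdist x C > 0"
              using C \<open>C \<noteq> {}\<close> by (metis in_closed_iff_infdist_zero infdist_nonneg less_le)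
            then obtain N :: nat where N: "1 / infdist x C < real N" using reals_Archimedean2 by blast
            have "g n x = 0" if "n \<ge> N" for n
            proof -
              have "1 < real N * infdist x C" using N d by (simp add: field_simps)
              also have "\<dots> \<le> real n * infdist x C" using that d by (simp add: mult_right_mono)
              finally show ?thesis by (simp add: g_def)
            qed
            then have "\<forall>\<^sub>F n in sequentially. complex_of_real (g n x) = 0"
              unfolding eventually_sequentially by (intro exI[of _ N]) simp
            then show ?thesis using False by (simp add: tendsto_eventually)
          qed
        qed
        show "(\<lambda>x. ?h x * (of_real (g n x) * gaussian x)) \<in> borel_measurable lborel" for n
          using h(1) borel_measurable_continuous_onI[OF gc] by measurable
        show "(\<lambda>x. ?h x * (indicator C x * gaussian x)) \<in> borel_measurable lborel"
        proof -
          have [measurable]: "C \<in> sets borel" using C by simp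
          have [measurable]: "gaussian \<in> borel_measurable lborel" by simp
          show ?thesis using h(1) by simp measurable
        qed
      qed
      have "(LINT x|lborel. ?h x * (of_real (g n x) * gaussian x)) = 0" for n
      proof (rule schwartz_test_zero_L1[OF hi z, of _ 1])
        show c: "continuous_on UNIV (\<lambda>x. of_real (g n x) * gaussian x)"
          by (intro continuous_intros gc gaussian_continuous)
        have b: "norm (of_real (g n x) * gaussian x) \<le> norm (gaussian x)" for x
          using g[of n x] by (simp add: norm_mult mult_left_le_one_le)
        then show "norm (of_real (g n x) * gaussian x) \<le> 1" for x
          using gaussian_bounds order_trans by blast
        show "integrable lborel (\<lambda>x. of_real (g n x) * gaussian x)"
          by (rule Bochner_Integration.integrable_bound[OF schwartz_integrable[OF schwartz_gaussian]])
            (use b borel_measurable_continuous_onI[OF c] in auto)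
      qed
      then have "(LINT x|lborel. ?h x * (indicator C x * gaussian x)) = 0"
        using lim by (simp add: LIMSEQ_const_iff)
      moreover have "indicator C x *\<^sub>R (?h x * gaussian x) = ?h x * (indicator C x * gaussian x)" for x
        by (auto simp: indicator_def)
      ultimately show ?thesis
        unfolding set_lebesgue_integral_def by simp
    qed (simp add: set_lebesgue_integral_def)
  qed
  then show ?thesis by (rule AE_mp) (simp add: gaussian_def)
qed

section \<open>Distributions with a regular Fourier transform\<close>

lemma borel_measurable_cnj [measurable]: "cnj \<in> borel_measurable borel"
  by (intro borel_measurable_continuous_onI continuous_intros)

text \<open>Local integrability carries measurability: \<open>g\<close> is the pointwise limit of
  its restrictions to balls.\<close>

lemma has_fourier_borel_measurable:
  assumes "has_fourier T g" shows "g \<in> borel_measurable borel"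
proof (rule borel_measurable_LIMSEQ_metric)
  show "(\<lambda>x. indicator (cball 0 (real n)) x *\<^sub>R g x) \<in> borel_measurable borel" for n
  proof -
    have "set_integrable lborel (cball 0 (real n)) g"
      using assms unfolding has_fourier_def by simp
    then show ?thesis unfolding set_integrable_def by auto
  qed
  show "(\<lambda>n. indicator (cball 0 (real n)) x *\<^sub>R g x) \<longlonglongrightarrow> g x" if "x \<in> space borel" for x
  proof (rule tendsto_eventually)
    obtain N :: nat where "norm x \<le> real N" using real_arch_simple by blast
    then show "\<forall>\<^sub>F n in sequentially. indicator (cball 0 (real n)) x *\<^sub>R g x = g x"
      unfolding eventually_sequentially by (intro exI[of _ N]) auto
  qed
qed

lemma has_fourierD:
  assumes "has_fourier T g" "f \<in> schwartz"
  shows "integrable lborel (\<lambda>k. g k * f k)" "pairing T (fourier f) = (LINT k|lborel. g k * f k)"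
  using assms unfolding has_fourier_def by auto

lemma pairing_outside: "f \<notin> schwartz \<Longrightarrow> pairing T f = 0"
  using pairing[of T] by (simp add: is_tempered_def)

lemma tempered_eqI:
  assumes "\<And>f. f \<in> schwartz \<Longrightarrow> pairing S (fourier f) = pairing T (fourier f)"
  shows "S = T"
proof -
  have "pairing S f = pairing T f" for f
  proof (cases "f \<in> schwartz")
    case True
    then show ?thesis using assms[of "fourier (\<lambda>x. f (- x))"] by (simp add: fourier_surj)
  qed (simp add: pairing_outside)
  then show ?thesis by (simp add: pairing_inject[symmetric] fun_eq_iff)
qed

lemma has_fourier_unique_AE:
  assumes "has_fourier S g" "has_fourier T h" "AE k in lborel. g k = h k"
  shows "S = T"
proof (rule tempered_eqI)
  fix f assume f: "f \<in> schwartz"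
  have "AE k in lborel. g k * f k = h k * f k" using assms(3) by eventually_elim simp
  then have "(LINT k|lborel. g k * f k) = (LINT k|lborel. h k * f k)"
    by (intro integral_cong_AE borel_measurable_integrable has_fourierD(1)[OF assms(1) f] has_fourierD(1)[OF assms(2) f])
  then show "pairing S (fourier f) = pairing T (fourier f)"
    using has_fourierD(2)[OF assms(1) f] has_fourierD(2)[OF assms(2) f] by simp
qed

lemma has_fourier_unique: "has_fourier S g \<Longrightarrow> has_fourier T g \<Longrightarrow> S = T"
  by (rule has_fourier_unique_AE) auto

lemma of_fourier_eq: "has_fourier T g \<Longrightarrow> of_fourier g = T"
  unfolding of_fourier_def by (rule the_equality) (auto intro: has_fourier_unique)

lemma has_fourier_AE_unique:
  assumes "has_fourier T g" "has_fourier T h"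
  shows "AE k in lborel. g k = h k"
proof -
  have "AE k in lborel. g k - h k = 0"
  proof (rule schwartz_test_zero)
    show "(\<lambda>k. g k - h k) \<in> borel_measurable borel"
      using assms[THEN has_fourier_borel_measurable] by measurable
    fix f assume f: "f \<in> schwartz"
    show "integrable lborel (\<lambda>k. (g k - h k) * f k)" "(LINT k|lborel. (g k - h k) * f k) = 0"
      using has_fourierD[OF assms(1) f] has_fourierD[OF assms(2) f] by (simp_all add: left_diff_distrib)
  qed
  then show ?thesis by simp
qed

lemma has_fourier_fhat: "has_fourier T g \<Longrightarrow> has_fourier T (fhat T)"
  unfolding fhat_def by (rule someI[of "has_fourier T"])

lemma fhat_AE: "has_fourier T g \<Longrightarrow> AE k in lborel. fhat T k = g k"
  using has_fourier_AE_unique has_fourier_fhat by blast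

lemma has_fourier_zero: "has_fourier 0 (\<lambda>k. 0)"
  by (simp add: has_fourier_def zero_tempered.rep_eq set_integrable_def)

lemma has_fourier_add:
  assumes "has_fourier S g" "has_fourier T h"
  shows "has_fourier (S + T) (\<lambda>k. g k + h k)"
  using assms unfolding has_fourier_def
  by (auto simp: plus_tempered.rep_eq distrib_right intro!: set_integral_add)

lemma has_fourier_scaleR:
  assumes "has_fourier T g"
  shows "has_fourier (r *\<^sub>R T) (\<lambda>k. r *\<^sub>R g k)"
proof -
  have "set_integrable lborel K (\<lambda>k. r *\<^sub>R g k)" if "set_integrable lborel K g" for K
    using integrable_scaleR_right[of r lborel "\<lambda>k. indicator K k *\<^sub>R g k"] that
    by (simp add: set_integrable_def mult.commute)
  then show ?thesis
    using assms unfolding has_fourier_def by (auto simp: scaleR_tempered.rep_eq)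
qed

lemma has_fourier_uminus: "has_fourier T g \<Longrightarrow> has_fourier (- T) (\<lambda>k. - g k)"
  using has_fourier_scaleR[of T g "-1"] by simp

text \<open>The growth class on which integration against Schwartz functions defines a tempered
  distribution. It is stable under pointwise domination, which is how it is verified for all later
  symbols.\<close>

definition slowly_growing :: "(R3 \<Rightarrow> 'b::{real_normed_vector, second_countable_topology}) \<Rightarrow> bool" where
  "slowly_growing g \<longleftrightarrow> g \<in> borel_measurable borel \<and> (\<exists>N. integrable lborel (\<lambda>k. norm (g k) / (1 + norm k) ^ N))"

lemma one_plus_norm_pos: "0 < 1 + norm (k :: 'a::real_normed_vector)"
  by (simp add: add_pos_nonneg)

lemma slowly_growingI_dominated:
  fixes w :: "R3 \<Rightarrow> 'b::{real_normed_vector, second_countable_topology}"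
    and g :: "R3 \<Rightarrow> 'c::{real_normed_vector, second_countable_topology}"
    and h :: "R3 \<Rightarrow> 'd::{real_normed_vector, second_countable_topology}"
  assumes "w \<in> borel_measurable borel" "slowly_growing g" "slowly_growing h" "\<And>k. norm (w k) \<le> C * norm (g k) + D * norm (h k)"
  shows "slowly_growing w"
proof -
  obtain N M where N: "integrable lborel (\<lambda>k. norm (g k) / (1 + norm k) ^ N)"
    and M: "integrable lborel (\<lambda>k. norm (h k) / (1 + norm k) ^ M)"
    using assms(2,3) unfolding slowly_growing_def by blast
  have "integrable lborel (\<lambda>k. norm (w k) / (1 + norm k) ^ (max N M))"
  proof (rule Bochner_Integration.integrable_bound)
    show "integrable lborel (\<lambda>k. \<bar>C\<bar> * (norm (g k) / (1 + norm k) ^ N) + \<bar>D\<bar> * (norm (h k) / (1 + norm k) ^ M))"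
      by (intro Bochner_Integration.integrable_add integrable_mult_right N M)
    show "(\<lambda>k. norm (w k) / (1 + norm k) ^ (max N M)) \<in> borel_measurable lborel"
      using assms(1) by measurable
    show "AE k in lborel. norm (norm (w k) / (1 + norm k) ^ (max N M))
        \<le> norm (\<bar>C\<bar> * (norm (g k) / (1 + norm k) ^ N) + \<bar>D\<bar> * (norm (h k) / (1 + norm k) ^ M))"
    proof (rule AE_I2)
      fix k :: R3
      let ?p = "\<lambda>n. (1 + norm k) ^ n"
      have p: "0 < ?p n" for n using one_plus_norm_pos by (rule zero_less_power)
      have le: "x / ?p (max N M) \<le> x / ?p n" if "n \<le> max N M" "0 \<le> x" for n x
        using that p by (intro divide_left_mono power_increasing mult_pos_pos) auto
      have "norm (w k) / ?p (max N M) \<le> (\<bar>C\<bar> * norm (g k) + \<bar>D\<bar> * norm (h k)) / ?p (max N M)"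
        using assms(4)[of k] p[of "max N M"]
          mult_right_mono[OF abs_ge_self[of C], of "norm (g k)"] mult_right_mono[OF abs_ge_self[of D], of "norm (h k)"]
        by (intro divide_right_mono) auto
      also have "\<dots> \<le> (\<bar>C\<bar> * norm (g k)) / ?p N + (\<bar>D\<bar> * norm (h k)) / ?p M"
        unfolding add_divide_distrib by (intro add_mono le) auto
      finally show "norm (norm (w k) / ?p (max N M))
          \<le> norm (\<bar>C\<bar> * (norm (g k) / ?p N) + \<bar>D\<bar> * (norm (h k) / ?p M))"
        using p[of N] p[of M] p[of "max N M"] by (simp add: abs_of_nonneg)
    qed
  qed
  then show ?thesis using assms(1) unfolding slowly_growing_def by blast
qed

lemma slowly_growing_schwartz_integrable:
  assumes "slowly_growing g" "f \<in> schwartz"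
  shows "integrable lborel (\<lambda>k. g k * f k)"
proof -
  obtain N where N: "integrable lborel (\<lambda>k. norm (g k) / (1 + norm k) ^ N)" and m: "g \<in> borel_measurable borel"
    using assms(1) unfolding slowly_growing_def by blast
  show ?thesis
  proof (rule Bochner_Integration.integrable_bound)
    show "integrable lborel (\<lambda>k. schwartz_seminorm N [] f * (norm (g k) / (1 + norm k) ^ N))"
      by (intro integrable_mult_right N)
    show "(\<lambda>k. g k * f k) \<in> borel_measurable lborel"
      using m schwartz_borel_measurable[OF assms(2)] by measurable
    show "AE k in lborel. norm (g k * f k) \<le> norm (schwartz_seminorm N [] f * (norm (g k) / (1 + norm k) ^ N))"
    proof (rule AE_I2)
      fix k
      have "norm (g k) * norm (f k) \<le> norm (g k) * (schwartz_seminorm N [] f / (1 + norm k) ^ N)"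
        using schwartz_decay[OF assms(2), of "[]" k N] by (intro mult_left_mono) (auto simp: partial_derivs_Nil)
      also have "\<dots> = schwartz_seminorm N [] f * (norm (g k) / (1 + norm k) ^ N)" by simp
      finally show "norm (g k * f k) \<le> norm (schwartz_seminorm N [] f * (norm (g k) / (1 + norm k) ^ N))"
        unfolding real_norm_def norm_mult by (rule order_trans[OF _ abs_ge_self])
    qed
  qed
qed

lemma slowly_growing_set_integrable:
  fixes g :: "R3 \<Rightarrow> complex"
  assumes "slowly_growing g" "compact K"
  shows "set_integrable lborel K g"
proof -
  obtain N where N: "integrable lborel (\<lambda>k. norm (g k) / (1 + norm k) ^ N)" and m: "g \<in> borel_measurable borel"
    using assms(1) unfolding slowly_growing_def by blast
  obtain R where R: "\<And>k. k \<in> K \<Longrightarrow> norm k \<le> R"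
    using compact_imp_bounded[OF assms(2)] unfolding bounded_iff by blast
  show ?thesis unfolding set_integrable_def
  proof (rule Bochner_Integration.integrable_bound)
    show "integrable lborel (\<lambda>k. (1 + R) ^ N * (norm (g k) / (1 + norm k) ^ N))"
      by (intro integrable_mult_right N)
    have "K \<in> sets borel" using compact_imp_closed[OF assms(2)] by simp
    then show "(\<lambda>k. indicator K k *\<^sub>R g k) \<in> borel_measurable lborel"
      using m by measurable
    show "AE k in lborel. norm (indicator K k *\<^sub>R g k) \<le> norm ((1 + R) ^ N * (norm (g k) / (1 + norm k) ^ N))"
    proof (rule AE_I2)
      fix k
      show "norm (indicator K k *\<^sub>R g k) \<le> norm ((1 + R) ^ N * (norm (g k) / (1 + norm k) ^ N))"
      proof (cases "k \<in> K")
        case True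
        have "(1 + norm k) ^ N \<le> (1 + R) ^ N" using R[OF True] by (intro power_mono) auto
        then have "norm (g k) * (1 + norm k) ^ N \<le> norm (g k) * (1 + R) ^ N" by (rule mult_left_mono) simp
        then have "norm (g k) \<le> (1 + R) ^ N * (norm (g k) / (1 + norm k) ^ N)"
          using zero_less_power[OF one_plus_norm_pos[of k], of N] by (simp add: pos_le_divide_eq mult.commute)
        then show ?thesis using True unfolding real_norm_def by (intro order_trans[OF _ abs_ge_self]) simp
      qed simp
    qed
  qed
qed

text \<open>The pairing is with \<open>fourier f (- k)\<close>, the inverse transform, so that by
  inversion the distribution has Fourier transform \<open>g\<close>. Continuity follows from the
  decay of \<open>fourier f\<close> at the order \<open>N\<close> at which \<open>g\<close>
  grows.\<close>

lemma is_tempered_fourier_pairing: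
  assumes "slowly_growing g"
  shows "is_tempered (\<lambda>f. if f \<in> schwartz then LINT k|lborel. g k * fourier f (- k) else 0)"
proof -
  obtain N where N: "integrable lborel (\<lambda>k. norm (g k) / (1 + norm k) ^ N)"
    using assms unfolding slowly_growing_def by blast
  define A where "A = (LINT k|lborel. norm (g k) / (1 + norm k) ^ N)"
  have r: "(\<lambda>k. fourier f (- k)) \<in> schwartz" if "f \<in> schwartz" for f
    by (intro schwartz_reflect schwartz_fourier that)
  have i: "integrable lborel (\<lambda>k. g k * fourier f (- k))" if "f \<in> schwartz" for f
    by (intro slowly_growing_schwartz_integrable assms r that)
  have lin: "(LINT k|lborel. g k * fourier (\<lambda>x. a * f x + b * h x) (- k))
     = a * (LINT k|lborel. g k * fourier f (- k)) + b * (LINT k|lborel. g k * fourier h (- k))"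
    if "f \<in> schwartz" "h \<in> schwartz" for f h a b
  proof -
    have "(LINT k|lborel. g k * fourier (\<lambda>x. a * f x + b * h x) (- k))
      = (LINT k|lborel. a * (g k * fourier f (- k)) + b * (g k * fourier h (- k)))"
      unfolding fourier_lin[OF that] by (simp add: algebra_simps)
    also have "\<dots> = a * (LINT k|lborel. g k * fourier f (- k)) + b * (LINT k|lborel. g k * fourier h (- k))"
      using i[OF that(1)] i[OF that(2)] by (subst Bochner_Integration.integral_add) simp_all
    finally show ?thesis .
  qed
  \<comment> \<open>The index pairs of \<open>fourier_bound\<close>. They coincide when
    \<open>N = 0\<close>, so each seminorm is bounded by the whole sum over \<open>F\<close>, at the
    price of a factor 4.\<close>
  define F where "F = insert (6::nat, []) (range (\<lambda>j::3. (6, replicate N j)))"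
  have bnd: "norm (LINT k|lborel. g k * fourier f (- k)) \<le> (4 ^ N * decay_const * A * 4) * (\<Sum>(n, \<alpha>)\<in>F. schwartz_seminorm n \<alpha> f)"
    if f: "f \<in> schwartz" for f
  proof -
    let ?S = "\<Sum>(n, \<alpha>)\<in>F. schwartz_seminorm n \<alpha> f"
    have fin: "finite F" by (simp add: F_def)
    have mem: "schwartz_seminorm n \<alpha> f \<le> ?S" if "(n, \<alpha>) \<in> F" for n \<alpha>
    proof -
      have "(case (n, \<alpha>) of (n, \<alpha>) \<Rightarrow> schwartz_seminorm n \<alpha> f) \<le> ?S"
        using that fin schwartz_seminorm_nonneg[OF f] by (intro member_le_sum) auto
      then show ?thesis by simp
    qed
    have "fourier_bound N f \<le> ?S + (\<Sum>j\<in>(UNIV :: 3 set). ?S)"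
      unfolding fourier_bound_def by (intro add_mono sum_mono mem) (auto simp: F_def)
    then have fb: "fourier_bound N f \<le> 4 * ?S" by simp
    have "norm (LINT k|lborel. g k * fourier f (- k)) \<le> (LINT k|lborel. (4 ^ N * decay_const * fourier_bound N f) * (norm (g k) / (1 + norm k) ^ N))"
    proof (rule integral_mult_bound[OF i[OF f]])
      show "integrable lborel (\<lambda>k. (4 ^ N * decay_const * fourier_bound N f) * (norm (g k) / (1 + norm k) ^ N))"
        by (intro integrable_mult_right N)
      fix k :: R3
      have "norm (fourier f (- k)) \<le> (4 ^ N * decay_const * fourier_bound N f) / (1 + norm k) ^ N"
        using fourier_decay[OF f, of "- k" N] zero_less_power[OF one_plus_norm_pos[of k], of N]
        by (simp add: pos_le_divide_eq mult.commute)
      then have "norm (g k) * norm (fourier f (- k)) \<le> norm (g k) * ((4 ^ N * decay_const * fourier_bound N f) / (1 + norm k) ^ N)"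
        by (rule mult_left_mono) simp
      then show "norm (g k * fourier f (- k)) \<le> (4 ^ N * decay_const * fourier_bound N f) * (norm (g k) / (1 + norm k) ^ N)"
        by (simp add: norm_mult mult.commute)
    qed
    also have "\<dots> = (4 ^ N * decay_const * A) * fourier_bound N f"
      unfolding integral_mult_right_zero A_def by simp
    also have "\<dots> \<le> (4 ^ N * decay_const * A) * (4 * ?S)"
      using fb decay_const_nonneg by (intro mult_left_mono mult_nonneg_nonneg) (auto simp: A_def intro!: integral_nonneg_AE)
    finally show ?thesis by (simp only: mult.assoc)
  qed
  have "finite F" by (simp add: F_def)
  with bnd have "\<exists>F C. finite F \<and> (\<forall>f\<in>schwartz. norm (if f \<in> schwartz then LINT k|lborel. g k * fourier f (- k) else 0)
      \<le> C * (\<Sum>(n, \<alpha>)\<in>F. schwartz_seminorm n \<alpha> f))"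
    by (intro exI[of _ F] exI[of _ "4 ^ N * decay_const * A * 4"]) simp
  then show ?thesis unfolding is_tempered_def using lin by (simp add: schwartz_lin)
qed

lemma of_fourier_has_fourier:
  assumes "slowly_growing g"
  shows "has_fourier (of_fourier g) g"
proof -
  define T where "T = Abs_tempered (\<lambda>f. if f \<in> schwartz then LINT k|lborel. g k * fourier f (- k) else 0)"
  have p: "pairing T = (\<lambda>f. if f \<in> schwartz then LINT k|lborel. g k * fourier f (- k) else 0)"
    unfolding T_def using is_tempered_fourier_pairing[OF assms] by (intro Abs_tempered_inverse) simp
  have "has_fourier T g"
    unfolding has_fourier_def p
    using slowly_growing_set_integrable[OF assms] slowly_growing_schwartz_integrable[OF assms]
    by (simp add: schwartz_fourier fourier_inversion)
  then show ?thesis using of_fourier_eq by simp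
qed

section \<open>Sobolev distributions through their Fourier transforms\<close>

lemma hdotD:
  assumes "T \<in> hdot \<sigma>"
  shows "has_fourier T (fhat T)" "integrable lborel (\<lambda>k. norm k powr (2 * \<sigma>) * (norm (fhat T k))\<^sup>2)"
    "Defs.real_distribution T"
proof -
  obtain g where g: "has_fourier T g" "integrable lborel (\<lambda>k. norm k powr (2 * \<sigma>) * (norm (g k))\<^sup>2)"
    and r: "Defs.real_distribution T"
    using assms unfolding hdot_def by blast
  show h: "has_fourier T (fhat T)" using has_fourier_fhat[OF g(1)] .
  have [measurable]: "fhat T \<in> borel_measurable borel" by (rule has_fourier_borel_measurable[OF h])
  have "AE k in lborel. norm k powr (2 * \<sigma>) * (norm (g k))\<^sup>2 = norm k powr (2 * \<sigma>) * (norm (fhat T k))\<^sup>2"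
    using fhat_AE[OF g(1)] by eventually_elim simp
  then show "integrable lborel (\<lambda>k. norm k powr (2 * \<sigma>) * (norm (fhat T k))\<^sup>2)"
    by (rule integrable_cong_AE_imp[OF g(2), rotated]) measurable
  show "Defs.real_distribution T" by (rule r)
qed

text \<open>Near the origin local integrability is used, away from it the weighted square integrability
  together with \<open>x \<le> w * x\<^sup>2 + 1 / w\<close>.\<close>

lemma slowly_growingI_weighted:
  fixes g :: "R3 \<Rightarrow> complex"
  assumes h: "has_fourier T g" and w: "integrable lborel (\<lambda>k. norm k powr (2 * \<sigma>) * (norm (g k))\<^sup>2)"
  shows "slowly_growing g"
proof -
  have m [measurable]: "g \<in> borel_measurable borel" by (rule has_fourier_borel_measurable[OF h])
  have loc: "integrable lborel (\<lambda>k. indicator (cball 0 1) k *\<^sub>R g k)"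
    using h unfolding has_fourier_def set_integrable_def by (metis compact_cball)
  \<comment> \<open>Chosen so that the reciprocal weight
    \<open>norm k powr (- (2 * \<sigma>))\<close> is at most \<open>(1 + norm k) ^ n\<close> for
    \<open>norm k > 1\<close>, whatever the sign of \<open>\<sigma>\<close>; the further power 6
    makes the term \<open>1 / w\<close> integrable.\<close>
  obtain n :: nat where n: "2 * \<bar>\<sigma>\<bar> \<le> real n" using real_arch_simple by blast
  have "integrable lborel (\<lambda>k. norm (g k) / (1 + norm k) ^ (n + 6))"
  proof (rule Bochner_Integration.integrable_bound)
    show "integrable lborel (\<lambda>k. norm (indicator (cball 0 1) k *\<^sub>R g k) + (norm k powr (2 * \<sigma>) * (norm (g k))\<^sup>2 + 1 / (1 + norm k) ^ 6))"
      by (intro Bochner_Integration.integrable_add integrable_norm loc w integrable_inverse_norm_power)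
    show "(\<lambda>k. norm (g k) / (1 + norm k) ^ (n + 6)) \<in> borel_measurable lborel" by measurable
    show "AE k in lborel. norm (norm (g k) / (1 + norm k) ^ (n + 6))
       \<le> norm (norm (indicator (cball 0 1) k *\<^sub>R g k) + (norm k powr (2 * \<sigma>) * (norm (g k))\<^sup>2 + 1 / (1 + norm k) ^ 6))"
    proof (rule AE_I2)
      fix k :: R3
      let ?p = "1 + norm k"
      have p: "0 < ?p ^ m" "1 \<le> ?p ^ m" for m
        using zero_less_power[OF one_plus_norm_pos[of k]] by (auto intro: one_le_power)
      have nn: "0 \<le> norm (indicator (cball 0 1) k *\<^sub>R g k)" "0 \<le> norm k powr (2 * \<sigma>) * (norm (g k))\<^sup>2" "0 \<le> 1 / ?p ^ 6"
        using p by (auto simp: less_imp_le)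
      have "norm (g k) / ?p ^ (n + 6) \<le> norm (indicator (cball 0 1) k *\<^sub>R g k) + (norm k powr (2 * \<sigma>) * (norm (g k))\<^sup>2 + 1 / ?p ^ 6)"
      proof (cases "norm k \<le> 1")
        case True
        have "norm (g k) / ?p ^ (n + 6) \<le> norm (g k)"
          using p(1)[of "n + 6"] mult_left_mono[OF p(2)[of "n + 6"], of "norm (g k)"]
          by (simp add: pos_divide_le_eq)
        also have "\<dots> = norm (indicator (cball 0 1) k *\<^sub>R g k)" using True by simp
        finally show ?thesis using nn(2,3) by linarith
      next
        case False
        define x where "x = norm k powr (2 * \<sigma>)"
        have x: "0 < x" using False by (auto simp: x_def)
        have "1 / x = norm k powr (- (2 * \<sigma>))" by (simp add: x_def powr_minus divide_inverse)
        also have "\<dots> \<le> norm k powr real n" using False n by (intro powr_mono) auto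
        also have "\<dots> = norm k ^ n" using False by (intro powr_realpow) auto
        also have "\<dots> \<le> ?p ^ n" by (intro power_mono) auto
        finally have xn: "1 / x \<le> ?p ^ n" .
        have "norm (g k) \<le> x * (norm (g k))\<^sup>2 + 1 / x"
        proof -
          have "0 \<le> (x * norm (g k) - 1)\<^sup>2" by simp
          also have "\<dots> = x * (x * (norm (g k))\<^sup>2 + 1 / x - 2 * norm (g k))"
            using x by (simp add: power2_eq_square field_simps)
          finally have "0 \<le> x * (norm (g k))\<^sup>2 + 1 / x - 2 * norm (g k)"
            using x by (simp add: zero_le_mult_iff)
          then show ?thesis using norm_ge_zero[of "g k"] by linarith
        qed
        also have "\<dots> \<le> x * (norm (g k))\<^sup>2 * ?p ^ (n + 6) + ?p ^ n"
          using xn p(2)[of "n + 6"] nn(2) mult_left_mono[OF p(2)[of "n + 6"], of "x * (norm (g k))\<^sup>2"]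
          by (simp add: x_def)
        finally have "norm (g k) / ?p ^ (n + 6) \<le> (x * (norm (g k))\<^sup>2 * ?p ^ (n + 6) + ?p ^ n) / ?p ^ (n + 6)"
          using p(1)[of "n + 6"] by (intro divide_right_mono) auto
        also have "\<dots> = x * (norm (g k))\<^sup>2 + 1 / ?p ^ 6"
          using p(1)[of n] p(1)[of 6] by (simp add: add_divide_distrib power_add)
        finally show ?thesis using nn unfolding x_def by linarith
      qed
      then show "norm (norm (g k) / ?p ^ (n + 6))
       \<le> norm (norm (indicator (cball 0 1) k *\<^sub>R g k) + (norm k powr (2 * \<sigma>) * (norm (g k))\<^sup>2 + 1 / ?p ^ 6))"
        using nn p(1)[of "n + 6"] by (simp only: real_norm_def abs_of_nonneg add_nonneg_nonneg divide_nonneg_nonneg norm_ge_zero less_imp_le)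
    qed
  qed
  then show ?thesis unfolding slowly_growing_def using m by blast
qed

lemma hdot_slowly_growing: "T \<in> hdot \<sigma> \<Longrightarrow> slowly_growing (fhat T)"
  using slowly_growingI_weighted hdotD(1,2) by blast

lemma integral_reflect:
  fixes f :: "R3 \<Rightarrow> complex"
  assumes "f \<in> borel_measurable borel"
  shows "(LINT x|lborel. f (- x)) = (LINT x|lborel. f x)"
  using integral_lborel_affine[OF assms, of "-1" 0] by simp

lemma cnj_fourier:
  assumes "f \<in> schwartz"
  shows "(\<lambda>x. cnj (fourier f x)) = fourier (\<lambda>k. cnj (f (- k)))"
proof
  fix x
  have "cnj (fourier f x) = fourier_const * (LINT k|lborel. cis (- (- x \<bullet> k)) * cnj (f k))"
    unfolding fourier_altdef complex_cnj_mult
    by (subst Bochner_Integration.integral_cnj[symmetric]) (simp add: fourier_const_def cis_cnj)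
  also have "\<dots> = fourier (\<lambda>k. cnj (f k)) (- x)" by (simp add: fourier_altdef)
  also have "\<dots> = fourier (\<lambda>k. cnj (f (- k))) x"
    using fourier_reflect[OF schwartz_cnj[OF assms], of x] by simp
  finally show "cnj (fourier f x) = fourier (\<lambda>k. cnj (f (- k))) x" .
qed

lemma pairing_cnj_fourier:
  assumes "has_fourier T g" "f \<in> schwartz"
  shows "pairing T (\<lambda>x. cnj (fourier f x)) = (LINT k|lborel. g (- k) * cnj (f k))"
    and "integrable lborel (\<lambda>k. g (- k) * cnj (f k))"
proof -
  have s: "(\<lambda>k. cnj (f (- k))) \<in> schwartz"
    by (intro schwartz_reflect[of "\<lambda>k. cnj (f k)"] schwartz_cnj assms)
  have m: "(\<lambda>k. g k * cnj (f (- k))) \<in> borel_measurable borel"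
    using has_fourierD(1)[OF assms(1) s] by auto
  show "pairing T (\<lambda>x. cnj (fourier f x)) = (LINT k|lborel. g (- k) * cnj (f k))"
    unfolding cnj_fourier[OF assms(2)] has_fourierD(2)[OF assms(1) s]
    using integral_reflect[OF m] by simp
  show "integrable lborel (\<lambda>k. g (- k) * cnj (f k))"
    using integrable_lborel_affine[OF has_fourierD(1)[OF assms(1) s], of "-1" 0] by simp
qed

text \<open>Conjugating a test function conjugates and reflects its transform, so reality becomes an
  identity between \<open>g (- k)\<close> and \<open>cnj (g k)\<close> tested against all Schwartz
  functions. Membership in \<open>hdot\<close> can thus be checked on symbols.\<close>

lemma real_distribution_iff_hermitian:
  assumes h: "has_fourier T g"
  shows "Defs.real_distribution T \<longleftrightarrow> (AE k in lborel. g (- k) = cnj (g k))"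
proof
  have m [measurable]: "g \<in> borel_measurable borel" by (rule has_fourier_borel_measurable[OF h])
  assume r: "Defs.real_distribution T"
  have "AE k in lborel. g (- k) - cnj (g k) = 0"
  proof (rule schwartz_test_zero)
    show "(\<lambda>k. g (- k) - cnj (g k)) \<in> borel_measurable borel" by measurable
    fix f assume f: "f \<in> schwartz"
    have f': "(\<lambda>k. cnj (f k)) \<in> schwartz" by (rule schwartz_cnj[OF f])
    have i1: "integrable lborel (\<lambda>k. g (- k) * f k)" and
      p1: "pairing T (\<lambda>x. cnj (fourier (\<lambda>k. cnj (f k)) x)) = (LINT k|lborel. g (- k) * f k)"
      using pairing_cnj_fourier[OF h f'] by auto
    have i2: "integrable lborel (\<lambda>k. cnj (g k) * f k)"
      using integrable_cnj[of lborel "\<lambda>k. g k * cnj (f k)"] has_fourierD(1)[OF h f'] by simp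
    have "(LINT k|lborel. cnj (g k) * f k) = cnj (LINT k|lborel. g k * cnj (f k))"
      unfolding Bochner_Integration.integral_cnj[symmetric] by simp
    also have "\<dots> = cnj (pairing T (fourier (\<lambda>k. cnj (f k))))" using has_fourierD(2)[OF h f'] by simp
    also have "\<dots> = (LINT k|lborel. g (- k) * f k)"
      using r schwartz_fourier[OF f'] p1 unfolding Defs.real_distribution_def by metis
    finally show "(LINT k|lborel. (g (- k) - cnj (g k)) * f k) = 0"
      using i1 i2 by (simp add: left_diff_distrib)
    show "integrable lborel (\<lambda>k. (g (- k) - cnj (g k)) * f k)"
      using i1 i2 by (simp add: left_diff_distrib)
  qed
  then show "AE k in lborel. g (- k) = cnj (g k)" by simp
next
  have m [measurable]: "g \<in> borel_measurable borel" by (rule has_fourier_borel_measurable[OF h])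
  assume ae: "AE k in lborel. g (- k) = cnj (g k)"
  show "Defs.real_distribution T" unfolding Defs.real_distribution_def
  proof
    fix u assume u: "u \<in> schwartz"
    define f where "f = fourier (\<lambda>x. u (- x))"
    have f: "f \<in> schwartz" "u = fourier f" unfolding f_def using fourier_surj[OF u] by auto
    have "pairing T (\<lambda>x. cnj (u x)) = (LINT k|lborel. g (- k) * cnj (f k))"
      unfolding f(2) by (rule pairing_cnj_fourier(1)[OF h f(1)])
    also have "\<dots> = (LINT k|lborel. cnj (g k * f k))"
    proof (rule integral_cong_AE)
      show "AE k in lborel. g (- k) * cnj (f k) = cnj (g k * f k)" using ae by eventually_elim simp
    qed (use schwartz_borel_measurable[OF f(1)] in measurable)
    also have "\<dots> = cnj (pairing T u)"
      unfolding f(2) has_fourierD(2)[OF h f(1)] by (rule Bochner_Integration.integral_cnj)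
    finally show "pairing T (\<lambda>x. cnj (u x)) = cnj (pairing T u)" .
  qed
qed

text \<open>Derivatives fall on \<open>fourier f\<close> and become multiplications by coordinates.
  This turns the Gauss laws into linear algebra at each frequency.\<close>

lemma has_divergence_iff:
  assumes E: "\<And>j. has_fourier (E $ j) (g j)" and T: "has_fourier T r"
  shows "has_divergence E T \<longleftrightarrow> (AE k in lborel. (\<Sum>j\<in>UNIV. \<i> * of_real (k $ j) * g j k) = r k)"
proof -
  have [measurable]: "g j \<in> borel_measurable borel" "r \<in> borel_measurable borel" for j
    using has_fourier_borel_measurable E T by auto
  have s: "(\<lambda>k. (- \<i>) * (of_real (k $ j) * f k)) \<in> schwartz" if "f \<in> schwartz" for f j
    by (intro schwartz_cmult schwartz_coord that)
  have ij: "integrable lborel (\<lambda>k. g j k * (\<i> * (of_real (k $ j) * f k)))" if f: "f \<in> schwartz" for f j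
    by (intro has_fourierD(1)[OF E] schwartz_cmult schwartz_coord f)
  have e: "(\<Sum>j\<in>UNIV. \<i> * of_real (k $ j) * g j k) * f k = (\<Sum>j\<in>UNIV. g j k * (\<i> * (of_real (k $ j) * f k)))" for k f
    unfolding sum_distrib_right by (intro sum.cong refl) (simp only: mult_ac)
  have int: "integrable lborel (\<lambda>k. (\<Sum>j\<in>UNIV. \<i> * of_real (k $ j) * g j k) * f k)" if f: "f \<in> schwartz" for f
    unfolding e by (intro Bochner_Integration.integrable_sum ij f)
  have L: "- (\<Sum>j\<in>UNIV. pairing (E $ j) (partial_deriv j (fourier f)))
      = (LINT k|lborel. (\<Sum>j\<in>UNIV. \<i> * of_real (k $ j) * g j k) * f k)" if f: "f \<in> schwartz" for f
  proof -
    have "- pairing (E $ j) (partial_deriv j (fourier f)) = (LINT k|lborel. g j k * (\<i> * (of_real (k $ j) * f k)))" for j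
      unfolding partial_deriv_fourier[OF f] has_fourierD(2)[OF E s[OF f]]
      by (simp flip: integral_minus)
    then show ?thesis unfolding e Bochner_Integration.integral_sum[OF ij[OF f]] by (simp flip: sum_negf)
  qed
  have "has_divergence E T \<longleftrightarrow> (\<forall>f\<in>schwartz. (LINT k|lborel. (\<Sum>j\<in>UNIV. \<i> * of_real (k $ j) * g j k) * f k) = (LINT k|lborel. r k * f k))"
    (is "_ \<longleftrightarrow> ?I")
  proof
    assume d: "has_divergence E T"
    show ?I
    proof
      fix f assume f: "f \<in> schwartz"
      show "(LINT k|lborel. (\<Sum>j\<in>UNIV. \<i> * of_real (k $ j) * g j k) * f k) = (LINT k|lborel. r k * f k)"
        using d schwartz_fourier[OF f] unfolding has_divergence_def
        by (simp only: L[OF f, symmetric] has_fourierD(2)[OF T f, symmetric])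
    qed
  next
    assume I: ?I
    show "has_divergence E T" unfolding has_divergence_def
    proof
      fix u assume u: "u \<in> schwartz"
      define f where "f = fourier (\<lambda>x. u (- x))"
      have f: "f \<in> schwartz" "u = fourier f" unfolding f_def using fourier_surj[OF u] by auto
      show "- (\<Sum>j\<in>UNIV. pairing (E $ j) (partial_deriv j u)) = pairing T u"
        unfolding f(2) L[OF f(1)] has_fourierD(2)[OF T f(1)] using I f(1) by blast
    qed
  qed
  also have "\<dots> \<longleftrightarrow> (AE k in lborel. (\<Sum>j\<in>UNIV. \<i> * of_real (k $ j) * g j k) = r k)"
  proof
    assume I: ?I
    have "AE k in lborel. (\<Sum>j\<in>UNIV. \<i> * of_real (k $ j) * g j k) - r k = 0"
    proof (rule schwartz_test_zero)
      show "(\<lambda>k. (\<Sum>j\<in>UNIV. \<i> * of_real (k $ j) * g j k) - r k) \<in> borel_measurable borel" by measurable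
      fix f assume f: "f \<in> schwartz"
      show "integrable lborel (\<lambda>k. ((\<Sum>j\<in>UNIV. \<i> * of_real (k $ j) * g j k) - r k) * f k)"
        "(LINT k|lborel. ((\<Sum>j\<in>UNIV. \<i> * of_real (k $ j) * g j k) - r k) * f k) = 0"
        unfolding left_diff_distrib using int[OF f] has_fourierD(1)[OF T f] I f by simp_all
    qed
    then show "AE k in lborel. (\<Sum>j\<in>UNIV. \<i> * of_real (k $ j) * g j k) = r k" by simp
  next
    assume ae: "AE k in lborel. (\<Sum>j\<in>UNIV. \<i> * of_real (k $ j) * g j k) = r k"
    show ?I
    proof
      fix f assume f: "f \<in> schwartz"
      show "(LINT k|lborel. (\<Sum>j\<in>UNIV. \<i> * of_real (k $ j) * g j k) * f k) = (LINT k|lborel. r k * f k)"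
      proof (rule integral_cong_AE)
        show "AE k in lborel. (\<Sum>j\<in>UNIV. \<i> * of_real (k $ j) * g j k) * f k = r k * f k"
          using ae by eventually_elim simp
      qed (use int[OF f] has_fourierD(1)[OF T f] in auto)
    qed
  qed
  finally show ?thesis .
qed

section \<open>Distributions given by functions\<close>

lemma represents_unique:
  assumes "represents S f" "represents T f" shows "S = T"
  by (rule tempered_eqI) (use assms schwartz_fourier in \<open>simp add: represents_def\<close>)

lemma of_fun_eq: "represents T (\<lambda>x. of_real (f x)) \<Longrightarrow> of_fun f = T"
  unfolding of_fun_def by (rule the_equality) (auto intro: represents_unique)

text \<open>Translation gives the phase; reflection gives \<open>p (- k)\<close>, which is
  \<open>cnj (p k)\<close> because the function is real. The candidate is built from its symbol and
  then shown to be represented by the function, so that the definite description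
  \<open>of_fun\<close> denotes it.\<close>

lemma has_fourier_translate_reflect:
  assumes \<Phi>: "represents \<Phi> (\<lambda>x. complex_of_real (\<phi> x))" and p: "has_fourier \<Phi> p" "slowly_growing p"
    and real: "Defs.real_distribution \<Phi>"
  shows "has_fourier (of_fun (\<lambda>x. c * \<phi> (\<xi> - x))) (\<lambda>k. of_real c * cnj (p k) * cis (- (k \<bullet> \<xi>)))"
proof -
  let ?g = "\<lambda>k. of_real c * cnj (p k) * cis (- (k \<bullet> \<xi>))"
  have m [measurable]: "p \<in> borel_measurable borel" using p(2) by (simp add: slowly_growing_def)
  have cism [measurable]: "(\<lambda>k. cis (- (k \<bullet> \<xi>))) \<in> borel_measurable borel"
    by (intro borel_measurable_continuous_onI continuous_intros)
  have ae: "AE k in lborel. p (- k) = cnj (p k)"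
    using real_distribution_iff_hermitian[OF p(1)] real by blast
  have sg: "slowly_growing ?g"
  proof (rule slowly_growingI_dominated[of _ p p "\<bar>c\<bar>" 0])
    show "?g \<in> borel_measurable borel" by measurable
  qed (use p(2) in \<open>simp_all add: norm_mult\<close>)
  then have S: "has_fourier (of_fourier ?g) ?g" by (rule of_fourier_has_fourier)
  have "represents (of_fourier ?g) (\<lambda>x. complex_of_real (c * \<phi> (\<xi> - x)))"
    unfolding represents_def
  proof (intro conjI allI ballI impI)
    fix K :: "R3 set" assume K: "compact K"
    have "compact ((\<lambda>x. \<xi> + (-1) *\<^sub>R x) ` K)"
      by (intro compact_continuous_image continuous_intros K)
    then have "integrable lborel (\<lambda>x. indicator ((\<lambda>x. \<xi> + (-1) *\<^sub>R x) ` K) x *\<^sub>R complex_of_real (\<phi> x))"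
      using \<Phi> unfolding represents_def set_integrable_def by blast
    from integrable_lborel_affine[OF this, of "-1" \<xi>]
    have "integrable lborel (\<lambda>x. indicator ((\<lambda>x. \<xi> - x) ` K) (\<xi> - x) *\<^sub>R complex_of_real (\<phi> (\<xi> - x)))" by simp
    moreover have "indicator ((\<lambda>x. \<xi> - x) ` K) (\<xi> - x) = (indicator K x :: real)" for x
      by (auto simp: indicator_def)
    ultimately have "integrable lborel (\<lambda>x. of_real c * (indicator K x *\<^sub>R complex_of_real (\<phi> (\<xi> - x))))"
      by (intro integrable_mult_right) simp
    then show "set_integrable lborel K (\<lambda>x. complex_of_real (c * \<phi> (\<xi> - x)))"
      unfolding set_integrable_def by (simp add: mult_ac)
  next
    fix u assume u: "u \<in> schwartz"
    define f where "f = fourier (\<lambda>x. u (- x))"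
    have f: "f \<in> schwartz" "u = fourier f" unfolding f_def using fourier_surj[OF u] by auto
    \<comment> \<open>Chosen so that its Fourier transform is the test function \<open>u\<close>,
      reflected and translated by \<open>\<xi>\<close>.\<close>
    define v where "v k = cis (\<xi> \<bullet> k) * f (- k)" for k
    have v: "v \<in> schwartz" unfolding v_def by (intro schwartz_cis schwartz_reflect f(1))
    have Fv: "fourier v y = u (\<xi> - y)" for y
    proof -
      have mm: "(\<lambda>k. cis (- ((\<xi> - y) \<bullet> k)) * f k) \<in> borel_measurable borel"
        by (intro schwartz_borel_measurable schwartz_cis_minus f(1))
      have "u (\<xi> - y) = fourier_const * (LINT k|lborel. cis (- ((\<xi> - y) \<bullet> k)) * f k)"
        by (simp add: f(2) fourier_altdef)
      also have "\<dots> = fourier_const * (LINT k|lborel. cis (- ((\<xi> - y) \<bullet> (- k))) * f (- k))"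
        using integral_reflect[OF mm] by simp
      also have "\<dots> = fourier v y"
        by (simp add: fourier_altdef v_def inner_diff_left flip: mult.assoc cis_mult)
          (simp only: cis_mult, simp add: algebra_simps)
      finally show ?thesis by simp
    qed
    have iy: "integrable lborel (\<lambda>y. complex_of_real (\<phi> y) * u (\<xi> - y))"
      and py: "pairing \<Phi> (fourier v) = (LINT y|lborel. complex_of_real (\<phi> y) * u (\<xi> - y))"
    proof -
      have e: "fourier v = (\<lambda>y. u (\<xi> - y))" using Fv by (rule ext)
      note conjunct2[OF \<Phi>[unfolded represents_def], rule_format, OF schwartz_fourier[OF v]]
      then show "integrable lborel (\<lambda>y. complex_of_real (\<phi> y) * u (\<xi> - y))"
        "pairing \<Phi> (fourier v) = (LINT y|lborel. complex_of_real (\<phi> y) * u (\<xi> - y))"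
        unfolding e by (rule conjunct1, rule conjunct2)
    qed
    have ix: "integrable lborel (\<lambda>x. complex_of_real (\<phi> (\<xi> - x)) * u x)"
      using integrable_lborel_affine[OF iy, of "-1" \<xi>] by simp
    then show "integrable lborel (\<lambda>x. complex_of_real (c * \<phi> (\<xi> - x)) * u x)"
      using integrable_mult_right[of "of_real c", OF ix] by (simp add: mult.assoc)
    have "(LINT x|lborel. complex_of_real (c * \<phi> (\<xi> - x)) * u x) = of_real c * (LINT x|lborel. complex_of_real (\<phi> (\<xi> - x)) * u x)"
      by (simp add: mult.assoc)
    also have "(LINT x|lborel. complex_of_real (\<phi> (\<xi> - x)) * u x) = pairing \<Phi> (fourier v)"
      using integral_lborel_affine[OF borel_measurable_integrable[OF iy, simplified], of "-1" \<xi>] py by simp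
    also have "\<dots> = (LINT k|lborel. p k * v k)" by (rule has_fourierD(2)[OF p(1) v])
    also have "\<dots> = (LINT k|lborel. p (- k) * v (- k))"
      using integral_reflect[of "\<lambda>k. p k * v k"] has_fourierD(1)[OF p(1) v] by auto
    also have "\<dots> = (LINT k|lborel. cnj (p k) * (cis (- (k \<bullet> \<xi>)) * f k))"
    proof (rule integral_cong_AE)
      show "AE k in lborel. p (- k) * v (- k) = cnj (p k) * (cis (- (k \<bullet> \<xi>)) * f k)"
        using ae by eventually_elim (simp add: v_def inner_commute)
    qed (use schwartz_borel_measurable[OF v] schwartz_borel_measurable[OF f(1)] in measurable)
    also have "of_real c * \<dots> = (LINT k|lborel. ?g k * f k)"
      by (simp add: mult.assoc)
    also have "\<dots> = pairing (of_fourier ?g) u" unfolding f(2) by (rule has_fourierD(2)[OF S f(1), symmetric])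
    finally show "pairing (of_fourier ?g) u = (LINT x|lborel. complex_of_real (c * \<phi> (\<xi> - x)) * u x)" by simp
  qed
  then have "of_fun (\<lambda>x. c * \<phi> (\<xi> - x)) = of_fourier ?g" by (rule of_fun_eq)
  then show ?thesis using S by simp
qed

section \<open>Symbols of vector fields\<close>

type_synonym amplitude = "C3 \<times> C3"

definition cscale :: "complex \<Rightarrow> amplitude \<Rightarrow> amplitude" where
  "cscale c w = (c *s fst w, c *s snd w)"

definition conj_amp :: "amplitude \<Rightarrow> amplitude" where
  "conj_amp w = (\<chi> j. cnj (fst w $ j), \<chi> j. cnj (snd w $ j))"

lemma norm_vector_scalar_mult: "norm (c *s x) = norm c * norm x" for x :: "complex ^ 'n::finite"
  unfolding norm_vec_def by (simp add: norm_mult L2_set_right_distrib)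

lemma norm_cscale: "norm (cscale c w) = norm c * norm w"
  by (simp add: cscale_def norm_prod_def norm_vector_scalar_mult power_mult_distrib
      real_sqrt_mult flip: distrib_left)

lemma bounded_bilinear_cscale: "bounded_bilinear cscale"
proof (standard, goal_cases)
  case 5
  then show ?case by (rule exI[of _ 1]) (simp add: norm_cscale)
qed (simp_all add: cscale_def prod_eq_iff vec_eq_iff algebra_simps scaleR_conv_of_real[where 'a = complex])

lemmas cscale_simps =
  bounded_bilinear.add_left[OF bounded_bilinear_cscale] bounded_bilinear.add_right[OF bounded_bilinear_cscale]
  bounded_bilinear.diff_left[OF bounded_bilinear_cscale] bounded_bilinear.diff_right[OF bounded_bilinear_cscale]
  bounded_bilinear.minus_left[OF bounded_bilinear_cscale] bounded_bilinear.minus_right[OF bounded_bilinear_cscale]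
  bounded_bilinear.zero_left[OF bounded_bilinear_cscale] bounded_bilinear.zero_right[OF bounded_bilinear_cscale]
  bounded_bilinear.scaleR_left[OF bounded_bilinear_cscale] bounded_bilinear.scaleR_right[OF bounded_bilinear_cscale]

lemma cscale_borel_measurable [measurable]:
  assumes "c \<in> borel_measurable M" "w \<in> borel_measurable M"
  shows "(\<lambda>x. cscale (c x) (w x)) \<in> borel_measurable M"
  using assms by (rule borel_measurable_continuous_Pair)
    (intro bounded_bilinear.continuous_on[OF bounded_bilinear_cscale] continuous_intros)

lemma norm_amplitude_sq:
  "(norm (w :: amplitude))\<^sup>2 = (\<Sum>j\<in>UNIV. (norm (fst w $ j))\<^sup>2) + (\<Sum>j\<in>UNIV. (norm (snd w $ j))\<^sup>2)"
  by (simp add: norm_prod_def norm_vec_def L2_set_def sum_nonneg)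

lemma norm_fst_nth_le: "norm (fst w $ j) \<le> norm (w :: amplitude)"
  using norm_fst_le[of "fst w" "snd w"] Finite_Cartesian_Product.norm_nth_le[of "fst w" j] by simp

lemma norm_snd_nth_le: "norm (snd w $ j) \<le> norm (w :: amplitude)"
  using norm_snd_le[of "snd w" "fst w"] Finite_Cartesian_Product.norm_nth_le[of "snd w" j] by simp

lemma fst_nth_borel_measurable [measurable]:
  assumes "w \<in> borel_measurable M"
  shows "(\<lambda>x. fst (w x :: amplitude) $ j) \<in> borel_measurable M"
  using assms by (rule borel_measurable_continuous_on[rotated]) (intro continuous_intros)

lemma snd_nth_borel_measurable [measurable]:
  assumes "w \<in> borel_measurable M"
  shows "(\<lambda>x. snd (w x :: amplitude) $ j) \<in> borel_measurable M"
  using assms by (rule borel_measurable_continuous_on[rotated]) (intro continuous_intros)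

lemma amplitude_borel_measurableI:
  assumes "\<And>j. (\<lambda>x. f x $ j) \<in> borel_measurable M" "\<And>j. (\<lambda>x. g x $ j) \<in> borel_measurable M"
  shows "(\<lambda>x. (f x, g x) :: amplitude) \<in> borel_measurable M"
proof -
  have v: "h \<in> borel_measurable M" if [measurable]: "\<And>j. (\<lambda>x. h x $ j) \<in> borel_measurable M" for h :: "_ \<Rightarrow> C3"
  proof -
    have e: "h = (\<lambda>x. \<Sum>j\<in>UNIV. h x $ j *s axis j 1)" by (simp add: basis_expansion)
    have c: "continuous_on UNIV (\<lambda>z. z *s (axis j 1 :: C3))" for j
      unfolding vector_scalar_mult_def by (intro continuous_intros)
    have "(\<lambda>x. h x $ j *s (axis j 1 :: C3)) \<in> borel_measurable M" for j
      using that[of j] by (rule borel_measurable_continuous_on[OF c])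
    then show ?thesis by (subst e) (intro borel_measurable_sum)
  qed
  show ?thesis using v[OF assms(1)] v[OF assms(2)] by (rule borel_measurable_Pair)
qed

text \<open>The relation holds for every almost everywhere equal representative. Slow growth is
  included so that a symbol transformed by an isometry at each frequency again belongs to some
  field.\<close>

definition has_symbol :: "em_field \<Rightarrow> (R3 \<Rightarrow> amplitude) \<Rightarrow> bool" where
  "has_symbol F w \<longleftrightarrow> slowly_growing w \<and> (\<forall>j. has_fourier (fst F $ j) (\<lambda>k. fst (w k) $ j)) \<and>
     (\<forall>j. has_fourier (snd F $ j) (\<lambda>k. snd (w k) $ j))"

definition of_symbol :: "(R3 \<Rightarrow> amplitude) \<Rightarrow> em_field" where
  "of_symbol w = (\<chi> j. of_fourier (\<lambda>k. fst (w k) $ j), \<chi> j. of_fourier (\<lambda>k. snd (w k) $ j))"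

definition symbol_of :: "em_field \<Rightarrow> R3 \<Rightarrow> amplitude" where
  "symbol_of F k = (\<chi> j. fhat (fst F $ j) k, \<chi> j. fhat (snd F $ j) k)"

lemma slowly_growing_borel: "slowly_growing w \<Longrightarrow> w \<in> borel_measurable borel"
  by (simp add: slowly_growing_def)

lemma slowly_growing_components:
  assumes "slowly_growing w"
  shows "slowly_growing (\<lambda>k. fst (w k :: amplitude) $ j)" "slowly_growing (\<lambda>k. snd (w k :: amplitude) $ j)"
  using slowly_growing_borel[OF assms]
  by (auto intro!: slowly_growingI_dominated[OF _ assms assms, of _ 1 0] norm_fst_nth_le norm_snd_nth_le)

lemma of_symbol_has_symbol: "slowly_growing w \<Longrightarrow> has_symbol (of_symbol w) w"
  unfolding has_symbol_def of_symbol_def by (simp add: of_fourier_has_fourier slowly_growing_components)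

lemma has_symbol_unique:
  assumes "has_symbol F w" "has_symbol G u" "AE k in lborel. w k = u k"
  shows "F = G"
proof -
  have "fst F $ j = fst G $ j" for j
    by (rule has_fourier_unique_AE[of _ "\<lambda>k. fst (w k) $ j" _ "\<lambda>k. fst (u k) $ j"])
      (use assms in \<open>auto simp: has_symbol_def elim: eventually_mono\<close>)
  moreover have "snd F $ j = snd G $ j" for j
    by (rule has_fourier_unique_AE[of _ "\<lambda>k. snd (w k) $ j" _ "\<lambda>k. snd (u k) $ j"])
      (use assms in \<open>auto simp: has_symbol_def elim: eventually_mono\<close>)
  ultimately show ?thesis by (simp add: prod_eq_iff vec_eq_iff)
qed

lemma symbol_of_AE:
  assumes "has_symbol F w" shows "AE k in lborel. symbol_of F k = w k"
proof -
  have "AE k in lborel. \<forall>j. fhat (fst F $ j) k = fst (w k) $ j"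
    by (subst AE_all_countable) (use assms fhat_AE in \<open>auto simp: has_symbol_def\<close>)
  moreover have "AE k in lborel. \<forall>j. fhat (snd F $ j) k = snd (w k) $ j"
    by (subst AE_all_countable) (use assms fhat_AE in \<open>auto simp: has_symbol_def\<close>)
  ultimately show ?thesis by eventually_elim (simp add: prod_eq_iff vec_eq_iff symbol_of_def)
qed

lemma symbol_of_has_symbol:
  assumes "\<And>j. has_fourier (fst F $ j) (fhat (fst F $ j)) \<and> slowly_growing (fhat (fst F $ j))"
    "\<And>j. has_fourier (snd F $ j) (fhat (snd F $ j)) \<and> slowly_growing (fhat (snd F $ j))"
  shows "has_symbol F (symbol_of F)"
proof -
  let ?a = "\<lambda>j k. fhat (fst F $ j) k" and ?b = "\<lambda>j k. fhat (snd F $ j) k"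
  have [measurable]: "?a j \<in> borel_measurable borel" "?b j \<in> borel_measurable borel" for j
    using assms slowly_growing_borel by blast+
  have m: "symbol_of F \<in> borel_measurable borel"
    unfolding symbol_of_def [abs_def] by (rule amplitude_borel_measurableI) simp_all
  have sq: "norm (symbol_of F k) \<le> (\<Sum>j\<in>UNIV. norm (?a j k)) + (\<Sum>j\<in>UNIV. norm (?b j k))" for k
    unfolding symbol_of_def
    by (rule order_trans[OF norm_Pair_le add_mono]) (simp_all add: norm_vec_def L2_set_le_sum)
  have sl: "slowly_growing (\<lambda>k. \<Sum>j\<in>UNIV. f j k)" if "\<And>j. slowly_growing (f j :: R3 \<Rightarrow> real)" for f :: "3 \<Rightarrow> R3 \<Rightarrow> real"
    unfolding sum_3
    by (rule slowly_growingI_dominated[of _ "\<lambda>k. f 1 k + f 2 k" "f 3" 1 1, OF _ slowly_growingI_dominated[of _ "f 1" "f 2" 1 1]])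
      (use that slowly_growing_borel[OF that] in \<open>auto intro!: order_trans[OF norm_triangle_ineq] borel_measurable_add\<close>)
  have sn: "slowly_growing (\<lambda>k. norm (g k))" if "slowly_growing g" for g :: "R3 \<Rightarrow> complex"
    using that unfolding slowly_growing_def by auto
  have "slowly_growing (symbol_of F)"
    by (rule slowly_growingI_dominated[OF m sl[of "\<lambda>j k. norm (?a j k)"] sl[of "\<lambda>j k. norm (?b j k)"], of 1 1])
      (use assms sn sq in \<open>auto simp: sum_nonneg\<close>)
  then show ?thesis unfolding has_symbol_def using assms by (simp add: symbol_of_def)
qed

lemma has_symbol_zero: "has_symbol 0 (\<lambda>k. 0)"
  by (auto simp: has_symbol_def slowly_growing_def has_fourier_zero)

lemma has_symbol_add:
  assumes "has_symbol F w" "has_symbol G u"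
  shows "has_symbol (F + G) (\<lambda>k. w k + u k)"
proof -
  have "slowly_growing (\<lambda>k. w k + u k)"
  proof -
    have s: "slowly_growing w" "slowly_growing u" using assms by (simp_all add: has_symbol_def)
    show ?thesis
      by (rule slowly_growingI_dominated[OF borel_measurable_add[OF s[THEN slowly_growing_borel]] s, of 1 1])
        (simp add: norm_triangle_ineq)
  qed
  then show ?thesis using assms unfolding has_symbol_def by (simp add: has_fourier_add)
qed

lemma has_symbol_scaleR:
  assumes "has_symbol F w"
  shows "has_symbol (r *\<^sub>R F) (\<lambda>k. r *\<^sub>R w k)"
proof -
  have "slowly_growing (\<lambda>k. r *\<^sub>R w k)"
  proof -
    have s: "slowly_growing w" using assms by (simp add: has_symbol_def)
    have "(\<lambda>k. r *\<^sub>R w k) \<in> borel_measurable borel" using slowly_growing_borel[OF s] by measurable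
    from slowly_growingI_dominated[OF this s s, of "\<bar>r\<bar>" 0] show ?thesis by simp
  qed
  then show ?thesis using assms unfolding has_symbol_def
    by (simp add: has_fourier_scaleR)
qed

lemma has_symbol_uminus: "has_symbol F w \<Longrightarrow> has_symbol (- F) (\<lambda>k. - w k)"
  using has_symbol_scaleR[of F w "-1"] by simp

lemma has_symbol_diff: "has_symbol F w \<Longrightarrow> has_symbol G u \<Longrightarrow> has_symbol (F - G) (\<lambda>k. w k - u k)"
  using has_symbol_add[OF _ has_symbol_uminus, of F w G u] by simp

lemma has_symbol_sum:
  "(\<And>i. i \<in> I \<Longrightarrow> has_symbol (F i) (w i)) \<Longrightarrow> has_symbol (\<Sum>i\<in>I. F i) (\<lambda>k. \<Sum>i\<in>I. w i k)"
  by (induction I rule: infinite_finite_induct) (auto intro: has_symbol_zero has_symbol_add)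

section \<open>The energy space on the Fourier side\<close>

definition weighted_L2 :: "real \<Rightarrow> (R3 \<Rightarrow> 'a::{real_normed_vector, second_countable_topology}) \<Rightarrow> bool" where
  "weighted_L2 s w \<longleftrightarrow> w \<in> borel_measurable borel \<and> integrable lborel (\<lambda>k. norm k powr (2 * s) * (norm (w k))\<^sup>2)"

definition weighted_L2_sq :: "real \<Rightarrow> (R3 \<Rightarrow> 'a::{real_normed_vector, second_countable_topology}) \<Rightarrow> real" where
  "weighted_L2_sq s w = (LINT k|lborel. norm k powr (2 * s) * (norm (w k))\<^sup>2)"

lemma sq_sum_le: "0 \<le> z \<Longrightarrow> z \<le> a + b \<Longrightarrow> z\<^sup>2 \<le> 2 * a\<^sup>2 + 2 * b\<^sup>2" for a b z :: real
proof -
  assume "0 \<le> z" "z \<le> a + b"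
  then have "z\<^sup>2 \<le> (a + b)\<^sup>2" by (rule power_mono[rotated])
  also have "\<dots> \<le> 2 * a\<^sup>2 + 2 * b\<^sup>2"
    using zero_le_power2[of "a - b"] by (simp add: power2_eq_square algebra_simps)
  finally show ?thesis .
qed

text \<open>From \<open>(a + b)\<^sup>2 \<le> 2 * a\<^sup>2 + 2 * b\<^sup>2\<close>. This crude
  inequality replaces the triangle inequality of the norm throughout; \<open>D = 0\<close> gives
  domination by a single function.\<close>

lemma weighted_L2_dominated:
  assumes w: "w \<in> borel_measurable borel" and g: "weighted_L2 s g" and h: "weighted_L2 s h"
    and le: "\<And>k. norm (w k) \<le> C * norm (g k) + D * norm (h k)"
  shows "weighted_L2 s w" "weighted_L2_sq s w \<le> 2 * C\<^sup>2 * weighted_L2_sq s g + 2 * D\<^sup>2 * weighted_L2_sq s h"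
proof -
  let ?b = "\<lambda>k. 2 * C\<^sup>2 * (norm k powr (2 * s) * (norm (g k))\<^sup>2) + 2 * D\<^sup>2 * (norm k powr (2 * s) * (norm (h k))\<^sup>2)"
  have i: "integrable lborel (\<lambda>k. norm k powr (2 * s) * (norm (g k))\<^sup>2)" "integrable lborel (\<lambda>k. norm k powr (2 * s) * (norm (h k))\<^sup>2)"
    using g h unfolding weighted_L2_def by auto
  have ib: "integrable lborel ?b"
    by (intro Bochner_Integration.integrable_add integrable_mult_right i)
  have b: "norm k powr (2 * s) * (norm (w k))\<^sup>2 \<le> ?b k" for k
  proof -
    have "(norm (w k))\<^sup>2 \<le> 2 * (C * norm (g k))\<^sup>2 + 2 * (D * norm (h k))\<^sup>2"
      using le[of k] by (intro sq_sum_le) auto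
    then have "norm k powr (2 * s) * (norm (w k))\<^sup>2 \<le> norm k powr (2 * s) * (2 * (C * norm (g k))\<^sup>2 + 2 * (D * norm (h k))\<^sup>2)"
      by (rule mult_left_mono) simp
    then show ?thesis by (simp add: power_mult_distrib algebra_simps)
  qed
  have iw: "integrable lborel (\<lambda>k. norm k powr (2 * s) * (norm (w k))\<^sup>2)"
  proof (rule Bochner_Integration.integrable_bound[OF ib])
    show "(\<lambda>k. norm k powr (2 * s) * (norm (w k))\<^sup>2) \<in> borel_measurable lborel" using w by measurable
    show "AE k in lborel. norm (norm k powr (2 * s) * (norm (w k))\<^sup>2) \<le> norm (?b k)"
      using b by (intro AE_I2) (simp add: order_trans[OF _ abs_ge_self])
  qed
  then show "weighted_L2 s w" using w by (simp add: weighted_L2_def)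
  have "weighted_L2_sq s w \<le> (LINT k|lborel. ?b k)"
    unfolding weighted_L2_sq_def using b by (intro Bochner_Integration.integral_mono iw ib)
  then show "weighted_L2_sq s w \<le> 2 * C\<^sup>2 * weighted_L2_sq s g + 2 * D\<^sup>2 * weighted_L2_sq s h"
    unfolding weighted_L2_sq_def using i by simp
qed

lemma weighted_L2_sq_nonneg: "0 \<le> weighted_L2_sq s w"
  unfolding weighted_L2_sq_def by (intro integral_nonneg_AE) auto

lemma hdot_norm_sq:
  assumes "has_fourier T g"
  shows "(hdot_norm \<sigma> T)\<^sup>2 = (LINT k|lborel. norm k powr (2 * \<sigma>) * (norm (g k))\<^sup>2)"
proof -
  have [measurable]: "g \<in> borel_measurable borel" "fhat T \<in> borel_measurable borel"
    using has_fourier_borel_measurable assms has_fourier_fhat by blast+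
  have "(LINT k|lborel. norm k powr (2 * \<sigma>) * (norm (fhat T k))\<^sup>2) = (LINT k|lborel. norm k powr (2 * \<sigma>) * (norm (g k))\<^sup>2)"
  proof (rule integral_cong_AE)
    show "AE k in lborel. norm k powr (2 * \<sigma>) * (norm (fhat T k))\<^sup>2 = norm k powr (2 * \<sigma>) * (norm (g k))\<^sup>2"
      using fhat_AE[OF assms] by eventually_elim simp
  qed measurable
  moreover have "0 \<le> (LINT k|lborel. norm k powr (2 * \<sigma>) * (norm (g k))\<^sup>2)" by (intro integral_nonneg_AE) auto
  ultimately show ?thesis by (simp add: hdot_norm_def)
qed

lemma weighted_L2_components:
  assumes "weighted_L2 s w"
  shows "weighted_L2 s (\<lambda>k. fst (w k :: amplitude) $ j)" "weighted_L2 s (\<lambda>k. snd (w k :: amplitude) $ j)"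
proof -
  have m: "w \<in> borel_measurable borel" using assms by (simp add: weighted_L2_def)
  show "weighted_L2 s (\<lambda>k. fst (w k :: amplitude) $ j)" "weighted_L2 s (\<lambda>k. snd (w k :: amplitude) $ j)"
    by (rule weighted_L2_dominated(1)[OF _ assms assms, of _ 1 0]; use m norm_fst_nth_le norm_snd_nth_le in simp)+
qed

text \<open>Frees the norm from the representatives chosen by \<open>fhat\<close>: any symbol may be
  used to compute it.\<close>

lemma field_norm_sq:
  assumes F: "has_symbol F w" and w: "weighted_L2 s w"
  shows "(field_norm s F)\<^sup>2 = weighted_L2_sq s w"
proof -
  have i: "integrable lborel (\<lambda>k. norm k powr (2 * s) * (norm (fst (w k) $ j))\<^sup>2)"
    "integrable lborel (\<lambda>k. norm k powr (2 * s) * (norm (snd (w k) $ j))\<^sup>2)" for j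
    using weighted_L2_components[OF w] by (auto simp: weighted_L2_def)
  have h: "has_fourier (fst F $ j) (\<lambda>k. fst (w k) $ j)" "has_fourier (snd F $ j) (\<lambda>k. snd (w k) $ j)" for j
    using F by (simp_all add: has_symbol_def)
  have "(hdot3_norm s (fst F))\<^sup>2 = (\<Sum>j\<in>UNIV. (LINT k|lborel. norm k powr (2 * s) * (norm (fst (w k) $ j))\<^sup>2))"
    unfolding hdot3_norm_def by (simp add: sum_nonneg hdot_norm_sq[OF h(1)])
  moreover have "(hdot3_norm s (snd F))\<^sup>2 = (\<Sum>j\<in>UNIV. (LINT k|lborel. norm k powr (2 * s) * (norm (snd (w k) $ j))\<^sup>2))"
    unfolding hdot3_norm_def by (simp add: sum_nonneg hdot_norm_sq[OF h(2)])
  moreover have "weighted_L2_sq s w = (LINT k|lborel. (\<Sum>j\<in>UNIV. norm k powr (2 * s) * (norm (fst (w k) $ j))\<^sup>2) + (\<Sum>j\<in>UNIV. norm k powr (2 * s) * (norm (snd (w k) $ j))\<^sup>2))"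
    unfolding weighted_L2_sq_def norm_amplitude_sq by (simp add: distrib_left sum_distrib_left)
  moreover have "\<dots> = (\<Sum>j\<in>UNIV. (LINT k|lborel. norm k powr (2 * s) * (norm (fst (w k) $ j))\<^sup>2)) + (\<Sum>j\<in>UNIV. (LINT k|lborel. norm k powr (2 * s) * (norm (snd (w k) $ j))\<^sup>2))"
    using i by (subst Bochner_Integration.integral_add) (auto intro!: Bochner_Integration.integrable_sum)
  moreover have "(field_norm s F)\<^sup>2 = (hdot3_norm s (fst F))\<^sup>2 + (hdot3_norm s (snd F))\<^sup>2"
    by (simp add: field_norm_def case_prod_unfold)
  ultimately show ?thesis by simp
qed

lemma field_norm_nonneg: "0 \<le> field_norm s F"
  by (simp add: field_norm_def case_prod_unfold)

lemma AE_lborel_nonzero: "AE k in lborel. k \<noteq> (0::R3)"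
  using AE_lborel_singleton[of 0] by simp

lemma weighted_L2_sq_zero_AE:
  assumes "weighted_L2 s w" "weighted_L2_sq s w = 0"
  shows "AE k in lborel. w k = 0"
proof -
  have "AE k in lborel. norm k powr (2 * s) * (norm (w k))\<^sup>2 = 0"
    using assms unfolding weighted_L2_def weighted_L2_sq_def by (subst integral_nonneg_eq_0_iff_AE[symmetric]) auto
  with AE_lborel_nonzero show ?thesis by eventually_elim simp
qed

lemma hdot3_pairI:
  assumes F: "has_symbol F w" and w: "weighted_L2 s w" and herm: "AE k in lborel. w (- k) = conj_amp (w k)"
  shows "fst F \<in> hdot3 s" "snd F \<in> hdot3 s"
proof -
  have 1: "fst F $ j \<in> hdot s" "snd F $ j \<in> hdot s" for j
  proof -
    have h: "has_fourier (fst F $ j) (\<lambda>k. fst (w k) $ j)" "has_fourier (snd F $ j) (\<lambda>k. snd (w k) $ j)"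
      using F by (auto simp: has_symbol_def)
    have "AE k in lborel. fst (w (- k)) $ j = cnj (fst (w k) $ j)" "AE k in lborel. snd (w (- k)) $ j = cnj (snd (w k) $ j)"
      using herm by (auto elim!: eventually_mono simp: conj_amp_def)
    then show "fst F $ j \<in> hdot s" "snd F $ j \<in> hdot s"
      unfolding hdot_def
      using real_distribution_iff_hermitian[OF h(1)] real_distribution_iff_hermitian[OF h(2)] h weighted_L2_components[OF w]
      by (auto simp: weighted_L2_def)
  qed
  then show "fst F \<in> hdot3 s" "snd F \<in> hdot3 s" by (auto simp: hdot3_def)
qed

lemma hdot3_pairD:
  assumes "E \<in> hdot3 s" "B \<in> hdot3 s"
  shows "has_symbol (E, B) (symbol_of (E, B))" "weighted_L2 s (symbol_of (E, B))"
    "AE k in lborel. symbol_of (E, B) (- k) = conj_amp (symbol_of (E, B) k)"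
proof -
  have E: "E $ j \<in> hdot s" and B: "B $ j \<in> hdot s" for j using assms by (auto simp: hdot3_def)
  show h: "has_symbol (E, B) (symbol_of (E, B))"
    by (rule symbol_of_has_symbol) (use hdotD(1)[OF E] hdotD(1)[OF B] hdot_slowly_growing[OF E] hdot_slowly_growing[OF B] in auto)
  have m: "symbol_of (E, B) \<in> borel_measurable borel" using h by (simp add: has_symbol_def slowly_growing_borel)
  have "integrable lborel (\<lambda>k. (\<Sum>j\<in>UNIV. norm k powr (2 * s) * (norm (fhat (E $ j) k))\<^sup>2) + (\<Sum>j\<in>UNIV. norm k powr (2 * s) * (norm (fhat (B $ j) k))\<^sup>2))"
    by (intro Bochner_Integration.integrable_add Bochner_Integration.integrable_sum hdotD(2)[OF E] hdotD(2)[OF B])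
  then show "weighted_L2 s (symbol_of (E, B))"
    using m unfolding weighted_L2_def norm_amplitude_sq by (simp add: symbol_of_def distrib_left sum_distrib_left)
  have "AE k in lborel. \<forall>j. fhat (E $ j) (- k) = cnj (fhat (E $ j) k)"
    using hdotD(3)[OF E] real_distribution_iff_hermitian[OF hdotD(1)[OF E]] by (subst AE_all_countable) blast
  moreover have "AE k in lborel. \<forall>j. fhat (B $ j) (- k) = cnj (fhat (B $ j) k)"
    using hdotD(3)[OF B] real_distribution_iff_hermitian[OF hdotD(1)[OF B]] by (subst AE_all_countable) blast
  ultimately show "AE k in lborel. symbol_of (E, B) (- k) = conj_amp (symbol_of (E, B) k)"
    by eventually_elim (simp add: symbol_of_def conj_amp_def)
qed

section \<open>The free Maxwell flow\<close>

lemma maxwell_symbol_add: "maxwell_symbol t k (w + u) = maxwell_symbol t k w + maxwell_symbol t k u"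
  by (cases w, cases u)
    (simp add: maxwell_symbol_def Let_def longitudinal_def ccross_def vec_eq_iff forall_3 sum_3
      algebra_simps scaleR_conv_of_real[where 'a = complex])

lemma maxwell_symbol_cscale: "maxwell_symbol t k (cscale c w) = cscale c (maxwell_symbol t k w)"
  by (cases w)
    (simp add: maxwell_symbol_def Let_def longitudinal_def ccross_def vec_eq_iff forall_3 sum_3 cscale_def
      algebra_simps scaleR_conv_of_real[where 'a = complex])

lemma maxwell_symbol_minus: "maxwell_symbol t k (- w) = - maxwell_symbol t k w"
proof -
  have m: "- u = cscale (- 1) u" for u by (simp add: cscale_def prod_eq_iff vec_eq_iff)
  show ?thesis unfolding m[of w] m[of "maxwell_symbol t k w"] by (rule maxwell_symbol_cscale)
qed

lemma maxwell_symbol_diff: "maxwell_symbol t k (w - u) = maxwell_symbol t k w - maxwell_symbol t k u"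
  using maxwell_symbol_add[of t k w "- u"] by (simp add: maxwell_symbol_minus)

lemma maxwell_symbol_conj: "maxwell_symbol t (- k) (conj_amp w) = conj_amp (maxwell_symbol t k w)"
  by (cases w)
    (simp add: maxwell_symbol_def Let_def longitudinal_def ccross_def cvec_def vec_eq_iff forall_3 sum_3 conj_amp_def
      algebra_simps scaleR_conv_of_real[where 'a = complex])

text \<open>The operator \<open>\<i> *s ccross (cvec k)\<close> is symmetric for the real inner
  product; with the opposite signs in the two Maxwell equations the generator is skew.\<close>

lemma inner_ccross: "a \<bullet> (\<i> *s ccross (cvec k) b) = b \<bullet> (\<i> *s ccross (cvec k) a)"
  by (simp add: inner_vec_def sum_3 ccross_def cvec_def inner_complex_def algebra_simps)

text \<open>Conservation of energy at one frequency: the squared norm has derivative zero because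
  the generator is skew.\<close>

lemma norm_maxwell_symbol: "norm (maxwell_symbol t k w) = norm w"
proof -
  let ?u = "\<lambda>t. maxwell_symbol t k w"
  let ?D = "\<lambda>t. (\<i> *s ccross (cvec k) (snd (?u t)), - (\<i> *s ccross (cvec k) (fst (?u t))))"
  have "((\<lambda>t. ?u t \<bullet> ?u t) has_derivative (\<lambda>h. 0)) (at t)" for t
  proof -
    have d: "(?u has_derivative (\<lambda>h. h *\<^sub>R ?D t)) (at t)"
      using maxwell_symbol_deriv[of k w t] unfolding has_vector_derivative_def .
    have z: "?u t \<bullet> ?D t = 0"
      using inner_ccross[of "fst (?u t)" k "snd (?u t)"] by (simp add: inner_prod_def)
    have "?u t \<bullet> (h *\<^sub>R ?D t) + (h *\<^sub>R ?D t) \<bullet> ?u t = 0" for h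
      using z by (simp only: inner_scaleR_right inner_scaleR_left inner_commute[of "?D t"] mult_zero_right add_0)
    then show ?thesis using has_derivative_inner[OF d d] by (simp only:)
  qed
  then have "\<exists>c. \<forall>x\<in>UNIV. ?u x \<bullet> ?u x = c"
    by (intro has_derivative_zero_constant) auto
  then have "?u t \<bullet> ?u t = ?u 0 \<bullet> ?u 0" by fastforce
  then show ?thesis by (simp add: maxwell_symbol_0 norm_eq)
qed

lemma norm_ccross_cvec: "norm (ccross (cvec k) b) \<le> 6 * norm k * norm b"
proof -
  have c: "norm (cvec k $ i * b $ j - cvec k $ l * b $ m) \<le> 2 * norm k * norm b" for i j l m
  proof -
    have p: "norm (cvec k $ i * b $ j) \<le> norm k * norm b" for i j
      unfolding norm_mult using component_le_norm_cart[of k i] Finite_Cartesian_Product.norm_nth_le[of b j]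
      by (intro mult_mono) (auto simp: cvec_def)
    show ?thesis using norm_triangle_ineq4[of "cvec k $ i * b $ j" "cvec k $ l * b $ m"] p[of i j] p[of l m] by linarith
  qed
  have "norm (ccross (cvec k) b) \<le> (\<Sum>i\<in>UNIV. norm (ccross (cvec k) b $ i))"
    by (simp add: norm_vec_def L2_set_le_sum)
  also have "\<dots> \<le> 3 * (2 * norm k * norm b)"
    using c[of 2 3 3 2] c[of 3 1 1 3] c[of 1 2 2 1] unfolding sum_3 ccross_def by (simp del: mult.assoc)
  finally show ?thesis by simp
qed

text \<open>The flow is an isometry, so its speed is bounded by the size of the generator; 12 is
  twice the crude constant of \<open>norm_ccross_cvec\<close>. The factor \<open>norm k\<close> is
  the derivative lost by the flow in time.\<close>

lemma maxwell_symbol_lipschitz: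
  "norm (maxwell_symbol t k w - maxwell_symbol r k w) \<le> 12 * norm k * norm w * \<bar>t - r\<bar>"
proof -
  let ?u = "\<lambda>t. maxwell_symbol t k w"
  let ?D = "\<lambda>t. (\<i> *s ccross (cvec k) (snd (?u t)), - (\<i> *s ccross (cvec k) (fst (?u t))))"
  have D: "norm (?D t) \<le> 12 * norm k * norm w" for t
  proof -
    have "norm (?D t) \<le> norm (ccross (cvec k) (snd (?u t))) + norm (ccross (cvec k) (fst (?u t)))"
      by (rule order_trans[OF norm_Pair_le]) (simp add: norm_vector_scalar_mult)
    also have "\<dots> \<le> 6 * norm k * norm (?u t) + 6 * norm k * norm (?u t)"
      using norm_fst_le[of "fst (?u t)" "snd (?u t)"] norm_snd_le[of "snd (?u t)" "fst (?u t)"]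
      by (intro add_mono order_trans[OF norm_ccross_cvec] mult_left_mono) auto
    finally show ?thesis unfolding norm_maxwell_symbol by (simp only: mult.assoc)
  qed
  have "norm (?u t - ?u r) \<le> 12 * norm k * norm w * norm (t - r)"
  proof (rule differentiable_bound[of UNIV ?u "\<lambda>t h. h *\<^sub>R ?D t"])
    show "(?u has_derivative (\<lambda>h. h *\<^sub>R ?D x)) (at x within UNIV)" for x
      using maxwell_symbol_deriv[of k w x] unfolding has_vector_derivative_def .
    show "onorm (\<lambda>h. h *\<^sub>R ?D x) \<le> 12 * norm k * norm w" for x
    proof (rule onorm_le)
      fix h :: real
      show "norm (h *\<^sub>R ?D x) \<le> 12 * norm k * norm w * norm h"
        using mult_left_mono[OF D[of x] norm_ge_zero[of h]] by (simp only: norm_scaleR real_norm_def mult.commute)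
    qed
  qed auto
  then show ?thesis by simp
qed

text \<open>The generator takes values orthogonal to \<open>k\<close>, so the component along
  \<open>k\<close> is constant in time.\<close>

lemma maxwell_symbol_longitudinal:
  "(\<Sum>j\<in>UNIV. of_real (k $ j) * fst (maxwell_symbol t k w) $ j) = (\<Sum>j\<in>UNIV. of_real (k $ j) * fst w $ j)"
  "(\<Sum>j\<in>UNIV. of_real (k $ j) * snd (maxwell_symbol t k w) $ j) = (\<Sum>j\<in>UNIV. of_real (k $ j) * snd w $ j)"
proof -
  define g where "g u = (\<Sum>j\<in>UNIV. of_real (k $ j) * u $ j)" for u :: C3
  have z: "g (\<i> *s ccross (cvec k) u) = 0" for u
    by (simp add: g_def sum_3 ccross_def cvec_def algebra_simps)
  have z': "g (- (\<i> *s ccross (cvec k) u)) = 0" for u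
  proof -
    have "g (- v) = - g v" for v by (simp add: g_def sum_negf)
    then show ?thesis using z[of u] by (simp only: minus_zero)
  qed
  have bl: "bounded_linear g"
    unfolding g_def by (intro bounded_linear_sum bounded_linear_const_mult bounded_linear_vec_nth)
  have const: "h t = h 0" if "\<And>t. (h has_vector_derivative 0) (at t)" for h :: "real \<Rightarrow> complex"
  proof -
    have "\<exists>c. \<forall>x\<in>UNIV. h x = c"
      using that by (intro has_derivative_zero_constant) (auto simp: has_vector_derivative_def)
    then show ?thesis by fastforce
  qed
  have "g (fst (maxwell_symbol t k w)) = g (fst (maxwell_symbol 0 k w))"
  proof (rule const)
    fix r
    have "((\<lambda>t. g (fst (maxwell_symbol t k w))) has_vector_derivative
        g (fst (\<i> *s ccross (cvec k) (snd (maxwell_symbol r k w)), - (\<i> *s ccross (cvec k) (fst (maxwell_symbol r k w)))))) (at r)"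
      by (intro bounded_linear.has_vector_derivative[OF bl] bounded_linear.has_vector_derivative[OF bounded_linear_fst] maxwell_symbol_deriv)
    then show "((\<lambda>t. g (fst (maxwell_symbol t k w))) has_vector_derivative 0) (at r)" by (simp only: fst_conv z)
  qed
  then show "(\<Sum>j\<in>UNIV. of_real (k $ j) * fst (maxwell_symbol t k w) $ j) = (\<Sum>j\<in>UNIV. of_real (k $ j) * fst w $ j)"
    by (simp add: g_def maxwell_symbol_0)
  have "g (snd (maxwell_symbol t k w)) = g (snd (maxwell_symbol 0 k w))"
  proof (rule const)
    fix r
    have "((\<lambda>t. g (snd (maxwell_symbol t k w))) has_vector_derivative
        g (snd (\<i> *s ccross (cvec k) (snd (maxwell_symbol r k w)), - (\<i> *s ccross (cvec k) (fst (maxwell_symbol r k w)))))) (at r)"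
      by (intro bounded_linear.has_vector_derivative[OF bl] bounded_linear.has_vector_derivative[OF bounded_linear_snd] maxwell_symbol_deriv)
    then show "((\<lambda>t. g (snd (maxwell_symbol t k w))) has_vector_derivative 0) (at r)" by (simp only: snd_conv z')
  qed
  then show "(\<Sum>j\<in>UNIV. of_real (k $ j) * snd (maxwell_symbol t k w) $ j) = (\<Sum>j\<in>UNIV. of_real (k $ j) * snd w $ j)"
    by (simp add: g_def maxwell_symbol_0)
qed

section \<open>Regularity of the flow in the frequency\<close>

lemma ccross_altdef: "ccross a b =
  (\<chi> i. if i = 1 then a$2 * b$3 - a$3 * b$2 else if i = 2 then a$3 * b$1 - a$1 * b$3 else a$1 * b$2 - a$2 * b$1)"
  by (simp add: ccross_def vec_eq_iff forall_3)

text \<open>The formula contains the direction of the frequency, so the origin is kept out here.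
  Measurability arguments treat it as a single exceptional point.\<close>

lemma continuous_on_maxwell_symbol:
  fixes f :: "'x::t2_space \<Rightarrow> real"
  assumes "continuous_on A f" "continuous_on A g" "continuous_on A w" "\<And>x. x \<in> A \<Longrightarrow> g x \<noteq> 0"
  shows "continuous_on A (\<lambda>x. maxwell_symbol (f x) (g x) (w x))"
proof -
  have n: "continuous_on A (\<lambda>x. g x /\<^sub>R norm (g x))"
    using assms by (intro continuous_intros) auto
  have ni: "continuous_on A (\<lambda>x. inverse (norm (g x)))"
    using assms by (intro continuous_intros) auto
  have co: "continuous_on A (\<lambda>x. cos (norm (g x) * f x))" and si: "continuous_on A (\<lambda>x. sin (norm (g x) * f x))"
  proof -
    have "continuous_on A (\<lambda>x. norm (g x) * f x)"
      by (intro continuous_on_mult continuous_on_norm assms(1,2))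
    then show "continuous_on A (\<lambda>x. cos (norm (g x) * f x))" "continuous_on A (\<lambda>x. sin (norm (g x) * f x))"
      by (auto intro: continuous_on_cos continuous_on_sin)
  qed
  have c: "continuous_on A (\<lambda>x. h x $ i)" if "continuous_on A h" for h :: "_ \<Rightarrow> complex ^ 3" and i
    using that by (intro continuous_intros)
  have v: "continuous_on A (\<lambda>x. cvec (n x))" if "continuous_on A n" for n
    unfolding cvec_def using that by (intro continuous_intros)
  have s: "continuous_on A (\<lambda>x. z x *s h x)" if "continuous_on A z" "continuous_on A h" for z and h :: "_ \<Rightarrow> complex ^ 3"
    unfolding vector_scalar_mult_def using that by (intro continuous_intros)
  have l: "continuous_on A (\<lambda>x. longitudinal (n x) (a x))" if "continuous_on A n" "continuous_on A a" for n a
    unfolding longitudinal_def using that by (intro s continuous_on_sum continuous_on_mult c v)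
  have k: "continuous_on A (\<lambda>x. if P then h x else h' x)" if "continuous_on A h" "continuous_on A h'" for P and h h' :: "_ \<Rightarrow> complex"
    using that by (cases P) auto
  have x: "continuous_on A (\<lambda>x. ccross (a x) (b x))" if "continuous_on A a" "continuous_on A b" for a b
    unfolding ccross_altdef using that by (intro continuous_on_vec_lambda k continuous_on_diff continuous_on_mult c)
  have e: "maxwell_symbol t q u = (longitudinal (q /\<^sub>R norm q) (fst u) + cos (norm q * t) *\<^sub>R (fst u - longitudinal (q /\<^sub>R norm q) (fst u))
        + sin (norm q * t) *\<^sub>R (\<i> *s ccross (cvec (q /\<^sub>R norm q)) (snd u)),
      longitudinal (q /\<^sub>R norm q) (snd u) + cos (norm q * t) *\<^sub>R (snd u - longitudinal (q /\<^sub>R norm q) (snd u))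
        - sin (norm q * t) *\<^sub>R (\<i> *s ccross (cvec (q /\<^sub>R norm q)) (fst u)))" for t q u
    by (simp add: maxwell_symbol_def Let_def case_prod_unfold)
  show ?thesis unfolding e
    by (intro continuous_on_Pair continuous_on_add continuous_on_diff continuous_on_scaleR l n s x v
        continuous_on_cos continuous_on_sin continuous_on_mult continuous_on_norm continuous_on_const
        continuous_on_fst continuous_on_snd assms(1-3) ni co si)
qed

lemma maxwell_symbol_at_0: "maxwell_symbol t 0 w = w"
  by (cases w) (simp add: maxwell_symbol_def Let_def longitudinal_def cvec_def vec_eq_iff)

lemma maxwell_symbol_borel_measurable:
  assumes w: "w \<in> borel_measurable borel"
  shows "(\<lambda>k. maxwell_symbol t k (w k)) \<in> borel_measurable borel"
proof -
  let ?A = "(- {0}) \<times> UNIV :: (R3 \<times> amplitude) set"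
  let ?F = "\<lambda>(k, u). maxwell_symbol t k u"
  have "?A \<in> sets borel" by (intro borel_open open_Times) auto
  moreover have "continuous_on ?A ?F"
    unfolding case_prod_unfold by (intro continuous_on_maxwell_symbol continuous_intros) auto
  ultimately have "(\<lambda>x. indicator ?A x *\<^sub>R ?F x) \<in> borel_measurable borel"
    by (rule borel_measurable_continuous_on_indicator)
  moreover have "(\<lambda>k. (k, w k)) \<in> borel \<rightarrow>\<^sub>M borel"
    using w by (intro borel_measurable_Pair) auto
  ultimately have "(\<lambda>k. indicator ?A (k, w k) *\<^sub>R ?F (k, w k)) \<in> borel_measurable borel"
    by (rule measurable_compose[rotated])
  then have "(\<lambda>k. if k = 0 then w 0 else indicator ?A (k, w k) *\<^sub>R ?F (k, w k)) \<in> borel_measurable borel"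
    by (intro measurable_If) auto
  moreover have "(\<lambda>k. if k = 0 then w 0 else indicator ?A (k, w k) *\<^sub>R ?F (k, w k)) = (\<lambda>k. maxwell_symbol t k (w k))"
    by (auto simp: maxwell_symbol_at_0 indicator_def fun_eq_iff)
  ultimately show ?thesis by simp
qed

lemma slowly_growing_maxwell:
  assumes "slowly_growing w" shows "slowly_growing (\<lambda>k. maxwell_symbol t k (w k))"
  by (rule slowly_growingI_dominated[OF maxwell_symbol_borel_measurable[OF slowly_growing_borel[OF assms]] assms assms, of _ 1 0])
    (simp add: norm_maxwell_symbol)

lemma weighted_L2_maxwell:
  assumes "weighted_L2 s w" shows "weighted_L2 s (\<lambda>k. maxwell_symbol t k (w k))"
  using assms maxwell_symbol_borel_measurable by (auto simp: weighted_L2_def norm_maxwell_symbol)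

text \<open>The group is defined through the representatives \<open>fhat\<close>. Acting at each
  frequency separately, the flow respects equality almost everywhere, so any symbol may be
  propagated instead.\<close>

lemma maxwell_group_symbol:
  assumes "has_symbol F w"
  shows "has_symbol (maxwell_group t F) (\<lambda>k. maxwell_symbol t k (w k))"
proof -
  have sw: "slowly_growing w" using assms by (simp add: has_symbol_def)
  have h: "has_fourier (fst F $ j) (\<lambda>k. fst (w k) $ j)" "has_fourier (snd F $ j) (\<lambda>k. snd (w k) $ j)" for j
    using assms by (auto simp: has_symbol_def)
  have ae: "AE k in lborel. symbol_of F k = w k" by (rule symbol_of_AE[OF assms])
  have [measurable]: "fhat (fst F $ j) \<in> borel_measurable borel" "fhat (snd F $ j) \<in> borel_measurable borel" for j
    using has_fourier_borel_measurable has_fourier_fhat h by blast+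
  have m [measurable]: "symbol_of F \<in> borel_measurable borel"
    unfolding symbol_of_def [abs_def] by (rule amplitude_borel_measurableI) simp_all
  have [measurable]: "w \<in> borel_measurable borel" using sw by (rule slowly_growing_borel)
  have "slowly_growing (symbol_of F)"
  proof -
    obtain N where N: "integrable lborel (\<lambda>k. norm (w k) / (1 + norm k) ^ N)" using sw unfolding slowly_growing_def by blast
    have "AE k in lborel. norm (w k) / (1 + norm k) ^ N = norm (symbol_of F k) / (1 + norm k) ^ N"
      using ae by eventually_elim simp
    then have "integrable lborel (\<lambda>k. norm (symbol_of F k) / (1 + norm k) ^ N)"
      by (rule integrable_cong_AE_imp[OF N, rotated]) measurable
    then show ?thesis using m unfolding slowly_growing_def by blast
  qed
  then have 1: "has_symbol (of_symbol (\<lambda>k. maxwell_symbol t k (symbol_of F k))) (\<lambda>k. maxwell_symbol t k (symbol_of F k))"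
    by (intro of_symbol_has_symbol slowly_growing_maxwell)
  have 2: "has_symbol (of_symbol (\<lambda>k. maxwell_symbol t k (w k))) (\<lambda>k. maxwell_symbol t k (w k))"
    by (intro of_symbol_has_symbol slowly_growing_maxwell sw)
  have "AE k in lborel. maxwell_symbol t k (symbol_of F k) = maxwell_symbol t k (w k)"
    using ae by eventually_elim simp
  from has_symbol_unique[OF 1 2 this]
  have "maxwell_group t F = of_symbol (\<lambda>k. maxwell_symbol t k (w k))"
    by (simp add: maxwell_group_def of_symbol_def symbol_of_def case_prod_unfold Let_def)
  then show ?thesis using 2 by simp
qed

section \<open>Oriented integrals\<close>

text \<open>At least one of the two intervals is empty or a point, so its integral is zero and the
  difference is the oriented integral.\<close>

definition oint :: "(real \<Rightarrow> 'a::banach) \<Rightarrow> real \<Rightarrow> real \<Rightarrow> 'a" where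
  "oint f a b = integral {a..b} f - integral {b..a} f"

lemma oint_le: "a \<le> b \<Longrightarrow> oint f a b = integral {a..b} f"
  by (cases "a = b") (auto simp: oint_def)

lemma oint_swap: "oint f b a = - oint f a b"
  by (simp add: oint_def)

lemma oint_FTC:
  assumes "\<And>t. (G has_vector_derivative f t) (at t)"
  shows "oint f a b = G b - G a"
proof -
  have *: "oint f a b = G b - G a" if "a \<le> b" for a b
    using fundamental_theorem_of_calculus[OF that, of G f] assms that
    by (simp add: oint_le has_vector_derivative_at_within integral_unique)
  show ?thesis
  proof (cases "a \<le> b")
    case False
    then have "- oint f b a = - (G a - G b)" using *[of b a] by simp
    then show ?thesis unfolding oint_swap[of f b a] by simp
  qed (rule *)
qed

lemma oint_has_vector_derivative:
  assumes "continuous_on UNIV f"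
  shows "((\<lambda>t. oint f a t) has_vector_derivative f t) (at t)"
proof -
  \<comment> \<open>An interval with \<open>a\<close> inside and \<open>t\<close> in its interior:
    the derivative within the interval is then a two-sided one, and \<open>t\<close> may lie on
    either side of \<open>a\<close>.\<close>
  define c where "c = min a t - 1"
  define d where "d = max a t + 1"
  have i: "f integrable_on {x..y}" for x y
    using assms by (intro integrable_continuous_real) (rule continuous_on_subset, auto)
  have "((\<lambda>u. integral {c..u} f) has_vector_derivative f t) (at t within {c..d})"
    using assms by (intro integral_has_vector_derivative) (auto simp: c_def d_def intro: continuous_on_subset)
  then have "((\<lambda>u. integral {c..u} f) has_vector_derivative f t) (at t)"
    by (subst (asm) at_within_interior) (auto simp: c_def d_def)
  then have "((\<lambda>u. integral {c..u} f - integral {c..a} f) has_vector_derivative f t) (at t)"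
    using has_vector_derivative_diff[OF _ has_vector_derivative_const] by fastforce
  then show ?thesis
  proof (rule has_vector_derivative_transform_within_open[of _ _ _ "{c<..<d}"])
    fix u assume u: "u \<in> {c<..<d}"
    have "c \<le> a" "c \<le> u" using u by (auto simp: c_def)
    show "integral {c..u} f - integral {c..a} f = oint f a u"
    proof (cases "a \<le> u")
      case True
      then show ?thesis using Henstock_Kurzweil_Integration.integral_combine[OF \<open>c \<le> a\<close> True i] by (simp add: oint_le algebra_simps)
    next
      case False
      then show ?thesis using Henstock_Kurzweil_Integration.integral_combine[OF \<open>c \<le> u\<close> _ i, of a] oint_swap[of f a u]
        by (simp add: oint_le algebra_simps)
    qed
  qed (auto simp: c_def d_def)
qed

lemma oint_split:
  assumes "continuous_on UNIV f"
  shows "oint f a c = oint f a b + oint f b c"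
  using oint_FTC[OF oint_has_vector_derivative[OF assms, of a], of b c] by simp

lemma oint_bounded_linear:
  assumes "bounded_linear h" "continuous_on UNIV f"
  shows "oint (\<lambda>t. h (f t)) a b = h (oint f a b)"
proof -
  have i: "f integrable_on {x..y}" for x y
    using assms(2) by (intro integrable_continuous_real) (rule continuous_on_subset, auto)
  interpret h: bounded_linear h by (rule assms(1))
  show ?thesis
    using integral_linear[OF i assms(1)] by (simp add: oint_def o_def h.diff)
qed

lemma oint_diff:
  assumes "continuous_on UNIV f" "continuous_on UNIV g"
  shows "oint (\<lambda>t. f t - g t) a b = oint f a b - oint g a b"
proof -
  have i: "f integrable_on {x..y}" "g integrable_on {x..y}" for x y
    using assms by (auto intro!: integrable_continuous_real intro: continuous_on_subset)
  show ?thesis by (simp add: oint_def Henstock_Kurzweil_Integration.integral_diff i)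
qed

lemma norm_oint_le:
  assumes "continuous_on UNIV f" "\<And>\<tau>. \<tau> \<in> closed_segment a b \<Longrightarrow> norm (f \<tau>) \<le> B"
  shows "norm (oint f a b) \<le> B * \<bar>b - a\<bar>"
proof -
  have *: "norm (oint f a b) \<le> B * (b - a)" if "a \<le> b" "\<And>\<tau>. \<tau> \<in> {a..b} \<Longrightarrow> norm (f \<tau>) \<le> B" for a b
    using that assms(1) by (simp add: oint_le) (intro integral_bound, auto intro: continuous_on_subset)
  show ?thesis
  proof (cases "a \<le> b")
    case True then show ?thesis using *[of a b] assms(2) by (simp add: closed_segment_eq_real_ivl)
  next
    case False then show ?thesis using *[of b a] assms(2) oint_swap[of f a b] by (simp add: closed_segment_eq_real_ivl)
  qed
qed

text \<open>An error bound that depends on \<open>f\<close> only through its oscillation on the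
  pieces. One partition can therefore serve all frequencies at once.\<close>

lemma riemann_sum_error:
  fixes f :: "real \<Rightarrow> 'a::banach"
  assumes f: "continuous_on {a..b} f" and ab: "a \<le> b" and p: "p tagged_division_of cbox a b"
    and B: "\<And>x K y. (x, K) \<in> p \<Longrightarrow> y \<in> K \<Longrightarrow> norm (f x - f y) \<le> B"
  shows "norm ((\<Sum>(x, K)\<in>p. measure lborel K *\<^sub>R f x) - integral {a..b} f) \<le> B * (b - a)"
proof -
  have fi: "f integrable_on cbox a b" using f by (simp add: integrable_continuous_real cbox_interval)
  have I: "integral {a..b} f = (\<Sum>(x, K)\<in>p. integral K f)"
    using integral_combine_tagged_division_topdown[OF fi p] by (simp add: cbox_interval)
  have "norm (measure lborel K *\<^sub>R f x - integral K f) \<le> B * measure lborel K" if xK: "(x, K) \<in> p" for x K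
  proof -
    obtain c d where K: "K = cbox c d" using p xK by blast
    have sub: "K \<subseteq> cbox a b" and x: "x \<in> K" using tagged_division_ofD(2,3)[OF p xK] by auto
    have fK: "f integrable_on K" using integrable_on_subcbox[OF fi] sub unfolding K by auto
    have ck: "((\<lambda>y. f x) has_integral measure lborel K *\<^sub>R f x) K"
      unfolding K using has_integral_const[of "f x" c d] by simp
    have "((\<lambda>y. f x - f y) has_integral (measure lborel K *\<^sub>R f x - integral K f)) (cbox c d)"
      using has_integral_diff[OF ck integrable_integral[OF fK]] unfolding K .
    moreover have "0 \<le> B" using order_trans[OF norm_ge_zero B[OF xK x]] .
    ultimately show ?thesis using B[OF xK] unfolding K by (intro has_integral_bound) auto
  qed
  then have "norm (\<Sum>(x, K)\<in>p. (measure lborel K *\<^sub>R f x - integral K f)) \<le> (\<Sum>(x, K)\<in>p. B * measure lborel K)"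
    by (intro sum_norm_le) auto
  also have "\<dots> = B * (b - a)"
    using additive_content_tagged_division[OF p] ab by (simp add: case_prod_unfold flip: sum_distrib_left)
  finally show ?thesis unfolding I by (simp add: case_prod_unfold sum_subtractf)
qed

text \<open>In \<open>cont\<close> the same \<open>\<delta>\<close> works for every frequency, up to
  the weight \<open>m k\<close>. A single gauge then controls all Riemann sums simultaneously, and
  the pointwise error \<open>\<epsilon> * (b' - a') * norm (m k)\<close> is integrated against the
  Sobolev weight.\<close>

lemma has_oriented_integral_field:
  assumes F: "\<And>\<tau>. has_symbol (F \<tau>) (f \<tau>)" and I: "has_symbol I (\<lambda>k. oint (\<lambda>\<tau>. f \<tau> k) a b)"
    and m: "weighted_L2 s (m :: R3 \<Rightarrow> real)"
    and cont: "\<And>\<epsilon>. 0 < \<epsilon> \<Longrightarrow> \<exists>\<delta>>0. \<forall>x\<in>{min a b..max a b}. \<forall>y\<in>{min a b..max a b}.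
        \<bar>x - y\<bar> < \<delta> \<longrightarrow> (\<forall>k. norm (f x k - f y k) \<le> \<epsilon> * norm (m k))"
  shows "has_oriented_integral (field_norm s) F a b I"
proof -
  define a' where "a' = min a b"
  define b' where "b' = max a b"
  have ab: "a' \<le> b'" by (simp add: a'_def b'_def)
  have fc: "continuous_on {a'..b'} (\<lambda>\<tau>. f \<tau> k)" for k
  proof (rule continuous_onI)
    fix x e :: real assume x: "x \<in> {a'..b'}" and e: "0 < e"
    have "0 < e / (norm (m k) + 1) / 2" using e by (simp add: add_nonneg_pos)
    from cont[OF this] obtain \<delta> where \<delta>: "0 < \<delta>" "\<And>y. y \<in> {a'..b'} \<Longrightarrow> \<bar>y - x\<bar> < \<delta> \<Longrightarrow> norm (f y k - f x k) \<le> e / (norm (m k) + 1) / 2 * norm (m k)"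
      using x unfolding a'_def b'_def by blast
    have "e / (norm (m k) + 1) / 2 * norm (m k) \<le> e"
      using e by (simp add: divide_simps add_nonneg_pos)
    then show "\<exists>d>0. \<forall>x'\<in>{a'..b'}. dist x' x < d \<longrightarrow> dist (f x' k) (f x k) \<le> e"
      using \<delta>(1) order_trans[OF \<delta>(2)] unfolding dist_norm real_norm_def by (intro exI[of _ \<delta>]) blast
  qed
  have I': "has_symbol (if a \<le> b then I else - I) (\<lambda>k. integral {a'..b'} (\<lambda>\<tau>. f \<tau> k))"
  proof (cases "a \<le> b")
    case True then show ?thesis using I by (simp add: a'_def b'_def oint_le)
  next
    case False
    then have "(\<lambda>k. integral {a'..b'} (\<lambda>\<tau>. f \<tau> k)) = (\<lambda>k. - oint (\<lambda>\<tau>. f \<tau> k) a b)"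
      by (simp add: a'_def b'_def oint_def)
    then show ?thesis using has_symbol_uminus[OF I] False by simp
  qed
  have "\<forall>\<^sub>F p in division_filter (cbox a' b'). norm (field_norm s ((\<Sum>(x, K)\<in>p. measure lborel K *\<^sub>R F x) - (if a \<le> b then I else - I))) < \<eta>"
    if \<eta>: "0 < \<eta>" for \<eta>
  proof -
    \<comment> \<open>The 2 under the root is the constant of \<open>weighted_L2_dominated\<close>.
      The summands 1 in \<open>\<epsilon>\<close> avoid a zero denominator and make the final
      inequality strict.\<close>
    define M where "M = sqrt (2 * weighted_L2_sq s m)"
    define \<epsilon> where "\<epsilon> = \<eta> / ((b' - a' + 1) * (M + 1))"
    have M: "0 \<le> M" by (simp add: M_def weighted_L2_sq_nonneg)
    have \<epsilon>: "0 < \<epsilon>" using \<eta> M ab by (simp add: \<epsilon>_def)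
    from cont[OF \<epsilon>] obtain \<delta> where \<delta>: "0 < \<delta>" "\<And>x y k. x \<in> {a'..b'} \<Longrightarrow> y \<in> {a'..b'} \<Longrightarrow> \<bar>x - y\<bar> < \<delta> \<Longrightarrow> norm (f x k - f y k) \<le> \<epsilon> * norm (m k)"
      unfolding a'_def b'_def by blast
    have "norm (field_norm s ((\<Sum>(x, K)\<in>p. measure lborel K *\<^sub>R F x) - (if a \<le> b then I else - I))) < \<eta>"
      if p: "p tagged_division_of cbox a' b'" "(\<lambda>x. ball x \<delta>) fine p" for p
    proof -
      let ?w = "\<lambda>k. (\<Sum>(x, K)\<in>p. measure lborel K *\<^sub>R f x k) - integral {a'..b'} (\<lambda>\<tau>. f \<tau> k)"
      have hs: "has_symbol ((\<Sum>(x, K)\<in>p. measure lborel K *\<^sub>R F x) - (if a \<le> b then I else - I)) ?w"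
        unfolding case_prod_unfold by (intro has_symbol_diff has_symbol_sum has_symbol_scaleR F I')
      have wk: "norm (?w k) \<le> (\<epsilon> * (b' - a')) * norm (m k) + 0 * norm (m k)" for k
      proof -
        have "norm (?w k) \<le> (\<epsilon> * norm (m k)) * (b' - a')"
        proof (rule riemann_sum_error[OF fc ab p(1)])
          fix x K y assume xK: "(x, K) \<in> p" and y: "y \<in> K"
          have "K \<subseteq> ball x \<delta>" using p(2) xK by (auto simp: fine_def)
          then have "\<bar>x - y\<bar> < \<delta>" using y by (auto simp: dist_real_def)
          moreover have "x \<in> {a'..b'}" "y \<in> {a'..b'}"
            using tagged_division_ofD(2,3)[OF p(1) xK] y by (auto simp: cbox_interval)
          ultimately show "norm (f x k - f y k) \<le> \<epsilon> * norm (m k)" by (intro \<delta>(2))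
        qed
        then show ?thesis by (simp add: mult_ac)
      qed
      have wm: "?w \<in> borel_measurable borel"
        by (rule slowly_growing_borel[OF conjunct1[OF hs[unfolded has_symbol_def]]])
      have "(field_norm s ((\<Sum>(x, K)\<in>p. measure lborel K *\<^sub>R F x) - (if a \<le> b then I else - I)))\<^sup>2 = weighted_L2_sq s ?w"
        by (rule field_norm_sq[OF hs weighted_L2_dominated(1)[OF wm m m wk]])
      also have "\<dots> \<le> 2 * (\<epsilon> * (b' - a'))\<^sup>2 * weighted_L2_sq s m"
        using weighted_L2_dominated(2)[OF wm m m wk] by simp
      also have "\<dots> = (\<epsilon> * (b' - a') * M)\<^sup>2"
        by (simp add: M_def power_mult_distrib weighted_L2_sq_nonneg)
      finally have "field_norm s ((\<Sum>(x, K)\<in>p. measure lborel K *\<^sub>R F x) - (if a \<le> b then I else - I)) \<le> \<epsilon> * (b' - a') * M"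
        by (rule power2_le_imp_le) (use \<epsilon> ab M in auto)
      also have "\<dots> < \<epsilon> * ((b' - a' + 1) * (M + 1))"
        using \<epsilon> M ab unfolding mult.assoc by (intro mult_strict_left_mono) (auto simp: algebra_simps add_nonneg_pos mult_nonneg_nonneg intro!: add_strict_increasing)
      also have "\<dots> = \<eta>" using M ab by (simp add: \<epsilon>_def)
      finally show ?thesis by (simp add: field_norm_nonneg)
    qed
    then show ?thesis unfolding eventually_division_filter
      by (intro exI[of _ "\<lambda>x. ball x \<delta>"]) (use \<delta>(1) in \<open>auto simp: gauge_def\<close>)
  qed
  then show ?thesis
    unfolding has_oriented_integral_def a'_def[symmetric] b'_def[symmetric] tendsto_iff by simp
qed

lemma field_norm_triangle:
  assumes "has_symbol F w" "weighted_L2 s w" "has_symbol G u" "weighted_L2 s u"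
  shows "(field_norm s (F - G))\<^sup>2 \<le> 2 * (field_norm s F)\<^sup>2 + 2 * (field_norm s G)\<^sup>2"
proof -
  have le: "norm (w k - u k) \<le> 1 * norm (w k) + 1 * norm (u k)" for k
    using norm_triangle_ineq4[of "w k" "u k"] by simp
  have m: "(\<lambda>k. w k - u k) \<in> borel_measurable borel"
    using assms by (auto simp: weighted_L2_def)
  show ?thesis
    unfolding field_norm_sq[OF assms(1,2)] field_norm_sq[OF assms(3,4)]
      field_norm_sq[OF has_symbol_diff[OF assms(1,3)] weighted_L2_dominated(1)[OF m assms(2,4) le]]
    using weighted_L2_dominated(2)[OF m assms(2,4) le] by simp
qed

lemma weighted_L2_diff: "weighted_L2 s w \<Longrightarrow> weighted_L2 s u \<Longrightarrow> weighted_L2 s (\<lambda>k. w k - u k)" for w u :: "R3 \<Rightarrow> amplitude"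
  by (rule weighted_L2_dominated(1)[of _ s w u 1 1]) (auto simp: weighted_L2_def norm_triangle_ineq4)

lemma weighted_L2_scaleR: "weighted_L2 s w \<Longrightarrow> weighted_L2 s (\<lambda>k. r *\<^sub>R w k)" for w :: "R3 \<Rightarrow> amplitude"
  by (rule weighted_L2_dominated(1)[of _ s w w "\<bar>r\<bar>" 0]) (auto simp: weighted_L2_def)

lemma weighted_L2_add: "weighted_L2 s w \<Longrightarrow> weighted_L2 s u \<Longrightarrow> weighted_L2 s (\<lambda>k. w k + u k)" for w u :: "R3 \<Rightarrow> amplitude"
  by (rule weighted_L2_dominated(1)[of _ s w u 1 1]) (auto simp: weighted_L2_def norm_triangle_ineq)

lemma weighted_L2_sum: "(\<And>i. i \<in> A \<Longrightarrow> weighted_L2 s (w i)) \<Longrightarrow> weighted_L2 s (\<lambda>k. \<Sum>i\<in>A. w i k)" for w :: "_ \<Rightarrow> R3 \<Rightarrow> amplitude"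
proof (induction A rule: infinite_finite_induct)
  case (insert x A)
  then have "weighted_L2 s (\<lambda>k. w x k + (\<Sum>i\<in>A. w i k))" by (intro weighted_L2_add) auto
  then show ?case using insert(1,2) by simp
qed (auto simp: weighted_L2_def)

text \<open>Both candidates are limits of the same Riemann sums along a nontrivial filter, so their
  difference has norm zero. The Sobolev weight vanishes only on a null set, hence the symbols agree
  almost everywhere and the fields are equal.\<close>

lemma has_oriented_integral_field_unique:
  assumes F: "\<And>\<tau>. has_symbol (F \<tau>) (f \<tau>)" "\<And>\<tau>. weighted_L2 s (f \<tau>)"
    and I: "has_symbol I w" "weighted_L2 s w" and J: "has_symbol J u" "weighted_L2 s u"
    and int: "has_oriented_integral (field_norm s) F a b I" "has_oriented_integral (field_norm s) F a b J"
  shows "I = J"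
proof -
  let ?D = "division_filter (cbox (min a b) (max a b))"
  let ?S = "\<lambda>p. \<Sum>(x, K)\<in>p. measure lborel K *\<^sub>R F x"
  let ?g = "\<lambda>p k. \<Sum>(x, K)\<in>p. measure lborel K *\<^sub>R f x k"
  define I' where "I' = (if a \<le> b then I else - I)"
  define J' where "J' = (if a \<le> b then J else - J)"
  define w' where "w' = (\<lambda>k. if a \<le> b then w k else - w k)"
  define u' where "u' = (\<lambda>k. if a \<le> b then u k else - u k)"
  have I': "has_symbol I' w'" "weighted_L2 s w'"
    using I has_symbol_uminus[OF I(1)] weighted_L2_scaleR[OF I(2), of "-1"] unfolding I'_def w'_def by (cases "a \<le> b"; simp)+
  have J': "has_symbol J' u'" "weighted_L2 s u'"
    using J has_symbol_uminus[OF J(1)] weighted_L2_scaleR[OF J(2), of "-1"] unfolding J'_def u'_def by (cases "a \<le> b"; simp)+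
  have S: "has_symbol (?S p) (?g p)" "weighted_L2 s (?g p)" for p
    unfolding case_prod_unfold by (intro has_symbol_sum has_symbol_scaleR F weighted_L2_sum weighted_L2_scaleR)+
  have "((\<lambda>p. 2 * (field_norm s (?S p - J'))\<^sup>2 + 2 * (field_norm s (?S p - I'))\<^sup>2) \<longlongrightarrow> 2 * 0\<^sup>2 + 2 * 0\<^sup>2) ?D"
    using int unfolding has_oriented_integral_def I'_def[symmetric] J'_def[symmetric] by (intro tendsto_intros)
  moreover have "(field_norm s (I' - J'))\<^sup>2 \<le> 2 * (field_norm s (?S p - J'))\<^sup>2 + 2 * (field_norm s (?S p - I'))\<^sup>2" for p
    using field_norm_triangle[OF has_symbol_diff[OF S(1) J'(1)] weighted_L2_diff[OF S(2) J'(2)]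
        has_symbol_diff[OF S(1) I'(1)] weighted_L2_diff[OF S(2) I'(2)], of p p] by simp
  ultimately have "(field_norm s (I' - J'))\<^sup>2 \<le> 2 * 0\<^sup>2 + 2 * 0\<^sup>2"
    by (rule tendsto_lowerbound[OF _ always_eventually[OF allI] division_filter_not_empty])
  then have "(field_norm s (I' - J'))\<^sup>2 \<le> 0" by simp
  then have "weighted_L2_sq s (\<lambda>k. w' k - u' k) = 0"
    using field_norm_sq[OF has_symbol_diff[OF I'(1) J'(1)] weighted_L2_diff[OF I'(2) J'(2)]] weighted_L2_sq_nonneg[of s "\<lambda>k. w' k - u' k"] by simp
  then have "AE k in lborel. w' k - u' k = 0" by (rule weighted_L2_sq_zero_AE[OF weighted_L2_diff[OF I'(2) J'(2)]])
  then have "AE k in lborel. w k = u k" by eventually_elim (auto simp: w'_def u'_def split: if_splits)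
  then show ?thesis by (rule has_symbol_unique[OF I(1) J(1)])
qed

section \<open>Volterra equations\<close>

text \<open>Each integration gains one power and the factor \<open>1 / (n + 1)\<close>; repeated,
  this produces the factorial in the iteration below.\<close>

lemma norm_oint_power_le:
  assumes h: "continuous_on UNIV h" and b: "\<And>\<tau>. \<tau> \<in> closed_segment a t \<Longrightarrow> norm (h \<tau>) \<le> c * \<bar>\<tau> - a\<bar> ^ n"
  shows "norm (oint h a t) \<le> c * \<bar>t - a\<bar> ^ Suc n / real (Suc n)"
proof -
  have hi: "h integrable_on {x..y}" for x y
    using h by (intro integrable_continuous_real) (rule continuous_on_subset, auto)
  show ?thesis
  proof (cases "a \<le> t")
    case True
    define G where "G \<tau> = c * (\<tau> - a) ^ Suc n / real (Suc n)" for \<tau>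
    have "((\<lambda>\<tau>. c * (\<tau> - a) ^ n) has_integral (G t - G a)) {a..t}"
      using True unfolding G_def
      by (intro fundamental_theorem_of_calculus)
        (auto intro!: derivative_eq_intros simp: has_real_derivative_iff_has_vector_derivative[symmetric] simp del: power_Suc)
    moreover have "norm (h \<tau>) \<le> c * (\<tau> - a) ^ n" if "\<tau> \<in> {a..t}" for \<tau>
      using b[of \<tau>] that by (simp add: closed_segment_eq_real_ivl)
    ultimately have "norm (integral {a..t} h) \<le> G t - G a"
      using integral_norm_bound_integral[OF hi, of "\<lambda>\<tau>. c * (\<tau> - a) ^ n" a t]
      by (metis (no_types, lifting) has_integral_integrable_integral)
    then show ?thesis using True by (simp add: oint_le G_def)
  next
    case False
    define G where "G \<tau> = - c * (a - \<tau>) ^ Suc n / real (Suc n)" for \<tau>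
    have "((\<lambda>\<tau>. c * (a - \<tau>) ^ n) has_integral (G a - G t)) {t..a}"
      using False unfolding G_def
      by (intro fundamental_theorem_of_calculus)
        (auto intro!: derivative_eq_intros simp: has_real_derivative_iff_has_vector_derivative[symmetric] simp del: power_Suc)
    moreover have "norm (h \<tau>) \<le> c * (a - \<tau>) ^ n" if "\<tau> \<in> {t..a}" for \<tau>
      using b[of \<tau>] that False by (simp add: closed_segment_eq_real_ivl)
    ultimately have "norm (integral {t..a} h) \<le> G a - G t"
      using integral_norm_bound_integral[OF hi, of "\<lambda>\<tau>. c * (a - \<tau>) ^ n" t a]
      by (metis (no_types, lifting) has_integral_integrable_integral)
    then show ?thesis using False oint_swap[of h a t] by (simp add: oint_le G_def)
  qed
qed

lemma closed_segment_real_abs_le: "\<sigma> \<in> closed_segment a t \<Longrightarrow> \<bar>\<sigma> - a\<bar> \<le> \<bar>t - a\<bar>" for \<sigma> :: real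
  by (auto simp: closed_segment_eq_real_ivl split: if_splits)

text \<open>The Lipschitz condition \<open>lip\<close> is causal: the value at \<open>t\<close>
  depends only on the curves between \<open>t0\<close> and \<open>t\<close>. The bound for
  \<open>u\<close> and \<open>w\<close> may therefore be taken at the end of that segment before
  integrating.\<close>

lemma volterra_step:
  fixes u w f g :: "real \<Rightarrow> 'a::banach"
  assumes f: "continuous_on UNIV f" and g: "continuous_on UNIV g" and K: "0 \<le> K" and M: "0 \<le> M"
    and lip: "\<And>t c. \<bar>t - t0\<bar> \<le> T \<Longrightarrow> (\<And>\<sigma>. \<sigma> \<in> closed_segment t0 t \<Longrightarrow> norm (u \<sigma> - w \<sigma>) \<le> c) \<Longrightarrow> norm (f t - g t) \<le> K * c"
    and b: "\<And>t. \<bar>t - t0\<bar> \<le> T \<Longrightarrow> norm (u t - w t) \<le> M * (K * \<bar>t - t0\<bar>) ^ n / fact n"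
    and t: "\<bar>t - t0\<bar> \<le> T"
  shows "norm (oint f t0 t - oint g t0 t) \<le> M * (K * \<bar>t - t0\<bar>) ^ Suc n / fact (Suc n)"
proof -
  have "norm (oint (\<lambda>\<tau>. f \<tau> - g \<tau>) t0 t) \<le> (K * M * K ^ n / fact n) * \<bar>t - t0\<bar> ^ Suc n / real (Suc n)"
  proof (rule norm_oint_power_le)
    show "continuous_on UNIV (\<lambda>\<tau>. f \<tau> - g \<tau>)" using f g by (rule continuous_on_diff)
    fix \<tau> assume "\<tau> \<in> closed_segment t0 t"
    then have \<tau>: "\<bar>\<tau> - t0\<bar> \<le> T" using closed_segment_real_abs_le t by fastforce
    have "norm (f \<tau> - g \<tau>) \<le> K * (M * (K * \<bar>\<tau> - t0\<bar>) ^ n / fact n)"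
    proof (rule lip[OF \<tau>])
      fix \<sigma> assume "\<sigma> \<in> closed_segment t0 \<tau>"
      then have \<sigma>: "\<bar>\<sigma> - t0\<bar> \<le> \<bar>\<tau> - t0\<bar>" by (rule closed_segment_real_abs_le)
      then have "norm (u \<sigma> - w \<sigma>) \<le> M * (K * \<bar>\<sigma> - t0\<bar>) ^ n / fact n" using \<tau> by (intro b) simp
      also have "\<dots> \<le> M * (K * \<bar>\<tau> - t0\<bar>) ^ n / fact n"
        using \<sigma> K M by (intro divide_right_mono mult_left_mono power_mono) auto
      finally show "norm (u \<sigma> - w \<sigma>) \<le> M * (K * \<bar>\<tau> - t0\<bar>) ^ n / fact n" .
    qed
    then show "norm (f \<tau> - g \<tau>) \<le> (K * M * K ^ n / fact n) * \<bar>\<tau> - t0\<bar> ^ n"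
      by (simp add: power_mult_distrib mult_ac)
  qed
  also have "\<dots> = M * (K * \<bar>t - t0\<bar>) ^ Suc n / fact (Suc n)"
    by (simp add: power_mult_distrib mult_ac)
  finally show ?thesis by (simp only: oint_diff[OF f g])
qed

lemma continuous_bounded_interval:
  fixes u :: "real \<Rightarrow> 'a::real_normed_vector"
  assumes "continuous_on UNIV u"
  obtains M where "0 \<le> M" "\<And>t. \<bar>t - t0\<bar> \<le> T \<Longrightarrow> norm (u t) \<le> M"
proof -
  have "bounded (u ` cball t0 T)"
    using assms by (intro compact_imp_bounded compact_continuous_image) (auto intro: continuous_on_subset)
  then obtain M where M: "\<And>x. x \<in> u ` cball t0 T \<Longrightarrow> norm x \<le> M" unfolding bounded_iff by blast
  have "norm (u t) \<le> max 0 M" if "\<bar>t - t0\<bar> \<le> T" for t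
    using M[of "u t"] that by (auto simp: dist_real_def abs_minus_commute)
  then show thesis by (intro that[of "max 0 M"]) auto
qed

text \<open>The difference is below every term of an exponential series, hence zero.
  \<open>K\<close> may depend on the two given curves, so a locally Lipschitz right-hand side is
  covered.\<close>

lemma volterra_unique:
  fixes u w f g :: "real \<Rightarrow> 'a::banach"
  assumes u: "continuous_on UNIV u" and w: "continuous_on UNIV w"
    and f: "continuous_on UNIV f" and g: "continuous_on UNIV g"
    and lip: "\<And>T. 0 \<le> T \<Longrightarrow> \<exists>K\<ge>0. \<forall>t c. \<bar>t - t0\<bar> \<le> T \<longrightarrow> (\<forall>\<sigma>\<in>closed_segment t0 t. norm (u \<sigma> - w \<sigma>) \<le> c) \<longrightarrow> norm (f t - g t) \<le> K * c"
    and eq: "\<And>t. u t = v0 + oint f t0 t" "\<And>t. w t = v0 + oint g t0 t"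
  shows "u = w"
proof
  fix t
  define T where "T = \<bar>t - t0\<bar>"
  obtain K where K: "0 \<le> K" "\<And>t c. \<bar>t - t0\<bar> \<le> T \<Longrightarrow> (\<And>\<sigma>. \<sigma> \<in> closed_segment t0 t \<Longrightarrow> norm (u \<sigma> - w \<sigma>) \<le> c) \<Longrightarrow> norm (f t - g t) \<le> K * c"
    using lip[of T] unfolding T_def by auto
  obtain M where M: "0 \<le> M" "\<And>t. \<bar>t - t0\<bar> \<le> T \<Longrightarrow> norm (u t - w t) \<le> M"
    using continuous_bounded_interval[OF continuous_on_diff[OF u w], of t0 T] by blast
  have *: "\<bar>r - t0\<bar> \<le> T \<Longrightarrow> norm (u r - w r) \<le> M * (K * \<bar>r - t0\<bar>) ^ n / fact n" for r n
  proof (induction n arbitrary: r)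
    case (Suc n)
    then show ?case using volterra_step[OF f g K(1) M(1) K(2) Suc.IH] eq by simp
  qed (use M in simp)
  have "(\<lambda>n. M * ((K * \<bar>t - t0\<bar>) ^ n / fact n)) \<longlonglongrightarrow> M * 0"
    using summable_exp[of "K * \<bar>t - t0\<bar>"] by (intro tendsto_mult tendsto_const summable_LIMSEQ_zero) (simp add: divide_inverse mult.commute)
  then have "norm (u t - w t) \<le> M * 0"
    by (rule LIMSEQ_le_const) (use *[of t] in \<open>auto simp: T_def\<close>)
  then show "u t = w t" by simp
qed

text \<open>Picard iteration on an arbitrary time interval: the factorial beats any constant
  \<open>K\<close>, so no smallness of time and no continuation argument enter.\<close>

lemma volterra_exists:
  fixes G :: "(real \<Rightarrow> 'a::banach) \<Rightarrow> real \<Rightarrow> 'a"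
  assumes cont: "\<And>v. continuous_on UNIV v \<Longrightarrow> continuous_on UNIV (G v)"
    and lip: "\<And>T. 0 \<le> T \<Longrightarrow> \<exists>K\<ge>0. \<forall>v w t c. continuous_on UNIV v \<longrightarrow> continuous_on UNIV w \<longrightarrow> \<bar>t - t0\<bar> \<le> T \<longrightarrow>
      (\<forall>\<sigma>\<in>closed_segment t0 t. norm (v \<sigma> - w \<sigma>) \<le> c) \<longrightarrow> norm (G v t - G w t) \<le> K * c"
  shows "\<exists>v. continuous_on UNIV v \<and> (\<forall>t. v t = v0 + oint (G v) t0 t)"
proof -
  define V where "V = rec_nat (\<lambda>_. v0) (\<lambda>_ u t. v0 + oint (G u) t0 t)"
  have V0: "V 0 = (\<lambda>_. v0)" and VS: "V (Suc n) = (\<lambda>t. v0 + oint (G (V n)) t0 t)" for n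
    by (simp_all add: V_def)
  have step_cont: "continuous_on UNIV (\<lambda>t. v0 + oint f t0 t)" if "continuous_on UNIV f" for f
    using oint_has_vector_derivative[OF that, of t0]
    by (intro continuous_intros continuous_at_imp_continuous_on) (auto intro: has_vector_derivative_continuous)
  have Vc: "continuous_on UNIV (V n)" for n
    by (induction n) (auto simp: V0 VS intro: step_cont cont)
  have GVc: "continuous_on UNIV (G (V n))" for n by (rule cont[OF Vc])
  \<comment> \<open>The limit is written as a telescoping series so that the Weierstrass test gives
    uniform convergence on each ball around \<open>t0\<close>.\<close>
  define v where "v t = v0 + (\<Sum>n. V (Suc n) t - V n t)" for t
  have tele: "V n t = v0 + (\<Sum>i<n. V (Suc i) t - V i t)" for n t
    using sum_lessThan_telescope[of "\<lambda>i. V i t" n] by (simp add: V0)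
  have ul: "uniform_limit (cball t0 T) V v sequentially" if T: "0 \<le> T" for T
  proof -
    obtain K where K: "0 \<le> K" "\<And>v w t c. continuous_on UNIV v \<Longrightarrow> continuous_on UNIV w \<Longrightarrow> \<bar>t - t0\<bar> \<le> T \<Longrightarrow>
      (\<And>\<sigma>. \<sigma> \<in> closed_segment t0 t \<Longrightarrow> norm (v \<sigma> - w \<sigma>) \<le> c) \<Longrightarrow> norm (G v t - G w t) \<le> K * c"
      using lip[OF T] by auto
    obtain M where M: "0 \<le> M" "\<And>t. \<bar>t - t0\<bar> \<le> T \<Longrightarrow> norm (V (Suc 0) t - V 0 t) \<le> M"
      using continuous_bounded_interval[OF continuous_on_diff[OF Vc Vc], of t0 T] by blast
    have *: "\<bar>r - t0\<bar> \<le> T \<Longrightarrow> norm (V (Suc n) r - V n r) \<le> M * (K * \<bar>r - t0\<bar>) ^ n / fact n" for r n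
    proof (induction n arbitrary: r)
      case (Suc n)
      have e: "V (Suc (Suc n)) r - V (Suc n) r = oint (G (V (Suc n))) t0 r - oint (G (V n)) t0 r"
        using fun_cong[OF VS[of "Suc n"], of r] fun_cong[OF VS[of n], of r] by (simp only: add_diff_cancel_left)
      show ?case unfolding e
        by (rule volterra_step[OF GVc GVc K(1) M(1) K(2)[OF Vc Vc] Suc.IH Suc.prems])
    qed (use M in simp)
    have "uniform_limit (cball t0 T) (\<lambda>n t. \<Sum>i<n. V (Suc i) t - V i t) (\<lambda>t. \<Sum>i. V (Suc i) t - V i t) sequentially"
    proof (rule Weierstrass_m_test)
      show "summable (\<lambda>n. M * ((K * T) ^ n / fact n))"
        using summable_exp[of "K * T"] by (intro summable_mult) (simp add: divide_inverse mult.commute)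
      fix n t assume "t \<in> cball t0 T"
      then have t: "\<bar>t - t0\<bar> \<le> T" by (simp add: dist_real_def abs_minus_commute)
      have "norm (V (Suc n) t - V n t) \<le> M * (K * \<bar>t - t0\<bar>) ^ n / fact n" by (rule *[OF t])
      also have "\<dots> \<le> M * (K * T) ^ n / fact n"
        using t K M by (intro divide_right_mono mult_left_mono power_mono) auto
      finally show "norm (V (Suc n) t - V n t) \<le> M * ((K * T) ^ n / fact n)" by simp
    qed
    then have "uniform_limit (cball t0 T) (\<lambda>n t. v0 + (\<Sum>i<n. V (Suc i) t - V i t)) (\<lambda>t. v0 + (\<Sum>i. V (Suc i) t - V i t)) sequentially"
      by (intro uniform_limit_add uniform_limit_const)
    moreover have "(\<lambda>n t. v0 + (\<Sum>i<n. V (Suc i) t - V i t)) = V" using tele by (intro ext) (rule sym)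
    ultimately show ?thesis by (simp add: v_def [abs_def])
  qed
  have vc: "continuous_on UNIV v"
  proof (rule continuous_at_imp_continuous_on, rule ballI)
    fix t
    define T where "T = \<bar>t - t0\<bar> + 1"
    have "continuous_on (cball t0 T) v"
    proof (rule uniform_limit_theorem[OF _ ul])
      show "\<forall>\<^sub>F n in sequentially. continuous_on (cball t0 T) (V n)"
        by (rule always_eventually) (blast intro: continuous_on_subset[OF Vc])
    qed (simp_all add: T_def)
    then have "continuous_on (ball t0 T) v" by (rule continuous_on_subset) auto
    moreover have "t \<in> ball t0 T" by (simp add: T_def dist_real_def abs_minus_commute)
    ultimately show "isCont v t" using continuous_on_eq_continuous_at[of "ball t0 T" v] by blast
  qed
  have "v t = v0 + oint (G v) t0 t" for t
  proof -
    define T where "T = \<bar>t - t0\<bar>"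
    have T: "0 \<le> T" by (simp add: T_def)
    obtain K where K: "0 \<le> K" "\<And>v w t c. continuous_on UNIV v \<Longrightarrow> continuous_on UNIV w \<Longrightarrow> \<bar>t - t0\<bar> \<le> T \<Longrightarrow>
      (\<And>\<sigma>. \<sigma> \<in> closed_segment t0 t \<Longrightarrow> norm (v \<sigma> - w \<sigma>) \<le> c) \<Longrightarrow> norm (G v t - G w t) \<le> K * c"
      using lip[OF T] by auto
    have "(\<lambda>n. V (Suc n) t) \<longlonglongrightarrow> v0 + oint (G v) t0 t"
    proof (rule LIMSEQ_I)
      fix \<eta> :: real assume \<eta>: "0 < \<eta>"
      \<comment> \<open>\<open>K * T\<close> is the factor by which one integration of the
        functional amplifies a uniform error.\<close>
      define \<epsilon> where "\<epsilon> = \<eta> / (K * T + 1)"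
      have KT: "0 \<le> K * T" using K(1) T by simp
      then have \<epsilon>: "0 < \<epsilon>" using \<eta> by (simp add: \<epsilon>_def add_nonneg_pos)
      from ul[OF T] \<epsilon> have "\<forall>\<^sub>F n in sequentially. \<forall>x\<in>cball t0 T. dist (V n x) (v x) < \<epsilon>"
        by (rule uniform_limitD)
      then obtain N where N: "\<And>n x. n \<ge> N \<Longrightarrow> x \<in> cball t0 T \<Longrightarrow> dist (V n x) (v x) < \<epsilon>"
        unfolding eventually_sequentially by blast
      have "norm (V (Suc n) t - (v0 + oint (G v) t0 t)) < \<eta>" if "n \<ge> N" for n
      proof -
        have "norm (oint (\<lambda>\<tau>. G (V n) \<tau> - G v \<tau>) t0 t) \<le> (K * \<epsilon>) * \<bar>t - t0\<bar>"
        proof (rule norm_oint_le)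
          show "continuous_on UNIV (\<lambda>\<tau>. G (V n) \<tau> - G v \<tau>)" by (intro continuous_on_diff GVc cont vc)
          fix \<tau> assume "\<tau> \<in> closed_segment t0 t"
          then have \<tau>: "\<bar>\<tau> - t0\<bar> \<le> T" unfolding T_def by (rule closed_segment_real_abs_le)
          show "norm (G (V n) \<tau> - G v \<tau>) \<le> K * \<epsilon>"
          proof (rule K(2)[OF Vc vc \<tau>])
            fix \<sigma> assume "\<sigma> \<in> closed_segment t0 \<tau>"
            then have "\<bar>\<sigma> - t0\<bar> \<le> \<bar>\<tau> - t0\<bar>" by (rule closed_segment_real_abs_le)
            then have "\<sigma> \<in> cball t0 T" using \<tau> by (simp add: dist_real_def abs_minus_commute)
            then show "norm (V n \<sigma> - v \<sigma>) \<le> \<epsilon>" using N[OF that] by (simp add: dist_norm less_imp_le)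
          qed
        qed
        also have "\<dots> = \<epsilon> * (K * T)" by (simp add: T_def)
        also have "\<dots> < \<epsilon> * (K * T + 1)" using \<epsilon> by simp
        also have "\<dots> = \<eta>" using KT by (simp add: \<epsilon>_def)
        finally show ?thesis by (simp add: VS oint_diff[OF GVc cont[OF vc]])
      qed
      then show "\<exists>no. \<forall>n\<ge>no. norm (V (Suc n) t - (v0 + oint (G v) t0 t)) < \<eta>" by blast
    qed
    moreover have "(\<lambda>n. V (Suc n) t) \<longlonglongrightarrow> v t"
    proof -
      have "(\<lambda>n. V n t) \<longlonglongrightarrow> v t"
        by (rule tendsto_uniform_limitI[OF ul[OF T]]) (simp add: T_def dist_real_def abs_minus_commute)
      then show ?thesis by (rule LIMSEQ_Suc)
    qed
    ultimately show ?thesis by (intro LIMSEQ_unique)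
  qed
  then show ?thesis using vc by blast
qed

section \<open>Radial projection onto balls\<close>

definition truncate :: "real \<Rightarrow> 'a::real_normed_vector \<Rightarrow> 'a" where
  "truncate r x = (r / max r (norm x)) *\<^sub>R x"

lemma truncate_id: "0 < r \<Longrightarrow> norm x \<le> r \<Longrightarrow> truncate r x = x"
  by (simp add: truncate_def max_def)

lemma truncate_outside: "r < norm x \<Longrightarrow> truncate r x = (r / norm x) *\<^sub>R x"
  by (simp add: truncate_def max_def)

lemma norm_truncate_le: "0 < r \<Longrightarrow> norm (truncate r x) \<le> r"
  by (cases "norm x \<le> r") (auto simp: truncate_id truncate_outside)

text \<open>Moving a point \<open>x\<close> outside the ball to the sphere costs
  \<open>norm x - r\<close>, which is at most \<open>norm (x - y)\<close> for any \<open>y\<close>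
  in the ball. The constant 2 holds in every normed space.\<close>

lemma truncate_lipschitz:
  assumes r: "0 < r"
  shows "norm (truncate r x - truncate r y) \<le> 2 * norm (x - y)"
proof -
  have tri: "norm x - norm y \<le> norm (x - y)" for x y :: 'a by (rule norm_triangle_ineq2)
  have one: "norm (truncate r x - y) \<le> 2 * norm (x - y)" if "r < norm x" "norm y \<le> r" for x y :: 'a
  proof -
    have "norm (truncate r x - x) = norm x - r"
    proof -
      have "truncate r x - x = (r / norm x - 1) *\<^sub>R x"
        using that by (simp add: truncate_outside scaleR_left_diff_distrib)
      moreover have x: "0 < norm x" using that r by linarith
      then have "r / norm x < 1" using that by (simp only: pos_divide_less_eq mult_1)
      then have "\<bar>r / norm x - 1\<bar> = 1 - r / norm x" by simp
      moreover have "(1 - r / norm x) * norm x = norm x - r" using x by (simp add: field_simps)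
      ultimately show ?thesis by (simp only: norm_scaleR)
    qed
    moreover have "norm (truncate r x - y) \<le> norm (truncate r x - x) + norm (x - y)"
      using norm_triangle_ineq[of "truncate r x - x" "x - y"] by simp
    ultimately show ?thesis using tri[of x y] that by linarith
  qed
  show ?thesis
  proof (cases "norm x \<le> r"; cases "norm y \<le> r")
    assume "\<not> norm x \<le> r" "\<not> norm y \<le> r"
    then have a: "r < norm x" "r < norm y" by auto
    have e: "truncate r x - truncate r y = (r / norm x) *\<^sub>R (x - y) + (r / norm x - r / norm y) *\<^sub>R y"
      using a by (simp add: truncate_outside algebra_simps)
    have pos: "0 < norm x" "0 < norm y" using a r by linarith+
    have rx: "r / norm x \<le> 1" using pos a by (simp only: pos_divide_le_eq mult_1 less_imp_le)
    have rx0: "0 \<le> r / norm x" using r by simp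
    have "norm ((r / norm x) *\<^sub>R (x - y)) \<le> norm (x - y)"
      unfolding norm_scaleR abs_of_nonneg[OF rx0] by (rule mult_left_le_one_le[OF norm_ge_zero rx0 rx])
    moreover have "norm ((r / norm x - r / norm y) *\<^sub>R y) \<le> norm (x - y)"
    proof -
      have "(r / norm x - r / norm y) * norm y = (r / norm x) * (norm y - norm x)"
        using pos by (simp add: field_simps)
      then have "norm ((r / norm x - r / norm y) *\<^sub>R y) = (r / norm x) * \<bar>norm y - norm x\<bar>"
        using abs_of_nonneg[OF rx0] by (metis abs_mult abs_norm_cancel norm_scaleR)
      also have "\<dots> \<le> 1 * \<bar>norm y - norm x\<bar>"
        using rx by (rule mult_right_mono) simp
      also have "\<dots> \<le> norm (x - y)" using norm_triangle_ineq3[of x y] by (simp add: abs_minus_commute)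
      finally show ?thesis .
    qed
    ultimately show ?thesis unfolding e using norm_triangle_ineq[of "(r / norm x) *\<^sub>R (x - y)" "(r / norm x - r / norm y) *\<^sub>R y"] by linarith
  next
    assume "norm x \<le> r" "\<not> norm y \<le> r"
    then show ?thesis using one[of y x] r by (simp add: truncate_id norm_minus_commute)
  qed (use one[of x y] r in \<open>auto simp: truncate_id\<close>)
qed

lemma continuous_on_truncate:
  assumes "continuous_on A r" "continuous_on A v" "\<And>x. x \<in> A \<Longrightarrow> 0 < r x"
  shows "continuous_on A (\<lambda>x. truncate (r x) (v x))"
proof -
  have "max (r x) (norm (v x)) \<noteq> 0" if "x \<in> A" for x using assms(3)[OF that] by auto
  then show ?thesis unfolding truncate_def using assms(1,2) by (intro continuous_intros) auto
qed

section \<open>The particle in its own field\<close>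

lemma norm_cvec: "norm (cvec v) = norm v"
  by (simp add: norm_vec_def cvec_def)

lemma norm_cis_diff_le: "norm (cis a - cis b) \<le> \<bar>a - b\<bar>"
proof -
  have "cis a - cis b = cis b * (cis (a - b) - 1)" by (simp add: right_diff_distrib cis_mult)
  then have "norm (cis a - cis b) = norm (cis (a - b) - 1)" by (simp add: norm_mult)
  also have "\<dots> \<le> \<bar>a - b\<bar>" using iexp_approx1[of "a - b" 0] by (simp add: cis_conv_exp)
  finally show ?thesis .
qed

lemma norm_cis_inner_diff_le: "norm (cis (k \<bullet> x) - cis (k \<bullet> y)) \<le> norm k * norm (x - y)"
  using norm_cis_diff_le[of "k \<bullet> x" "k \<bullet> y"] Cauchy_Schwarz_ineq2[of k "x - y"]
  by (simp add: inner_diff_right)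

text \<open>Fourier transform of the current, up to the scalar factor \<open>e * cnj (p k)\<close>.\<close>

definition src :: "R3 \<Rightarrow> R3 \<Rightarrow> R3 \<Rightarrow> amplitude" where
  "src k x v = (cis (- (k \<bullet> x)) *s cvec v, 0)"

lemma norm_src: "norm (src k x v) = norm v"
  by (simp add: src_def norm_vector_scalar_mult norm_cvec)

lemma norm_src_diff: "norm (src k x v - src k y w) \<le> norm (v - w) + norm k * norm (x - y) * norm w"
proof -
  have e: "src k x v - src k y w = (cis (- (k \<bullet> x)) *s cvec (v - w) + (cis (- (k \<bullet> x)) - cis (- (k \<bullet> y))) *s cvec w, 0)"
    by (simp add: src_def vec_eq_iff cvec_def algebra_simps)
  have "norm (src k x v - src k y w) \<le> norm (cis (- (k \<bullet> x)) *s cvec (v - w)) + norm ((cis (- (k \<bullet> x)) - cis (- (k \<bullet> y))) *s cvec w)"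
    unfolding e by (simp add: norm_triangle_ineq)
  also have "\<dots> = norm (v - w) + norm (cis (- k \<bullet> x) - cis (- k \<bullet> y)) * norm w"
    unfolding norm_vector_scalar_mult norm_cvec by simp
  also have "\<dots> \<le> norm (v - w) + norm k * norm (x - y) * norm w"
    using mult_right_mono[OF norm_cis_inner_diff_le[of "- k" x y] norm_ge_zero[of w]] by simp
  finally show ?thesis .
qed

lemma continuous_on_src:
  assumes "continuous_on A g" "continuous_on A h" "continuous_on A u"
  shows "continuous_on A (\<lambda>x. src (g x) (h x) (u x))"
  unfolding src_def vector_scalar_mult_def cvec_def using assms by (intro continuous_intros)

lemma src_conj: "src (- k) x v = conj_amp (src k x v)"
  by (simp add: src_def conj_amp_def vec_eq_iff cvec_def cis_cnj)

lemma norm_conj_amp: "norm (conj_amp w) = norm w"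
  by (simp add: conj_amp_def norm_prod_def norm_vec_def)

lemma bounded_linear_conj_amp: "bounded_linear conj_amp"
  by (rule bounded_linear_intro[of _ 1])
    (simp_all add: norm_conj_amp, simp_all add: conj_amp_def prod_eq_iff vec_eq_iff)

lemma conj_amp_cscale: "conj_amp (cscale c w) = cscale (cnj c) (conj_amp w)"
  by (simp add: conj_amp_def cscale_def vec_eq_iff)

lemma conj_amp_add: "conj_amp (w + u) = conj_amp w + conj_amp u"
  by (simp add: conj_amp_def vec_eq_iff)

definition revec :: "C3 \<Rightarrow> R3" where
  "revec a = (\<chi> j. Re (a $ j))"

lemma norm_revec_le: "norm (revec a) \<le> norm a"
  unfolding norm_vec_def revec_def by (intro L2_set_mono) (auto simp: abs_Re_le_cmod)

lemma revec_diff: "revec (a - b) = revec a - revec b"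
  by (simp add: revec_def vec_eq_iff)

lemma norm_cross3_le: "norm (cross3 x y) \<le> norm x * norm y"
proof (rule power2_le_imp_le)
  show "(norm (cross3 x y))\<^sup>2 \<le> (norm x * norm y)\<^sup>2"
    using norm_cross_dot[of x y] zero_le_power2[of "x \<bullet> y"] by linarith
qed simp

text \<open>The force needs only these integrals. Those without \<open>norm k\<close> bound the part
  of the smeared field due to the initial data and the part due to the particle; those with
  \<open>norm k\<close> control their variation when the particle is displaced or time
  passes.\<close>

locale particle_in_field =
  fixes e t0 :: real and p :: "R3 \<Rightarrow> complex" and w0 :: "R3 \<Rightarrow> amplitude" and \<xi>0 v0 :: R3
  assumes p_measurable [measurable]: "p \<in> borel_measurable borel"
    and w0_measurable [measurable]: "w0 \<in> borel_measurable borel"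
    and int_pw: "integrable lborel (\<lambda>k. norm (p k) * norm (w0 k))"
    and int_kpw: "integrable lborel (\<lambda>k. norm k * norm (p k) * norm (w0 k))"
    and int_pp: "integrable lborel (\<lambda>k. (norm (p k))\<^sup>2)"
    and int_kpp: "integrable lborel (\<lambda>k. norm k * (norm (p k))\<^sup>2)"
begin

definition "Cpw = (LINT k|lborel. norm (p k) * norm (w0 k))"
definition "Ckpw = (LINT k|lborel. norm k * norm (p k) * norm (w0 k))"
definition "Cpp = (LINT k|lborel. (norm (p k))\<^sup>2)"
definition "Ckpp = (LINT k|lborel. norm k * (norm (p k))\<^sup>2)"

lemma consts_nonneg: "0 \<le> Cpw" "0 \<le> Ckpw" "0 \<le> Cpp" "0 \<le> Ckpp"
  unfolding Cpw_def Ckpw_def Cpp_def Ckpp_def by (intro integral_nonneg_AE; auto)+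

lemma integral_bound_combination:
  fixes f :: "R3 \<Rightarrow> amplitude"
  assumes m: "f \<in> borel_measurable borel"
    and b: "\<And>k. norm (f k) \<le> a * (norm (p k) * norm (w0 k)) + b * (norm k * norm (p k) * norm (w0 k))
      + c * (norm (p k))\<^sup>2 + d * (norm k * (norm (p k))\<^sup>2)"
  shows "integrable lborel f" "norm (LINT k|lborel. f k) \<le> a * Cpw + b * Ckpw + c * Cpp + d * Ckpp"
proof -
  let ?g = "\<lambda>k. a * (norm (p k) * norm (w0 k)) + b * (norm k * norm (p k) * norm (w0 k))
      + c * (norm (p k))\<^sup>2 + d * (norm k * (norm (p k))\<^sup>2)"
  have i: "integrable lborel ?g"
    by (intro Bochner_Integration.integrable_add integrable_mult_right int_pw int_kpw int_pp int_kpp)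
  show f: "integrable lborel f"
    by (rule Bochner_Integration.integrable_bound[OF i]) (use m b in \<open>auto intro: order_trans[OF _ abs_ge_self]\<close>)
  have "norm (LINT k|lborel. f k) \<le> (LINT k|lborel. norm (f k))" by (rule integral_norm_bound)
  also have "\<dots> \<le> (LINT k|lborel. ?g k)"
    using f b by (intro Bochner_Integration.integral_mono i) auto
  also have "\<dots> = a * Cpw + b * Ckpw + c * Cpp + d * Ckpp"
    unfolding Cpw_def Ckpw_def Cpp_def Ckpp_def
    by (simp add: int_pw int_kpw int_pp int_kpp)
  finally show "norm (LINT k|lborel. f k) \<le> a * Cpw + b * Ckpw + c * Cpp + d * Ckpp" .
qed

text \<open>The field radiated since \<open>t0\<close>, with the scalar coupling factored out.
  Without the form factor it is bounded uniformly in the frequency, which separates the estimates in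
  time from the integrability in \<open>k\<close>.\<close>

definition kern :: "(real \<Rightarrow> R3) \<Rightarrow> (real \<Rightarrow> R3) \<Rightarrow> real \<Rightarrow> R3 \<Rightarrow> amplitude" where
  "kern \<xi> v t k = oint (\<lambda>\<tau>. maxwell_symbol (t - \<tau>) k (src k (\<xi> \<tau>) (v \<tau>))) t0 t"

lemma kern_integrand_continuous:
  assumes "continuous_on UNIV \<xi>" "continuous_on UNIV v"
  shows "continuous_on UNIV (\<lambda>\<tau>. maxwell_symbol (t - \<tau>) k (src k (\<xi> \<tau>) (v \<tau>)))"
proof (cases "k = 0")
  case True
  then show ?thesis using assms by (simp add: maxwell_symbol_at_0 continuous_on_src)
next
  case False
  then show ?thesis
    by (intro continuous_on_maxwell_symbol continuous_on_src continuous_intros assms) auto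
qed

lemma kern_bound:
  assumes "continuous_on UNIV \<xi>" "continuous_on UNIV v"
    and "\<And>\<sigma>. \<sigma> \<in> closed_segment t0 t \<Longrightarrow> norm (v \<sigma>) \<le> R"
  shows "norm (kern \<xi> v t k) \<le> R * \<bar>t - t0\<bar>"
  unfolding kern_def
  by (rule norm_oint_le[OF kern_integrand_continuous[OF assms(1,2)]])
    (simp add: norm_maxwell_symbol norm_src assms(3))

text \<open>The isometry of the flow reduces the comparison to the sources; a displacement of the
  source shows up as \<open>norm k * d\<close> through its phase.\<close>

lemma kern_lipschitz:
  assumes c: "continuous_on UNIV \<xi>" "continuous_on UNIV v" "continuous_on UNIV \<eta>" "continuous_on UNIV w"
    and b: "\<And>\<sigma>. \<sigma> \<in> closed_segment t0 t \<Longrightarrow> norm (v \<sigma> - w \<sigma>) \<le> c" "\<And>\<sigma>. \<sigma> \<in> closed_segment t0 t \<Longrightarrow> norm (w \<sigma>) \<le> R"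
      "\<And>\<sigma>. \<sigma> \<in> closed_segment t0 t \<Longrightarrow> norm (\<xi> \<sigma> - \<eta> \<sigma>) \<le> d" and d: "0 \<le> d"
  shows "norm (kern \<xi> v t k - kern \<eta> w t k) \<le> (c + norm k * d * R) * \<bar>t - t0\<bar>"
  unfolding kern_def oint_diff[OF kern_integrand_continuous[OF c(1,2)] kern_integrand_continuous[OF c(3,4)], symmetric]
proof (rule norm_oint_le)
  show "continuous_on UNIV (\<lambda>\<tau>. maxwell_symbol (t - \<tau>) k (src k (\<xi> \<tau>) (v \<tau>)) - maxwell_symbol (t - \<tau>) k (src k (\<eta> \<tau>) (w \<tau>)))"
    by (intro continuous_on_diff kern_integrand_continuous c)
  fix \<tau> assume \<tau>: "\<tau> \<in> closed_segment t0 t"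
  have "norm (src k (\<xi> \<tau>) (v \<tau>) - src k (\<eta> \<tau>) (w \<tau>)) \<le> norm (v \<tau> - w \<tau>) + norm k * norm (\<xi> \<tau> - \<eta> \<tau>) * norm (w \<tau>)"
    by (rule norm_src_diff)
  also have "\<dots> \<le> c + norm k * d * R"
    using b[OF \<tau>] d by (intro add_mono mult_mono) auto
  finally show "norm (maxwell_symbol (t - \<tau>) k (src k (\<xi> \<tau>) (v \<tau>)) - maxwell_symbol (t - \<tau>) k (src k (\<eta> \<tau>) (w \<tau>))) \<le> c + norm k * d * R"
    unfolding maxwell_symbol_diff[symmetric] norm_maxwell_symbol .
qed

lemma kern_time_lipschitz:
  assumes c: "continuous_on UNIV \<xi>" "continuous_on UNIV v"
    and b: "\<And>\<sigma>. \<bar>\<sigma> - t0\<bar> \<le> T \<Longrightarrow> norm (v \<sigma>) \<le> R" and t: "\<bar>t - t0\<bar> \<le> T" and r: "\<bar>r - t0\<bar> \<le> T"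
  shows "norm (kern \<xi> v t k - kern \<xi> v r k) \<le> (R + 12 * norm k * R * T) * \<bar>t - r\<bar>"
proof -
  let ?f = "\<lambda>t \<tau>. maxwell_symbol (t - \<tau>) k (src k (\<xi> \<tau>) (v \<tau>))"
  note fc = kern_integrand_continuous[OF c]
  have R: "0 \<le> R" using b[OF t] norm_ge_zero order_trans by blast
  \<comment> \<open>The time enters as upper limit and in the propagator: the first integral is the
    newly emitted field, the second the further propagation of the old one.\<close>
  have e1: "kern \<xi> v t k - kern \<xi> v r k = oint (?f t) r t + oint (\<lambda>\<tau>. ?f t \<tau> - ?f r \<tau>) t0 r"
    unfolding kern_def oint_diff[OF fc fc] using oint_split[OF fc, of t k t0 t r] by simp
  have n1: "norm (oint (?f t) r t) \<le> R * \<bar>t - r\<bar>"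
  proof (rule norm_oint_le[OF fc])
    fix \<tau> assume "\<tau> \<in> closed_segment r t"
    then have "\<bar>\<tau> - t0\<bar> \<le> T" using t r by (auto simp: closed_segment_eq_real_ivl split: if_splits)
    then show "norm (?f t \<tau>) \<le> R" by (simp add: norm_maxwell_symbol norm_src b)
  qed
  have n2: "norm (oint (\<lambda>\<tau>. ?f t \<tau> - ?f r \<tau>) t0 r) \<le> (12 * norm k * R * \<bar>t - r\<bar>) * \<bar>r - t0\<bar>"
  proof (rule norm_oint_le)
    show "continuous_on UNIV (\<lambda>\<tau>. ?f t \<tau> - ?f r \<tau>)" by (intro continuous_on_diff fc)
    fix \<tau> assume "\<tau> \<in> closed_segment t0 r"
    then have "\<bar>\<tau> - t0\<bar> \<le> T" using closed_segment_real_abs_le r by fastforce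
    then have "norm (v \<tau>) \<le> R" by (rule b)
    then have "12 * norm k * norm (v \<tau>) * \<bar>t - r\<bar> \<le> 12 * norm k * R * \<bar>t - r\<bar>"
      by (intro mult_right_mono mult_left_mono) auto
    then show "norm (?f t \<tau> - ?f r \<tau>) \<le> 12 * norm k * R * \<bar>t - r\<bar>"
      using maxwell_symbol_lipschitz[of "t - \<tau>" k "src k (\<xi> \<tau>) (v \<tau>)" "r - \<tau>"] by (simp add: norm_src)
  qed
  have n3: "(12 * norm k * R * \<bar>t - r\<bar>) * \<bar>r - t0\<bar> \<le> (12 * norm k * R * \<bar>t - r\<bar>) * T"
    using r R by (intro mult_left_mono) auto
  have "norm (kern \<xi> v t k - kern \<xi> v r k) \<le> R * \<bar>t - r\<bar> + (12 * norm k * R * \<bar>t - r\<bar>) * T"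
    unfolding e1 by (rule norm_triangle_le[OF add_mono[OF n1 order_trans[OF n2 n3]]])
  also have "\<dots> = (R + 12 * norm k * R * T) * \<bar>t - r\<bar>" by (simp add: algebra_simps)
  finally show ?thesis .
qed

text \<open>Away from the origin it is continuous, as an integral of a jointly continuous function
  of frequency and time over a compact interval.\<close>

lemma kern_measurable [measurable]:
  assumes "continuous_on UNIV \<xi>" "continuous_on UNIV v"
  shows "kern \<xi> v t \<in> borel_measurable borel"
proof -
  have *: "continuous_on (- {0}) (\<lambda>k. integral {a..b} (\<lambda>\<tau>. maxwell_symbol (t - \<tau>) k (src k (\<xi> \<tau>) (v \<tau>))))" for a b
  proof -
    have "continuous_on (- {0}) (\<lambda>k. integral (cbox a b) (\<lambda>\<tau>. maxwell_symbol (t - \<tau>) k (src k (\<xi> \<tau>) (v \<tau>))))"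
    proof (rule integral_continuous_on_param)
      show "continuous_on ((- {0}) \<times> cbox a b) (\<lambda>(k, \<tau>). maxwell_symbol (t - \<tau>) k (src k (\<xi> \<tau>) (v \<tau>)))"
        unfolding case_prod_unfold
        by (intro continuous_on_maxwell_symbol continuous_on_src continuous_on_compose2[OF assms(1)]
            continuous_on_compose2[OF assms(2)] continuous_intros) auto
    qed
    then show ?thesis by (simp add: cbox_interval)
  qed
  have "continuous_on (- {0}) (kern \<xi> v t)"
    unfolding kern_def [abs_def] oint_def by (intro continuous_on_diff *)
  then have "(\<lambda>k. indicator (- {0}) k *\<^sub>R kern \<xi> v t k) \<in> borel_measurable borel"
    by (intro borel_measurable_continuous_on_indicator) auto
  then have "(\<lambda>k. if k = 0 then kern \<xi> v t 0 else indicator (- {0}) k *\<^sub>R kern \<xi> v t k) \<in> borel_measurable borel"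
    by (intro measurable_If) auto
  moreover have "(\<lambda>k. if k = 0 then kern \<xi> v t 0 else indicator (- {0}) k *\<^sub>R kern \<xi> v t k) = kern \<xi> v t"
    by (auto simp: indicator_def)
  ultimately show ?thesis by simp
qed

lemma kern_conj:
  assumes "continuous_on UNIV \<xi>" "continuous_on UNIV v"
  shows "kern \<xi> v t (- k) = conj_amp (kern \<xi> v t k)"
  unfolding kern_def src_conj maxwell_symbol_conj
  by (rule oint_bounded_linear[OF bounded_linear_conj_amp kern_integrand_continuous[OF assms]])

text \<open>Charge conservation at one frequency: the flow leaves the longitudinal part of the
  current alone, and \<open>(k \<bullet> v \<tau>) * cis (- (k \<bullet> \<xi> \<tau>))\<close> is
  the time derivative of \<open>\<i> * cis (- (k \<bullet> \<xi> \<tau>))\<close>.\<close>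

lemma kern_longitudinal:
  assumes c: "continuous_on UNIV \<xi>" "continuous_on UNIV v" and d: "\<And>t. (\<xi> has_vector_derivative v t) (at t)"
  shows "(\<Sum>j\<in>UNIV. of_real (k $ j) * fst (kern \<xi> v t k) $ j) = \<i> * (cis (- (k \<bullet> \<xi> t)) - cis (- (k \<bullet> \<xi> t0)))"
    "(\<Sum>j\<in>UNIV. of_real (k $ j) * snd (kern \<xi> v t k) $ j) = 0"
proof -
  let ?g = "\<lambda>w :: amplitude. \<Sum>j\<in>UNIV. of_real (k $ j) * fst w $ j"
  let ?h = "\<lambda>w :: amplitude. \<Sum>j\<in>UNIV. of_real (k $ j) * snd w $ j"
  have bl: "bounded_linear ?g" "bounded_linear ?h"
    by (intro bounded_linear_sum bounded_linear_const_mult bounded_linear_compose[OF bounded_linear_vec_nth]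
        bounded_linear_fst bounded_linear_snd)+
  have "?g (kern \<xi> v t k) = oint (\<lambda>\<tau>. ?g (maxwell_symbol (t - \<tau>) k (src k (\<xi> \<tau>) (v \<tau>)))) t0 t"
    unfolding kern_def by (rule oint_bounded_linear[OF bl(1) kern_integrand_continuous[OF c], symmetric])
  also have "\<dots> = oint (\<lambda>\<tau>. cis (- (k \<bullet> \<xi> \<tau>)) * of_real (k \<bullet> v \<tau>)) t0 t"
    unfolding maxwell_symbol_longitudinal
    by (simp add: src_def cvec_def inner_vec_def sum_distrib_left mult_ac)
  also have "\<dots> = \<i> * cis (- (k \<bullet> \<xi> t)) - \<i> * cis (- (k \<bullet> \<xi> t0))"
  proof (rule oint_FTC)
    fix r
    have "((\<lambda>r. - (k \<bullet> \<xi> r)) has_derivative (\<lambda>h. h * - (k \<bullet> v r))) (at r)"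
      using d[of r] unfolding has_vector_derivative_def by (auto intro!: derivative_eq_intros)
    then have "((\<lambda>r. \<i> * cis (- (k \<bullet> \<xi> r))) has_derivative (\<lambda>h. \<i> * ((h * - (k \<bullet> v r)) *\<^sub>R (\<i> * cis (- (k \<bullet> \<xi> r)))))) (at r)"
      by (intro has_derivative_mult_right has_derivative_cis)
    then show "((\<lambda>r. \<i> * cis (- (k \<bullet> \<xi> r))) has_vector_derivative cis (- (k \<bullet> \<xi> r)) * of_real (k \<bullet> v r)) (at r)"
      unfolding has_vector_derivative_def
      by (rule has_derivative_eq_rhs) (simp add: fun_eq_iff scaleR_conv_of_real[where 'a = complex] algebra_simps)
  qed
  finally show "?g (kern \<xi> v t k) = \<i> * (cis (- (k \<bullet> \<xi> t)) - cis (- (k \<bullet> \<xi> t0)))" by (simp add: right_diff_distrib)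
  have "?h (kern \<xi> v t k) = oint (\<lambda>\<tau>. ?h (maxwell_symbol (t - \<tau>) k (src k (\<xi> \<tau>) (v \<tau>)))) t0 t"
    unfolding kern_def by (rule oint_bounded_linear[OF bl(2) kern_integrand_continuous[OF c], symmetric])
  also have "\<dots> = 0"
    unfolding maxwell_symbol_longitudinal by (simp add: src_def oint_def)
  finally show "?h (kern \<xi> v t k) = 0" .
qed

text \<open>Duhamel's formula at one frequency. The minus sign is that of \<open>- j\<close>, and
  the conjugate comes from the reflected argument in \<open>\<phi> (\<xi> - x)\<close>.\<close>

definition field_symbol :: "(real \<Rightarrow> R3) \<Rightarrow> (real \<Rightarrow> R3) \<Rightarrow> real \<Rightarrow> R3 \<Rightarrow> amplitude" where
  "field_symbol \<xi> v t k = maxwell_symbol (t - t0) k (w0 k) + cscale (- (of_real e * cnj (p k))) (kern \<xi> v t k)"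

lemma cnj_p_measurable: "(\<lambda>k. cnj (p k)) \<in> borel_measurable borel"
  by (rule measurable_compose[OF p_measurable borel_measurable_cnj])

lemma field_symbol_measurable:
  assumes "continuous_on UNIV \<xi>" "continuous_on UNIV v"
  shows "field_symbol \<xi> v t \<in> borel_measurable borel"
  unfolding field_symbol_def [abs_def]
  using maxwell_symbol_borel_measurable[OF w0_measurable] kern_measurable[OF assms] cnj_p_measurable
  by (intro borel_measurable_add cscale_borel_measurable) auto

lemma field_symbol_bound:
  assumes "continuous_on UNIV \<xi>" "continuous_on UNIV v"
    and "\<And>\<sigma>. \<sigma> \<in> closed_segment t0 t \<Longrightarrow> norm (v \<sigma>) \<le> R"
  shows "norm (field_symbol \<xi> v t k) \<le> norm (w0 k) + \<bar>e\<bar> * norm (p k) * (R * \<bar>t - t0\<bar>)"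
proof -
  have "norm (field_symbol \<xi> v t k) \<le> norm (w0 k) + (\<bar>e\<bar> * norm (p k)) * norm (kern \<xi> v t k)"
    unfolding field_symbol_def by (rule order_trans[OF norm_triangle_ineq]) (simp add: norm_maxwell_symbol norm_cscale norm_mult)
  also have "\<dots> \<le> norm (w0 k) + \<bar>e\<bar> * norm (p k) * (R * \<bar>t - t0\<bar>)"
    using kern_bound[OF assms] by (intro add_left_mono mult_left_mono) auto
  finally show ?thesis .
qed

text \<open>The integrand of both convolutions at the position of the particle, before real parts
  are taken; keeping the electric and magnetic parts together halves the estimates.\<close>

definition smeared_integrand :: "(real \<Rightarrow> R3) \<Rightarrow> (real \<Rightarrow> R3) \<Rightarrow> real \<Rightarrow> R3 \<Rightarrow> amplitude" where
  "smeared_integrand \<xi> v t k = cscale (cis (k \<bullet> \<xi> t) * p k) (field_symbol \<xi> v t k)"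

definition smeared_field :: "(real \<Rightarrow> R3) \<Rightarrow> (real \<Rightarrow> R3) \<Rightarrow> real \<Rightarrow> amplitude" where
  "smeared_field \<xi> v t = (LINT k|lborel. smeared_integrand \<xi> v t k)"

lemma smeared_integrand_measurable:
  assumes "continuous_on UNIV \<xi>" "continuous_on UNIV v"
  shows "smeared_integrand \<xi> v t \<in> borel_measurable borel"
proof -
  have "(\<lambda>k. cis (k \<bullet> \<xi> t)) \<in> borel_measurable borel"
    by (intro borel_measurable_continuous_onI continuous_intros)
  then show ?thesis
    unfolding smeared_integrand_def [abs_def] using field_symbol_measurable[OF assms]
    by (intro cscale_borel_measurable borel_measurable_times) auto
qed

lemma
  assumes "continuous_on UNIV \<xi>" "continuous_on UNIV v"
    and "\<And>\<sigma>. \<sigma> \<in> closed_segment t0 t \<Longrightarrow> norm (v \<sigma>) \<le> R"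
  shows smeared_integrand_integrable': "integrable lborel (smeared_integrand \<xi> v t)"
    and norm_smeared_field_le: "norm (smeared_field \<xi> v t) \<le> Cpw + \<bar>e\<bar> * R * \<bar>t - t0\<bar> * Cpp"
proof -
  have "norm (smeared_integrand \<xi> v t k) \<le> 1 * (norm (p k) * norm (w0 k)) + 0 * (norm k * norm (p k) * norm (w0 k))
      + (\<bar>e\<bar> * R * \<bar>t - t0\<bar>) * (norm (p k))\<^sup>2 + 0 * (norm k * (norm (p k))\<^sup>2)" for k
  proof -
    have "norm (smeared_integrand \<xi> v t k) \<le> norm (p k) * (norm (w0 k) + \<bar>e\<bar> * norm (p k) * (R * \<bar>t - t0\<bar>))"
      unfolding smeared_integrand_def norm_cscale norm_mult norm_cis mult_1
      by (rule mult_left_mono[OF field_symbol_bound[OF assms] norm_ge_zero])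
    then show ?thesis by (simp add: algebra_simps power2_eq_square)
  qed
  from integral_bound_combination[OF smeared_integrand_measurable[OF assms(1,2)] this]
  show "integrable lborel (smeared_integrand \<xi> v t)" "norm (smeared_field \<xi> v t) \<le> Cpw + \<bar>e\<bar> * R * \<bar>t - t0\<bar> * Cpp"
    unfolding smeared_field_def by simp_all
qed

lemma smeared_integrand_integrable:
  assumes "continuous_on UNIV \<xi>" "continuous_on UNIV v"
  shows "integrable lborel (smeared_integrand \<xi> v t)"
proof -
  obtain M where M: "\<And>\<sigma>. \<bar>\<sigma> - t0\<bar> \<le> \<bar>t - t0\<bar> \<Longrightarrow> norm (v \<sigma>) \<le> M"
    using continuous_bounded_interval[OF assms(2), of t0 "\<bar>t - t0\<bar>"] by blast
  show ?thesis
    by (rule smeared_integrand_integrable'[OF assms, of t M]) (intro M closed_segment_real_abs_le)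
qed

lemma cscale_diff_split: "cscale a x - cscale b y = cscale (a - b) y + cscale a (x - y)"
  by (simp add: cscale_simps)

text \<open>The factor 2 in the last term counts the displacement twice: once in the phase at which
  the field is evaluated and once in the source that generated it.\<close>

lemma smeared_field_lipschitz:
  assumes c: "continuous_on UNIV \<xi>" "continuous_on UNIV v" "continuous_on UNIV \<eta>" "continuous_on UNIV w"
    and b: "\<And>\<sigma>. \<sigma> \<in> closed_segment t0 t \<Longrightarrow> norm (v \<sigma> - w \<sigma>) \<le> c" "\<And>\<sigma>. \<sigma> \<in> closed_segment t0 t \<Longrightarrow> norm (w \<sigma>) \<le> R"
      "\<And>\<sigma>. \<sigma> \<in> closed_segment t0 t \<Longrightarrow> norm (\<xi> \<sigma> - \<eta> \<sigma>) \<le> d"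
  shows "norm (smeared_field \<xi> v t - smeared_field \<eta> w t)
    \<le> d * Ckpw + (\<bar>e\<bar> * c * \<bar>t - t0\<bar>) * Cpp + (2 * \<bar>e\<bar> * d * R * \<bar>t - t0\<bar>) * Ckpp"
proof -
  have tt: "t \<in> closed_segment t0 t" by simp
  have d: "0 \<le> d" using b(3)[OF tt] norm_ge_zero order_trans by blast
  have R: "0 \<le> R" using b(2)[OF tt] norm_ge_zero order_trans by blast
  have "norm (smeared_integrand \<xi> v t k - smeared_integrand \<eta> w t k) \<le> 0 * (norm (p k) * norm (w0 k)) + d * (norm k * norm (p k) * norm (w0 k))
      + (\<bar>e\<bar> * c * \<bar>t - t0\<bar>) * (norm (p k))\<^sup>2 + (2 * \<bar>e\<bar> * d * R * \<bar>t - t0\<bar>) * (norm k * (norm (p k))\<^sup>2)" for k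
  proof -
    let ?a = "cis (k \<bullet> \<xi> t) * p k" and ?b = "cis (k \<bullet> \<eta> t) * p k"
    have "norm (?a - ?b) = norm (cis (k \<bullet> \<xi> t) - cis (k \<bullet> \<eta> t)) * norm (p k)"
      by (simp add: norm_mult flip: left_diff_distrib)
    also have "\<dots> \<le> norm k * d * norm (p k)"
      using b(3)[OF tt] by (intro mult_right_mono order_trans[OF norm_cis_inner_diff_le] mult_left_mono) auto
    finally have 1: "norm (cscale (?a - ?b) (field_symbol \<eta> w t k)) \<le> (norm k * d * norm (p k)) * (norm (w0 k) + \<bar>e\<bar> * norm (p k) * (R * \<bar>t - t0\<bar>))"
      unfolding norm_cscale using d by (intro mult_mono field_symbol_bound[OF c(3,4) b(2)]) auto
    have "field_symbol \<xi> v t k - field_symbol \<eta> w t k = cscale (- (of_real e * cnj (p k))) (kern \<xi> v t k - kern \<eta> w t k)"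
      by (simp add: field_symbol_def cscale_simps)
    then have "norm (field_symbol \<xi> v t k - field_symbol \<eta> w t k) = \<bar>e\<bar> * norm (p k) * norm (kern \<xi> v t k - kern \<eta> w t k)"
      by (simp add: norm_cscale norm_mult)
    also have "\<dots> \<le> \<bar>e\<bar> * norm (p k) * ((c + norm k * d * R) * \<bar>t - t0\<bar>)"
      by (intro mult_left_mono kern_lipschitz c b d) auto
    finally have 2: "norm (cscale ?a (field_symbol \<xi> v t k - field_symbol \<eta> w t k)) \<le> norm (p k) * (\<bar>e\<bar> * norm (p k) * ((c + norm k * d * R) * \<bar>t - t0\<bar>))"
      unfolding norm_cscale norm_mult norm_cis mult_1 by (rule mult_left_mono) simp
    have "norm (smeared_integrand \<xi> v t k - smeared_integrand \<eta> w t k) \<le> norm (cscale (?a - ?b) (field_symbol \<eta> w t k)) + norm (cscale ?a (field_symbol \<xi> v t k - field_symbol \<eta> w t k))"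
      unfolding smeared_integrand_def cscale_diff_split by (rule norm_triangle_ineq)
    also have "\<dots> \<le> (norm k * d * norm (p k)) * (norm (w0 k) + \<bar>e\<bar> * norm (p k) * (R * \<bar>t - t0\<bar>))
        + norm (p k) * (\<bar>e\<bar> * norm (p k) * ((c + norm k * d * R) * \<bar>t - t0\<bar>))"
      by (intro add_mono 1 2)
    also have "\<dots> = 0 * (norm (p k) * norm (w0 k)) + d * (norm k * norm (p k) * norm (w0 k))
      + (\<bar>e\<bar> * c * \<bar>t - t0\<bar>) * (norm (p k))\<^sup>2 + (2 * \<bar>e\<bar> * d * R * \<bar>t - t0\<bar>) * (norm k * (norm (p k))\<^sup>2)"
      by (simp add: algebra_simps power2_eq_square)
    finally show ?thesis .
  qed
  from integral_bound_combination(2)[OF borel_measurable_diff[OF smeared_integrand_measurable[OF c(1,2)] smeared_integrand_measurable[OF c(3,4)]] this]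
  show ?thesis unfolding smeared_field_def
    by (simp add: Bochner_Integration.integral_diff smeared_integrand_integrable c)
qed

text \<open>The field itself has no Lipschitz bound in the energy norm, but after smearing the lost
  factor \<open>norm k\<close> is absorbed by the form factor. Its use is the continuity of the
  force in time.\<close>

lemma smeared_field_time_lipschitz:
  assumes c: "continuous_on UNIV \<xi>" "continuous_on UNIV v"
    and b: "\<And>\<sigma>. \<bar>\<sigma> - t0\<bar> \<le> T \<Longrightarrow> norm (v \<sigma>) \<le> R" and t: "\<bar>t - t0\<bar> \<le> T" and r: "\<bar>r - t0\<bar> \<le> T"
  shows "norm (smeared_field \<xi> v t - smeared_field \<xi> v r) \<le> norm (\<xi> t - \<xi> r) * (Ckpw + \<bar>e\<bar> * R * T * Ckpp)
    + \<bar>t - r\<bar> * (12 * Ckpw + \<bar>e\<bar> * R * Cpp + 12 * \<bar>e\<bar> * R * T * Ckpp)"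
proof -
  have R: "0 \<le> R" using b[OF t] norm_ge_zero order_trans by blast
  have "norm (smeared_integrand \<xi> v t k - smeared_integrand \<xi> v r k) \<le> 0 * (norm (p k) * norm (w0 k))
      + (norm (\<xi> t - \<xi> r) + 12 * \<bar>t - r\<bar>) * (norm k * norm (p k) * norm (w0 k))
      + (\<bar>e\<bar> * R * \<bar>t - r\<bar>) * (norm (p k))\<^sup>2
      + (norm (\<xi> t - \<xi> r) * \<bar>e\<bar> * R * T + 12 * \<bar>e\<bar> * R * T * \<bar>t - r\<bar>) * (norm k * (norm (p k))\<^sup>2)" for k
  proof -
    let ?a = "cis (k \<bullet> \<xi> t) * p k" and ?b = "cis (k \<bullet> \<xi> r) * p k"
    have "norm (?a - ?b) = norm (cis (k \<bullet> \<xi> t) - cis (k \<bullet> \<xi> r)) * norm (p k)"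
      by (simp add: norm_mult flip: left_diff_distrib)
    also have "\<dots> \<le> norm k * norm (\<xi> t - \<xi> r) * norm (p k)"
      by (intro mult_right_mono norm_cis_inner_diff_le) auto
    finally have ab: "norm (?a - ?b) \<le> norm k * norm (\<xi> t - \<xi> r) * norm (p k)" .
    have "norm (field_symbol \<xi> v r k) \<le> norm (w0 k) + \<bar>e\<bar> * norm (p k) * (R * \<bar>r - t0\<bar>)"
      using r closed_segment_real_abs_le[of _ t0 r] by (intro field_symbol_bound c b) (meson order_trans)
    also have "\<dots> \<le> norm (w0 k) + \<bar>e\<bar> * norm (p k) * (R * T)"
      using r R by (intro add_left_mono mult_left_mono) auto
    finally have 1: "norm (cscale (?a - ?b) (field_symbol \<xi> v r k)) \<le> (norm k * norm (\<xi> t - \<xi> r) * norm (p k)) * (norm (w0 k) + \<bar>e\<bar> * norm (p k) * (R * T))"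
      unfolding norm_cscale by (intro mult_mono ab) auto
    have "field_symbol \<xi> v t k - field_symbol \<xi> v r k = (maxwell_symbol (t - t0) k (w0 k) - maxwell_symbol (r - t0) k (w0 k))
        + cscale (- (of_real e * cnj (p k))) (kern \<xi> v t k - kern \<xi> v r k)"
      by (simp add: field_symbol_def cscale_simps)
    then have "norm (field_symbol \<xi> v t k - field_symbol \<xi> v r k) \<le> norm (maxwell_symbol (t - t0) k (w0 k) - maxwell_symbol (r - t0) k (w0 k))
        + (\<bar>e\<bar> * norm (p k)) * norm (kern \<xi> v t k - kern \<xi> v r k)"
      using norm_triangle_ineq[of "maxwell_symbol (t - t0) k (w0 k) - maxwell_symbol (r - t0) k (w0 k)"
          "cscale (- (of_real e * cnj (p k))) (kern \<xi> v t k - kern \<xi> v r k)"]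
      by (simp add: norm_cscale norm_mult)
    also have "\<dots> \<le> 12 * norm k * norm (w0 k) * \<bar>t - r\<bar> + (\<bar>e\<bar> * norm (p k)) * ((R + 12 * norm k * R * T) * \<bar>t - r\<bar>)"
      using maxwell_symbol_lipschitz[of "t - t0" k "w0 k" "r - t0"]
      by (intro add_mono mult_left_mono kern_time_lipschitz c b t r) auto
    finally have 2: "norm (cscale ?a (field_symbol \<xi> v t k - field_symbol \<xi> v r k))
        \<le> norm (p k) * (12 * norm k * norm (w0 k) * \<bar>t - r\<bar> + (\<bar>e\<bar> * norm (p k)) * ((R + 12 * norm k * R * T) * \<bar>t - r\<bar>))"
      unfolding norm_cscale norm_mult norm_cis mult_1 by (rule mult_left_mono) simp
    have "norm (smeared_integrand \<xi> v t k - smeared_integrand \<xi> v r k) \<le> norm (cscale (?a - ?b) (field_symbol \<xi> v r k)) + norm (cscale ?a (field_symbol \<xi> v t k - field_symbol \<xi> v r k))"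
      unfolding smeared_integrand_def cscale_diff_split by (rule norm_triangle_ineq)
    also have "\<dots> \<le> (norm k * norm (\<xi> t - \<xi> r) * norm (p k)) * (norm (w0 k) + \<bar>e\<bar> * norm (p k) * (R * T))
       + norm (p k) * (12 * norm k * norm (w0 k) * \<bar>t - r\<bar> + (\<bar>e\<bar> * norm (p k)) * ((R + 12 * norm k * R * T) * \<bar>t - r\<bar>))"
      by (intro add_mono 1 2)
    also have "\<dots> = 0 * (norm (p k) * norm (w0 k))
      + (norm (\<xi> t - \<xi> r) + 12 * \<bar>t - r\<bar>) * (norm k * norm (p k) * norm (w0 k))
      + (\<bar>e\<bar> * R * \<bar>t - r\<bar>) * (norm (p k))\<^sup>2
      + (norm (\<xi> t - \<xi> r) * \<bar>e\<bar> * R * T + 12 * \<bar>e\<bar> * R * T * \<bar>t - r\<bar>) * (norm k * (norm (p k))\<^sup>2)"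
      by (simp add: algebra_simps power2_eq_square)
    finally show ?thesis .
  qed
  from integral_bound_combination(2)[OF borel_measurable_diff[OF smeared_integrand_measurable[OF c] smeared_integrand_measurable[OF c]] this]
  show ?thesis unfolding smeared_field_def
    by (simp add: Bochner_Integration.integral_diff smeared_integrand_integrable c algebra_simps)
qed

lemma smeared_field_continuous:
  assumes c: "continuous_on UNIV \<xi>" "continuous_on UNIV v"
  shows "continuous_on UNIV (smeared_field \<xi> v)"
proof (rule continuous_at_imp_continuous_on, rule ballI)
  fix t
  define T where "T = \<bar>t - t0\<bar> + 1"
  obtain R where R: "\<And>\<sigma>. \<bar>\<sigma> - t0\<bar> \<le> T \<Longrightarrow> norm (v \<sigma>) \<le> R"
    using continuous_bounded_interval[OF c(2), of t0 T] by blast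
  have "((\<lambda>r. smeared_field \<xi> v r - smeared_field \<xi> v t) \<longlongrightarrow> 0) (at t)"
  proof (rule Lim_null_comparison)
    show "\<forall>\<^sub>F r in at t. norm (smeared_field \<xi> v r - smeared_field \<xi> v t) \<le> norm (\<xi> r - \<xi> t) * (Ckpw + \<bar>e\<bar> * R * T * Ckpp)
        + \<bar>r - t\<bar> * (12 * Ckpw + \<bar>e\<bar> * R * Cpp + 12 * \<bar>e\<bar> * R * T * Ckpp)"
      unfolding eventually_at
      by (intro exI[of _ 1] conjI ballI impI smeared_field_time_lipschitz c R) (auto simp: T_def dist_real_def)
    have "((\<lambda>r. norm (\<xi> r - \<xi> t) * (Ckpw + \<bar>e\<bar> * R * T * Ckpp)
        + \<bar>r - t\<bar> * (12 * Ckpw + \<bar>e\<bar> * R * Cpp + 12 * \<bar>e\<bar> * R * T * Ckpp)) \<longlongrightarrow> norm (\<xi> t - \<xi> t) * (Ckpw + \<bar>e\<bar> * R * T * Ckpp)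
        + \<bar>t - t\<bar> * (12 * Ckpw + \<bar>e\<bar> * R * Cpp + 12 * \<bar>e\<bar> * R * T * Ckpp)) (at t)"
      using c(1) by (intro tendsto_intros) (auto simp: continuous_on_eq_continuous_at isCont_def)
    then show "((\<lambda>r. norm (\<xi> r - \<xi> t) * (Ckpw + \<bar>e\<bar> * R * T * Ckpp)
        + \<bar>r - t\<bar> * (12 * Ckpw + \<bar>e\<bar> * R * Cpp + 12 * \<bar>e\<bar> * R * T * Ckpp)) \<longlongrightarrow> 0) (at t)" by simp
  qed
  then show "isCont (smeared_field \<xi> v) t" unfolding isCont_def by (simp add: LIM_zero_iff)
qed

section \<open>The force as a functional of the velocity\<close>

definition force :: "(real \<Rightarrow> R3) \<Rightarrow> (real \<Rightarrow> R3) \<Rightarrow> real \<Rightarrow> R3" where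
  "force \<xi> v t = e *\<^sub>R (revec (fst (smeared_field \<xi> v t)) + cross3 (v t) (revec (snd (smeared_field \<xi> v t))))"

definition pos :: "(real \<Rightarrow> R3) \<Rightarrow> real \<Rightarrow> R3" where
  "pos v t = \<xi>0 + oint v t0 t"

lemma pos_has_vector_derivative:
  "continuous_on UNIV v \<Longrightarrow> (pos v has_vector_derivative v t) (at t)"
  unfolding pos_def [abs_def] using oint_has_vector_derivative[of v t0 t]
  by (auto intro!: derivative_eq_intros)

lemma pos_continuous: "continuous_on UNIV v \<Longrightarrow> continuous_on UNIV (pos v)"
  by (rule continuous_at_imp_continuous_on)
    (blast intro: has_vector_derivative_continuous[OF pos_has_vector_derivative])

lemma continuous_on_revec: "continuous_on A f \<Longrightarrow> continuous_on A (\<lambda>x. revec (f x))"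
  unfolding revec_def by (intro continuous_intros)

lemma force_continuous:
  assumes "continuous_on UNIV \<xi>" "continuous_on UNIV v"
  shows "continuous_on UNIV (force \<xi> v)"
  unfolding force_def [abs_def]
  by (intro continuous_intros continuous_on_cross continuous_on_revec smeared_field_continuous assms)

text \<open>Positions are integrals of velocities, so on a time span \<open>T\<close> velocities
  within \<open>c\<close> give positions within \<open>T * c\<close>. The constant depends on the
  speed bound \<open>R\<close> through the source and the magnetic term; this is where only a local
  Lipschitz property survives.\<close>

lemma force_lipschitz:
  assumes "0 \<le> T" "0 \<le> R"
  shows "\<exists>K\<ge>0. \<forall>v w t c. continuous_on UNIV v \<longrightarrow> continuous_on UNIV w \<longrightarrow> \<bar>t - t0\<bar> \<le> T \<longrightarrow>
    (\<forall>\<sigma>\<in>closed_segment t0 t. norm (v \<sigma>) \<le> R \<and> norm (w \<sigma>) \<le> R \<and> norm (v \<sigma> - w \<sigma>) \<le> c) \<longrightarrow>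
    norm (force (pos v) v t - force (pos w) w t) \<le> K * c"
proof -
  \<comment> \<open>\<open>L\<close> is the Lipschitz constant of the smeared field in the velocity
    and \<open>N\<close> a bound for its size; the product rule for the cross product combines them
    to \<open>L + N + R * L\<close>.\<close>
  define L where "L = T * Ckpw + \<bar>e\<bar> * T * Cpp + 2 * \<bar>e\<bar> * T * R * T * Ckpp"
  define N where "N = Cpw + \<bar>e\<bar> * R * T * Cpp"
  have L: "0 \<le> L" "0 \<le> N" using assms consts_nonneg by (auto simp: L_def N_def)
  have "norm (force (pos v) v t - force (pos w) w t) \<le> \<bar>e\<bar> * (L + N + R * L) * c"
    if v: "continuous_on UNIV v" and w: "continuous_on UNIV w" and t: "\<bar>t - t0\<bar> \<le> T"
      and b: "\<forall>\<sigma>\<in>closed_segment t0 t. norm (v \<sigma>) \<le> R \<and> norm (w \<sigma>) \<le> R \<and> norm (v \<sigma> - w \<sigma>) \<le> c" for v w t c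
  proof -
    have tt: "t \<in> closed_segment t0 t" by simp
    have c: "0 \<le> c" using b tt norm_ge_zero order_trans by blast
    have pd: "norm (pos v \<sigma> - pos w \<sigma>) \<le> T * c" if "\<sigma> \<in> closed_segment t0 t" for \<sigma>
    proof -
      have sub: "closed_segment t0 \<sigma> \<subseteq> closed_segment t0 t" using that by (auto simp: closed_segment_eq_real_ivl split: if_splits)
      have "norm (oint (\<lambda>\<tau>. v \<tau> - w \<tau>) t0 \<sigma>) \<le> c * \<bar>\<sigma> - t0\<bar>"
        by (rule norm_oint_le[OF continuous_on_diff[OF v w]]) (use b sub in auto)
      also have "\<dots> \<le> c * T" using closed_segment_real_abs_le[OF that] t c by (intro mult_left_mono) auto
      finally show ?thesis by (simp add: pos_def oint_diff[OF v w] mult.commute)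
    qed
    let ?Zv = "smeared_field (pos v) v t" and ?Zw = "smeared_field (pos w) w t"
    have "norm (?Zv - ?Zw) \<le> (T * c) * Ckpw + (\<bar>e\<bar> * c * \<bar>t - t0\<bar>) * Cpp + (2 * \<bar>e\<bar> * (T * c) * R * \<bar>t - t0\<bar>) * Ckpp"
      by (rule smeared_field_lipschitz) (use b pd pos_continuous v w in auto)
    also have "\<dots> \<le> (T * c) * Ckpw + (\<bar>e\<bar> * c * T) * Cpp + (2 * \<bar>e\<bar> * (T * c) * R * T) * Ckpp"
      using t c assms consts_nonneg by (intro add_mono mult_right_mono mult_left_mono) auto
    also have "\<dots> = L * c" by (simp add: L_def algebra_simps)
    finally have ZL: "norm (?Zv - ?Zw) \<le> L * c" .
    have "norm ?Zv \<le> Cpw + \<bar>e\<bar> * R * \<bar>t - t0\<bar> * Cpp"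
      by (rule norm_smeared_field_le) (use b pos_continuous v in auto)
    also have "\<dots> \<le> N" unfolding N_def using t assms consts_nonneg by (intro add_mono mult_right_mono mult_left_mono) auto
    finally have ZN: "norm ?Zv \<le> N" .
    have f: "norm (revec (fst ?Zv) - revec (fst ?Zw)) \<le> L * c" "norm (revec (snd ?Zv) - revec (snd ?Zw)) \<le> L * c"
    proof -
      have "norm (revec (fst u)) \<le> norm u" "norm (revec (snd u)) \<le> norm u" for u :: amplitude
        using norm_revec_le[of "fst u"] norm_revec_le[of "snd u"]
          norm_fst_le[of "fst u" "snd u"] norm_snd_le[of "snd u" "fst u"] by simp_all
      from order_trans[OF this(1) ZL] order_trans[OF this(2) ZL]
      show "norm (revec (fst ?Zv) - revec (fst ?Zw)) \<le> L * c" "norm (revec (snd ?Zv) - revec (snd ?Zw)) \<le> L * c"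
        by (simp_all only: fst_diff snd_diff revec_diff)
    qed
    have s: "norm (revec (snd ?Zv)) \<le> N"
      using norm_revec_le[of "snd ?Zv"] norm_snd_le[of "snd ?Zv" "fst ?Zv"] ZN by simp
    have e1: "force (pos v) v t - force (pos w) w t = e *\<^sub>R ((revec (fst ?Zv) - revec (fst ?Zw))
       + (cross3 (v t - w t) (revec (snd ?Zv)) + cross3 (w t) (revec (snd ?Zv) - revec (snd ?Zw))))"
      by (simp add: force_def left_diff_distrib right_diff_distrib cross3_def vec_eq_iff forall_3 algebra_simps)
    have "norm (cross3 (v t - w t) (revec (snd ?Zv))) \<le> c * N"
      using b tt s by (intro order_trans[OF norm_cross3_le] mult_mono) (auto simp: c)
    moreover have "norm (cross3 (w t) (revec (snd ?Zv) - revec (snd ?Zw))) \<le> R * (L * c)"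
      using b tt f assms by (intro order_trans[OF norm_cross3_le] mult_mono) auto
    ultimately have "norm ((revec (fst ?Zv) - revec (fst ?Zw))
       + (cross3 (v t - w t) (revec (snd ?Zv)) + cross3 (w t) (revec (snd ?Zv) - revec (snd ?Zw)))) \<le> L * c + (c * N + R * (L * c))"
      using f by (intro order_trans[OF norm_triangle_ineq] add_mono) auto
    then have "norm (force (pos v) v t - force (pos w) w t) \<le> \<bar>e\<bar> * (L * c + (c * N + R * (L * c)))"
      unfolding e1 norm_scaleR real_norm_def by (rule mult_left_mono) simp
    then show ?thesis by (simp add: algebra_simps)
  qed
  moreover have "0 \<le> \<bar>e\<bar> * (L + N + R * L)" using L assms by simp
  ultimately show ?thesis by blast
qed

text \<open>The magnetic part of the force is orthogonal to the velocity; this makes the a priori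
  bound linear and the solution global.\<close>

lemma inner_force_le:
  assumes c: "continuous_on UNIV \<xi>" "continuous_on UNIV v"
    and b: "\<And>\<sigma>. \<sigma> \<in> closed_segment t0 t \<Longrightarrow> norm (v \<sigma>) \<le> R" and x: "x = \<mu> *\<^sub>R v t"
  shows "\<bar>x \<bullet> force \<xi> v t\<bar> \<le> norm x * (\<bar>e\<bar> * (Cpw + \<bar>e\<bar> * R * \<bar>t - t0\<bar> * Cpp))"
proof -
  have "x \<bullet> cross3 (v t) (revec (snd (smeared_field \<xi> v t))) = 0"
    unfolding x by (simp add: dot_cross_self)
  then have "x \<bullet> force \<xi> v t = e * (x \<bullet> revec (fst (smeared_field \<xi> v t)))"
    by (simp add: force_def inner_add_right)
  also have "\<bar>\<dots>\<bar> \<le> \<bar>e\<bar> * (norm x * norm (smeared_field \<xi> v t))"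
  proof -
    have "\<bar>x \<bullet> revec (fst (smeared_field \<xi> v t))\<bar> \<le> norm x * norm (revec (fst (smeared_field \<xi> v t)))" by (rule Cauchy_Schwarz_ineq2)
    also have "\<dots> \<le> norm x * norm (smeared_field \<xi> v t)"
      using norm_revec_le[of "fst (smeared_field \<xi> v t)"] norm_fst_le[of "fst (smeared_field \<xi> v t)" "snd (smeared_field \<xi> v t)"]
      by (intro mult_left_mono) auto
    finally show ?thesis unfolding abs_mult by (rule mult_left_mono) simp
  qed
  also have "\<dots> \<le> \<bar>e\<bar> * (norm x * (Cpw + \<bar>e\<bar> * R * \<bar>t - t0\<bar> * Cpp))"
    by (intro mult_left_mono norm_smeared_field_le[OF c b]) auto
  finally show ?thesis by (simp add: mult_ac)
qed

text \<open>The radius at which velocities are truncated. It solves the linear differential equation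
  that corresponds to the a priori bound for the speed, so that the truncation is inactive along the
  solution of the truncated problem.\<close>

definition \<rho> :: "real \<Rightarrow> real" where
  "\<rho> r = sqrt (1 + (norm v0)\<^sup>2) * exp (\<bar>e\<bar> * Cpw * r + e\<^sup>2 * Cpp * r\<^sup>2 / 2)"

lemma \<rho>_pos: "0 < \<rho> r"
  by (simp add: \<rho>_def add_pos_nonneg)

lemma \<rho>_mono: "0 \<le> r \<Longrightarrow> r \<le> q \<Longrightarrow> \<rho> r \<le> \<rho> q"
  unfolding \<rho>_def using consts_nonneg
  by (auto intro!: mult_left_mono add_mono power_mono divide_right_mono)

lemma \<rho>_ge_1: "0 \<le> r \<Longrightarrow> 1 \<le> \<rho> r"
proof -
  assume "0 \<le> r"
  then have "1 * 1 \<le> \<rho> r" unfolding \<rho>_def using consts_nonneg by (intro mult_mono) auto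
  then show ?thesis by simp
qed

lemma \<rho>_deriv: "(\<rho> has_real_derivative (\<bar>e\<bar> * Cpw + e\<^sup>2 * Cpp * r) * \<rho> r) (at r)"
  unfolding \<rho>_def [abs_def] by (auto intro!: derivative_eq_intros simp: algebra_simps)

text \<open>The truncated velocity is at most \<open>\<rho>\<close>, so the growth of the speed is
  bounded by an expression in \<open>\<rho>\<close> alone, which is exactly the derivative of
  \<open>\<rho>\<close>. Comparing derivatives then suffices.\<close>

lemma a_priori_bound:
  assumes v: "continuous_on UNIV v" and w: "w = (\<lambda>t. truncate (\<rho> \<bar>t - t0\<bar>) (v t))"
    and eq: "\<And>t. v t = v0 + oint (force (pos w) w) t0 t"
  shows "norm (v t) \<le> \<rho> \<bar>t - t0\<bar>"
proof -
  have \<rho>c: "continuous_on UNIV (\<lambda>t. \<rho> \<bar>t - t0\<bar>)"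
    unfolding \<rho>_def by (intro continuous_intros) simp
  have wc: "continuous_on UNIV w"
    unfolding w by (intro continuous_on_truncate \<rho>c v \<rho>_pos)
  let ?F = "force (pos w) w"
  have Fc: "continuous_on UNIV ?F" by (intro force_continuous pos_continuous wc)
  have dv: "(v has_vector_derivative ?F t) (at t)" for t
  proof -
    have "((\<lambda>t. v0 + oint ?F t0 t) has_vector_derivative ?F t) (at t)"
      using oint_has_vector_derivative[OF Fc, of t0 t] by (auto intro!: derivative_eq_intros)
    moreover have "v = (\<lambda>t. v0 + oint ?F t0 t)" using eq by (rule ext)
    ultimately show ?thesis by simp
  qed
  \<comment> \<open>A smooth upper bound for the speed: the summand 1 keeps the root differentiable
    where the velocity vanishes, and it matches the initial value of \<open>\<rho>\<close>.\<close>
  define y where "y t = sqrt (1 + v t \<bullet> v t)" for t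
  have y1: "0 < 1 + v t \<bullet> v t" for t by (simp add: add_pos_nonneg)
  have ypos: "0 < y t" "norm (v t) \<le> y t" for t
    using y1[of t] by (auto simp: y_def norm_eq_sqrt_inner)
  have dy: "(y has_real_derivative (v t \<bullet> ?F t) / y t) (at t)" for t
  proof -
    have "((\<lambda>t. 1 + v t \<bullet> v t) has_real_derivative 2 * (v t \<bullet> ?F t)) (at t)"
      using has_derivative_add[OF has_derivative_const[of 1]
          has_derivative_inner[OF dv[of t, unfolded has_vector_derivative_def] dv[of t, unfolded has_vector_derivative_def]]]
      unfolding has_field_derivative_def
      by (rule has_derivative_eq_rhs) (auto simp: inner_commute fun_eq_iff)
    from DERIV_chain2[OF DERIV_real_sqrt[OF y1[of t]] this]
    show ?thesis unfolding y_def by (simp add: field_simps)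
  qed
  have bd: "\<bar>(v t \<bullet> ?F t) / y t\<bar> \<le> (\<bar>e\<bar> * Cpw + e\<^sup>2 * Cpp * \<bar>t - t0\<bar>) * \<rho> \<bar>t - t0\<bar>" for t
  proof -
    let ?r = "\<bar>t - t0\<bar>"
    \<comment> \<open>The magnetic force is orthogonal to the truncated velocity \<open>w t\<close>;
      it stays orthogonal to \<open>v t\<close> since the two are parallel.\<close>
    have x: "v t = (max (\<rho> ?r) (norm (v t)) / \<rho> ?r) *\<^sub>R w t"
      using \<rho>_pos[of ?r] by (simp add: w truncate_def)
    have "\<bar>v t \<bullet> ?F t\<bar> \<le> norm (v t) * (\<bar>e\<bar> * (Cpw + \<bar>e\<bar> * \<rho> ?r * \<bar>t - t0\<bar> * Cpp))"
    proof (rule inner_force_le[OF pos_continuous[OF wc] wc _ x])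
      fix \<sigma> assume "\<sigma> \<in> closed_segment t0 t"
      then have "\<rho> \<bar>\<sigma> - t0\<bar> \<le> \<rho> ?r" by (intro \<rho>_mono closed_segment_real_abs_le) auto
      then show "norm (w \<sigma>) \<le> \<rho> ?r" unfolding w using norm_truncate_le[OF \<rho>_pos] order_trans by blast
    qed
    also have "\<dots> \<le> y t * (\<bar>e\<bar> * (Cpw * \<rho> ?r + \<bar>e\<bar> * \<rho> ?r * \<bar>t - t0\<bar> * Cpp))"
    proof (rule mult_mono[OF ypos(2) mult_left_mono[OF add_right_mono abs_ge_zero]])
      \<comment> \<open>Since \<open>\<rho>\<close> is at least 1, the contribution of the initial
        field can be multiplied by it; the bound becomes homogeneous in \<open>\<rho>\<close>, as
        its differential equation requires.\<close>
      show "Cpw \<le> Cpw * \<rho> ?r"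
        using mult_left_mono[OF \<rho>_ge_1[of ?r] consts_nonneg(1)] by simp
      show "0 \<le> y t" using ypos(1) by (rule less_imp_le)
      show "0 \<le> \<bar>e\<bar> * (Cpw + \<bar>e\<bar> * \<rho> ?r * \<bar>t - t0\<bar> * Cpp)"
        by (intro mult_nonneg_nonneg add_nonneg_nonneg consts_nonneg abs_ge_zero less_imp_le[OF \<rho>_pos])
    qed
    also have "\<dots> = ((\<bar>e\<bar> * Cpw + e\<^sup>2 * Cpp * ?r) * \<rho> ?r) * y t"
    proof -
      have "y t * (a * (Cpw * \<rho> ?r + a * \<rho> ?r * ?r * Cpp)) = ((a * Cpw + (a * a) * Cpp * ?r) * \<rho> ?r) * y t" for a
        by (simp add: algebra_simps)
      moreover have "e\<^sup>2 = \<bar>e\<bar> * \<bar>e\<bar>" by (simp add: power2_eq_square)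
      ultimately show ?thesis by (simp only:)
    qed
    finally show ?thesis using ypos(1)[of t] by (simp add: pos_divide_le_eq abs_of_pos)
  qed
  have y0: "y t0 = \<rho> 0"
    using eq[of t0] by (simp add: y_def \<rho>_def oint_def power2_norm_eq_inner)
  have "y t \<le> \<rho> \<bar>t - t0\<bar>"
  proof (cases "t0 \<le> t")
    case True
    have "y t - \<rho> (t - t0) \<le> y t0 - \<rho> (t0 - t0)"
    proof (rule DERIV_nonpos_imp_nonincreasing[OF True])
      fix r assume r: "t0 \<le> r" "r \<le> t"
      have "((\<lambda>r. y r - \<rho> (r - t0)) has_real_derivative (v r \<bullet> ?F r) / y r - (\<bar>e\<bar> * Cpw + e\<^sup>2 * Cpp * (r - t0)) * \<rho> (r - t0) * 1) (at r)"
        by (intro DERIV_diff dy DERIV_chain2[OF \<rho>_deriv]) (auto intro!: derivative_eq_intros)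
      moreover have "(v r \<bullet> ?F r) / y r - (\<bar>e\<bar> * Cpw + e\<^sup>2 * Cpp * (r - t0)) * \<rho> (r - t0) * 1 \<le> 0"
        using order_trans[OF abs_ge_self bd[of r]] r by simp
      ultimately show "\<exists>z. ((\<lambda>r. y r - \<rho> (r - t0)) has_real_derivative z) (at r) \<and> z \<le> 0" by blast
    qed
    then show ?thesis using True y0 by simp
  next
    case False
    then have le: "t \<le> t0" by simp
    \<comment> \<open>For times before \<open>t0\<close> the comparison runs backwards:
      \<open>\<rho> (t0 - r)\<close> decreases in \<open>r\<close>, and the lower bound for the
      derivative of \<open>y\<close> is used.\<close>
    have "y t - \<rho> (t0 - t) \<le> y t0 - \<rho> (t0 - t0)"
    proof (rule DERIV_nonneg_imp_nondecreasing[OF le])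
      fix r assume r: "t \<le> r" "r \<le> t0"
      have "((\<lambda>r. y r - \<rho> (t0 - r)) has_real_derivative (v r \<bullet> ?F r) / y r - (\<bar>e\<bar> * Cpw + e\<^sup>2 * Cpp * (t0 - r)) * \<rho> (t0 - r) * -1) (at r)"
        by (intro DERIV_diff dy DERIV_chain2[OF \<rho>_deriv]) (auto intro!: derivative_eq_intros)
      moreover have "(v r \<bullet> ?F r) / y r - (\<bar>e\<bar> * Cpw + e\<^sup>2 * Cpp * (t0 - r)) * \<rho> (t0 - r) * -1 \<ge> 0"
        using order_trans[OF abs_ge_minus_self bd[of r]] r by simp
      ultimately show "\<exists>z. ((\<lambda>r. y r - \<rho> (t0 - r)) has_real_derivative z) (at r) \<and> 0 \<le> z" by blast
    qed
    then show ?thesis using le y0 by simp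
  qed
  then show ?thesis using ypos(2)[of t] by linarith
qed

text \<open>Truncation makes the force Lipschitz on each time interval, since there the radius is at
  most \<open>\<rho> T\<close>. The fixed point satisfies the a priori bound, so truncation does
  nothing to it and it solves the original equation.\<close>

lemma particle_exists: "\<exists>v. continuous_on UNIV v \<and> (\<forall>t. v t = v0 + oint (force (pos v) v) t0 t)"
proof -
  define P where "P v t = truncate (\<rho> \<bar>t - t0\<bar>) (v t)" for v :: "real \<Rightarrow> R3" and t
  have \<rho>c: "continuous_on UNIV (\<lambda>t. \<rho> \<bar>t - t0\<bar>)"
    unfolding \<rho>_def by (intro continuous_intros) simp
  have Pc: "continuous_on UNIV (P v)" if "continuous_on UNIV v" for v
    unfolding P_def [abs_def] by (intro continuous_on_truncate \<rho>c that \<rho>_pos)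
  have "\<exists>v. continuous_on UNIV v \<and> (\<forall>t. v t = v0 + oint (force (pos (P v)) (P v)) t0 t)"
  proof (rule volterra_exists)
    show "continuous_on UNIV (force (pos (P v)) (P v))" if "continuous_on UNIV v" for v
      by (intro force_continuous pos_continuous Pc that)
    fix T :: real assume T: "0 \<le> T"
    obtain K where K: "0 \<le> K" "\<And>v w t c. continuous_on UNIV v \<Longrightarrow> continuous_on UNIV w \<Longrightarrow> \<bar>t - t0\<bar> \<le> T \<Longrightarrow>
      (\<forall>\<sigma>\<in>closed_segment t0 t. norm (v \<sigma>) \<le> \<rho> T \<and> norm (w \<sigma>) \<le> \<rho> T \<and> norm (v \<sigma> - w \<sigma>) \<le> c) \<Longrightarrow>
      norm (force (pos v) v t - force (pos w) w t) \<le> K * c"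
      using force_lipschitz[OF T less_imp_le[OF \<rho>_pos, of T]] by blast
    have "norm (force (pos (P v)) (P v) t - force (pos (P w)) (P w) t) \<le> (2 * K) * c"
      if v: "continuous_on UNIV v" and w: "continuous_on UNIV w" and t: "\<bar>t - t0\<bar> \<le> T"
        and b: "\<forall>\<sigma>\<in>closed_segment t0 t. norm (v \<sigma> - w \<sigma>) \<le> c" for v w t c
    proof -
      have "norm (force (pos (P v)) (P v) t - force (pos (P w)) (P w) t) \<le> K * (2 * c)"
      proof (rule K(2)[OF Pc[OF v] Pc[OF w] t], intro ballI conjI)
        fix \<sigma> assume \<sigma>: "\<sigma> \<in> closed_segment t0 t"
        have le: "\<rho> \<bar>\<sigma> - t0\<bar> \<le> \<rho> T" using closed_segment_real_abs_le[OF \<sigma>] t by (intro \<rho>_mono) auto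
        show "norm (P v \<sigma>) \<le> \<rho> T" "norm (P w \<sigma>) \<le> \<rho> T"
          unfolding P_def using norm_truncate_le[OF \<rho>_pos] le by (meson order_trans)+
        have "norm (P v \<sigma> - P w \<sigma>) \<le> 2 * norm (v \<sigma> - w \<sigma>)" unfolding P_def by (rule truncate_lipschitz[OF \<rho>_pos])
        also have "\<dots> \<le> 2 * c" using b \<sigma> by simp
        finally show "norm (P v \<sigma> - P w \<sigma>) \<le> 2 * c" .
      qed
      then show ?thesis by simp
    qed
    then show "\<exists>K\<ge>0. \<forall>v w t c. continuous_on UNIV v \<longrightarrow> continuous_on UNIV w \<longrightarrow> \<bar>t - t0\<bar> \<le> T \<longrightarrow>
        (\<forall>\<sigma>\<in>closed_segment t0 t. norm (v \<sigma> - w \<sigma>) \<le> c) \<longrightarrow>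
        norm (force (pos (P v)) (P v) t - force (pos (P w)) (P w) t) \<le> K * c"
      using K(1) by (intro exI[of _ "2 * K"]) simp
  qed
  then obtain v where v: "continuous_on UNIV v" "\<And>t. v t = v0 + oint (force (pos (P v)) (P v)) t0 t" by blast
  have Pv: "P v = (\<lambda>t. truncate (\<rho> \<bar>t - t0\<bar>) (v t))" by (rule ext) (simp add: P_def)
  have "norm (v t) \<le> \<rho> \<bar>t - t0\<bar>" for t by (rule a_priori_bound[OF v(1) Pv v(2)])
  then have "P v = v" by (intro ext) (simp add: P_def truncate_id \<rho>_pos)
  then show ?thesis using v by metis
qed

text \<open>Two given continuous velocities are bounded on every compact interval, so the local
  Lipschitz bound applies to them directly.\<close>

lemma particle_unique:
  assumes v: "continuous_on UNIV v" "\<And>t. v t = v0 + oint (force (pos v) v) t0 t"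
    and w: "continuous_on UNIV w" "\<And>t. w t = v0 + oint (force (pos w) w) t0 t"
  shows "v = w"
proof (rule volterra_unique[OF v(1) w(1) _ _ _ v(2) w(2)])
  show "continuous_on UNIV (force (pos v) v)" "continuous_on UNIV (force (pos w) w)"
    by (intro force_continuous pos_continuous v w)+
  fix T :: real assume T: "0 \<le> T"
  obtain R1 where R1: "0 \<le> R1" "\<And>t. \<bar>t - t0\<bar> \<le> T \<Longrightarrow> norm (v t) \<le> R1"
    using continuous_bounded_interval[OF v(1), of t0 T] by blast
  obtain R2 where R2: "0 \<le> R2" "\<And>t. \<bar>t - t0\<bar> \<le> T \<Longrightarrow> norm (w t) \<le> R2"
    using continuous_bounded_interval[OF w(1), of t0 T] by blast
  define R where "R = max R1 R2"
  have "0 \<le> R" using R1(1) by (simp add: R_def)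
  then obtain K where K: "0 \<le> K" "\<And>v w t c. continuous_on UNIV v \<Longrightarrow> continuous_on UNIV w \<Longrightarrow> \<bar>t - t0\<bar> \<le> T \<Longrightarrow>
      (\<forall>\<sigma>\<in>closed_segment t0 t. norm (v \<sigma>) \<le> R \<and> norm (w \<sigma>) \<le> R \<and> norm (v \<sigma> - w \<sigma>) \<le> c) \<Longrightarrow>
      norm (force (pos v) v t - force (pos w) w t) \<le> K * c"
    using force_lipschitz[OF T, of R] by blast
  have "norm (force (pos v) v t - force (pos w) w t) \<le> K * c"
    if t: "\<bar>t - t0\<bar> \<le> T" and b: "\<forall>\<sigma>\<in>closed_segment t0 t. norm (v \<sigma> - w \<sigma>) \<le> c" for t c
  proof (rule K(2)[OF v(1) w(1) t], intro ballI conjI)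
    fix \<sigma> assume \<sigma>: "\<sigma> \<in> closed_segment t0 t"
    then have "\<bar>\<sigma> - t0\<bar> \<le> T" using closed_segment_real_abs_le t by fastforce
    then show "norm (v \<sigma>) \<le> R" "norm (w \<sigma>) \<le> R" using R1(2)[of \<sigma>] R2(2)[of \<sigma>] by (auto simp: R_def)
    show "norm (v \<sigma> - w \<sigma>) \<le> c" using b \<sigma> by blast
  qed
  then show "\<exists>K\<ge>0. \<forall>t c. \<bar>t - t0\<bar> \<le> T \<longrightarrow> (\<forall>\<sigma>\<in>closed_segment t0 t. norm (v \<sigma> - w \<sigma>) \<le> c) \<longrightarrow>
      norm (force (pos v) v t - force (pos w) w t) \<le> K * c"
    using K(1) by blast
qed

end

section \<open>The Maxwell-Newton system\<close>

lemma weighted_L2_mult_norm: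
  assumes "weighted_L2 (\<sigma> + 1) f"
  shows "weighted_L2 \<sigma> (\<lambda>k. norm k * norm (f k) :: real)"
proof -
  have [measurable]: "f \<in> borel_measurable borel" using assms by (simp add: weighted_L2_def)
  have e: "norm k powr (2 * \<sigma>) * (norm (norm k * norm (f k) :: real))\<^sup>2 = norm k powr (2 * (\<sigma> + 1)) * (norm (f k))\<^sup>2" for k :: R3
  proof (cases "k = 0")
    case False
    have "norm k powr (2 * (\<sigma> + 1)) = norm k powr (2 * \<sigma>) * (norm k)\<^sup>2"
      using False by (simp add: powr_add distrib_left powr_numeral)
    then show ?thesis by (simp add: power_mult_distrib)
  qed simp
  have "integrable lborel (\<lambda>k. norm k powr (2 * \<sigma>) * (norm (norm k * norm (f k) :: real))\<^sup>2)"
    unfolding e using assms by (simp add: weighted_L2_def)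
  then show ?thesis unfolding weighted_L2_def by simp
qed

lemma weighted_L2_norm: "weighted_L2 \<sigma> f \<Longrightarrow> weighted_L2 \<sigma> (\<lambda>k. norm (f k))"
  by (auto simp: weighted_L2_def)

text \<open>The duality between Sobolev orders \<open>- \<sigma>\<close> and
  \<open>\<sigma>\<close>: the reciprocal weights cancel in the product, except at the origin where
  both are 0 by the convention for \<open>powr\<close>.\<close>

lemma weighted_L2_dual_integrable:
  fixes f g :: "R3 \<Rightarrow> real"
  assumes f: "weighted_L2 (- \<sigma>) f" and g: "weighted_L2 \<sigma> g"
  shows "integrable lborel (\<lambda>k. f k * g k)"
proof (rule Bochner_Integration.integrable_bound)
  have [measurable]: "f \<in> borel_measurable borel" "g \<in> borel_measurable borel" using f g by (auto simp: weighted_L2_def)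
  show "integrable lborel (\<lambda>k. norm k powr (2 * (- \<sigma>)) * (norm (f k))\<^sup>2 + norm k powr (2 * \<sigma>) * (norm (g k))\<^sup>2)"
    using f g unfolding weighted_L2_def by (intro Bochner_Integration.integrable_add) auto
  show "(\<lambda>k. f k * g k) \<in> borel_measurable lborel" by simp
  show "AE k in lborel. norm (f k * g k) \<le> norm (norm k powr (2 * (- \<sigma>)) * (norm (f k))\<^sup>2 + norm k powr (2 * \<sigma>) * (norm (g k))\<^sup>2)"
    using AE_lborel_nonzero
  proof eventually_elim
    fix k :: R3 assume k: "k \<noteq> 0"
    define a where "a = norm k powr (- \<sigma>) * \<bar>f k\<bar>"
    define b where "b = norm k powr \<sigma> * \<bar>g k\<bar>"
    have "norm k powr (- \<sigma>) * norm k powr \<sigma> = 1" using k by (simp flip: powr_add)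
    then have "\<bar>f k * g k\<bar> = a * b" by (simp add: a_def b_def abs_mult mult_ac flip: mult.assoc)
    also have "\<dots> \<le> a\<^sup>2 + b\<^sup>2"
      using sum_squares_bound[of a b] zero_le_power2[of a] zero_le_power2[of b] by linarith
    also have "a\<^sup>2 = norm k powr (2 * (- \<sigma>)) * (norm (f k))\<^sup>2"
      unfolding a_def power_mult_distrib using k by (simp add: powr_power mult.commute)
    also have "b\<^sup>2 = norm k powr (2 * \<sigma>) * (norm (g k))\<^sup>2"
      unfolding b_def power_mult_distrib using k by (simp add: powr_power mult.commute)
    finally show "norm (f k * g k) \<le> norm (norm k powr (2 * (- \<sigma>)) * (norm (f k))\<^sup>2 + norm k powr (2 * \<sigma>) * (norm (g k))\<^sup>2)"
      by simp
  qed
qed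

lemma has_oriented_integral_norm_iff:
  fixes f :: "real \<Rightarrow> 'a::banach"
  assumes "continuous_on UNIV f"
  shows "has_oriented_integral norm f a b I \<longleftrightarrow> I = oint f a b"
proof -
  have i: "f integrable_on {x..y}" for x y
    using assms by (intro integrable_continuous_real) (rule continuous_on_subset, auto)
  have "(f has_integral J) {min a b..max a b} \<longleftrightarrow> J = integral {min a b..max a b} f" for J
    using integrable_integral[OF i] has_integral_unique by blast
  note * = this
  show ?thesis
  proof (cases "a \<le> b")
    case True
    then show ?thesis using *[of I] by (simp add: has_oriented_integral_norm oint_le)
  next
    case False
    then have "has_oriented_integral norm f a b I \<longleftrightarrow> - I = integral {b..a} f"
      using *[of "- I"] by (simp add: has_oriented_integral_norm)
    also have "\<dots> \<longleftrightarrow> I = - integral {b..a} f" by (rule minus_equation_iff[THEN trans, OF eq_commute])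
    also have "- integral {b..a} f = oint f a b" using False by (simp add: oint_def)
    finally show ?thesis .
  qed
qed

lemma oint_Pair:
  assumes "continuous_on UNIV f" "continuous_on UNIV g"
  shows "oint (\<lambda>t. (f t, g t)) a b = (oint f a b, oint g a b)"
proof (rule prod_eqI)
  have c: "continuous_on UNIV (\<lambda>t. (f t, g t))" using assms by (rule continuous_on_Pair)
  show "fst (oint (\<lambda>t. (f t, g t)) a b) = fst (oint f a b, oint g a b)"
    using oint_bounded_linear[OF bounded_linear_fst c, of a b] by simp
  show "snd (oint (\<lambda>t. (f t, g t)) a b) = snd (oint f a b, oint g a b)"
    using oint_bounded_linear[OF bounded_linear_snd c, of a b] by simp
qed

text \<open>The Duhamel integral for the position has the weight \<open>t - \<tau>\<close>; it
  equals the double integral of the force. Subtracting the free motion then leaves the plain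
  integral of the velocity.\<close>

lemma oint_particle_flow:
  fixes F :: "real \<Rightarrow> R3"
  assumes F: "continuous_on UNIV F"
  shows "oint (\<lambda>\<tau>. particle_flow (t - \<tau>) (0, F \<tau>)) t0 t
    = (oint (\<lambda>r. v0 + oint F t0 r) t0 t - (t - t0) *\<^sub>R v0, oint F t0 t)"
proof -
  have tF: "continuous_on UNIV (\<lambda>\<tau>. \<tau> *\<^sub>R F \<tau>)" using F by (intro continuous_intros)
  have sF: "continuous_on UNIV (\<lambda>\<tau>. t *\<^sub>R F \<tau>)" using F by (intro continuous_intros)
  \<comment> \<open>A primitive of \<open>v0 + oint F t0 r\<close>: the two boundary terms
    \<open>r *\<^sub>R F r\<close> from the product rule cancel.\<close>
  define G where "G r = (r - t0) *\<^sub>R v0 + (r *\<^sub>R oint F t0 r - oint (\<lambda>\<tau>. \<tau> *\<^sub>R F \<tau>) t0 r)" for r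
  have "(G has_vector_derivative v0 + oint F t0 r) (at r)" for r
    unfolding G_def using oint_has_vector_derivative[OF F, of t0 r] oint_has_vector_derivative[OF tF, of t0 r]
    by (auto intro!: derivative_eq_intros)
  from oint_FTC[of G, OF this] have "oint (\<lambda>r. v0 + oint F t0 r) t0 t = G t"
    by (simp add: G_def oint_def)
  moreover have "oint (\<lambda>\<tau>. t *\<^sub>R F \<tau>) t0 t = t *\<^sub>R oint F t0 t"
    by (rule oint_bounded_linear[OF bounded_linear_scaleR_right F])
  moreover have "oint (\<lambda>\<tau>. particle_flow (t - \<tau>) (0, F \<tau>)) t0 t
      = (oint (\<lambda>\<tau>. t *\<^sub>R F \<tau> - \<tau> *\<^sub>R F \<tau>) t0 t, oint F t0 t)"
    using oint_Pair[OF continuous_on_diff[OF sF tF] F, of t0 t]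
    by (simp add: particle_flow_def scaleR_left_diff_distrib)
  ultimately show ?thesis by (simp add: oint_diff[OF sF tF] G_def)
qed

locale maxwell_newton =
  fixes e t0 s :: real and \<phi> :: "R3 \<Rightarrow> real" and \<xi>0 v0 :: R3 and E0 B0 :: "tempered ^ 3"
  assumes \<phi>1: "fun_in_hdot (- s) \<phi>" and \<phi>2: "fun_in_hdot (- s + 1) \<phi>"
    and \<phi>3: "fun_in_hdot s \<phi>" and \<phi>4: "fun_in_hdot (s + 1) \<phi>"
    and E0: "E0 \<in> hdot3 s" and B0: "B0 \<in> hdot3 s"
    and div_E0: "has_divergence E0 (charge_density e \<phi> \<xi>0)" and div_B0: "has_divergence B0 0"
begin

definition "p = fhat (of_fun \<phi>)"
definition "w0 = symbol_of (E0, B0)"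

lemma of_fun_phi:
  assumes "fun_in_hdot \<sigma> \<phi>"
  shows "of_fun \<phi> \<in> hdot \<sigma>" "represents (of_fun \<phi>) (\<lambda>x. complex_of_real (\<phi> x))"
proof -
  obtain T where T: "T \<in> hdot \<sigma>" "represents T (\<lambda>x. complex_of_real (\<phi> x))"
    using assms unfolding fun_in_hdot_def by blast
  from of_fun_eq[OF T(2)] T show "of_fun \<phi> \<in> hdot \<sigma>" "represents (of_fun \<phi>) (\<lambda>x. complex_of_real (\<phi> x))"
    by simp_all
qed

lemma p_fourier: "has_fourier (of_fun \<phi>) p"
  unfolding p_def by (rule hdotD(1)[OF of_fun_phi(1)[OF \<phi>3]])

lemma p_slowly_growing: "slowly_growing p"
  unfolding p_def by (rule hdot_slowly_growing[OF of_fun_phi(1)[OF \<phi>3]])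

lemma p_real: "Defs.real_distribution (of_fun \<phi>)"
  by (rule hdotD(3)[OF of_fun_phi(1)[OF \<phi>3]])

lemma p_weighted_L2: "fun_in_hdot \<sigma> \<phi> \<Longrightarrow> weighted_L2 \<sigma> p"
  using hdotD(2)[OF of_fun_phi(1), of \<sigma>] slowly_growing_borel[OF p_slowly_growing] by (simp add: weighted_L2_def p_def)

lemmas w0_symbol = hdot3_pairD[OF E0 B0, folded w0_def]

lemma w0_slowly_growing: "slowly_growing w0"
  using w0_symbol(1) by (simp add: has_symbol_def)

sublocale particle_in_field e t0 p w0 \<xi>0 v0
proof
  show "p \<in> borel_measurable borel" "w0 \<in> borel_measurable borel"
    using p_slowly_growing w0_slowly_growing by (auto intro: slowly_growing_borel)
  \<comment> \<open>Initial data of order \<open>s\<close> are paired with the form factor at order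
    \<open>- s\<close>, and at order \<open>- s + 1\<close> when a factor \<open>norm k\<close> is
    present. For the self-interaction the form factor at order \<open>s\<close> takes the place of
    the data.\<close>
  note p1 = weighted_L2_norm[OF p_weighted_L2[OF \<phi>1]] and p3 = weighted_L2_norm[OF p_weighted_L2[OF \<phi>3]]
    and kp = weighted_L2_mult_norm[OF p_weighted_L2[OF \<phi>2]] and w = weighted_L2_norm[OF w0_symbol(2)]
  show "integrable lborel (\<lambda>k. norm (p k) * norm (w0 k))" by (rule weighted_L2_dual_integrable[OF p1 w])
  show "integrable lborel (\<lambda>k. norm k * norm (p k) * norm (w0 k))" by (rule weighted_L2_dual_integrable[OF kp w])
  show "integrable lborel (\<lambda>k. (norm (p k))\<^sup>2)"
    using weighted_L2_dual_integrable[OF p1 p3] by (simp add: power2_eq_square)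
  show "integrable lborel (\<lambda>k. norm k * (norm (p k))\<^sup>2)"
    using weighted_L2_dual_integrable[OF kp p3] by (simp add: power2_eq_square mult.assoc)
qed

section \<open>Symbols of the current and of the generated field\<close>

lemma translate_symbol:
  "has_fourier (of_fun (\<lambda>x. c * \<phi> (\<xi> - x))) (\<lambda>k. of_real c * cnj (p k) * cis (- (k \<bullet> \<xi>)))"
  by (rule has_fourier_translate_reflect[OF of_fun_phi(2)[OF \<phi>3] p_fourier p_slowly_growing p_real])

definition coupling :: "R3 \<Rightarrow> complex" where
  "coupling k = - (of_real e * cnj (p k))"

lemma norm_coupling: "norm (coupling k) = \<bar>e\<bar> * norm (p k)"
  by (simp add: coupling_def norm_mult)

lemma coupling_measurable: "coupling \<in> borel_measurable borel"
  unfolding coupling_def [abs_def] using cnj_p_measurable by measurable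

lemma continuous_src_k: "continuous_on UNIV (\<lambda>k. src k x v)"
  by (intro continuous_on_src continuous_intros)

lemma coupling_src_measurable: "(\<lambda>k. cscale (coupling k) (src k x v)) \<in> borel_measurable borel"
  by (intro cscale_borel_measurable coupling_measurable borel_measurable_continuous_onI continuous_src_k)

lemma current_symbol: "has_symbol (- current e \<phi> x v, 0) (\<lambda>k. cscale (coupling k) (src k x v))"
proof -
  have "slowly_growing (\<lambda>k. cscale (coupling k) (src k x v))"
    by (rule slowly_growingI_dominated[OF coupling_src_measurable p_slowly_growing p_slowly_growing, where C = "\<bar>e\<bar> * norm v" and D = 0])
      (simp add: norm_cscale norm_coupling norm_src mult_ac)
  moreover have "has_fourier ((- current e \<phi> x v) $ j) (\<lambda>k. fst (cscale (coupling k) (src k x v)) $ j)" for j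
  proof -
    have "(\<lambda>k. fst (cscale (coupling k) (src k x v)) $ j) = (\<lambda>k. - (of_real (e * v $ j) * cnj (p k) * cis (- (k \<bullet> x))))"
      by (simp add: cscale_def src_def coupling_def cvec_def mult_ac)
    then show ?thesis
      using has_fourier_uminus[OF translate_symbol[of "e * v $ j" x]] by (simp add: current_def)
  qed
  moreover have "has_fourier ((0 :: tempered ^ 3) $ j) (\<lambda>k. snd (cscale (coupling k) (src k x v)) $ j)" for j
    using has_fourier_zero by (simp add: cscale_def src_def)
  ultimately show ?thesis unfolding has_symbol_def by simp
qed

lemma propagated_current_symbol:
  "has_symbol (maxwell_group t (- current e \<phi> x v, 0)) (\<lambda>k. cscale (coupling k) (maxwell_symbol t k (src k x v)))"
  using maxwell_group_symbol[OF current_symbol[of x v], of t] by (simp add: maxwell_symbol_cscale)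

lemma propagated_current_weighted_L2: "weighted_L2 s (\<lambda>k. cscale (coupling k) (maxwell_symbol t k (src k x v)))"
proof -
  have "weighted_L2 s (\<lambda>k. cscale (coupling k) (src k x v))"
    by (rule weighted_L2_dominated(1)[OF coupling_src_measurable p_weighted_L2[OF \<phi>3] p_weighted_L2[OF \<phi>3], where C = "\<bar>e\<bar> * norm v" and D = 0])
      (simp add: norm_cscale norm_coupling norm_src mult_ac)
  from weighted_L2_maxwell[OF this, of t] show ?thesis by (simp add: maxwell_symbol_cscale)
qed

lemma kern_bounded:
  assumes "continuous_on UNIV \<xi>" "continuous_on UNIV v"
  obtains M where "0 \<le> M" "\<And>k. norm (kern \<xi> v t k) \<le> M"
proof -
  obtain R where R: "0 \<le> R" "\<And>\<sigma>. \<bar>\<sigma> - t0\<bar> \<le> \<bar>t - t0\<bar> \<Longrightarrow> norm (v \<sigma>) \<le> R"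
    using continuous_bounded_interval[OF assms(2), of t0 "\<bar>t - t0\<bar>"] by blast
  have "norm (kern \<xi> v t k) \<le> R * \<bar>t - t0\<bar>" for k
    by (rule kern_bound[OF assms]) (intro R closed_segment_real_abs_le)
  then show thesis using R(1) by (intro that[of "R * \<bar>t - t0\<bar>"]) auto
qed

lemma field_symbol_altdef: "field_symbol \<xi> v t k = maxwell_symbol (t - t0) k (w0 k) + cscale (coupling k) (kern \<xi> v t k)"
  by (simp add: field_symbol_def coupling_def)

lemma
  assumes c: "continuous_on UNIV \<xi>" "continuous_on UNIV v"
  shows field_symbol_slowly_growing: "slowly_growing (field_symbol \<xi> v t)" and field_symbol_weighted_L2: "weighted_L2 s (field_symbol \<xi> v t)"
proof -
  obtain M where M: "0 \<le> M" "\<And>k. norm (kern \<xi> v t k) \<le> M" using kern_bounded[OF c, of t] by blast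
  have b: "norm (field_symbol \<xi> v t k) \<le> 1 * norm (w0 k) + (\<bar>e\<bar> * M) * norm (p k)" for k
  proof -
    have "norm (field_symbol \<xi> v t k) \<le> norm (w0 k) + (\<bar>e\<bar> * norm (p k)) * norm (kern \<xi> v t k)"
      unfolding field_symbol_altdef by (rule order_trans[OF norm_triangle_ineq]) (simp add: norm_maxwell_symbol norm_cscale norm_coupling)
    also have "\<dots> \<le> norm (w0 k) + (\<bar>e\<bar> * norm (p k)) * M"
      using M by (intro add_left_mono mult_left_mono) auto
    finally show ?thesis by (simp add: mult_ac)
  qed
  show "slowly_growing (field_symbol \<xi> v t)" by (rule slowly_growingI_dominated[OF field_symbol_measurable[OF c] w0_slowly_growing p_slowly_growing b])
  show "weighted_L2 s (field_symbol \<xi> v t)" by (rule weighted_L2_dominated(1)[OF field_symbol_measurable[OF c] w0_symbol(2) p_weighted_L2[OF \<phi>3] b])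
qed

lemma duhamel:
  assumes c: "continuous_on UNIV \<xi>" "continuous_on UNIV v"
  shows "has_oriented_integral (field_norm s) (\<lambda>\<tau>. maxwell_group (t - \<tau>) (- current e \<phi> (\<xi> \<tau>) (v \<tau>), 0)) t0 t
    (of_symbol (field_symbol \<xi> v t) - maxwell_group (t - t0) (E0, B0))"
proof (rule has_oriented_integral_field)
  show "has_symbol (maxwell_group (t - \<tau>) (- current e \<phi> (\<xi> \<tau>) (v \<tau>), 0))
      (\<lambda>k. cscale (coupling k) (maxwell_symbol (t - \<tau>) k (src k (\<xi> \<tau>) (v \<tau>))))" for \<tau>
    by (rule propagated_current_symbol)
  have "oint (\<lambda>\<tau>. cscale (coupling k) (maxwell_symbol (t - \<tau>) k (src k (\<xi> \<tau>) (v \<tau>)))) t0 t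
      = field_symbol \<xi> v t k - maxwell_symbol (t - t0) k (w0 k)" for k
    using oint_bounded_linear[OF bounded_bilinear.bounded_linear_right[OF bounded_bilinear_cscale] kern_integrand_continuous[OF c]]
    by (simp add: field_symbol_altdef kern_def)
  then show "has_symbol (of_symbol (field_symbol \<xi> v t) - maxwell_group (t - t0) (E0, B0))
      (\<lambda>k. oint (\<lambda>\<tau>. cscale (coupling k) (maxwell_symbol (t - \<tau>) k (src k (\<xi> \<tau>) (v \<tau>)))) t0 t)"
    using has_symbol_diff[OF of_symbol_has_symbol[OF field_symbol_slowly_growing[OF c]] maxwell_group_symbol[OF w0_symbol(1)], of t "t - t0"]
    by simp
  \<comment> \<open>The first term accounts for changes of the velocity, the second for the phase of
    the source and for the flow. It lies in the weighted space because the form factor has the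
    orders \<open>s\<close> and \<open>s + 1\<close>.\<close>
  let ?m = "\<lambda>k. norm (p k) + norm k * norm (p k)"
  show "weighted_L2 s ?m"
  proof (rule weighted_L2_dominated(1)[OF _ p_weighted_L2[OF \<phi>3] weighted_L2_mult_norm[OF p_weighted_L2[OF \<phi>4]], of _ 1 1])
    show "?m \<in> borel_measurable borel" by simp
  qed simp
  fix \<epsilon> :: real assume \<epsilon>: "0 < \<epsilon>"
  let ?I = "{min t0 t..max t0 t}"
  obtain R where R: "0 \<le> R" "\<And>\<sigma>. \<bar>\<sigma> - t0\<bar> \<le> \<bar>t - t0\<bar> \<Longrightarrow> norm (v \<sigma>) \<le> R"
    using continuous_bounded_interval[OF c(2), of t0 "\<bar>t - t0\<bar>"] by blast
  have vR: "norm (v \<sigma>) \<le> R" if "\<sigma> \<in> ?I" for \<sigma>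
    using that by (intro R(2)) (auto simp: min_def max_def split: if_splits)
  \<comment> \<open>13 is 12 from the Lipschitz bound of the flow plus 1 from the phase of the
    source, both multiplied by the speed; the last 1 is the change of the velocity itself.\<close>
  define C where "C = \<bar>e\<bar> * (13 * R + 1)"
  have C: "0 \<le> C" using R(1) by (simp add: C_def)
  let ?h = "\<lambda>\<tau>. (\<tau>, \<xi> \<tau>, v \<tau>)"
  have "uniformly_continuous_on ?I ?h"
    by (intro compact_uniformly_continuous continuous_intros continuous_on_subset[OF c(1)] continuous_on_subset[OF c(2)]) auto
  moreover have "0 < \<epsilon> / (C + 1)" using \<epsilon> C by simp
  ultimately obtain \<delta> where \<delta>: "\<delta> > 0" "\<And>x y. x \<in> ?I \<Longrightarrow> y \<in> ?I \<Longrightarrow> dist x y < \<delta> \<Longrightarrow> dist (?h x) (?h y) < \<epsilon> / (C + 1)"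
    unfolding uniformly_continuous_on_def by (metis dist_commute)
  have "norm (cscale (coupling k) (maxwell_symbol (t - x) k (src k (\<xi> x) (v x)))
      - cscale (coupling k) (maxwell_symbol (t - y) k (src k (\<xi> y) (v y)))) \<le> \<epsilon> * norm (?m k)"
    if x: "x \<in> ?I" and y: "y \<in> ?I" and xy: "\<bar>x - y\<bar> < \<delta>" for x y k
  proof -
    define d where "d = dist (?h x) (?h y)"
    have d: "0 \<le> d" "d \<le> \<epsilon> / (C + 1)" using \<delta>(2)[OF x y] xy by (auto simp: d_def dist_real_def)
    have dx: "\<bar>x - y\<bar> \<le> d" using dist_fst_le[of "?h x" "?h y"] by (simp add: d_def dist_real_def)
    have d2: "dist (\<xi> x, v x) (\<xi> y, v y) \<le> d" using dist_snd_le[of "?h x" "?h y"] by (simp add: d_def)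
    have d\<xi>: "norm (\<xi> x - \<xi> y) \<le> d" using dist_fst_le[of "(\<xi> x, v x)" "(\<xi> y, v y)"] d2 by (simp add: dist_norm)
    have dv: "norm (v x - v y) \<le> d" using dist_snd_le[of "(\<xi> x, v x)" "(\<xi> y, v y)"] d2 by (simp add: dist_norm)
    let ?sx = "src k (\<xi> x) (v x)" and ?sy = "src k (\<xi> y) (v y)"
    have "norm (maxwell_symbol (t - x) k ?sx - maxwell_symbol (t - y) k ?sy)
      \<le> norm (maxwell_symbol (t - x) k ?sx - maxwell_symbol (t - y) k ?sx) + norm (maxwell_symbol (t - y) k (?sx - ?sy))"
      unfolding maxwell_symbol_diff
      using norm_triangle_ineq[of "maxwell_symbol (t - x) k ?sx - maxwell_symbol (t - y) k ?sx" "maxwell_symbol (t - y) k ?sx - maxwell_symbol (t - y) k ?sy"]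
      by simp
    also have "\<dots> \<le> 12 * norm k * R * d + (d + norm k * d * R)"
    proof (rule add_mono)
      have "norm (maxwell_symbol (t - x) k ?sx - maxwell_symbol (t - y) k ?sx) \<le> 12 * norm k * norm (v x) * \<bar>x - y\<bar>"
        using maxwell_symbol_lipschitz[of "t - x" k ?sx "t - y"] by (simp add: norm_src abs_minus_commute)
      also have "\<dots> \<le> 12 * norm k * R * d"
        using vR[OF x] dx R(1) by (intro mult_mono mult_nonneg_nonneg) auto
      finally show "norm (maxwell_symbol (t - x) k ?sx - maxwell_symbol (t - y) k ?sx) \<le> 12 * norm k * R * d" .
      have "norm (?sx - ?sy) \<le> norm (v x - v y) + norm k * norm (\<xi> x - \<xi> y) * norm (v y)" by (rule norm_src_diff)
      also have "\<dots> \<le> d + norm k * d * R"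
        using dv d\<xi> vR[OF y] d(1) by (intro add_mono mult_mono mult_nonneg_nonneg) auto
      finally show "norm (maxwell_symbol (t - y) k (?sx - ?sy)) \<le> d + norm k * d * R" by (simp only: norm_maxwell_symbol)
    qed
    also have "\<dots> \<le> (13 * R + 1) * (1 + norm k) * d"
      using d(1) R(1) by (simp add: algebra_simps mult_nonneg_nonneg)
    finally have "norm (maxwell_symbol (t - x) k ?sx - maxwell_symbol (t - y) k ?sy) \<le> (13 * R + 1) * (1 + norm k) * d" .
    then have "norm (cscale (coupling k) (maxwell_symbol (t - x) k ?sx) - cscale (coupling k) (maxwell_symbol (t - y) k ?sy))
        \<le> (\<bar>e\<bar> * norm (p k)) * ((13 * R + 1) * (1 + norm k) * d)"
      unfolding bounded_bilinear.diff_right[OF bounded_bilinear_cscale, symmetric] norm_cscale norm_coupling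
      by (rule mult_left_mono) simp
    also have "\<dots> = (C * d) * ?m k" by (simp add: C_def algebra_simps)
    also have "\<dots> \<le> \<epsilon> * ?m k"
    proof (rule mult_right_mono)
      have "C * d \<le> C * (\<epsilon> / (C + 1))" using d(2) C by (rule mult_left_mono)
      also have "\<dots> \<le> \<epsilon>" using C \<epsilon> by (simp add: field_simps)
      finally show "C * d \<le> \<epsilon>" .
    qed simp
    also have "?m k = norm (?m k)" by simp
    finally show ?thesis .
  qed
  then show "\<exists>\<delta>>0. \<forall>x\<in>?I. \<forall>y\<in>?I. \<bar>x - y\<bar> < \<delta> \<longrightarrow> (\<forall>k. norm (cscale (coupling k) (maxwell_symbol (t - x) k (src k (\<xi> x) (v x)))
      - cscale (coupling k) (maxwell_symbol (t - y) k (src k (\<xi> y) (v y)))) \<le> \<epsilon> * norm (?m k))"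
    using \<delta>(1) by blast
qed

text \<open>The field is recovered from any continuous trajectory, even before the trajectory is
  known to satisfy its own equation. The Maxwell part of the system is thereby solved and
  eliminated.\<close>

lemma duhamel_unique:
  assumes c: "continuous_on UNIV \<xi>" "continuous_on UNIV v"
    and F: "fst F \<in> hdot3 s" "snd F \<in> hdot3 s"
    and int: "has_oriented_integral (field_norm s) (\<lambda>\<tau>. maxwell_group (t - \<tau>) (- current e \<phi> (\<xi> \<tau>) (v \<tau>), 0)) t0 t
      (F - maxwell_group (t - t0) (E0, B0))"
  shows "F = of_symbol (field_symbol \<xi> v t)"
proof -
  have Fs: "has_symbol F (symbol_of F)" "weighted_L2 s (symbol_of F)" using hdot3_pairD[OF F] by simp_all
  note U = maxwell_group_symbol[OF w0_symbol(1), of "t - t0"] weighted_L2_maxwell[OF w0_symbol(2), of "t - t0"]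
  have "F - maxwell_group (t - t0) (E0, B0) = of_symbol (field_symbol \<xi> v t) - maxwell_group (t - t0) (E0, B0)"
    by (rule has_oriented_integral_field_unique[OF propagated_current_symbol propagated_current_weighted_L2
          has_symbol_diff[OF Fs(1) U(1)] weighted_L2_diff[OF Fs(2) U(2)]
          has_symbol_diff[OF of_symbol_has_symbol[OF field_symbol_slowly_growing[OF c]] U(1)] weighted_L2_diff[OF field_symbol_weighted_L2[OF c] U(2)]
          int duhamel[OF c]])
  then show ?thesis by simp
qed

lemma conv_of_symbol:
  assumes g: "has_fourier T g" and i: "integrable lborel (\<lambda>k. cis (k \<bullet> x) * p k * g k)"
  shows "conv (of_fun \<phi>) T x = Re (LINT k|lborel. cis (k \<bullet> x) * p k * g k)"
proof -
  have [measurable]: "fhat T \<in> borel_measurable borel"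
    using has_fourier_borel_measurable[OF has_fourier_fhat[OF g]] .
  have [measurable]: "(\<lambda>k. cis (k \<bullet> x)) \<in> borel_measurable borel"
    by (intro borel_measurable_continuous_onI continuous_intros)
  have "(LINT k|lborel. cis (k \<bullet> x) * p k * fhat T k) = (LINT k|lborel. cis (k \<bullet> x) * p k * g k)"
  proof (rule integral_cong_AE)
    show "AE k in lborel. cis (k \<bullet> x) * p k * fhat T k = cis (k \<bullet> x) * p k * g k"
      using fhat_AE[OF g] by eventually_elim simp
    show "(\<lambda>k. cis (k \<bullet> x) * p k * fhat T k) \<in> borel_measurable lborel" by simp
    show "(\<lambda>k. cis (k \<bullet> x) * p k * g k) \<in> borel_measurable lborel" using i by auto
  qed
  then show ?thesis by (simp add: conv_def p_def)
qed

text \<open>Taking a component is linear and bounded, so it commutes with the integral that defines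
  the smeared field. This links the abstract force functional to the Lorentz force of the
  system.\<close>

lemma em_force_of_field:
  assumes c: "continuous_on UNIV \<xi>" "continuous_on UNIV v" and F: "(E, B) = of_symbol (field_symbol \<xi> v t)"
  shows "em_force e \<phi> E B (\<xi> t) (v t) = force \<xi> v t"
proof -
  have h: "has_symbol (E, B) (field_symbol \<xi> v t)" unfolding F by (rule of_symbol_has_symbol[OF field_symbol_slowly_growing[OF c]])
  have Zi: "integrable lborel (smeared_integrand \<xi> v t)" by (rule smeared_integrand_integrable[OF c])
  have l: "bounded_linear (\<lambda>w :: amplitude. fst w $ j)" "bounded_linear (\<lambda>w :: amplitude. snd w $ j)" for j
    by (intro bounded_linear_compose[OF bounded_linear_vec_nth] bounded_linear_fst bounded_linear_snd)+
  have z: "fst (smeared_integrand \<xi> v t k) $ j = cis (k \<bullet> \<xi> t) * p k * fst (field_symbol \<xi> v t k) $ j"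
    "snd (smeared_integrand \<xi> v t k) $ j = cis (k \<bullet> \<xi> t) * p k * snd (field_symbol \<xi> v t k) $ j" for k j
    by (simp_all add: smeared_integrand_def cscale_def)
  have "conv (of_fun \<phi>) (E $ j) (\<xi> t) = Re (fst (smeared_field \<xi> v t) $ j)" for j
    using conv_of_symbol[of "E $ j" "\<lambda>k. fst (field_symbol \<xi> v t k) $ j" "\<xi> t"] h
      integrable_bounded_linear[OF l(1) Zi, of j] integral_bounded_linear[OF l(1) Zi, of j]
    by (simp add: z has_symbol_def smeared_field_def)
  moreover have "conv (of_fun \<phi>) (B $ j) (\<xi> t) = Re (snd (smeared_field \<xi> v t) $ j)" for j
    using conv_of_symbol[of "B $ j" "\<lambda>k. snd (field_symbol \<xi> v t k) $ j" "\<xi> t"] h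
      integrable_bounded_linear[OF l(2) Zi, of j] integral_bounded_linear[OF l(2) Zi, of j]
    by (simp add: z has_symbol_def smeared_field_def)
  ultimately show ?thesis by (simp add: em_force_def force_def conv3_def revec_def)
qed

lemma field_symbol_hermitian:
  assumes c: "continuous_on UNIV \<xi>" "continuous_on UNIV v"
  shows "AE k in lborel. field_symbol \<xi> v t (- k) = conj_amp (field_symbol \<xi> v t k)"
proof -
  have "AE k in lborel. p (- k) = cnj (p k)"
    using real_distribution_iff_hermitian[OF p_fourier] p_real by blast
  with w0_symbol(3) show ?thesis
    by eventually_elim
      (simp add: field_symbol_def kern_conj[OF c] conj_amp_add conj_amp_cscale maxwell_symbol_conj)
qed

lemma field_symbol_time_lipschitz:
  assumes c: "continuous_on UNIV \<xi>" "continuous_on UNIV v"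
    and b: "\<And>\<sigma>. \<bar>\<sigma> - t0\<bar> \<le> T \<Longrightarrow> norm (v \<sigma>) \<le> R" and t: "\<bar>t - t0\<bar> \<le> T" and r: "\<bar>r - t0\<bar> \<le> T"
  shows "norm (field_symbol \<xi> v t k - field_symbol \<xi> v r k)
    \<le> (12 * norm k * norm (w0 k) + \<bar>e\<bar> * norm (p k) * (R + 12 * norm k * R * T)) * \<bar>t - r\<bar>"
proof -
  have "field_symbol \<xi> v t k - field_symbol \<xi> v r k = (maxwell_symbol (t - t0) k (w0 k) - maxwell_symbol (r - t0) k (w0 k))
      + cscale (coupling k) (kern \<xi> v t k - kern \<xi> v r k)"
    by (simp add: field_symbol_altdef cscale_simps)
  also have "norm \<dots> \<le> 12 * norm k * norm (w0 k) * \<bar>t - r\<bar> + (\<bar>e\<bar> * norm (p k)) * ((R + 12 * norm k * R * T) * \<bar>t - r\<bar>)"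
    using maxwell_symbol_lipschitz[of "t - t0" k "w0 k" "r - t0"] kern_time_lipschitz[OF c b t r, of k]
    by (intro order_trans[OF norm_triangle_ineq] add_mono) (auto simp: norm_cscale norm_coupling intro!: mult_left_mono)
  finally show ?thesis by (simp add: algebra_simps)
qed

text \<open>The Lipschitz bound in time contains \<open>norm k * norm (w0 k)\<close>, which need not
  be square integrable with the weight. It is therefore used only at fixed frequency, and dominated
  convergence does the rest.\<close>

lemma weighted_L2_sq_field_symbol_tendsto:
  assumes c: "continuous_on UNIV \<xi>" "continuous_on UNIV v"
  shows "((\<lambda>\<tau>. weighted_L2_sq s (\<lambda>k. field_symbol \<xi> v \<tau> k - field_symbol \<xi> v t k)) \<longlongrightarrow> 0) (at t)"
  unfolding tendsto_at_iff_sequentially comp_def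
proof (intro allI impI)
  fix X :: "nat \<Rightarrow> real" assume X: "X \<longlonglongrightarrow> t"
  obtain T where T: "\<And>n. \<bar>X n - t0\<bar> \<le> T" "\<bar>t - t0\<bar> \<le> T"
  proof -
    have "Bseq (\<lambda>n. X n - t0)" using X by (intro convergent_imp_Bseq convergent_diff convergent_const convergentI)
    then obtain B where "\<And>n. norm (X n - t0) \<le> B" unfolding Bseq_def by blast
    then show thesis by (intro that[of "max B \<bar>t - t0\<bar>"]) (auto simp: le_max_iff_disj)
  qed
  have T0: "0 \<le> T" using T(2) by simp
  obtain R where R: "0 \<le> R" "\<And>\<sigma>. \<bar>\<sigma> - t0\<bar> \<le> T \<Longrightarrow> norm (v \<sigma>) \<le> R"
    using continuous_bounded_interval[OF c(2), of t0 T] by blast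
  \<comment> \<open>Twice the bound of the field symbol on the time interval, once for each of the
    two times compared.\<close>
  define b where "b k = 2 * norm (w0 k) + (2 * \<bar>e\<bar> * (R * T)) * norm (p k)" for k
  have bL: "weighted_L2 s b"
  proof (rule weighted_L2_dominated(1)[OF _ w0_symbol(2) p_weighted_L2[OF \<phi>3], of _ 2 "2 * \<bar>e\<bar> * (R * T)"])
    show "b \<in> borel_measurable borel" unfolding b_def by simp
  qed (use R T0 in \<open>simp add: b_def\<close>)
  have sb: "norm (field_symbol \<xi> v r k) \<le> norm (w0 k) + \<bar>e\<bar> * norm (p k) * (R * T)" if r: "\<bar>r - t0\<bar> \<le> T" for r k
  proof -
    have "norm (field_symbol \<xi> v r k) \<le> norm (w0 k) + \<bar>e\<bar> * norm (p k) * (R * \<bar>r - t0\<bar>)"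
      using r closed_segment_real_abs_le[of _ t0 r] by (intro field_symbol_bound c R) (meson order_trans)
    also have "\<dots> \<le> norm (w0 k) + \<bar>e\<bar> * norm (p k) * (R * T)"
      using r R(1) by (intro add_left_mono mult_left_mono) auto
    finally show ?thesis .
  qed
  have db: "norm (field_symbol \<xi> v (X n) k - field_symbol \<xi> v t k) \<le> b k" for n k
    using norm_triangle_ineq4[of "field_symbol \<xi> v (X n) k" "field_symbol \<xi> v t k"] sb[OF T(1), of n k] sb[OF T(2), of k]
    by (simp add: b_def algebra_simps)
  have "(\<lambda>n. LINT k|lborel. norm k powr (2 * s) * (norm (field_symbol \<xi> v (X n) k - field_symbol \<xi> v t k))\<^sup>2) \<longlonglongrightarrow> (LINT k|(lborel :: R3 measure). 0)"
  proof (rule integral_dominated_convergence)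
    show "integrable lborel (\<lambda>k. norm k powr (2 * s) * (norm (b k))\<^sup>2)" using bL by (simp add: weighted_L2_def)
    show "(\<lambda>k. norm k powr (2 * s) * (norm (field_symbol \<xi> v (X n) k - field_symbol \<xi> v t k))\<^sup>2) \<in> borel_measurable lborel" for n
      using field_symbol_measurable[OF c] by measurable
    show "AE k in lborel. norm (norm k powr (2 * s) * (norm (field_symbol \<xi> v (X n) k - field_symbol \<xi> v t k))\<^sup>2) \<le> norm k powr (2 * s) * (norm (b k))\<^sup>2" for n
    proof (rule AE_I2)
      fix k
      have "(norm (field_symbol \<xi> v (X n) k - field_symbol \<xi> v t k))\<^sup>2 \<le> (norm (b k))\<^sup>2"
        using db[of n k] by (intro power_mono) auto
      then show "norm (norm k powr (2 * s) * (norm (field_symbol \<xi> v (X n) k - field_symbol \<xi> v t k))\<^sup>2) \<le> norm k powr (2 * s) * (norm (b k))\<^sup>2"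
        by (simp add: mult_left_mono)
    qed
    show "AE k in lborel. (\<lambda>n. norm k powr (2 * s) * (norm (field_symbol \<xi> v (X n) k - field_symbol \<xi> v t k))\<^sup>2) \<longlonglongrightarrow> 0"
    proof (rule AE_I2)
      fix k
      let ?L = "12 * norm k * norm (w0 k) + \<bar>e\<bar> * norm (p k) * (R + 12 * norm k * R * T)"
      have "(\<lambda>n. field_symbol \<xi> v (X n) k - field_symbol \<xi> v t k) \<longlonglongrightarrow> 0"
      proof (rule Lim_null_comparison)
        show "\<forall>\<^sub>F n in sequentially. norm (field_symbol \<xi> v (X n) k - field_symbol \<xi> v t k) \<le> ?L * \<bar>X n - t\<bar>"
          by (intro always_eventually allI field_symbol_time_lipschitz c R T)
        have "(\<lambda>n. ?L * \<bar>X n - t\<bar>) \<longlonglongrightarrow> ?L * \<bar>t - t\<bar>" by (intro tendsto_intros X)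
        then show "(\<lambda>n. ?L * \<bar>X n - t\<bar>) \<longlonglongrightarrow> 0" by simp
      qed
      then have "(\<lambda>n. norm k powr (2 * s) * (norm (field_symbol \<xi> v (X n) k - field_symbol \<xi> v t k))\<^sup>2) \<longlonglongrightarrow> norm k powr (2 * s) * (norm (0 :: amplitude))\<^sup>2"
        by (intro tendsto_mult tendsto_const tendsto_power tendsto_norm)
      then show "(\<lambda>n. norm k powr (2 * s) * (norm (field_symbol \<xi> v (X n) k - field_symbol \<xi> v t k))\<^sup>2) \<longlonglongrightarrow> 0" by simp
    qed
  qed simp
  then show "(\<lambda>n. weighted_L2_sq s (\<lambda>k. field_symbol \<xi> v (X n) k - field_symbol \<xi> v t k)) \<longlonglongrightarrow> 0" by (simp add: weighted_L2_sq_def)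
qed

section \<open>Assembling and characterising the solution\<close>

lemma state_norm_sq: "(state_norm s (E, B, \<xi>, v))\<^sup>2 = (field_norm s (E, B))\<^sup>2 + (norm \<xi>)\<^sup>2 + (norm v)\<^sup>2"
  by (simp add: state_norm_def field_norm_def)

lemma state_norm_nonneg: "0 \<le> state_norm s u"
  by (cases u) (simp add: state_norm_def)

definition solution :: "(real \<Rightarrow> R3) \<Rightarrow> real \<Rightarrow> state" where
  "solution v t = (fst (of_symbol (field_symbol (pos v) v t)), snd (of_symbol (field_symbol (pos v) v t)), pos v t, v t)"

lemma solution_continuous:
  assumes v: "continuous_on UNIV v"
  shows "solution v \<in> continuous_curves s"
  unfolding continuous_curves_def
proof (intro CollectI conjI allI)
  fix t
  let ?s = "field_symbol (pos v) v" and ?F = "\<lambda>t. of_symbol (field_symbol (pos v) v t)"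
  note c = pos_continuous[OF v] v
  have h: "has_symbol (?F t) (?s t)" for t by (rule of_symbol_has_symbol[OF field_symbol_slowly_growing[OF c]])
  show "solution v t \<in> state_space s"
    using hdot3_pairI[OF h field_symbol_weighted_L2[OF c] field_symbol_hermitian[OF c], of t] by (simp add: solution_def state_space_def)
  have "(state_norm s (solution v \<tau> - solution v t))\<^sup>2
      = weighted_L2_sq s (\<lambda>k. ?s \<tau> k - ?s t k) + (norm (pos v \<tau> - pos v t))\<^sup>2 + (norm (v \<tau> - v t))\<^sup>2" for \<tau>
    using field_norm_sq[OF has_symbol_diff[OF h h] weighted_L2_diff[OF field_symbol_weighted_L2[OF c] field_symbol_weighted_L2[OF c]], of \<tau> t]
    by (simp add: solution_def state_norm_sq minus_prod_def)
  moreover have "((\<lambda>\<tau>. weighted_L2_sq s (\<lambda>k. ?s \<tau> k - ?s t k) + (norm (pos v \<tau> - pos v t))\<^sup>2 + (norm (v \<tau> - v t))\<^sup>2)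
      \<longlongrightarrow> 0 + (norm (pos v t - pos v t))\<^sup>2 + (norm (v t - v t))\<^sup>2) (at t)"
    using c by (intro tendsto_intros weighted_L2_sq_field_symbol_tendsto) (auto simp: continuous_on_eq_continuous_at isCont_def)
  ultimately have "((\<lambda>\<tau>. (state_norm s (solution v \<tau> - solution v t))\<^sup>2) \<longlongrightarrow> 0) (at t)" by simp
  from tendsto_real_sqrt[OF this] show "((\<lambda>\<tau>. state_norm s (solution v \<tau> - solution v t)) \<longlongrightarrow> 0) (at t)"
    by (simp add: state_norm_nonneg)
qed

lemma div_initial:
  "AE k in lborel. (\<Sum>j\<in>UNIV. of_real (k $ j) * fst (w0 k) $ j) = - \<i> * (of_real e * cnj (p k) * cis (- (k \<bullet> \<xi>0)))"
  "AE k in lborel. (\<Sum>j\<in>UNIV. of_real (k $ j) * snd (w0 k) $ j) = 0"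
proof -
  have h: "has_fourier (E0 $ j) (\<lambda>k. fst (w0 k) $ j)" "has_fourier (B0 $ j) (\<lambda>k. snd (w0 k) $ j)" for j
    using w0_symbol(1) by (simp_all add: has_symbol_def)
  have "AE k in lborel. (\<Sum>j\<in>UNIV. \<i> * of_real (k $ j) * fst (w0 k) $ j) = of_real e * cnj (p k) * cis (- (k \<bullet> \<xi>0))"
    using div_E0 has_divergence_iff[OF h(1) translate_symbol[of e \<xi>0]] by (simp add: charge_density_def)
  then show "AE k in lborel. (\<Sum>j\<in>UNIV. of_real (k $ j) * fst (w0 k) $ j) = - \<i> * (of_real e * cnj (p k) * cis (- (k \<bullet> \<xi>0)))"
  proof eventually_elim
    fix k assume "(\<Sum>j\<in>UNIV. \<i> * of_real (k $ j) * fst (w0 k) $ j) = of_real e * cnj (p k) * cis (- (k \<bullet> \<xi>0))"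
    moreover have "(\<Sum>j\<in>UNIV. \<i> * of_real (k $ j) * fst (w0 k) $ j) = \<i> * (\<Sum>j\<in>UNIV. of_real (k $ j) * fst (w0 k) $ j)"
      by (simp add: sum_distrib_left mult.assoc)
    moreover have "z = - \<i> * y" if "x = y" "x = \<i> * z" for x y z
    proof -
      have "- \<i> * (\<i> * z) = z" by (simp flip: mult.assoc)
      then show ?thesis unfolding that(1)[symmetric] that(2) by (rule HOL.sym)
    qed
    ultimately show "(\<Sum>j\<in>UNIV. of_real (k $ j) * fst (w0 k) $ j) = - \<i> * (of_real e * cnj (p k) * cis (- (k \<bullet> \<xi>0)))"
      by blast
  qed
  have "AE k in lborel. (\<Sum>j\<in>UNIV. \<i> * of_real (k $ j) * snd (w0 k) $ j) = 0"
    using div_B0 has_divergence_iff[OF h(2) has_fourier_zero] by simp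
  then show "AE k in lborel. (\<Sum>j\<in>UNIV. of_real (k $ j) * snd (w0 k) $ j) = 0"
    by eventually_elim (simp add: mult.assoc flip: sum_distrib_left)
qed

lemma pos_t0: "pos v t0 = \<xi>0"
  by (simp add: pos_def oint_def)

text \<open>The initial field carries the charge at \<open>\<xi>0\<close>; the longitudinal part of
  the radiated field adds the charge at the present position and removes the initial one.\<close>

lemma solution_divergence:
  assumes v: "continuous_on UNIV v"
  shows "has_divergence (fst (of_symbol (field_symbol (pos v) v t))) (charge_density e \<phi> (pos v t))"
    "has_divergence (snd (of_symbol (field_symbol (pos v) v t))) 0"
proof -
  note c = pos_continuous[OF v] v
  have h: "has_fourier (fst (of_symbol (field_symbol (pos v) v t)) $ j) (\<lambda>k. fst (field_symbol (pos v) v t k) $ j)"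
    "has_fourier (snd (of_symbol (field_symbol (pos v) v t)) $ j) (\<lambda>k. snd (field_symbol (pos v) v t k) $ j)" for j
    using of_symbol_has_symbol[OF field_symbol_slowly_growing[OF c, of t]] by (simp_all add: has_symbol_def)
  have split: "(\<Sum>j\<in>UNIV. of_real (k $ j) * fst (field_symbol (pos v) v t k) $ j)
      = (\<Sum>j\<in>UNIV. of_real (k $ j) * fst (w0 k) $ j) + coupling k * (\<Sum>j\<in>UNIV. of_real (k $ j) * fst (kern (pos v) v t k) $ j)"
    "(\<Sum>j\<in>UNIV. of_real (k $ j) * snd (field_symbol (pos v) v t k) $ j)
      = (\<Sum>j\<in>UNIV. of_real (k $ j) * snd (w0 k) $ j) + coupling k * (\<Sum>j\<in>UNIV. of_real (k $ j) * snd (kern (pos v) v t k) $ j)" for k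
    unfolding maxwell_symbol_longitudinal[of k "t - t0" "w0 k", symmetric]
    by (simp_all add: field_symbol_altdef cscale_def distrib_left sum.distrib sum_distrib_left mult_ac)
  note long = kern_longitudinal[OF c pos_has_vector_derivative[OF v]]
  have i: "(\<Sum>j\<in>UNIV. \<i> * of_real (k $ j) * f j) = \<i> * (\<Sum>j\<in>UNIV. of_real (k $ j) * f j)" for k :: R3 and f :: "3 \<Rightarrow> complex"
    by (simp add: sum_distrib_left mult.assoc)
  show "has_divergence (fst (of_symbol (field_symbol (pos v) v t))) (charge_density e \<phi> (pos v t))"
    unfolding charge_density_def has_divergence_iff[OF h(1) translate_symbol]
    using div_initial(1)
  proof eventually_elim
    fix k assume d: "(\<Sum>j\<in>UNIV. of_real (k $ j) * fst (w0 k) $ j) = - \<i> * (of_real e * cnj (p k) * cis (- (k \<bullet> \<xi>0)))"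
    \<comment> \<open>Here \<open>a\<close> stands for \<open>e\<close> times the conjugate form
      factor, \<open>x\<close> for the phase at time \<open>t\<close> and \<open>y\<close> for the
      phase at time \<open>t0\<close>.\<close>
    have "\<i> * (- \<i> * (a * y) + - a * (\<i> * (x - y))) = a * x" for a x y :: complex
    proof -
      have "\<i> * \<i> = -1" by simp
      then show ?thesis by algebra
    qed
    then show "(\<Sum>j\<in>UNIV. \<i> * of_real (k $ j) * fst (field_symbol (pos v) v t k) $ j) = of_real e * cnj (p k) * cis (- (k \<bullet> pos v t))"
      unfolding i split(1) d long(1) pos_t0 coupling_def by blast
  qed
  show "has_divergence (snd (of_symbol (field_symbol (pos v) v t))) 0"
    unfolding has_divergence_iff[OF h(2) has_fourier_zero]
    using div_initial(2) by eventually_elim (simp only: i split(2) long(2), simp)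
qed

lemma solution_solves:
  assumes v: "continuous_on UNIV v" "\<And>t. v t = v0 + oint (force (pos v) v) t0 t"
  shows "maxwell_newton_solution s e \<phi> t0 E0 B0 \<xi>0 v0 (solution v)"
  unfolding maxwell_newton_solution_def
proof (intro exI conjI allI)
  let ?F = "\<lambda>t. of_symbol (field_symbol (pos v) v t)"
  note c = pos_continuous[OF v(1)] v(1)
  show "solution v = (\<lambda>t. (fst (?F t), snd (?F t), pos v t, v t))"
    by (rule ext) (simp add: solution_def)
  show "has_oriented_integral (field_norm s) (\<lambda>\<tau>. maxwell_group (t - \<tau>) (- current e \<phi> (pos v \<tau>) (v \<tau>), 0)) t0 t
      ((fst (?F t), snd (?F t)) - maxwell_group (t - t0) (E0, B0))" for t
    using duhamel[OF c] by simp
  show "has_oriented_integral norm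
      (\<lambda>\<tau>. particle_flow (t - \<tau>) (0, em_force e \<phi> (fst (?F \<tau>)) (snd (?F \<tau>)) (pos v \<tau>) (v \<tau>))) t0 t
      ((pos v t, v t) - particle_flow (t - t0) (\<xi>0, v0))" for t
  proof -
    have f: "em_force e \<phi> (fst (?F \<tau>)) (snd (?F \<tau>)) (pos v \<tau>) (v \<tau>) = force (pos v) v \<tau>" for \<tau>
      by (rule em_force_of_field[OF c]) simp
    have fc: "continuous_on UNIV (force (pos v) v)" by (rule force_continuous[OF c])
    have pc: "continuous_on UNIV (\<lambda>\<tau>. particle_flow (t - \<tau>) (0, force (pos v) v \<tau>))"
      unfolding particle_flow_def case_prod_conv by (intro continuous_intros fc)
    have "v = (\<lambda>r. v0 + oint (force (pos v) v) t0 r)" using v(2) by (rule ext)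
    then have "oint (\<lambda>r. v0 + oint (force (pos v) v) t0 r) t0 t = oint v t0 t" by simp
    then show ?thesis
      unfolding f has_oriented_integral_norm_iff[OF pc] oint_particle_flow[OF fc, where ?v0.0 = v0]
      using v(2)[of t] by (simp add: particle_flow_def pos_def)
  qed
  show "has_divergence (fst (?F t)) (charge_density e \<phi> (pos v t))" "has_divergence (snd (?F t)) 0" for t
    by (rule solution_divergence[OF v(1)])+
qed

text \<open>Reduces uniqueness for the system to the velocity: continuity of the trajectory fixes
  the field, the field fixes the force, and the particle equations then give the Volterra
  equation.\<close>

lemma solution_form:
  assumes u: "u \<in> continuous_curves s" and sol: "maxwell_newton_solution s e \<phi> t0 E0 B0 \<xi>0 v0 u"
  shows "\<exists>v. continuous_on UNIV v \<and> (\<forall>t. v t = v0 + oint (force (pos v) v) t0 t) \<and> u = solution v"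
proof -
  obtain E B \<xi> v where u_eq: "u = (\<lambda>t. (E t, B t, \<xi> t, v t))"
    and d: "\<And>t. has_oriented_integral (field_norm s) (\<lambda>\<tau>. maxwell_group (t - \<tau>) (- current e \<phi> (\<xi> \<tau>) (v \<tau>), 0)) t0 t
      ((E t, B t) - maxwell_group (t - t0) (E0, B0))"
    and n: "\<And>t. has_oriented_integral norm
      (\<lambda>\<tau>. particle_flow (t - \<tau>) (0, em_force e \<phi> (E \<tau>) (B \<tau>) (\<xi> \<tau>) (v \<tau>))) t0 t
      ((\<xi> t, v t) - particle_flow (t - t0) (\<xi>0, v0))"
    using sol unfolding maxwell_newton_solution_def by blast
  have EB: "E t \<in> hdot3 s" "B t \<in> hdot3 s" for t
    using u unfolding u_eq continuous_curves_def state_space_def by auto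
  have lim: "((\<lambda>\<tau>. state_norm s (E \<tau> - E t, B \<tau> - B t, \<xi> \<tau> - \<xi> t, v \<tau> - v t)) \<longlongrightarrow> 0) (at t)" for t
    using u unfolding u_eq continuous_curves_def by (simp add: minus_prod_def)
  \<comment> \<open>Continuity of position and velocity is extracted from the state norm first,
    since the formula for the field presupposes it.\<close>
  have le: "norm (\<xi> \<tau> - \<xi> t) \<le> state_norm s (E \<tau> - E t, B \<tau> - B t, \<xi> \<tau> - \<xi> t, v \<tau> - v t)"
    "norm (v \<tau> - v t) \<le> state_norm s (E \<tau> - E t, B \<tau> - B t, \<xi> \<tau> - \<xi> t, v \<tau> - v t)" for \<tau> t
    by (rule power2_le_imp_le[OF _ state_norm_nonneg]; simp add: state_norm_sq)+
  have "((\<lambda>\<tau>. \<xi> \<tau> - \<xi> t) \<longlongrightarrow> 0) (at t)" "((\<lambda>\<tau>. v \<tau> - v t) \<longlongrightarrow> 0) (at t)" for t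
    using le by (auto intro!: Lim_null_comparison[OF always_eventually lim])
  then have c: "continuous_on UNIV \<xi>" "continuous_on UNIV v"
    by (auto intro!: continuous_at_imp_continuous_on simp: isCont_def LIM_zero_iff)
  have F: "(E t, B t) = of_symbol (field_symbol \<xi> v t)" for t
    by (rule duhamel_unique[OF c _ _ d]) (simp_all add: EB)
  have f: "em_force e \<phi> (E \<tau>) (B \<tau>) (\<xi> \<tau>) (v \<tau>) = force \<xi> v \<tau>" for \<tau>
    by (rule em_force_of_field[OF c F])
  have fc: "continuous_on UNIV (force \<xi> v)" by (rule force_continuous[OF c])
  have pc: "continuous_on UNIV (\<lambda>\<tau>. particle_flow (t - \<tau>) (0, force \<xi> v \<tau>))" for t
    unfolding particle_flow_def case_prod_conv by (intro continuous_intros fc)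
  have eq: "(\<xi> t, v t) - particle_flow (t - t0) (\<xi>0, v0)
      = (oint (\<lambda>r. v0 + oint (force \<xi> v) t0 r) t0 t - (t - t0) *\<^sub>R v0, oint (force \<xi> v) t0 t)" for t
    using n[of t] unfolding f has_oriented_integral_norm_iff[OF pc] oint_particle_flow[OF fc, where ?v0.0 = v0] .
  have veq: "v t = v0 + oint (force \<xi> v) t0 t" for t
    using eq[of t] by (simp add: particle_flow_def algebra_simps)
  have "v = (\<lambda>r. v0 + oint (force \<xi> v) t0 r)" using veq by (rule ext)
  then have "\<xi> t = pos v t" for t
    using eq[of t] by (simp add: particle_flow_def pos_def algebra_simps)
  then have \<xi>: "\<xi> = pos v" by (rule ext)
  have "u = solution v"
    unfolding u_eq solution_def \<xi>[symmetric] F[symmetric] by simp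
  moreover have "\<forall>t. v t = v0 + oint (force (pos v) v) t0 t" using veq unfolding \<xi>[symmetric] by blast
  ultimately show ?thesis using c(2) by blast
qed

lemma unique_solution:
  "\<exists>!u. u \<in> continuous_curves s \<and> maxwell_newton_solution s e \<phi> t0 E0 B0 \<xi>0 v0 u"
proof -
  obtain v where v: "continuous_on UNIV v" "\<And>t. v t = v0 + oint (force (pos v) v) t0 t"
    using particle_exists by metis
  show ?thesis
  proof (rule ex1I[of _ "solution v"])
    show "solution v \<in> continuous_curves s \<and> maxwell_newton_solution s e \<phi> t0 E0 B0 \<xi>0 v0 (solution v)"
      using solution_continuous[OF v(1)] solution_solves[OF v] by blast
    fix u assume "u \<in> continuous_curves s \<and> maxwell_newton_solution s e \<phi> t0 E0 B0 \<xi>0 v0 u"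
    then have "\<exists>w. continuous_on UNIV w \<and> (\<forall>t. w t = v0 + oint (force (pos w) w) t0 t) \<and> u = solution w"
      by (intro solution_form) simp_all
    then obtain w where w: "continuous_on UNIV w" "\<And>t. w t = v0 + oint (force (pos w) w) t0 t" "u = solution w"
      by blast
    show "u = solution v" unfolding w(3) particle_unique[OF w(1,2) v] ..
  qed
qed

end

theorem theorem1:
  fixes e t0 s :: real and \<phi> :: "real ^ 3 \<Rightarrow> real"
    and \<xi>0 v0 :: "real ^ 3" and E0 B0 :: "tempered ^ 3"
  assumes "s < 3 / 2"
    and "\<forall>x. \<phi> differentiable (at x)"
    and "fun_in_hdot (- s) \<phi>" and "fun_in_hdot (- s + 1) \<phi>"
    and "fun_in_hdot s \<phi>" and "fun_in_hdot (s + 1) \<phi>"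
    and "\<forall>\<xi>. \<exists>E\<in>hdot3 s. \<exists>B\<in>hdot3 s.
           has_divergence E (charge_density e \<phi> \<xi>) \<and> has_divergence B 0"
    and "E0 \<in> hdot3 s" and "B0 \<in> hdot3 s"
    and "has_divergence E0 (charge_density e \<phi> \<xi>0)" and "has_divergence B0 0"
  shows "\<exists>!u. u \<in> continuous_curves s \<and> maxwell_newton_solution s e \<phi> t0 E0 B0 \<xi>0 v0 u"
proof -
  interpret maxwell_newton e t0 s \<phi> \<xi>0 v0 E0 B0
    by unfold_locales (fact assms)+
  show ?thesis by (rule unique_solution)
qed

end
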